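(* The helicity of vector fields on $S^3$ and $H^3$ is given by the following formulas. (1) On $S^3$, in left-translation format: for every smooth vector field $\mathbf{v}$ on $S^3$, $$\begin{aligned}\mathrm{H}(\mathbf{v})={}&\int_{S^3\times S^3}L_{\mathbf{y}\mathbf{x}^{-1}}\mathbf{v}(\mathbf{x})\times\mathbf{v}(\mathbf{y})\cdot\nabla_{\mathbf{y}}\varphi(\mathbf{x},\mathbf{y})\,d\mathbf{x}\,d\mathbf{y}-\frac{1}{4\pi^2}\int_{S^3\times S^3}L_{\mathbf{y}\mathbf{x}^{-1}}\mathbf{v}(\mathbf{x})\cdot\mathbf{v}(\mathbf{y})\,d\mathbf{x}\,d\mathbf{y}\\&+2\int_{S^3\times S^3}\nabla_{\mathbf{y}}\bigl(L_{\mathbf{y}\mathbf{x}^{-1}}\mathbf{v}(\mathbf{x})\cdot\nabla_{\mathbf{y}}\varphi_1(\mathbf{x},\mathbf{y})\bigr)\cdot\mathbf{v}(\mathbf{y})\,d\mathbf{x}\,d\mathbf{y},\end{aligned}$$ where $\varphi(\alpha)=\frac{1}{4\pi^2}(\pi-\alpha)\cot\alpha$ and $\varphi_1(\alpha)=-\frac{1}{16\pi^2}\alpha(2\pi-\alpha)$. (2) On $S^3$, in parallel transport format: for every smooth vector field $\mathbf{v}$ on $S^3$, $$\mathrm{H}(\mathbf{v})=\int_{S^3\times S^3}P_{\mathbf{y}\mathbf{x}}\mathbf{v}(\mathbf{x})\times\mathbf{v}(\mathbf{y})\cdot\nabla_{\mathbf{y}}\varphi(\mathbf{x},\mathbf{y})\,d\mathbf{x}\,d\mathbf{y},$$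 where $\varphi(\alpha)=\frac{1}{4\pi^2}(\pi-\alpha)\csc\alpha$. (3) On $H^3$, in parallel transport format: for every smooth compactly supported vector field $\mathbf{v}$ on $H^3$, $$\mathrm{H}(\mathbf{v})=\int_{H^3\times H^3}P_{\mathbf{y}\mathbf{x}}\mathbf{v}(\mathbf{x})\times\mathbf{v}(\mathbf{y})\cdot\nabla_{\mathbf{y}}\varphi(\mathbf{x},\mathbf{y})\,d\mathbf{x}\,d\mathbf{y},$$ where $\varphi(\alpha)=\frac{1}{4\pi}\operatorname{csch}\alpha$.
   Context: $S^3\subset\mathbb{R}^4$ is the unit sphere, identified with the group of unit quaternions via $(x_0,x_1,x_2,x_3)\leftrightarrow x_0+x_1i+x_2j+x_3k$, with the round metric, oriented so that $(\mathbf{u},\mathbf{v},\mathbf{w})$ in $T_{\mathbf{x}}S^3$ is positive iff $\det(\mathbf{x},\mathbf{u},\mathbf{v},\mathbf{w})>0$; the cross product is given by $\mathbf{u}\cdot(\mathbf{v}\times\mathbf{w})=\det(\mathbf{x},\mathbf{u},\mathbf{v},\mathbf{w})$. $H^3=\{\mathbf{x}\in\mathbb{R}^{1,3}:\langle\mathbf{x},\mathbf{x}\rangle=1,\ x_0>0\}$, with $\langle\mathbf{x},\mathbf{y}\rangle=x_0y_0-x_1y_1-x_2y_2-x_3y_3$, is hyperbolic 3-space of curvature $-1$ with Riemannian metric $\mathbf{v}\cdot\mathbf{w}=-\langle\mathbf{v},\mathbf{w}\rangle$ and cross product $\mathbf{u}\times\mathbf{v}\cdot\mathbf{w}=\det(\mathbf{x},\mathbf{u},\mathbf{v},\mathbf{w})$.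 $\alpha(\mathbf{x},\mathbf{y})$ is geodesic distance; a function $\psi(\alpha)$ is abbreviated $\psi(\mathbf{x},\mathbf{y})=\psi(\alpha(\mathbf{x},\mathbf{y}))$. $\nabla_{\mathbf{y}}$ denotes differentiation in $\mathbf{y}$ with $\mathbf{x}$ fixed, and $d\mathbf{x}$, $d\mathbf{y}$ are Riemannian volume elements. $P_{\mathbf{y}\mathbf{x}}$ is parallel transport of tangent vectors from $\mathbf{x}$ to $\mathbf{y}$ along the geodesic segment; $L_{\mathbf{y}\mathbf{x}^{-1}}$ is the differential of left translation by $\mathbf{y}\mathbf{x}^{-1}$ on $S^3$, carrying tangent vectors at $\mathbf{x}$ to tangent vectors at $\mathbf{y}$. Helicity is defined by $\mathrm{H}(\mathbf{v})=\int \mathrm{BS}(\mathbf{v})(\mathbf{y})\cdot\mathbf{v}(\mathbf{y})\,d\mathbf{y}$ (over $S^3$, resp. $H^3$), where $\mathrm{BS}$ is the Biot–Savart operator (the magnetic field due to the steady current $\mathbf{v}$): On $S^3$, $\mathrm{BS}(\mathbf{v})$ is the unique smooth vector field with $\nabla\cdot\mathrm{BS}(\mathbf{v})=0$ and $\nabla_{\mathbf{y}}\times\mathrm{BS}(\mathbf{v})(\mathbf{y})=\mathbf{v}(\mathbf{y})+\nabla_{\mathbf{y}}\int_{S^3}\mathbf{v}(\mathbf{x})\cdot\nabla_{\mathbf{x}}\varphi_0(\mathbf{x},\mathbf{y})\,d\mathbf{x}$, where $\varphi_0(\alpha)=-\frac{1}{4\pi^2}(\pi-\alpha)\cot\alpha$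 is the fundamental solution of the Laplacian on $S^3$ ($\Delta\varphi_0=\delta-\frac{1}{2\pi^2}$). On $H^3$, for $\mathbf{v}$ smooth with compact support, $\mathrm{BS}(\mathbf{v})(\mathbf{y})=\int_{H^3}P_{\mathbf{y}\mathbf{x}}\mathbf{v}(\mathbf{x})\times\nabla_{\mathbf{y}}\varphi_0(\mathbf{x},\mathbf{y})\,d\mathbf{x}$ with $\varphi_0(\alpha)=-\frac{1}{4\pi}\operatorname{csch}\alpha$. *)

theory Defs
  imports "HOL-Analysis.Analysis"
begin

definition the_or_zero :: "('a::zero \<Rightarrow> bool) \<Rightarrow> 'a" where
  "the_or_zero P = (if \<exists>!z. P z then THE z. P z else 0)"


section \<open>Smooth maps\<close>

text \<open>
  \<^term>\<open>U\<close> is meant to be open. For \<open>f\<close> defined on a subset \<open>M\<close> of the ambient space,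
  smoothness means that \<open>f\<close> locally extends to a smooth map on an open set.
\<close>

fun Ck_on :: "nat \<Rightarrow> ('a::real_normed_vector \<Rightarrow> 'b::real_normed_vector) \<Rightarrow> 'a set \<Rightarrow> bool" where
  "Ck_on 0 f U \<longleftrightarrow> continuous_on U f"
| "Ck_on (Suc k) f U \<longleftrightarrow>
     (\<forall>x\<in>U. f differentiable (at x)) \<and> (\<forall>h. Ck_on k (\<lambda>x. frechet_derivative f (at x) h) U)"

definition Cinf_on :: "('a::real_normed_vector \<Rightarrow> 'b::real_normed_vector) \<Rightarrow> 'a set \<Rightarrow> bool" where
  "Cinf_on f U \<longleftrightarrow> (\<forall>k. Ck_on k f U)"

definition smooth_map_on :: "'a::real_normed_vector set \<Rightarrow> ('a \<Rightarrow> 'b::real_normed_vector) \<Rightarrow> bool" where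
  "smooth_map_on M f \<longleftrightarrow>
     (\<forall>x\<in>M. \<exists>U F. open U \<and> x \<in> U \<and> Cinf_on F U \<and> (\<forall>z\<in>M \<inter> U. F z = f z))"


section \<open>The two spaces\<close>

text \<open>
  Coordinates \<open>x\<^sub>0, x\<^sub>1, x\<^sub>2, x\<^sub>3\<close> of the ambient space are the components
  \<open>x $ 1, x $ 2, x $ 3, x $ 4\<close>.

  Both spaces are hypersurfaces \<open>M\<close> of the ambient space whose Riemannian metric is the
  restriction to the tangent spaces of a constant nondegenerate symmetric bilinear form \<open>B\<close>:
  the Euclidean inner product for \<open>S3\<close>, minus the Lorentz form for \<open>H3\<close>. Both are
  (components of) level sets of \<open>B x x\<close>, so the tangent space at \<open>x\<close> is the
  \<open>B\<close>-orthogonal complement of \<open>x\<close>. The Riemannian notions below take \<open>B\<close> and \<open>M\<close>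
  as parameters. They only use the values on \<open>M\<close> of the functions and fields involved.
\<close>

type_synonym R4 = "real^4"

definition S3 :: "R4 set" where
  "S3 = {x. norm x = 1}"

definition lorentz :: "R4 \<Rightarrow> R4 \<Rightarrow> real" where
  "lorentz x y = x$1 * y$1 - x$2 * y$2 - x$3 * y$3 - x$4 * y$4"

definition H3 :: "R4 set" where
  "H3 = {x. lorentz x x = 1 \<and> x$1 > 0}"

definition hdot :: "R4 \<Rightarrow> R4 \<Rightarrow> real" where
  "hdot v w = - lorentz v w"

definition tangent :: "(R4 \<Rightarrow> R4 \<Rightarrow> real) \<Rightarrow> R4 \<Rightarrow> R4 set" where
  "tangent B x = {v. B x v = 0}"

definition smooth_vector_field :: "(R4 \<Rightarrow> R4 \<Rightarrow> real) \<Rightarrow> R4 set \<Rightarrow> (R4 \<Rightarrow> R4) \<Rightarrow> bool" where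
  "smooth_vector_field B M v \<longleftrightarrow> smooth_map_on M v \<and> (\<forall>x\<in>M. v x \<in> tangent B x)"

text \<open>
  The conventions \<open>u \<cdot> (v \<times> w) = det(x,u,v,w)\<close> on \<open>S3\<close> and
  \<open>(u \<times> v) \<cdot> w = det(x,u,v,w)\<close> on \<open>H3\<close> have the same form, the determinant being
  invariant under cyclic permutations of its last three arguments.
\<close>

definition cross :: "(R4 \<Rightarrow> R4 \<Rightarrow> real) \<Rightarrow> R4 \<Rightarrow> R4 \<Rightarrow> R4 \<Rightarrow> R4" where
  "cross B x u v =
     (THE z. z \<in> tangent B x \<and>
        (\<forall>w\<in>tangent B x. B z w = det (vector [x, u, v, w] :: real^4^4)))"


section \<open>Geodesic distance and parallel transport\<close>

text \<open>
  The curves are \<open>C\<^sup>1\<close> on the closed interval rather than piecewise \<open>C\<^sup>1\<close> in the sense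
  of the library, which admits unbounded velocities and hence curves for which
  the length integral does not exist.
\<close>

definition curve_length :: "(R4 \<Rightarrow> R4 \<Rightarrow> real) \<Rightarrow> (real \<Rightarrow> R4) \<Rightarrow> real" where
  "curve_length B \<gamma> =
     integral {0..1} (\<lambda>t. sqrt (B (vector_derivative \<gamma> (at t)) (vector_derivative \<gamma> (at t))))"

definition geodesic_dist :: "(R4 \<Rightarrow> R4 \<Rightarrow> real) \<Rightarrow> R4 set \<Rightarrow> R4 \<Rightarrow> R4 \<Rightarrow> real" where
  "geodesic_dist B M x y =
     Inf {curve_length B \<gamma> | \<gamma>. \<gamma> C1_differentiable_on {0..1} \<and> \<gamma> ` {0..1} \<subseteq> M
                              \<and> \<gamma> 0 = x \<and> \<gamma> 1 = y}"

text \<open>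
  The covariant derivative of a tangent field along a curve in \<open>M\<close> is the tangential part
  (with respect to \<open>B\<close>) of its derivative in the ambient space. So the field is parallel iff
  this derivative is normal to \<open>M\<close>; a geodesic is a curve with parallel velocity.
\<close>

definition parallel_along :: "(R4 \<Rightarrow> R4 \<Rightarrow> real) \<Rightarrow> (real \<Rightarrow> R4) \<Rightarrow> (real \<Rightarrow> R4) \<Rightarrow> bool" where
  "parallel_along B \<gamma> V \<longleftrightarrow>
     (\<forall>t\<in>{0..1}. V t \<in> tangent B (\<gamma> t) \<and>
        (\<exists>D. (V has_vector_derivative D) (at t) \<and> (\<forall>w\<in>tangent B (\<gamma> t). B D w = 0)))"

definition geodesic_segment :: "(R4 \<Rightarrow> R4 \<Rightarrow> real) \<Rightarrow> R4 set \<Rightarrow> (real \<Rightarrow> R4) \<Rightarrow> R4 \<Rightarrow> R4 \<Rightarrow> bool" where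
  "geodesic_segment B M \<gamma> x y \<longleftrightarrow>
     \<gamma> ` {0..1} \<subseteq> M \<and> \<gamma> 0 = x \<and> \<gamma> 1 = y \<and>
     (\<exists>\<gamma>'. (\<forall>t\<in>{0..1}. (\<gamma> has_vector_derivative \<gamma>' t) (at t)) \<and> parallel_along B \<gamma> \<gamma>') \<and>
     curve_length B \<gamma> = geodesic_dist B M x y"

text \<open>
  \<open>parallel_transport B M y x u\<close> is \<open>P\<^sub>y\<^sub>x u\<close>. On \<open>S3\<close> there is no unique geodesic segment
  joining antipodal points; there the value is 0 where it would depend on the segment.
\<close>

definition parallel_transport :: "(R4 \<Rightarrow> R4 \<Rightarrow> real) \<Rightarrow> R4 set \<Rightarrow> R4 \<Rightarrow> R4 \<Rightarrow> R4 \<Rightarrow> R4" where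
  "parallel_transport B M y x u =
     the_or_zero (\<lambda>w. \<exists>\<gamma> V. geodesic_segment B M \<gamma> x y \<and> parallel_along B \<gamma> V
                            \<and> V 0 = u \<and> V 1 = w)"


section \<open>Differential operators\<close>

text \<open>
  The derivative within \<open>M\<close> at \<open>y\<close> is determined on tangent vectors only, and
  requiring the gradient to be tangent makes it unique. The value is 0 where the
  function is not differentiable.
\<close>

definition grad :: "(R4 \<Rightarrow> R4 \<Rightarrow> real) \<Rightarrow> R4 set \<Rightarrow> (R4 \<Rightarrow> real) \<Rightarrow> R4 \<Rightarrow> R4" where
  "grad B M f y =
     the_or_zero (\<lambda>g. g \<in> tangent B y \<and> (f has_derivative B g) (at y within M))"

text \<open>
  The inner product of \<open>h \<mapsto> frechet_derivative w (at y within S3) h\<close> with a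
  tangent vector is that of the covariant derivative \<open>\<nabla>\<^sub>h w\<close>; so no tangential projection appears
  in the next two definitions. The curl is defined by
  \<open>(\<nabla>\<^sub>a w) \<cdot> b - (\<nabla>\<^sub>b w) \<cdot> a = (curl w) \<cdot> (a \<times> b)\<close>, the left hand side being the
  exterior derivative of the dual 1-form of \<open>w\<close>.
\<close>

definition div_S3 :: "(R4 \<Rightarrow> R4) \<Rightarrow> R4 \<Rightarrow> real" where
  "div_S3 w y = (let D = frechet_derivative w (at y within S3) in
     THE d. \<forall>a\<in>tangent (\<bullet>) y. \<forall>b\<in>tangent (\<bullet>) y. \<forall>c\<in>tangent (\<bullet>) y.
       norm a = 1 \<and> norm b = 1 \<and> norm c = 1 \<and> a \<bullet> b = 0 \<and> a \<bullet> c = 0 \<and> b \<bullet> c = 0 \<longrightarrow>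
       d = D a \<bullet> a + D b \<bullet> b + D c \<bullet> c)"

definition curl_S3 :: "(R4 \<Rightarrow> R4) \<Rightarrow> R4 \<Rightarrow> R4" where
  "curl_S3 w y = (let D = frechet_derivative w (at y within S3) in
     THE z. z \<in> tangent (\<bullet>) y \<and>
       (\<forall>a\<in>tangent (\<bullet>) y. \<forall>b\<in>tangent (\<bullet>) y. D a \<bullet> b - D b \<bullet> a = z \<bullet> cross (\<bullet>) y a b))"


section \<open>Riemannian volume\<close>

text \<open>
  The Riemannian volume is the Borel measure on \<open>M\<close> that has density \<open>sqrt (det g)\<close> in every
  local parametrization.
\<close>

definition parametrization :: "R4 set \<Rightarrow> (real^3) set \<Rightarrow> (real^3 \<Rightarrow> R4) \<Rightarrow> bool" where
  "parametrization M U f \<longleftrightarrow>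
     open U \<and> Cinf_on f U \<and> inj_on f U \<and> f ` U \<subseteq> M \<and> (\<forall>u\<in>U. inj (frechet_derivative f (at u)))"

definition metric_matrix :: "(R4 \<Rightarrow> R4 \<Rightarrow> real) \<Rightarrow> (real^3 \<Rightarrow> R4) \<Rightarrow> real^3 \<Rightarrow> real^3^3" where
  "metric_matrix B f u =
     (\<chi> i j. B (frechet_derivative f (at u) (axis i 1)) (frechet_derivative f (at u) (axis j 1)))"

definition volume :: "(R4 \<Rightarrow> R4 \<Rightarrow> real) \<Rightarrow> R4 set \<Rightarrow> R4 measure" where
  "volume B M =
     (THE \<mu>. sets \<mu> = sets (restrict_space borel M) \<and>
        (\<forall>U f. parametrization M U f \<longrightarrow>
          (\<forall>A\<in>sets \<mu>. A \<subseteq> f ` U \<longrightarrow>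
             emeasure \<mu> A =
               (\<integral>\<^sup>+u\<in>{u\<in>U. f u \<in> A}. ennreal (sqrt (det (metric_matrix B f u))) \<partial>lborel))))"


section \<open>Left translation\<close>

definition qmult :: "R4 \<Rightarrow> R4 \<Rightarrow> R4" where
  "qmult p q = vector
     [p$1 * q$1 - p$2 * q$2 - p$3 * q$3 - p$4 * q$4,
      p$1 * q$2 + p$2 * q$1 + p$3 * q$4 - p$4 * q$3,
      p$1 * q$3 - p$2 * q$4 + p$3 * q$1 + p$4 * q$2,
      p$1 * q$4 + p$2 * q$3 - p$3 * q$2 + p$4 * q$1]"

definition qinv :: "R4 \<Rightarrow> R4" where
  "qinv p = vector [p$1, - p$2, - p$3, - p$4] /\<^sub>R (norm p)\<^sup>2"

text \<open>\<open>left_transport y x\<close> is \<open>L\<^bsub>yx\<^sup>-\<^sup>1\<^esub>\<close> on the tangent space at \<open>x\<close>.\<close>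

definition left_transport :: "R4 \<Rightarrow> R4 \<Rightarrow> R4 \<Rightarrow> R4" where
  "left_transport y x = frechet_derivative (qmult (qmult y (qinv x))) (at x)"


section \<open>Biot-Savart operators and helicity\<close>

abbreviation "grad_S3 \<equiv> grad (\<bullet>) S3"
abbreviation "grad_H3 \<equiv> grad hdot H3"
abbreviation "dist_S3 \<equiv> geodesic_dist (\<bullet>) S3"
abbreviation "dist_H3 \<equiv> geodesic_dist hdot H3"
abbreviation "cross_S3 \<equiv> cross (\<bullet>)"
abbreviation "cross_H3 \<equiv> cross hdot"
abbreviation "transport_S3 \<equiv> parallel_transport (\<bullet>) S3"
abbreviation "transport_H3 \<equiv> parallel_transport hdot H3"
abbreviation "vol_S3 \<equiv> volume (\<bullet>) S3"
abbreviation "vol_H3 \<equiv> volume hdot H3"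

definition phi0_S3 :: "real \<Rightarrow> real" where
  "phi0_S3 \<alpha> = - (1 / (4 * pi\<^sup>2)) * (pi - \<alpha>) * cot \<alpha>"

definition phi0_H3 :: "real \<Rightarrow> real" where
  "phi0_H3 \<alpha> = - (1 / (4 * pi)) * (1 / sinh \<alpha>)"

text \<open>Fields on \<open>S3\<close> are extended by 0 to make the description unique as a function.\<close>

definition biot_savart_S3 :: "(R4 \<Rightarrow> R4) \<Rightarrow> R4 \<Rightarrow> R4" where
  "biot_savart_S3 v =
     (THE w. smooth_vector_field (\<bullet>) S3 w \<and> (\<forall>y. y \<notin> S3 \<longrightarrow> w y = 0) \<and>
        (\<forall>y\<in>S3. div_S3 w y = 0 \<and>
           curl_S3 w y = v y + grad_S3 (\<lambda>z.
             \<integral>x. v x \<bullet> grad_S3 (\<lambda>s. phi0_S3 (dist_S3 s z)) x \<partial>vol_S3) y))"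

definition helicity_S3 :: "(R4 \<Rightarrow> R4) \<Rightarrow> real" where
  "helicity_S3 v = (\<integral>y. biot_savart_S3 v y \<bullet> v y \<partial>vol_S3)"

definition biot_savart_H3 :: "(R4 \<Rightarrow> R4) \<Rightarrow> R4 \<Rightarrow> R4" where
  "biot_savart_H3 v y =
     (\<integral>x. cross_H3 y (transport_H3 y x (v x)) (grad_H3 (\<lambda>z. phi0_H3 (dist_H3 x z)) y) \<partial>vol_H3)"

definition helicity_H3 :: "(R4 \<Rightarrow> R4) \<Rightarrow> real" where
  "helicity_H3 v = (\<integral>y. hdot (biot_savart_H3 v y) (v y) \<partial>vol_H3)"

end

theory Submission
 imports Defs
begin

text \<open>
The sphere. Write a tangent field in the left-invariant frame \<open>y i, y j, y k\<close>, with derivations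
\<open>X\<^sub>1, X\<^sub>2, X\<^sub>3\<close> (\<open>Lie\<close>). Then \<open>curl = C - 2\<close> with
\<open>C a = (X\<^sub>2 a\<^sub>3 - X\<^sub>3 a\<^sub>2, X\<^sub>3 a\<^sub>1 - X\<^sub>1 a\<^sub>3, X\<^sub>1 a\<^sub>2 - X\<^sub>2 a\<^sub>1)\<close>, and the commutators
\<open>[X\<^sub>1, X\<^sub>2] = 2 X\<^sub>3\<close> give \<open>C C = grad div - \<Delta> + 2 C\<close>, where \<open>\<Delta>\<close> acts on each component
(\<open>curl_curl\<close>). Let \<open>G\<^sub>0, G\<^sub>1\<close> be convolution with \<open>\<phi>\<^sub>0, \<phi>\<^sub>1\<close>. By Green's identities
\<open>G\<^sub>0 \<Delta> F = F - mean F\<close> and \<open>G\<^sub>1 \<Delta> F = G\<^sub>0 F + const\<close>, and convolutions commute with the \<open>X\<^sub>i\<close>. Hence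
\<open>w = - G\<^sub>0 C v + 2 grad G\<^sub>1 div v - (mean v) / 2\<close> satisfies \<open>div w = 0\<close> and
\<open>curl w = v - grad G\<^sub>0 div v\<close>, which is the defining system of the Biot--Savart field since integration by
parts turns the potential in it into \<open>- G\<^sub>0 div v\<close>. A difference \<open>d\<close> of two solutions satisfies \<open>div d = 0\<close>
and \<open>C d = 2 d\<close>, hence \<open>\<Delta> d = 0\<close>, so \<open>d\<close> is constant in the frame, \<open>C d = 0\<close> and \<open>d = 0\<close>. Thus
\<open>BS v = w\<close> (\<open>biot_savart_S3_eq\<close>). Multiply by \<open>v\<close>, integrate, and move the derivatives from \<open>v\<close> to
the kernels: the three terms of \<open>w\<close> become the three integrals of the first formula (\<open>k_integrals\<close>).

The integrand of the second formula is the combination of those of the first at every pair of points that are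
neither equal nor antipodal: parallel and left translation differ by a rotation about the geodesic, and the identity
reduces to two relations between \<open>\<phi>\<^sub>0'\<close>, \<open>\<phi>\<^sub>1'\<close> and \<open>\<phi>\<^sub>1''\<close> (\<open>parallel_integrand_eq\<close>,
\<open>green_relations\<close>).

Hyperbolic space. The formula is Fubini's theorem applied to the definition of the Biot--Savart field, because
the two integrands differ only by an exchange of arguments of a determinant. What has to be shown is absolute
convergence: on bounded sets the kernel is at most a multiple of the inverse square of the distance.
Transport disappears from the formulas, since \<open>P v(x)\<close> and \<open>v(x)\<close> differ by a multiple of \<open>x + y\<close> and
the determinants in question contain \<open>x\<close> and \<open>y\<close>.

All of this presupposes closed forms of the geometric notions: distances are \<open>arccos (x \<cdot> y)\<close> and
\<open>arcosh (- hdot x y)\<close>; the integrands are computed at every pair of points, equal and antipodal ones included, because the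
integrals exist only if the integrands are measurable; the volumes are obtained from Lebesgue
measure of cones.
\<close>

section \<open>Determinants and quaternions in coordinates\<close>

abbreviation det4 :: "R4 => R4 => R4 => R4 => real" where
 "det4 a b c d \<equiv> det (vector [a, b, c, d])"

abbreviation fderiv :: "('a::real_normed_vector => 'b::real_normed_vector) => 'a => 'a => 'b" where
 "fderiv f x \<equiv> frechet_derivative f (at x)"

lemma vector_4_nth [simp]:
 "(vector [a, b, c, d] :: 'a::zero^4) $ 1 = a"
 "(vector [a, b, c, d] :: 'a^4) $ 2 = b"
 "(vector [a, b, c, d] :: 'a^4) $ 3 = c"
 "(vector [a, b, c, d] :: 'a^4) $ 4 = d"
 by (simp_all add: vector_def)

lemma R4_eq_iff: "(x :: R4) = y \<longleftrightarrow> x$1 = y$1 \<and> x$2 = y$2 \<and> x$3 = y$3 \<and> x$4 = y$4"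
 by (simp add: vec_eq_iff forall_4)

lemma inner_R4: "(x :: R4) \<bullet> y = x$1 * y$1 + x$2 * y$2 + x$3 * y$3 + x$4 * y$4"
 by (simp add: inner_vec_def sum_4)

lemma axis_R4_nth [simp]:
 "(axis 1 a :: R4) $ 1 = a" "(axis 1 a :: R4) $ 2 = 0" "(axis 1 a :: R4) $ 3 = 0" "(axis 1 a :: R4) $ 4 = 0"
 "(axis 2 a :: R4) $ 1 = 0" "(axis 2 a :: R4) $ 2 = a" "(axis 2 a :: R4) $ 3 = 0" "(axis 2 a :: R4) $ 4 = 0"
 "(axis 3 a :: R4) $ 1 = 0" "(axis 3 a :: R4) $ 2 = 0" "(axis 3 a :: R4) $ 3 = a" "(axis 3 a :: R4) $ 4 = 0"
 "(axis 4 a :: R4) $ 1 = 0" "(axis 4 a :: R4) $ 2 = 0" "(axis 4 a :: R4) $ 3 = 0" "(axis 4 a :: R4) $ 4 = a"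
 by (simp_all add: axis_def)

lemma det_4:
 "det (A::'a::comm_ring_1^4^4) =
   A$1$1 * (A$2$2 * (A$3$3 * A$4$4 - A$3$4 * A$4$3)
      - A$2$3 * (A$3$2 * A$4$4 - A$3$4 * A$4$2)
      + A$2$4 * (A$3$2 * A$4$3 - A$3$3 * A$4$2))
  - A$1$2 * (A$2$1 * (A$3$3 * A$4$4 - A$3$4 * A$4$3)
      - A$2$3 * (A$3$1 * A$4$4 - A$3$4 * A$4$1)
      + A$2$4 * (A$3$1 * A$4$3 - A$3$3 * A$4$1))
  + A$1$3 * (A$2$1 * (A$3$2 * A$4$4 - A$3$4 * A$4$2)
      - A$2$2 * (A$3$1 * A$4$4 - A$3$4 * A$4$1)
      + A$2$4 * (A$3$1 * A$4$2 - A$3$2 * A$4$1))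
  - A$1$4 * (A$2$1 * (A$3$2 * A$4$3 - A$3$3 * A$4$2)
      - A$2$2 * (A$3$1 * A$4$3 - A$3$3 * A$4$1)
      + A$2$3 * (A$3$1 * A$4$2 - A$3$2 * A$4$1))"
proof -
 have f1: "finite {2::4, 3, 4}" "1 \<notin> {2::4, 3, 4}" by auto
 have f2: "finite {3::4, 4}" "2 \<notin> {3::4, 4}" by auto
 have f3: "finite {4::4}" "3 \<notin> {4::4}" by auto
 show ?thesis
  unfolding det_def UNIV_4
  unfolding sum_over_permutations_insert[OF f1]
  unfolding sum_over_permutations_insert[OF f2]
  unfolding sum_over_permutations_insert[OF f3]
  unfolding permutes_sing
  by (simp add: sign_swap_id permutation_swap_id permutation_compose sign_compose sign_id swap_id_eq algebra_simps)
qed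

definition qone :: R4 where "qone = axis 1 1"
definition qi :: R4 where "qi = axis 2 1"
definition qj :: R4 where "qj = axis 3 1"
definition qk :: R4 where "qk = axis 4 1"
definition qconj :: "R4 => R4" where "qconj x = vector [x$1, - x$2, - x$3, - x$4]"

lemma qmult_nth:
 "qmult p q $ 1 = p$1 * q$1 - p$2 * q$2 - p$3 * q$3 - p$4 * q$4"
 "qmult p q $ 2 = p$1 * q$2 + p$2 * q$1 + p$3 * q$4 - p$4 * q$3"
 "qmult p q $ 3 = p$1 * q$3 - p$2 * q$4 + p$3 * q$1 + p$4 * q$2"
 "qmult p q $ 4 = p$1 * q$4 + p$2 * q$3 - p$3 * q$2 + p$4 * q$1"
 by (simp_all add: qmult_def)

lemma qconj_nth: "qconj x $ 1 = x$1" "qconj x $ 2 = - x$2" "qconj x $ 3 = - x$3" "qconj x $ 4 = - x$4"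
 by (simp_all add: qconj_def)

lemma qunit_nth [simp]:
 "qone $ 1 = 1" "qone $ 2 = 0" "qone $ 3 = 0" "qone $ 4 = 0"
 "qi $ 1 = 0" "qi $ 2 = 1" "qi $ 3 = 0" "qi $ 4 = 0"
 "qj $ 1 = 0" "qj $ 2 = 0" "qj $ 3 = 1" "qj $ 4 = 0"
 "qk $ 1 = 0" "qk $ 2 = 0" "qk $ 3 = 0" "qk $ 4 = 1"
 by (simp_all add: qone_def qi_def qj_def qk_def)

lemmas qcoords = R4_eq_iff inner_R4 qmult_nth qconj_nth

lemma qmult_assoc: "qmult (qmult x y) z = qmult x (qmult y z)"
 by (simp add: qcoords) (intro conjI; algebra)

lemma qmult_one [simp]: "qmult qone x = x" "qmult x qone = x"
 by (simp_all add: qcoords)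

lemma qmult_lin [simp]:
 "qmult (x + x') y = qmult x y + qmult x' y" "qmult x (y + y') = qmult x y + qmult x y'"
 "qmult (x - x') y = qmult x y - qmult x' y" "qmult x (y - y') = qmult x y - qmult x y'"
 "qmult (r *\<^sub>R x) y = r *\<^sub>R qmult x y" "qmult x (r *\<^sub>R y) = r *\<^sub>R qmult x y"
 "qmult 0 y = 0" "qmult x 0 = 0" "qmult (- x) y = - qmult x y" "qmult x (- y) = - qmult x y"
 by (simp_all add: qcoords algebra_simps)

text \<open>Multiplication by \<open>p\<close> and by its conjugate are adjoint.\<close>

lemma inner_qmult_left: "qmult x p \<bullet> y = x \<bullet> qmult y (qconj p)"
 by (simp add: qcoords) algebra

lemma inner_qmult_right: "qmult p x \<bullet> y = x \<bullet> qmult (qconj p) y"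
 by (simp add: qcoords) algebra

lemma qconj_mult_self: "qmult (qconj p) p = (p \<bullet> p) *\<^sub>R qone" "qmult p (qconj p) = (p \<bullet> p) *\<^sub>R qone"
 by (simp_all add: qcoords algebra_simps)

lemma qconj_qconj [simp]: "qconj (qconj p) = p"
 by (simp add: qcoords)

lemma qconj_lin [simp]:
 "qconj (x + y) = qconj x + qconj y" "qconj (x - y) = qconj x - qconj y"
 "qconj (r *\<^sub>R x) = r *\<^sub>R qconj x" "qconj (- x) = - qconj x" "qconj 0 = 0"
 by (simp_all add: qcoords)

lemma qconj_unit [simp]: "qconj qone = qone" "qconj qi = - qi" "qconj qj = - qj" "qconj qk = - qk"
 by (simp_all add: qcoords)

lemma inner_qmult_same_left: "qmult g x \<bullet> qmult g y = (g \<bullet> g) * (x \<bullet> y)"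
 by (simp add: inner_qmult_right qmult_assoc[symmetric] qconj_mult_self)

lemma inner_qmult_same_right: "qmult x g \<bullet> qmult y g = (g \<bullet> g) * (x \<bullet> y)"
 by (simp add: inner_qmult_left qmult_assoc qconj_mult_self)

lemma norm_qmult: "norm (qmult x y) = norm x * norm y"
 by (simp add: norm_eq_sqrt_inner inner_qmult_same_left real_sqrt_mult)

lemma norm_qconj [simp]: "norm (qconj x) = norm x"
 by (simp add: norm_eq_sqrt_inner qcoords)

lemma bounded_bilinear_qmult: "bounded_bilinear qmult"
 by standard (auto simp: norm_qmult intro!: exI[of _ 1])

interpretation qmult: bounded_bilinear qmult
 by (rule bounded_bilinear_qmult)

lemmas qmult_has_derivative [derivative_intros] = qmult.FDERIV
lemmas qmult_continuous_on [continuous_intros] = qmult.continuous_on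

lemma qunit_table:
 "qmult qi qi = - qone" "qmult qj qj = - qone" "qmult qk qk = - qone"
 "qmult qi qj = qk" "qmult qj qk = qi" "qmult qk qi = qj"
 "qmult qj qi = - qk" "qmult qk qj = - qi" "qmult qi qk = - qj"
 by (simp_all add: qcoords)

lemma S3_iff_inner: "x \<in> S3 \<longleftrightarrow> x \<bullet> x = 1"
 by (simp add: S3_def norm_eq_1)

lemma qmult_in_S3: "x \<in> S3 ==> y \<in> S3 ==> qmult x y \<in> S3"
 by (simp add: S3_def norm_qmult)

lemma qconj_in_S3: "x \<in> S3 ==> qconj x \<in> S3"
 by (simp add: S3_def)

lemma qunit_in_S3: "qone \<in> S3" "qi \<in> S3" "qj \<in> S3" "qk \<in> S3"
 by (simp_all add: S3_iff_inner inner_R4)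

lemma qconj_cancel:
 "x \<in> S3 ==> qmult x (qmult (qconj x) z) = z" "x \<in> S3 ==> qmult (qconj x) (qmult x z) = z"
 "x \<in> S3 ==> qmult (qmult z x) (qconj x) = z" "x \<in> S3 ==> qmult (qmult z (qconj x)) x = z"
 by (simp_all add: qmult_assoc[symmetric] qconj_mult_self S3_iff_inner)
   (simp_all add: qmult_assoc qconj_mult_self S3_iff_inner)

text \<open>
 Left multiplication by a unit quaternion is a rotation of the ambient space. This reduces determinants
 at \<open>y\<close> to determinants at the unit element.
\<close>

lemma det_qmult_left:
 assumes "y \<in> S3"
 shows "det4 (qmult y a) (qmult y b) (qmult y c) (qmult y d) = det4 a b c d"
proof -
 define L :: "real^4^4" where "L = vector [qmult y qone, qmult y qi, qmult y qj, qmult y qk]"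
 have "(vector [qmult y a, qmult y b, qmult y c, qmult y d] :: real^4^4) = vector [a, b, c, d] ** L"
  by (simp add: vec_eq_iff forall_4 matrix_matrix_mult_def sum_4 L_def qmult_nth algebra_simps)
 moreover have "det L = (y \<bullet> y)^2"
  unfolding L_def det_4 by (simp add: qmult_nth inner_R4; algebra)
 ultimately show ?thesis
  using assms by (simp add: det_mul S3_iff_inner)
qed

lemma det_frame:
 assumes "y \<in> S3"
 shows "det4 y (qmult y p) (qmult y q) (qmult y r)
    = p$2 * (q$3 * r$4 - q$4 * r$3) - p$3 * (q$2 * r$4 - q$4 * r$2) + p$4 * (q$2 * r$3 - q$3 * r$2)"
 using det_qmult_left[OF assms(1), of qone p q r]
 by (simp add: det_4)

section \<open>The bilinear forms\<close>

lemma hdot_lin [simp]: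
 "hdot (x + x') y = hdot x y + hdot x' y" "hdot x (y + y') = hdot x y + hdot x y'"
 "hdot (x - x') y = hdot x y - hdot x' y" "hdot x (y - y') = hdot x y - hdot x y'"
 "hdot (r *\<^sub>R x) y = r * hdot x y" "hdot x (r *\<^sub>R y) = r * hdot x y"
 "hdot 0 y = 0" "hdot x 0 = 0" "hdot (- x) y = - hdot x y" "hdot x (- y) = - hdot x y"
 by (simp_all add: hdot_def lorentz_def algebra_simps)

lemma hdot_R4: "hdot x y = x$2 * y$2 + x$3 * y$3 + x$4 * y$4 - x$1 * y$1"
 by (simp add: hdot_def lorentz_def)

lemma hdot_commute: "hdot x y = hdot y x"
 by (simp add: hdot_R4 mult.commute)

lemma abs_hdot_le: "\<bar>hdot x y\<bar> <= norm x * norm y"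
proof -
 have "hdot x y = x \<bullet> vector [- y$1, y$2, y$3, y$4]"
  by (simp add: hdot_R4 inner_R4)
 moreover have "norm (vector [- y$1, y$2, y$3, y$4] :: R4) = norm y"
  by (simp add: norm_eq_sqrt_inner inner_R4)
 ultimately show ?thesis
  using Cauchy_Schwarz_ineq2[of x "vector [- y$1, y$2, y$3, y$4]"] by simp
qed

lemma bounded_bilinear_hdot: "bounded_bilinear hdot"
 by standard (auto intro!: exI[of _ 1] simp: abs_hdot_le)

interpretation hdot: bounded_bilinear hdot
 by (rule bounded_bilinear_hdot)

lemmas hdot_has_derivative [derivative_intros] = hdot.FDERIV
lemmas hdot_continuous_on [continuous_intros] = hdot.continuous_on

lemma H3_iff: "x \<in> H3 \<longleftrightarrow> hdot x x = - 1 \<and> x$1 > 0"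
 by (auto simp: H3_def hdot_def)

text \<open>
 A time-like vector is \<open>hdot\<close>-orthogonal only to space-like ones: by Cauchy--Schwarz in the last
 three coordinates, \<open>x\<^sub>0\<^sup>2 w\<^sub>0\<^sup>2 = (u \<cdot> u')^2 \<le> (x\<^sub>0\<^sup>2 - 1) \<bar>u'\<bar>^2\<close>.
\<close>

lemma hdot_tangent_ge:
 assumes "x \<in> H3" "hdot x w = 0"
 shows "hdot w w * (x$1)^2 \<ge> (w$2)^2 + (w$3)^2 + (w$4)^2"
proof -
 have eq: "x$1 * w$1 = x$2 * w$2 + x$3 * w$3 + x$4 * w$4"
  using assms(2) by (simp add: hdot_R4)
 have x: "(x$1)^2 = 1 + (x$2)^2 + (x$3)^2 + (x$4)^2"
  using assms(1) by (simp add: H3_iff hdot_R4 power2_eq_square)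
 have "(x$1)^2 * (w$1)^2 = (x$2 * w$2 + x$3 * w$3 + x$4 * w$4)^2"
  by (metis eq power_mult_distrib)
 also have "\<dots> = ((x$2)^2 + (x$3)^2 + (x$4)^2) * ((w$2)^2 + (w$3)^2 + (w$4)^2)
   - ((x$2 * w$3 - x$3 * w$2)^2 + (x$2 * w$4 - x$4 * w$2)^2 + (x$3 * w$4 - x$4 * w$3)^2)"
  by algebra
 also have "\<dots> <= ((x$2)^2 + (x$3)^2 + (x$4)^2) * ((w$2)^2 + (w$3)^2 + (w$4)^2)"
  using zero_le_power2[of "x$2 * w$3 - x$3 * w$2"] zero_le_power2[of "x$2 * w$4 - x$4 * w$2"]
   zero_le_power2[of "x$3 * w$4 - x$4 * w$3"] by linarith
 also have "(x$2)^2 + (x$3)^2 + (x$4)^2 = (x$1)^2 - 1"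
  using x by linarith
 finally show ?thesis
  by (simp add: hdot_R4 power2_eq_square algebra_simps)
qed

lemma H3_ge_1: "x \<in> H3 ==> x$1 \<ge> 1"
proof -
 assume "x \<in> H3"
 then have eq: "x$2 * x$2 + x$3 * x$3 + x$4 * x$4 - x$1 * x$1 = - 1" and pos: "x$1 > 0"
  by (simp_all add: H3_iff hdot_R4)
 have "x$1 * x$1 \<ge> 1"
  using eq zero_le_square[of "x$2"] zero_le_square[of "x$3"] zero_le_square[of "x$4"] by linarith
 then have "1\<^sup>2 <= (x$1)^2" "0 <= x$1" using pos by (simp_all add: power2_eq_square)
 then show ?thesis using power2_le_imp_le[of 1 "x$1"] by linarith
qed

lemma hdot_tangent_pos:
 assumes "x \<in> H3" "hdot x w = 0"
 shows "hdot w w \<ge> 0" "hdot w w = 0 ==> w = 0"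
proof -
 have pos: "x$1 > 0" using assms(1) by (simp add: H3_iff)
 have ge: "hdot w w * (x$1)^2 \<ge> (w$2)^2 + (w$3)^2 + (w$4)^2"
  by (rule hdot_tangent_ge[OF assms])
 then have "hdot w w * (x$1)^2 \<ge> 0" by (smt (verit) zero_le_power2)
 then show "hdot w w \<ge> 0" using pos by (simp add: zero_le_mult_iff)
 assume "hdot w w = 0"
 with ge have "(w$2)^2 + (w$3)^2 + (w$4)^2 <= 0" by simp
 then have "w$2 = 0" "w$3 = 0" "w$4 = 0"
  by (smt (verit) zero_le_power2 power2_eq_iff_nonneg zero_eq_power2)+
 moreover have "w$1 = 0" using assms(2) calculation pos by (simp add: hdot_R4)
 ultimately show "w = 0" by (simp add: R4_eq_iff)
qed

section \<open>The cross products\<close>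

lemma det_repeated:
 "det4 x u v x = 0" "det4 x u u v = 0"
 "det4 x u v u = 0"
 unfolding det_4 vector_4_nth by (simp_all add: algebra_simps)

lemma det_zero: 
 "det4 x 0 v w = 0"
 "det4 x v 0 w = 0"
 "det4 x v w 0 = 0"
 unfolding det_4 vector_4_nth by simp_all

text \<open>The vector that represents the linear form \<open>w \<mapsto> det(x, u, v, w)\<close> for the Euclidean inner product.\<close>

definition cofactor_vec :: "R4 => R4 => R4 => R4" where
 "cofactor_vec x u v = vector
   [det4 x u v (axis 1 1), det4 x u v (axis 2 1),
   det4 x u v (axis 3 1), det4 x u v (axis 4 1)]"

lemma cofactor_vec_inner: "cofactor_vec x u v \<bullet> w = det4 x u v w"
 unfolding cofactor_vec_def inner_R4 vector_4_nth det_4 axis_R4_nth by (simp add: algebra_simps)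

lemma cross_eqI:
 assumes add: "!!a b c. B (a - b) c = B a c - B b c"
  and pos: "!!w. w \<in> tangent B x ==> B w w = 0 ==> w = 0"
  and comm: "!!a b. B a b = B b a"
  and z: "!!w. B z w = det4 x u v w"
 shows "cross B x u v = z"
proof -
 have zt: "z \<in> tangent B x"
  using z[of x] by (simp add: tangent_def comm[of x z] det_repeated)
 show ?thesis
  unfolding cross_def
 proof (rule the_equality)
  show "z \<in> tangent B x \<and> (\<forall>w\<in>tangent B x. B z w = det4 x u v w)"
   using z zt by simp
  fix z' assume z': "z' \<in> tangent B x \<and> (\<forall>w\<in>tangent B x. B z' w = det4 x u v w)"
  have t: "z' - z \<in> tangent B x"
   using z' zt by (simp add: tangent_def comm[of x] add)
  have "B (z' - z) (z' - z) = 0"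
   using z z' t by (simp add: add)
  then show "z' = z" using pos[OF t] by simp
 qed
qed

lemma cross_S3_eq: "cross_S3 x u v = cofactor_vec x u v"
 by (rule cross_eqI) (simp add: inner_diff_left, simp, rule inner_commute, simp add: cofactor_vec_inner)

lemma cross_S3_inner: "cross_S3 x u v \<bullet> w = det4 x u v w"
 by (simp add: cross_S3_eq cofactor_vec_inner)

text \<open>Changes the representing vector of a linear form from the Euclidean product to \<open>hdot\<close>.\<close>

definition time_flip :: "R4 => R4" where
 "time_flip x = vector [- x$1, x$2, x$3, x$4]"

lemma hdot_time_flip: "hdot (time_flip x) y = x \<bullet> y" 
 by (simp add: hdot_R4 inner_R4 time_flip_def)

lemma cross_H3_eq: "x \<in> H3 ==> cross_H3 x u v = time_flip (cofactor_vec x u v)"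
 by (rule cross_eqI) (simp, simp add: tangent_def hdot_tangent_pos, rule hdot_commute, simp add: hdot_time_flip cofactor_vec_inner)

lemma cross_H3_hdot: "x \<in> H3 ==> hdot (cross_H3 x u v) w = det4 x u v w"
 by (simp add: cross_H3_eq hdot_time_flip cofactor_vec_inner)

text \<open>
 If \<open>f\<^sub>1, f\<^sub>2, f\<^sub>3\<close> are orthogonal to \<open>x\<close>, the Gram matrix of \<open>x, f\<^sub>1, f\<^sub>2, f\<^sub>3\<close> is block
 diagonal; it is also \<open>A J A\<^sup>T\<close> for the matrix \<open>A\<close> with these rows. So the Riemannian volume density
 is the Euclidean volume of the parallelepiped with the edge \<open>x\<close> added.
\<close>

lemma det_gram_S3:
 assumes "x \<bullet> x = 1" "!!i. x \<bullet> f i = 0"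
 shows "det (\<chi> i j. f i \<bullet> f j :: real^3^3) = (det4 x (f 1) (f 2) (f 3))^2"
proof -
 define A :: "real^4^4" where "A = vector [x, f 1, f 2, f 3]"
 have "(det A)^2 = det (A ** transpose A)"
  by (simp add: det_mul power2_eq_square)
 also have "A ** transpose A = vector [vector [1, 0, 0, 0],
    vector [0, f 1 \<bullet> f 1, f 1 \<bullet> f 2, f 1 \<bullet> f 3], vector [0, f 2 \<bullet> f 1, f 2 \<bullet> f 2, f 2 \<bullet> f 3],
    vector [0, f 3 \<bullet> f 1, f 3 \<bullet> f 2, f 3 \<bullet> f 3]]"
  using assms(1) assms(2)[of 1] assms(2)[of 2] assms(2)[of 3]
  by (simp add: vec_eq_iff forall_4 matrix_matrix_mult_def transpose_def sum_4 A_def inner_R4 algebra_simps)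
 also have "det \<dots> = det (\<chi> i j. f i \<bullet> f j :: real^3^3)"
  unfolding det_4 det_3 by (simp add: algebra_simps)
 finally show ?thesis by (simp add: A_def)
qed

lemma det_gram_H3:
 assumes "hdot x x = - 1" "!!i. hdot x (f i) = 0"
 shows "det (\<chi> i j. hdot (f i) (f j) :: real^3^3) = (det4 x (f 1) (f 2) (f 3))^2"
proof -
 define A :: "real^4^4" where "A = vector [x, f 1, f 2, f 3]"
 define J :: "real^4^4" where "J = vector [vector [-1,0,0,0], vector [0,1,0,0], vector [0,0,1,0], vector [0,0,0,1]]"
 have "det J = - 1" unfolding det_4 J_def by simp
 then have "(det A)^2 = - det (A ** (J ** transpose A))"
  by (simp add: det_mul power2_eq_square)
 also have "A ** (J ** transpose A) = vector [vector [- 1, 0, 0, 0],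
    vector [0, hdot (f 1) (f 1), hdot (f 1) (f 2), hdot (f 1) (f 3)],
    vector [0, hdot (f 2) (f 1), hdot (f 2) (f 2), hdot (f 2) (f 3)],
    vector [0, hdot (f 3) (f 1), hdot (f 3) (f 2), hdot (f 3) (f 3)]]"
  using assms(1) assms(2)[of 1] assms(2)[of 2] assms(2)[of 3]
  by (simp add: vec_eq_iff forall_4 matrix_matrix_mult_def transpose_def sum_4 A_def J_def hdot_R4 algebra_simps)
 also have "- det \<dots> = det (\<chi> i j. hdot (f i) (f j) :: real^3^3)"
  unfolding det_4 det_3 by (simp add: algebra_simps)
 finally show ?thesis by (simp add: A_def)
qed

section \<open>Geodesics and parallel transport\<close>

lemma the_or_zero_eqI: "P w ==> (!!z. P z ==> z = w) ==> the_or_zero P = w"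
 unfolding the_or_zero_def by (metis the_equality)

lemma vector_derivative_unique_unit_interval:
 assumes "t \<in> {0..1::real}" "(f has_vector_derivative a) (at t within {0..1})"
  "(f has_vector_derivative b) (at t within {0..1})"
 shows "a = b"
 using vector_derivative_unique_within_closed_interval[of 0 1 t f a b] assms by simp

text \<open>
 What the sphere (\<open>\<sigma> = 1\<close>) and hyperbolic space (\<open>\<sigma> = - 1\<close>) have in common. The last assumption says
 that \<open>M\<close> is a union of components of the level set: on the hyperboloid, \<open>B x z < 0\<close> selects the sheet of \<open>x\<close>.
\<close>

locale space_form =
 fixes B :: "R4 => R4 => real" and M :: "R4 set" and \<sigma> :: real
 assumes bilinear: "bounded_bilinear B"
  and comm: "B x y = B y x"
  and level: "x \<in> M ==> B x x = \<sigma>"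
  and sigma: "\<sigma> = 1 \<or> \<sigma> = - 1"
  and tangent_nonneg: "x \<in> M ==> B x w = 0 ==> B w w \<ge> 0"
  and tangent_definite: "x \<in> M ==> B x w = 0 ==> B w w = 0 ==> w = 0"
  and component: "x \<in> M ==> B z z = \<sigma> ==> \<sigma> = 1 \<or> B x z < 0 ==> z \<in> M"
begin

sublocale B: bounded_bilinear B
 by (rule bilinear)

lemmas B_lin [simp] = B.add_left B.add_right B.diff_left B.diff_right B.scaleR_left B.scaleR_right
 B.zero_left B.zero_right B.minus_left B.minus_right

lemma sigma_sq [simp]: "\<sigma> * \<sigma> = 1" "\<sigma> ~= 0" "\<sigma> * (\<sigma> * a) = a"
 using sigma by auto

lemma normal_eq:
 assumes "x \<in> M" "\<forall>w\<in>tangent B x. B D w = 0"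
 shows "D = (\<sigma> * B D x) *\<^sub>R x"
proof -
 define z where "z = D - (\<sigma> * B D x) *\<^sub>R x"
 have Bxz: "B x z = 0"
  using level[OF assms(1)] by (simp add: z_def comm[of x D])
 then have "B D z = 0" using assms(2) by (simp add: tangent_def)
 then have "B z z = 0" using Bxz by (subst (1) z_def) simp
 from tangent_definite[OF assms(1) Bxz this] show ?thesis by (simp add: z_def)
qed

lemma tangent_Cauchy_Schwarz:
 assumes "x \<in> M" "B x v = 0" "B x w = 0"
 shows "(B v w)^2 <= B v v * B w w"
proof (cases "B w w = 0")
 case True
 then have "w = 0" using tangent_definite assms by blast
 then show ?thesis by simp
next
 case False
 then have pos: "B w w > 0" using tangent_nonneg[OF assms(1,3)] by linarith
 define s where "s = B v w / B w w"
 have "B x (v - s *\<^sub>R w) = 0" using assms by simp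
 then have "0 <= B (v - s *\<^sub>R w) (v - s *\<^sub>R w)" by (rule tangent_nonneg[OF assms(1)])
 also have "\<dots> = B v v - (B v w)^2 / B w w"
  using False by (simp add: s_def comm[of w v] field_simps power2_eq_square)
 finally show ?thesis using pos by (simp add: field_simps)
qed

text \<open>
 Cauchy--Schwarz for \<open>w\<close> and the tangential part of \<open>x\<close> at \<open>z\<close>: the directional derivative of
 \<open>z \<mapsto> B x z\<close> is at most the length of \<open>w\<close> times the sine, or hyperbolic sine, of the distance.
\<close>

lemma radial_derivative_bound:
 assumes "x \<in> M" "z \<in> M" "B z w = 0"
 shows "\<bar>\<sigma> * B x w\<bar> <= sqrt (\<sigma> * (1 - (\<sigma> * B x z)^2)) * sqrt (B w w)"
proof -
 define v where "v = x - (\<sigma> * B x z) *\<^sub>R z"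
 have Bzv: "B z v = 0" by (simp add: v_def level[OF assms(2)] comm[of z x])
 have Bvw: "B v w = B x w" by (simp add: v_def assms)
 have s1: "\<sigma> * (\<sigma> * a) = a" for a by simp
 have Bvv: "B v v = \<sigma> * (1 - (\<sigma> * B x z)^2)"
  by (simp add: v_def level[OF assms(1)] level[OF assms(2)] comm[of z x] power2_eq_square algebra_simps)
 have "\<bar>B x w\<bar> <= sqrt (B v v * B w w)"
  using tangent_Cauchy_Schwarz[OF assms(2) Bzv assms(3)] Bvw
  by (metis real_sqrt_abs real_sqrt_le_iff)
 moreover have "\<bar>\<sigma>\<bar> = 1" using sigma by auto
 ultimately show ?thesis by (simp add: Bvv[symmetric] abs_mult real_sqrt_mult)
qed

text \<open>
 \<open>G\<close> stands for a function of the cosine of the distance from \<open>x\<close>. If it is 1-Lipschitz along \<open>M\<close>, it changes along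
 a curve by at most the length.
\<close>

lemma curve_length_ge:
 assumes C1: "\<gamma> C1_differentiable_on {0..1}" and M: "\<gamma> ` {0..1} \<subseteq> M" and x: "x \<in> M"
  and dG: "!!z. z \<in> M ==> (G has_real_derivative G' (\<sigma> * B x z)) (at (\<sigma> * B x z))"
  and bd: "!!z. z \<in> M ==> \<bar>G' (\<sigma> * B x z)\<bar> * sqrt (\<sigma> * (1 - (\<sigma> * B x z)^2)) <= 1"
 shows "\<bar>G (\<sigma> * B x (\<gamma> 1)) - G (\<sigma> * B x (\<gamma> 0))\<bar> <= curve_length B \<gamma>"
proof -
 obtain D where D: "!!t. t \<in> {0..1} ==> (\<gamma> has_vector_derivative D t) (at t)" and cD: "continuous_on {0..1} D"
  using C1 unfolding C1_differentiable_on_def by blast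
 have Mt: "\<gamma> t \<in> M" if "t \<in> {0..1}" for t using M that by auto
 have dB: "((%t. \<sigma> * B x (\<gamma> t)) has_real_derivative \<sigma> * B x (D t)) (at t)" if "t \<in> {0..1}" for t
 proof -
  have "((%t. B x (\<gamma> t)) has_vector_derivative B x (D t)) (at t)"
   using bounded_linear.has_vector_derivative[OF B.bounded_linear_right D[OF that]] .
  then show ?thesis
   by (auto simp: has_real_derivative_iff_has_vector_derivative intro!: derivative_eq_intros)
 qed
 have tang: "B (\<gamma> t) (D t) = 0" if t: "t \<in> {0..1}" for t
 proof -
  have d1: "((%t. B (\<gamma> t) (\<gamma> t)) has_vector_derivative B (\<gamma> t) (D t) + B (D t) (\<gamma> t)) (at t within {0..1})"
   by (rule B.has_vector_derivative; rule has_vector_derivative_at_within[OF D[OF t]])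
  have d2: "((%t. B (\<gamma> t) (\<gamma> t)) has_vector_derivative 0) (at t within {0..1})"
   by (rule has_vector_derivative_transform[OF t _ has_vector_derivative_const[of \<sigma>]])
     (simp add: level Mt)
  have "B (\<gamma> t) (D t) + B (D t) (\<gamma> t) = 0"
   by (rule vector_derivative_unique_unit_interval[OF t d1 d2])
  then show ?thesis using comm[of "\<gamma> t" "D t"] by simp
 qed
 define h where "h t = G' (\<sigma> * B x (\<gamma> t)) * (\<sigma> * B x (D t))" for t
 have "((%t. G (\<sigma> * B x (\<gamma> t))) has_vector_derivative h t) (at t within {0..1})" if "t \<in> {0..1}" for t
  unfolding h_def has_real_derivative_iff_has_vector_derivative[symmetric]
  by (rule DERIV_subset[OF DERIV_chain2[OF dG[OF Mt[OF that]] dB[OF that]]]) simp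
 then have I: "(h has_integral (G (\<sigma> * B x (\<gamma> 1)) - G (\<sigma> * B x (\<gamma> 0)))) {0..1}"
  by (intro fundamental_theorem_of_calculus) auto
 define s where "s t = sqrt (B (D t) (D t))" for t
 have cs: "continuous_on {0..1} s"
  unfolding s_def by (intro continuous_intros B.continuous_on cD)
 have sI: "s integrable_on {0..1}" by (rule integrable_continuous_real[OF cs])
 have hs: "norm (h t) <= s t" if t: "t \<in> {0..1}" for t
 proof -
  have "norm (h t) = \<bar>G' (\<sigma> * B x (\<gamma> t))\<bar> * \<bar>\<sigma> * B x (D t)\<bar>"
   by (simp add: h_def abs_mult)
  also have "\<dots> <= \<bar>G' (\<sigma> * B x (\<gamma> t))\<bar> * (sqrt (\<sigma> * (1 - (\<sigma> * B x (\<gamma> t))^2)) * sqrt (B (D t) (D t)))"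
   by (rule mult_left_mono[OF radial_derivative_bound[OF x Mt[OF t] tang[OF t]]]) simp
  also have "\<dots> <= 1 * sqrt (B (D t) (D t))"
   unfolding mult.assoc[symmetric]
   by (rule mult_right_mono[OF bd[OF Mt[OF t]]]) (simp add: tangent_nonneg[OF Mt[OF t] tang[OF t]])
  finally show ?thesis by (simp add: s_def)
 qed
 have "norm (integral {0..1} h) <= integral {0..1} s"
  by (rule integral_norm_bound_integral) (use I sI hs in auto)
 moreover have "integral {0..1} s = curve_length B \<gamma>"
  unfolding curve_length_def s_def
  by (rule integral_cong) (simp add: vector_derivative_at[OF D])
 ultimately show ?thesis using integral_unique[OF I] by simp
qed

text \<open>
 \<open>C\<close> and \<open>S\<close> stand for \<open>cos (l t)\<close> and \<open>sin (l t) / l\<close> (\<open>t\<close> if \<open>l = 0\<close>), or their hyperbolic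
 counterparts, the fundamental solutions of \<open>\<gamma>'' = - \<sigma> l^2 \<gamma>\<close>, the equation of the geodesics
 of speed \<open>l\<close>.
\<close>

lemma geodesic_existence:
 assumes x: "x \<in> M" and e: "B x e = 0" "B e e = l^2" and l: "l \<ge> 0"
  and dC: "!!t. (C has_real_derivative - \<sigma> * l^2 * S t) (at t)"
  and dS: "!!t. (S has_real_derivative C t) (at t)"
  and C0: "C 0 = 1" and S0: "S 0 = 0"
  and id: "!!t. (C t)^2 + \<sigma> * l^2 * (S t)^2 = 1"
  and pos: "!!t. \<sigma> = 1 \<or> C t > 0"
 defines "\<gamma> \<equiv> %t. C t *\<^sub>R x + S t *\<^sub>R e"
  and "\<gamma>' \<equiv> %t. (- \<sigma> * l^2 * S t) *\<^sub>R x + C t *\<^sub>R e"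
 shows "\<gamma> t \<in> M" "\<gamma> 0 = x" "(\<gamma> has_vector_derivative \<gamma>' t) (at t)" (is ?g3)
  "(\<gamma>' has_vector_derivative (- \<sigma> * l^2) *\<^sub>R \<gamma> t) (at t)" (is ?g4)
  "B (\<gamma> t) (\<gamma>' t) = 0" "curve_length B \<gamma> = l" "\<gamma> C1_differentiable_on {0..1}" (is ?g7)
  "parallel_along B \<gamma> \<gamma>'" (is ?g8)
proof -
 have Bxx: "B x x = \<sigma>" by (rule level[OF x])
 have ex: "B e x = 0" using e comm by metis
 have "B (\<gamma> t) (\<gamma> t) = \<sigma> * ((C t)^2 + \<sigma> * l^2 * (S t)^2)" for t
  by (simp add: \<gamma>_def e ex Bxx power2_eq_square algebra_simps)
 then have lev: "B (\<gamma> t) (\<gamma> t) = \<sigma>" for t using id by simp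
 have sg: "B x (\<gamma> t) = \<sigma> * C t" for t by (simp add: \<gamma>_def e Bxx)
 show M: "\<gamma> t \<in> M" for t
  by (rule component[OF x lev]) (use pos[of t] sg[of t] sigma in auto)
 show "\<gamma> 0 = x" by (simp add: \<gamma>_def C0 S0)
 have d: "(\<gamma> has_vector_derivative \<gamma>' t) (at t)" for t
  unfolding \<gamma>_def \<gamma>'_def
  by (auto intro!: derivative_eq_intros dC dS)
 then show ?g3 .
 have d': "(\<gamma>' has_vector_derivative (- \<sigma> * l^2) *\<^sub>R \<gamma> t) (at t)" for t
  unfolding \<gamma>_def \<gamma>'_def
  by (auto intro!: derivative_eq_intros dC dS simp: algebra_simps)
 then show ?g4 .
 show tan: "B (\<gamma> t) (\<gamma>' t) = 0" for t
  by (simp add: \<gamma>_def \<gamma>'_def e ex Bxx power2_eq_square algebra_simps)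
 have sp: "B (\<gamma>' t) (\<gamma>' t) = l^2" for t
 proof -
  have "B (\<gamma>' t) (\<gamma>' t) = l^2 * ((C t)^2 + \<sigma> * l^2 * (S t)^2)"
   by (simp add: \<gamma>'_def e ex Bxx power2_eq_square algebra_simps)
  then show ?thesis by (simp add: id)
 qed
 show "curve_length B \<gamma> = l"
  unfolding curve_length_def vector_derivative_at[OF d] sp using l by simp
 show ?g7
  unfolding C1_differentiable_on_def
  by (intro exI[of _ \<gamma>'] conjI ballI d)
    (meson d' continuous_at_imp_continuous_on has_vector_derivative_continuous)
 show ?g8
  unfolding parallel_along_def tangent_def using tan d' by fastforce
qed

lemma geodesic_dist_eq:
 assumes "\<gamma> C1_differentiable_on {0..1}" "!!t. \<gamma> t \<in> M" "\<gamma> 0 = x" "\<gamma> 1 = y" "curve_length B \<gamma> = l"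
  and ge: "!!\<gamma>. \<gamma> C1_differentiable_on {0..1} ==> \<gamma> ` {0..1} \<subseteq> M ==> \<gamma> 0 = x ==> \<gamma> 1 = y ==> l <= curve_length B \<gamma>"
 shows "geodesic_dist B M x y = l"
 unfolding geodesic_dist_def
 by (rule cInf_eq_minimum) (use assms in blast)+

text \<open>
 Along a geodesic of speed \<open>l\<close>, a parallel field \<open>V\<close> satisfies \<open>V' = - \<sigma> k \<gamma>\<close> with constant
 \<open>k = V \<cdot> \<gamma>'\<close>, whereas \<open>\<gamma>'' = - \<sigma> l^2 \<gamma>\<close>. So \<open>l^2 V - k \<gamma>'\<close> is a constant vector of the ambient space.
\<close>

lemma parallel_transport_unique:
 assumes g: "geodesic_segment B M \<gamma> x y" and V: "parallel_along B \<gamma> V"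
  and l: "l = geodesic_dist B M x y"
  and dC: "!!t. (C has_real_derivative - \<sigma> * l^2 * S t) (at t)"
  and dS: "!!t. (S has_real_derivative C t) (at t)"
  and C0: "C 0 = 1" and S0: "S 0 = 0"
  and id: "!!t. (C t)^2 + \<sigma> * l^2 * (S t)^2 = 1"
  and ne: "\<sigma> * B x y ~= 1" "\<sigma> * B x y ~= - 1"
 shows "V 1 = V 0 - (B (V 0) y / (\<sigma> + B x y)) *\<^sub>R (x + y)"
proof -
 let ?I = "{0..1::real}"
 obtain \<gamma>' where d: "!!t. t \<in> ?I ==> (\<gamma> has_vector_derivative \<gamma>' t) (at t)"
  and par: "parallel_along B \<gamma> \<gamma>'" and len: "curve_length B \<gamma> = l"
  and M: "\<gamma> ` ?I \<subseteq> M" and ends: "\<gamma> 0 = x" "\<gamma> 1 = y"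
  using g l unfolding geodesic_segment_def by blast
 have Mt: "\<gamma> t \<in> M" if "t \<in> ?I" for t using M that by auto
 have field_eq: "(W has_vector_derivative (- \<sigma> * B (W t) (\<gamma>' t)) *\<^sub>R \<gamma> t) (at t within ?I)"
  if W: "parallel_along B \<gamma> W" and t: "t \<in> ?I" for W t
 proof -
  obtain D where D: "(W has_vector_derivative D) (at t)" "\<forall>w\<in>tangent B (\<gamma> t). B D w = 0"
   using W t unfolding parallel_along_def by blast
  have d1: "((%t. B (W t) (\<gamma> t)) has_vector_derivative B (W t) (\<gamma>' t) + B D (\<gamma> t)) (at t within ?I)"
   by (rule B.has_vector_derivative; rule has_vector_derivative_at_within; fact D d[OF t])
  have d2: "((%t. B (W t) (\<gamma> t)) has_vector_derivative 0) (at t within ?I)"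
   by (rule has_vector_derivative_transform[OF t _ has_vector_derivative_const[of 0]])
     (use W comm in \<open>auto simp: parallel_along_def tangent_def\<close>)
  have "B (W t) (\<gamma>' t) + B D (\<gamma> t) = 0"
   by (rule vector_derivative_unique_unit_interval[OF t d1 d2])
  then have "D = (- \<sigma> * B (W t) (\<gamma>' t)) *\<^sub>R \<gamma> t"
   using normal_eq[OF Mt[OF t] D(2)] by (simp add: add_eq_0_iff)
  then show ?thesis using has_vector_derivative_at_within[OF D(1)] by simp
 qed
 have tan: "B (\<gamma> t) (W t) = 0" if "parallel_along B \<gamma> W" "t \<in> ?I" for W t
  using that by (auto simp: parallel_along_def tangent_def)
 have tan': "B (W t) (\<gamma> t) = 0" if "parallel_along B \<gamma> W" "t \<in> ?I" for W t
  using tan[OF that] comm by metis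
 have dt: "(\<gamma> has_vector_derivative \<gamma>' t) (at t within ?I)" if "t \<in> ?I" for t
  by (rule has_vector_derivative_at_within[OF d[OF that]])
 have const: "f 1 = f 0" if "!!t. t \<in> ?I ==> (f has_vector_derivative 0) (at t within ?I)" for f :: "real => 'a::real_normed_vector"
  using has_vector_derivative_zero_constant[of ?I f] that by (metis atLeastAtMost_iff convex_real_interval(5) order_refl zero_le_one)
 have const': "f t = f 0" if "!!t. t \<in> ?I ==> (f has_vector_derivative 0) (at t within ?I)" "t \<in> ?I" for f :: "real => 'a::real_normed_vector" and t
  using has_vector_derivative_zero_constant[of ?I f] that by (metis atLeastAtMost_iff convex_real_interval(5) order_refl zero_le_one)
 define k where "k = B (V 0) (\<gamma>' 0)"
 have kc: "B (W t) (\<gamma>' t) = B (W 0) (\<gamma>' 0)" if W: "parallel_along B \<gamma> W" and t: "t \<in> ?I" for W t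
 proof (rule const'[OF _ t])
  fix t assume t: "t \<in> ?I"
  have "((%t. B (W t) (\<gamma>' t)) has_vector_derivative
    B (W t) ((- \<sigma> * B (\<gamma>' t) (\<gamma>' t)) *\<^sub>R \<gamma> t) + B ((- \<sigma> * B (W t) (\<gamma>' t)) *\<^sub>R \<gamma> t) (\<gamma>' t)) (at t within ?I)"
   by (rule B.has_vector_derivative; rule field_eq; fact W par t)
  then show "((%t. B (W t) (\<gamma>' t)) has_vector_derivative 0) (at t within ?I)"
   by (simp add: tan[OF par t] tan'[OF W t])
 qed
 have speed: "B (\<gamma>' 0) (\<gamma>' 0) = l^2"
 proof -
  have "l = integral ?I (%t. sqrt (B (\<gamma>' 0) (\<gamma>' 0)))"
   unfolding len[symmetric] curve_length_def
  proof (rule integral_cong)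
   fix t assume t: "t \<in> ?I"
   show "sqrt (B (vector_derivative \<gamma> (at t)) (vector_derivative \<gamma> (at t))) = sqrt (B (\<gamma>' 0) (\<gamma>' 0))"
    unfolding vector_derivative_at[OF d[OF t]] kc[OF par t] ..
  qed
  then have "l = sqrt (B (\<gamma>' 0) (\<gamma>' 0))" by simp
  moreover have "B (\<gamma>' 0) (\<gamma>' 0) \<ge> 0"
   by (rule tangent_nonneg[OF Mt tan[OF par]]) auto
  ultimately show ?thesis by simp
 qed
 have d': "(\<gamma>' has_vector_derivative (- \<sigma> * l^2) *\<^sub>R \<gamma> t) (at t within ?I)" if "t \<in> ?I" for t
  using field_eq[OF par that] kc[OF par that] speed by simp
 have dV: "(V has_vector_derivative (- \<sigma> * k) *\<^sub>R \<gamma> t) (at t within ?I)" if "t \<in> ?I" for t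
  using field_eq[OF V that] kc[OF V that] by (simp add: k_def)
 have dCt: "(C has_real_derivative - \<sigma> * l^2 * S t) (at t within ?I)"
  and dSt: "(S has_real_derivative C t) (at t within ?I)" for t
  using dC dS by (blast intro: DERIV_subset)+
 \<comment> \<open>First integrals: constant vectors of the ambient space along the geodesic.\<close>
 have W: "l^2 *\<^sub>R V 1 - k *\<^sub>R \<gamma>' 1 = l^2 *\<^sub>R V 0 - k *\<^sub>R \<gamma>' 0"
  by (rule const) (auto intro!: derivative_eq_intros dV d' simp: algebra_simps)
 have "C 1 *\<^sub>R \<gamma> 1 - S 1 *\<^sub>R \<gamma>' 1 = C 0 *\<^sub>R \<gamma> 0 - S 0 *\<^sub>R \<gamma>' 0"
  by (rule const) (auto intro!: derivative_eq_intros dt d' dCt dSt simp: algebra_simps)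
 then have E1: "C 1 *\<^sub>R y - S 1 *\<^sub>R \<gamma>' 1 = x" using ends C0 S0 by simp
 have "(\<sigma> * l^2 * S 1) *\<^sub>R \<gamma> 1 + C 1 *\<^sub>R \<gamma>' 1 = (\<sigma> * l^2 * S 0) *\<^sub>R \<gamma> 0 + C 0 *\<^sub>R \<gamma>' 0"
  by (rule const) (auto intro!: derivative_eq_intros dt d' dCt dSt simp: algebra_simps)
 then have E2: "(\<sigma> * l^2 * S 1) *\<^sub>R y + C 1 *\<^sub>R \<gamma>' 1 = \<gamma>' 0" using ends C0 S0 by simp
 have G1: "S 1 *\<^sub>R \<gamma>' 1 = C 1 *\<^sub>R y - x" using E1 by (simp add: algebra_simps)
 have "S 1 *\<^sub>R \<gamma>' 0 = (\<sigma> * l^2 * (S 1)^2) *\<^sub>R y + C 1 *\<^sub>R (S 1 *\<^sub>R \<gamma>' 1)"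
  unfolding E2[symmetric] by (simp add: power2_eq_square algebra_simps)
 also have "\<dots> = ((C 1)^2 + \<sigma> * l^2 * (S 1)^2) *\<^sub>R y - C 1 *\<^sub>R x"
  unfolding G1 by (simp add: power2_eq_square algebra_simps)
 finally have G0: "S 1 *\<^sub>R \<gamma>' 0 = y - C 1 *\<^sub>R x" by (simp add: id)
 have xM: "x \<in> M" using Mt[of 0] ends by simp
 have "B x (S 1 *\<^sub>R \<gamma>' 0) = 0" using tan[OF par, of 0] ends by simp
 then have c: "C 1 = \<sigma> * B x y" unfolding G0 using level[OF xM] by (simp add: algebra_simps)
 have k: "S 1 * k = B (V 0) y"
 proof -
  have "S 1 * k = B (V 0) (S 1 *\<^sub>R \<gamma>' 0)" by (simp add: k_def)
  also have "\<dots> = B (V 0) y" unfolding G0 using tan'[OF V, of 0] ends by simp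
  finally show ?thesis .
 qed
 have sl: "(S 1)^2 * l^2 = \<sigma> * (1 - (C 1)^2)"
 proof -
  have "1 - (C 1)^2 = \<sigma> * (l^2 * (S 1)^2)" using id[of 1] by (simp add: mult.assoc)
  then have "\<sigma> * (1 - (C 1)^2) = \<sigma> * (\<sigma> * (l^2 * (S 1)^2))" by (rule arg_cong)
  then show ?thesis by (simp only: sigma_sq mult.commute)
 qed
 have "((S 1)^2 * l^2) *\<^sub>R (V 1 - V 0) = (S 1 * k) *\<^sub>R (S 1 *\<^sub>R \<gamma>' 1 - S 1 *\<^sub>R \<gamma>' 0)"
 proof -
  have "l^2 *\<^sub>R (V 1 - V 0) = k *\<^sub>R (\<gamma>' 1 - \<gamma>' 0)" using W by (simp add: algebra_simps)
  then have "(S 1)^2 *\<^sub>R (l^2 *\<^sub>R (V 1 - V 0)) = (S 1)^2 *\<^sub>R (k *\<^sub>R (\<gamma>' 1 - \<gamma>' 0))" by simp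
  then show ?thesis by (simp add: power2_eq_square algebra_simps)
 qed
 also have "\<dots> = (B (V 0) y * (C 1 - 1)) *\<^sub>R (x + y)"
  unfolding k G1 G0 by (simp add: algebra_simps)
 finally have "(\<sigma> * (1 - (C 1)^2)) *\<^sub>R (V 1 - V 0) = (B (V 0) y * (C 1 - 1)) *\<^sub>R (x + y)"
  unfolding sl .
 moreover have "\<sigma> * (1 - (C 1)^2) = (C 1 - 1) * (- (\<sigma> + B x y))"
  by (simp add: c power2_eq_square algebra_simps)
 ultimately have "(C 1 - 1) *\<^sub>R (- (\<sigma> + B x y) *\<^sub>R (V 1 - V 0)) = (C 1 - 1) *\<^sub>R (B (V 0) y *\<^sub>R (x + y))"
  by (simp only: scaleR_scaleR mult.commute)
 then have "- (\<sigma> + B x y) *\<^sub>R (V 1 - V 0) = B (V 0) y *\<^sub>R (x + y)"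
  using ne(1) c by (simp only: scaleR_cancel_left) simp
 then have "V 1 - V 0 = - ((B (V 0) y / (\<sigma> + B x y)) *\<^sub>R (x + y))"
 proof -
  assume *: "- (\<sigma> + B x y) *\<^sub>R (V 1 - V 0) = B (V 0) y *\<^sub>R (x + y)"
  have ne0: "\<sigma> + B x y ~= 0" using ne(2) sigma by auto
  have "V 1 - V 0 = (- 1 / (\<sigma> + B x y)) *\<^sub>R (- (\<sigma> + B x y) *\<^sub>R (V 1 - V 0))"
  proof -
   have "(- 1 / (\<sigma> + B x y)) * (- (\<sigma> + B x y)) = 1"
    using ne0 by (simp add: field_simps)
   then show ?thesis unfolding scaleR_scaleR by simp
  qed
  then show ?thesis unfolding * by simp
 qed
 then show ?thesis by (simp add: algebra_simps)
qed

text \<open>The field \<open>u + (k / l^2) (\<gamma>' - \<gamma>'(0))\<close> is parallel along the geodesic; uniqueness gives its value at \<open>y\<close>.\<close>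

lemma parallel_transport_eq:
 assumes x: "x \<in> M" and y: "y \<in> M" and u: "B x u = 0"
  and l: "l = geodesic_dist B M x y" "l > 0"
  and dC: "!!t. (C has_real_derivative - \<sigma> * l^2 * S t) (at t)"
  and dS: "!!t. (S has_real_derivative C t) (at t)"
  and C0: "C 0 = 1" and S0: "S 0 = 0"
  and id: "!!t. (C t)^2 + \<sigma> * l^2 * (S t)^2 = 1"
  and pos: "!!t. \<sigma> = 1 \<or> C t > 0"
  and C1: "C 1 = \<sigma> * B x y"
  and ne: "\<sigma> * B x y ~= 1" "\<sigma> * B x y ~= - 1"
 shows "parallel_transport B M y x u = u - (B u y / (\<sigma> + B x y)) *\<^sub>R (x + y)"
proof -
 have S1: "S 1 ~= 0"
 proof
  assume "S 1 = 0"
  with id[of 1] have "(C 1)^2 = 1" by simp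
  then show False using ne by (simp add: C1 power2_eq_1_iff)
 qed
 define e where "e = (1 / S 1) *\<^sub>R (y - C 1 *\<^sub>R x)"
 have Bxe: "B x e = 0" by (simp add: e_def C1 level[OF x] algebra_simps)
 have "B e e = (1 / S 1)^2 * (\<sigma> * (1 - (C 1)^2))"
  by (simp add: e_def C1 level[OF x] level[OF y] comm[of y x] power2_eq_square algebra_simps)
 also have "1 - (C 1)^2 = \<sigma> * l^2 * (S 1)^2" using id[of 1] by simp
 finally have Bee: "B e e = l^2" using S1 by (simp add: power2_eq_square field_simps)
 define \<gamma> where "\<gamma> = (%t. C t *\<^sub>R x + S t *\<^sub>R e)"
 define \<gamma>' where "\<gamma>' = (%t. (- \<sigma> * l^2 * S t) *\<^sub>R x + C t *\<^sub>R e)"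
 have G: "\<gamma> t \<in> M" "\<gamma> 0 = x" "(\<gamma> has_vector_derivative \<gamma>' t) (at t)"
  "(\<gamma>' has_vector_derivative (- \<sigma> * l^2) *\<^sub>R \<gamma> t) (at t)"
  "B (\<gamma> t) (\<gamma>' t) = 0" "curve_length B \<gamma> = l" "parallel_along B \<gamma> \<gamma>'" for t
  unfolding \<gamma>_def \<gamma>'_def
  by (rule geodesic_existence[where C = C and S = S,
     OF x Bxe Bee less_imp_le[OF l(2)] dC dS C0 S0 id pos])+
 have y: "\<gamma> 1 = y" using S1 by (simp add: \<gamma>_def e_def)
 have seg: "geodesic_segment B M \<gamma> x y"
  unfolding geodesic_segment_def using G y l(1) by blast
 define k where "k = B u e"
 define V where "V = (%t. u + (k / l^2) *\<^sub>R (\<gamma>' t - \<gamma>' 0))"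
 have g0: "\<gamma>' 0 = e" by (simp add: \<gamma>'_def C0 S0)
 have "parallel_along B \<gamma> V"
  unfolding parallel_along_def
 proof
  fix t :: real assume "t \<in> {0..1}"
  have ux: "B u x = 0" using u comm by metis
  have ex: "B e x = 0" using Bxe comm by metis
  have "B (V t) (\<gamma> t) = B u (\<gamma> t) + (k / l^2) * (B (\<gamma> t) (\<gamma>' t) - B e (\<gamma> t))"
   unfolding V_def g0 by (simp add: comm)
  also have "\<dots> = 0"
   unfolding G(5) using l(2) by (simp add: \<gamma>_def k_def ux ex Bee)
  finally have "V t \<in> tangent B (\<gamma> t)" by (simp add: tangent_def comm)
  moreover have "(V has_vector_derivative (k / l^2) *\<^sub>R ((- \<sigma> * l^2) *\<^sub>R \<gamma> t)) (at t)"
   unfolding V_def by (auto intro!: derivative_eq_intros G(4))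
  moreover have "\<forall>w\<in>tangent B (\<gamma> t). B ((k / l^2) *\<^sub>R ((- \<sigma> * l^2) *\<^sub>R \<gamma> t)) w = 0"
   by (simp add: tangent_def)
  ultimately show "V t \<in> tangent B (\<gamma> t) \<and> (\<exists>D. (V has_vector_derivative D) (at t) \<and> (\<forall>w\<in>tangent B (\<gamma> t). B D w = 0))"
   by blast
 qed
 moreover have "V 0 = u" by (simp add: V_def)
 ultimately have ex: "\<exists>\<gamma> V. geodesic_segment B M \<gamma> x y \<and> parallel_along B \<gamma> V \<and> V 0 = u \<and> V 1 = V 1"
  and V1: "V 1 = u - (B u y / (\<sigma> + B x y)) *\<^sub>R (x + y)"
  using seg parallel_transport_unique[OF seg _ l(1) dC dS C0 S0 id ne, of V] by auto
 show ?thesis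
  unfolding parallel_transport_def
 proof (rule the_or_zero_eqI)
  show "\<exists>\<gamma> V. geodesic_segment B M \<gamma> x y \<and> parallel_along B \<gamma> V \<and> V 0 = u
    \<and> V 1 = u - (B u y / (\<sigma> + B x y)) *\<^sub>R (x + y)"
   using seg \<open>parallel_along B \<gamma> V\<close> \<open>V 0 = u\<close> V1 by blast
  fix z assume "\<exists>\<gamma> V. geodesic_segment B M \<gamma> x y \<and> parallel_along B \<gamma> V \<and> V 0 = u \<and> V 1 = z"
  then obtain \<gamma>2 V2 where 2: "geodesic_segment B M \<gamma>2 x y" "parallel_along B \<gamma>2 V2" "V2 0 = u" "V2 1 = z"
   by blast
  show "z = u - (B u y / (\<sigma> + B x y)) *\<^sub>R (x + y)"
   using parallel_transport_unique[OF 2(1,2) l(1) dC dS C0 S0 id ne] 2 by simp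
 qed
qed

end

interpretation S3: space_form "(\<bullet>)" S3 1
 by (rule space_form.intro) (auto simp: bounded_bilinear_inner inner_commute S3_iff_inner)

interpretation H3: space_form hdot H3 "- 1"
proof (rule space_form.intro)
 fix x z assume x: "x \<in> H3" and z: "hdot z z = - 1" and "(- 1::real) = 1 \<or> hdot x z < 0"
 then have neg: "hdot x z < 0" by simp
 have x1: "x$1 > 0" and xx: "hdot x x = - 1" using x by (auto simp: H3_iff)
 \<comment> \<open>On opposite sheets the product would be positive, by Cauchy--Schwarz (as Lagrange identity) in the space coordinates.\<close>
 have "z$1 > 0"
 proof (rule ccontr)
  assume "\<not> z$1 > 0"
  then have z1: "z$1 <= 0" by simp
  have "x$2 * z$2 + x$3 * z$3 + x$4 * z$4 < x$1 * z$1" using neg by (simp add: hdot_R4)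
  then have le: "- (x$1 * z$1) < - (x$2 * z$2 + x$3 * z$3 + x$4 * z$4)" by simp
  have "0 <= - (x$1 * z$1)" using x1 z1 by (simp add: mult_nonneg_nonpos)
  from power_strict_mono[OF le this, of 2]
  have "(x$1 * z$1)^2 < (x$2 * z$2 + x$3 * z$3 + x$4 * z$4)^2" unfolding power2_minus by simp
  also have "\<dots> = ((x$2)^2 + (x$3)^2 + (x$4)^2) * ((z$2)^2 + (z$3)^2 + (z$4)^2)
   - ((x$2 * z$3 - x$3 * z$2)^2 + (x$2 * z$4 - x$4 * z$2)^2 + (x$3 * z$4 - x$4 * z$3)^2)"
   by algebra
  also have "\<dots> <= ((x$2)^2 + (x$3)^2 + (x$4)^2) * ((z$2)^2 + (z$3)^2 + (z$4)^2)"
   using zero_le_power2[of "x$2 * z$3 - x$3 * z$2"] zero_le_power2[of "x$2 * z$4 - x$4 * z$2"]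
    zero_le_power2[of "x$3 * z$4 - x$4 * z$3"] by linarith
  also have "\<dots> = ((x$1)^2 - 1) * ((z$1)^2 - 1)"
  proof -
   have "(x$2)^2 + (x$3)^2 + (x$4)^2 = (x$1)^2 - 1" "(z$2)^2 + (z$3)^2 + (z$4)^2 = (z$1)^2 - 1"
    using xx z by (simp_all add: hdot_R4 power2_eq_square)
   then show ?thesis by simp
  qed
  also have "\<dots> = (x$1 * z$1)^2 + (1 - (x$1)^2 - (z$1)\<^sup>2)" by (simp add: power_mult_distrib algebra_simps)
  finally have "(x$1)^2 + (z$1)^2 < 1" by simp
  moreover have "(x$1)^2 \<ge> 1" using H3_ge_1[OF x] by simp
  ultimately show False using zero_le_power2[of "z$1"] by linarith
 qed
 then show "z \<in> H3" using z by (simp add: H3_iff)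
qed (auto simp: bounded_bilinear_hdot hdot_commute H3_iff hdot_tangent_pos)

lemma S3_inner_bounds: "x \<in> S3 ==> y \<in> S3 ==> - 1 <= x \<bullet> y \<and> x \<bullet> y <= 1"
 using Cauchy_Schwarz_ineq2[of x y] by (auto simp: S3_def abs_le_iff)

lemma S3_inner_eq_1: "x \<in> S3 ==> y \<in> S3 ==> x \<bullet> y = 1 \<longleftrightarrow> x = y"
 using inner_eq_zero_iff[of "x - y"] by (auto simp: S3_iff_inner inner_diff inner_commute algebra_simps)

lemma S3_inner_eq_m1: "x \<in> S3 ==> y \<in> S3 ==> x \<bullet> y = - 1 \<longleftrightarrow> x = - y"
 using S3_inner_eq_1[of x "- y"] by (auto simp: S3_def)

text \<open>The reversed Cauchy--Schwarz inequality for time-like vectors.\<close>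

lemma H3_hdot_le: "x \<in> H3 ==> y \<in> H3 ==> hdot x y <= - 1"
proof -
 assume x: "x \<in> H3" and y: "y \<in> H3"
 define w where "w = y + hdot x y *\<^sub>R x"
 have "hdot x w = 0" using x by (simp add: w_def H3_iff)
 from hdot_tangent_pos(1)[OF x this] have sq: "(hdot x y)^2 \<ge> 1"
  using x y by (simp add: w_def H3_iff hdot_commute[of y x] power2_eq_square)
 have "hdot x y < 0"
 proof (rule ccontr)
  assume "\<not> hdot x y < 0"
  then consider "hdot x y > 0" | "hdot x y = 0" by linarith
  then show False
  proof cases
   case 1
   then have "- y \<in> H3" using H3.component[OF x, of "- y"] y by (simp add: H3_iff)
   then show ?thesis using y by (simp add: H3_iff)
  qed (use sq in simp)
 qed
 then have "1 <= - hdot x y"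
  using sq power2_le_imp_le[of 1 "- hdot x y"] by simp
 then show ?thesis by simp
qed

lemma H3_hdot_eq: "x \<in> H3 ==> y \<in> H3 ==> hdot x y = - 1 \<longleftrightarrow> x = y"
proof
 assume x: "x \<in> H3" and y: "y \<in> H3" and e: "hdot x y = - 1"
 have "hdot x (y - x) = 0" using x e by (simp add: H3_iff)
 moreover have "hdot (y - x) (y - x) = 0" using x y e by (simp add: H3_iff hdot_commute[of y x])
 ultimately have "y - x = 0" using hdot_tangent_pos(2)[OF x] by blast
 then show "x = y" by simp
qed (simp add: H3_iff)

text \<open>
 Lower bounds of lengths: \<open>arccos (x \<cdot> \<gamma>)\<close> need not be differentiable where \<open>\<gamma>\<close> passes \<open>x\<close> or \<open>- x\<close>;
 \<open>arccos (r (x \<cdot> \<gamma>))\<close> with \<open>r < 1\<close> is, and its derivative is still at most the speed.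
\<close>

lemma dist_S3_eq:
 assumes x: "x \<in> S3" and y: "y \<in> S3"
 shows "dist_S3 x y = arccos (x \<bullet> y)"
proof -
 define l where "l = arccos (x \<bullet> y)"
 have cb: "- 1 <= x \<bullet> y" "x \<bullet> y <= 1" using S3_inner_bounds[OF x y] by auto
 have l: "0 <= l" "l <= pi" "cos l = x \<bullet> y" using cb by (auto simp: l_def arccos)
 define C where "C t = cos (l * t)" for t
 define S where "S t = (if l = 0 then t else sin (l * t) / l)" for t
 have dC: "(C has_real_derivative - 1 * l^2 * S t) (at t)" for t
  unfolding C_def S_def by (auto intro!: derivative_eq_intros simp: power2_eq_square)
 have dS: "(S has_real_derivative C t) (at t)" for t
  unfolding C_def S_def by (cases "l = 0") (auto intro!: derivative_eq_intros)
 have id: "(C t)^2 + 1 * l^2 * (S t)^2 = 1" for t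
  by (simp add: C_def S_def power_divide)
 have "\<exists>e. x \<bullet> e = 0 \<and> e \<bullet> e = l^2 \<and> C 1 *\<^sub>R x + S 1 *\<^sub>R e = y"
 proof (cases "sin l = 0")
  case False
  then have l0: "l ~= 0" by auto
  define e where "e = (l / sin l) *\<^sub>R (y - cos l *\<^sub>R x)"
  have "x \<bullet> e = 0" using x l by (simp add: e_def inner_diff_right S3_iff_inner)
  moreover have "(y - cos l *\<^sub>R x) \<bullet> (y - cos l *\<^sub>R x) = 1 - (cos l)^2"
   using x y l by (simp add: inner_diff S3_iff_inner inner_commute power2_eq_square algebra_simps)
  moreover have "e \<bullet> e = (l / sin l)^2 * ((y - cos l *\<^sub>R x) \<bullet> (y - cos l *\<^sub>R x))"
   unfolding e_def by (simp only: inner_scaleR_left inner_scaleR_right power2_eq_square mult.assoc)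
  ultimately have "x \<bullet> e = 0" "e \<bullet> e = (l / sin l)^2 * (1 - (cos l)^2)" by simp_all
  then have "x \<bullet> e = 0" "e \<bullet> e = l^2" using False by (simp_all add: power_divide flip: sin_squared_eq)
  moreover have "C 1 *\<^sub>R x + S 1 *\<^sub>R e = y"
   using False l0 by (simp add: C_def S_def e_def)
  ultimately show ?thesis by blast
 next
  case True
  \<comment> \<open>For equal or antipodal points any initial direction will do.\<close>
  define e where "e = l *\<^sub>R qmult x qi"
  have "x \<bullet> qmult x qi = 0" by (simp add: qcoords algebra_simps)
  moreover have "qmult x qi \<bullet> qmult x qi = 1"
   using qmult_in_S3[OF x qunit_in_S3(2)] by (simp add: S3_iff_inner)
  moreover have "S 1 *\<^sub>R e = 0" using True by (simp add: S_def e_def)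
  moreover have "(cos l)^2 = 1" using True sin_cos_squared_add[of l] by simp
  then have "y = x \<or> y = - x"
   using S3_inner_eq_1[OF x y] S3_inner_eq_m1[OF x y] l(3) by (auto simp: power2_eq_1_iff)
  then have "cos l *\<^sub>R x = y" using x l(3) by (auto simp: S3_iff_inner)
  ultimately show ?thesis
   by (intro exI[of _ e]) (simp add: C_def e_def power2_eq_square)
 qed
 then obtain e where e: "x \<bullet> e = 0" "e \<bullet> e = l^2" "C 1 *\<^sub>R x + S 1 *\<^sub>R e = y" by blast
 note G = S3.geodesic_existence[where C = C and S = S, OF x e(1,2) l(1) dC dS _ _ id]
 have "dist_S3 x y = l"
 proof (rule S3.geodesic_dist_eq)
  show "(%t. C t *\<^sub>R x + S t *\<^sub>R e) C1_differentiable_on {0..1}"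
   by (rule G) (auto simp: C_def S_def)
  show "C t *\<^sub>R x + S t *\<^sub>R e \<in> S3" for t
   by (rule G) (auto simp: C_def S_def)
  show "curve_length (\<bullet>) (%t. C t *\<^sub>R x + S t *\<^sub>R e) = l"
   by (rule G) (auto simp: C_def S_def)
  show "C 0 *\<^sub>R x + S 0 *\<^sub>R e = x" by (simp add: C_def S_def)
  show "C 1 *\<^sub>R x + S 1 *\<^sub>R e = y" by (rule e(3))
  fix \<gamma> :: "real => R4"
  assume g: "\<gamma> C1_differentiable_on {0..1}" "\<gamma> ` {0..1} \<subseteq> S3" "\<gamma> 0 = x" "\<gamma> 1 = y"
  have le: "\<bar>arccos (r * (x \<bullet> y)) - arccos (r * 1)\<bar> <= curve_length (\<bullet>) \<gamma>" if r: "0 < r" "r < 1" for r :: real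
  proof -
   have rz: "\<bar>r * (x \<bullet> z)\<bar> < 1" if "z \<in> S3" for z
   proof -
    have "\<bar>x \<bullet> z\<bar> <= 1" using S3_inner_bounds[OF x that] by (simp add: abs_le_iff)
    then have "\<bar>r\<bar> * \<bar>x \<bullet> z\<bar> <= \<bar>r\<bar> * 1" by (intro mult_left_mono) auto
    then show ?thesis using r unfolding abs_mult by linarith
   qed
   have "\<bar>arccos (r * (1 * (x \<bullet> \<gamma> 1))) - arccos (r * (1 * (x \<bullet> \<gamma> 0)))\<bar> <= curve_length (\<bullet>) \<gamma>"
   proof (rule S3.curve_length_ge[OF g(1,2) x, where G = "%s. arccos (r * s)" and G' = "%s. - r / sqrt (1 - (r * s)^2)"])
    fix z assume z: "z \<in> S3"
    show "((%s. arccos (r * s)) has_real_derivative - r / sqrt (1 - (r * (1 * (x \<bullet> z)))\<^sup>2)) (at (1 * (x \<bullet> z)))"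
     using rz[OF z] by (auto intro!: derivative_eq_intros simp: abs_less_iff divide_inverse)
    have "(x \<bullet> z)^2 <= 1" using S3_inner_bounds[OF x z] by (simp add: abs_square_le_1 abs_le_iff)
    have "r^2 <= 1" using r by (simp add: power_le_one)
    then have "r * sqrt (1 - (x \<bullet> z)^2) <= sqrt (1 - (r * (x \<bullet> z))^2)"
     using r by (intro real_le_rsqrt) (simp add: power_mult_distrib \<open>(x \<bullet> z)^2 <= 1\<close> algebra_simps)
    moreover have "sqrt (1 - (r * (x \<bullet> z))^2) > 0"
     using rz[OF z] by (simp add: abs_square_less_1)
    ultimately show "\<bar>- r / sqrt (1 - (r * (1 * (x \<bullet> z)))\<^sup>2)\<bar> * sqrt (1 * (1 - (1 * (x \<bullet> z))^2)) <= 1"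
     using r by (simp add: field_simps)
   qed
   then show ?thesis using g x by (simp add: S3_iff_inner)
  qed
  define r where "r n = 1 - inverse (real (Suc (Suc n)))" for n
  have r01: "0 < r n" "r n < 1" for n by (auto simp: r_def inverse_eq_divide)
  have "r \<longlonglongrightarrow> 1 - 0" unfolding r_def
   by (intro tendsto_diff tendsto_const LIMSEQ_Suc[OF LIMSEQ_inverse_real_of_nat])
  then have r1: "r \<longlonglongrightarrow> 1" by simp
  have lim: "(%n. arccos (r n * c)) \<longlonglongrightarrow> arccos c" if "- 1 <= c" "c <= 1" for c
  proof (rule continuous_on_tendsto_compose[OF continuous_on_arccos'])
   show "(%n. r n * c) \<longlonglongrightarrow> c" using tendsto_mult[OF r1 tendsto_const[of c]] by simp
   have "\<bar>r n * c\<bar> <= 1 * 1" for n unfolding abs_mult using r01[of n] that by (intro mult_mono) (auto simp: abs_le_iff)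
   then show "\<forall>\<^sub>F n in sequentially. r n * c \<in> {- 1..1}" by (auto simp: abs_le_iff algebra_simps intro!: always_eventually)
  qed (use that in auto)
  have "(%n. \<bar>arccos (r n * (x \<bullet> y)) - arccos (r n * 1)\<bar>) \<longlonglongrightarrow> \<bar>arccos (x \<bullet> y) - arccos 1\<bar>"
   by (intro tendsto_rabs tendsto_diff lim) (use cb in auto)
  from LIMSEQ_le_const2[OF this] le r01
  have "\<bar>arccos (x \<bullet> y) - arccos 1\<bar> <= curve_length (\<bullet>) \<gamma>" by blast
  then show "l <= curve_length (\<bullet>) \<gamma>" by (simp add: l_def)
 qed
 then show ?thesis by (simp add: l_def)
qed

lemma transport_S3_eq:
 assumes x: "x \<in> S3" and y: "y \<in> S3" and u: "x \<bullet> u = 0" and c: "\<bar>x \<bullet> y\<bar> < 1"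
 shows "transport_S3 y x u = u - (u \<bullet> y / (1 + x \<bullet> y)) *\<^sub>R (x + y)"
proof -
 define l where "l = dist_S3 x y"
 have l: "l = arccos (x \<bullet> y)" by (simp add: l_def dist_S3_eq x y)
 have "cos l = x \<bullet> y" using c by (simp add: l abs_less_iff)
 have "0 < l" using arccos_lt_bounded[of "x \<bullet> y"] c by (auto simp: l abs_less_iff)
 define C where "C t = cos (l * t)" for t
 define S where "S t = sin (l * t) / l" for t
 show ?thesis
 proof (rule S3.parallel_transport_eq[OF x y u l_def \<open>0 < l\<close>, of C S])
  show "(C has_real_derivative - 1 * l^2 * S t) (at t)" for t
   unfolding C_def S_def by (auto intro!: derivative_eq_intros simp: power2_eq_square)
  show "(S has_real_derivative C t) (at t)" for t
   unfolding C_def S_def using \<open>0 < l\<close> by (auto intro!: derivative_eq_intros)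
  show "(C t)^2 + 1 * l^2 * (S t)^2 = 1" for t
   using \<open>0 < l\<close> by (simp add: C_def S_def power_divide)
 qed (use c \<open>cos l = x \<bullet> y\<close> in \<open>auto simp: C_def S_def\<close>)
qed

lemma dist_H3_eq:
 assumes x: "x \<in> H3" and y: "y \<in> H3"
 shows "dist_H3 x y = arcosh (- hdot x y)"
proof -
 define l where "l = arcosh (- hdot x y)"
 have cb: "1 <= - hdot x y" using H3_hdot_le[OF x y] by simp
 have l: "0 <= l" "cosh l = - hdot x y" using cb by (auto simp: l_def)
 define C where "C t = cosh (l * t)" for t
 define S where "S t = (if l = 0 then t else sinh (l * t) / l)" for t
 have dC: "(C has_real_derivative - (- 1) * l^2 * S t) (at t)" for t
  unfolding C_def S_def by (auto intro!: derivative_eq_intros simp: power2_eq_square)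
 have dS: "(S has_real_derivative C t) (at t)" for t
  unfolding C_def S_def by (cases "l = 0") (auto intro!: derivative_eq_intros)
 have id: "(C t)^2 + (- 1) * l^2 * (S t)^2 = 1" for t
  by (simp add: C_def S_def power_divide cosh_square_eq)
 have "\<exists>e. hdot x e = 0 \<and> hdot e e = l^2 \<and> C 1 *\<^sub>R x + S 1 *\<^sub>R e = y"
 proof (cases "l = 0")
  case False
  define e where "e = (l / sinh l) *\<^sub>R (y - cosh l *\<^sub>R x)"
  have s0: "sinh l ~= 0" using False by simp
  have "hdot x e = 0" using x l by (simp add: e_def H3_iff)
  moreover have "hdot (y - cosh l *\<^sub>R x) (y - cosh l *\<^sub>R x) = (cosh l)^2 - 1"
   using x y l by (simp add: H3_iff hdot_commute[of y x] power2_eq_square algebra_simps)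
  moreover have "hdot e e = (l / sinh l)^2 * hdot (y - cosh l *\<^sub>R x) (y - cosh l *\<^sub>R x)"
   unfolding e_def by (simp only: hdot.scaleR_left hdot.scaleR_right real_scaleR_def power2_eq_square mult.assoc)
  ultimately have "hdot x e = 0" "hdot e e = (l / sinh l)^2 * ((cosh l)^2 - 1)" by simp_all
  then have "hdot x e = 0" "hdot e e = l^2" using s0 by (simp_all add: power_divide cosh_square_eq)
  moreover have "C 1 *\<^sub>R x + S 1 *\<^sub>R e = y"
   using False s0 by (simp add: C_def S_def e_def)
  ultimately show ?thesis by blast
 next
  case True
  then have "hdot x y = - 1" using l(2) by simp
  then have "x = y" using H3_hdot_eq[OF x y] by simp
  then show ?thesis using True by (intro exI[of _ 0]) (simp add: C_def)
 qed
 then obtain e where e: "hdot x e = 0" "hdot e e = l^2" "C 1 *\<^sub>R x + S 1 *\<^sub>R e = y" by blast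
 note G = H3.geodesic_existence[where C = C and S = S, OF x e(1,2) l(1) dC dS _ _ id]
 have "dist_H3 x y = l"
 proof (rule H3.geodesic_dist_eq)
  show "(%t. C t *\<^sub>R x + S t *\<^sub>R e) C1_differentiable_on {0..1}"
   by (rule G) (auto simp: C_def S_def)
  show "C t *\<^sub>R x + S t *\<^sub>R e \<in> H3" for t
   by (rule G) (auto simp: C_def S_def)
  show "curve_length hdot (%t. C t *\<^sub>R x + S t *\<^sub>R e) = l"
   by (rule G) (auto simp: C_def S_def)
  show "C 0 *\<^sub>R x + S 0 *\<^sub>R e = x" by (simp add: C_def S_def)
  show "C 1 *\<^sub>R x + S 1 *\<^sub>R e = y" by (rule e(3))
  fix \<gamma> :: "real => R4"
  assume g: "\<gamma> C1_differentiable_on {0..1}" "\<gamma> ` {0..1} \<subseteq> H3" "\<gamma> 0 = x" "\<gamma> 1 = y"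
  have le: "\<bar>arcosh (r * (- hdot x y)) - arcosh (r * 1)\<bar> <= curve_length hdot \<gamma>" if r: "1 < r" for r :: real
  proof -
   have "\<bar>arcosh (r * (- 1 * hdot x (\<gamma> 1))) - arcosh (r * (- 1 * hdot x (\<gamma> 0)))\<bar> <= curve_length hdot \<gamma>"
   proof (rule H3.curve_length_ge[OF g(1,2) x, where G = "%s. arcosh (r * s)" and G' = "%s. r / sqrt ((r * s)^2 - 1)"])
    fix z assume z: "z \<in> H3"
    define s where "s = - 1 * hdot x z"
    have s: "s \<ge> 1" using H3_hdot_le[OF x z] by (simp add: s_def)
    have "1 * s < r * s" using r s by (intro mult_strict_right_mono) auto
    then have rs: "1 < r * s" using s by linarith
    then have rs2: "1 < (r * s)^2" by simp
    show "((%s. arcosh (r * s)) has_real_derivative r / sqrt ((r * s)^2 - 1)) (at s)"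
     by (rule DERIV_chain2[OF arcosh_real_has_field_derivative, THEN DERIV_cong])
       (use rs in \<open>auto intro!: derivative_eq_intros simp: divide_inverse\<close>)
    have "1 <= r^2" using r by simp
    then have "r * sqrt (s^2 - 1) <= sqrt ((r * s)^2 - 1)"
     using r s by (intro real_le_rsqrt) (simp add: power_mult_distrib algebra_simps)
    moreover have "sqrt ((r * s)^2 - 1) > 0" using rs2 by simp
    ultimately show "\<bar>r / sqrt ((r * s)^2 - 1)\<bar> * sqrt (- 1 * (1 - s^2)) <= 1"
     using r by (simp add: field_simps)
   qed
   then show ?thesis using g x by (simp add: H3_iff)
  qed
  define r where "r n = 1 + inverse (real (Suc n))" for n
  have r01: "1 < r n" for n by (auto simp: r_def)
  have "r \<longlonglongrightarrow> 1 + 0" unfolding r_def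
   by (intro tendsto_add tendsto_const LIMSEQ_inverse_real_of_nat)
  then have r1: "r \<longlonglongrightarrow> 1" by simp
  have lim: "(%n. arcosh (r n * c)) \<longlonglongrightarrow> arcosh c" if "1 <= c" for c
  proof (rule continuous_on_tendsto_compose[of "{1..}" arcosh])
   show "continuous_on {1..} (arcosh :: real => real)" by (rule continuous_on_arcosh) simp
   show "(%n. r n * c) \<longlonglongrightarrow> c" using tendsto_mult[OF r1 tendsto_const[of c]] by simp
   have "1 * 1 <= r n * c" for n using r01[of n] that by (intro mult_mono) auto
   then show "\<forall>\<^sub>F n in sequentially. r n * c \<in> {1..}" by simp
  qed (use that in auto)
  have "(%n. \<bar>arcosh (r n * (- hdot x y)) - arcosh (r n * 1)\<bar>) \<longlonglongrightarrow> \<bar>arcosh (- hdot x y) - arcosh 1\<bar>"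
   by (intro tendsto_rabs tendsto_diff lim) (use cb in auto)
  from LIMSEQ_le_const2[OF this] le r01
  have "\<bar>arcosh (- hdot x y) - arcosh 1\<bar> <= curve_length hdot \<gamma>" by blast
  then show "l <= curve_length hdot \<gamma>" by (simp add: l_def)
 qed
 then show ?thesis by (simp add: l_def)
qed

lemma transport_H3_eq:
 assumes x: "x \<in> H3" and y: "y \<in> H3" and u: "hdot x u = 0" and ne: "x ~= y"
 shows "transport_H3 y x u = u - (hdot u y / (hdot x y - 1)) *\<^sub>R (x + y)"
proof -
 define l where "l = dist_H3 x y"
 have l: "l = arcosh (- hdot x y)" by (simp add: l_def dist_H3_eq x y)
 have c: "hdot x y < - 1" using H3_hdot_le[OF x y] H3_hdot_eq[OF x y] ne by fastforce
 have "cosh l = - hdot x y" using c by (simp add: l)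
 have "0 < l" using c by (simp add: l)
 define C where "C t = cosh (l * t)" for t
 define S where "S t = sinh (l * t) / l" for t
 have "transport_H3 y x u = u - (hdot u y / (- 1 + hdot x y)) *\<^sub>R (x + y)"
 proof (rule H3.parallel_transport_eq[OF x y u l_def \<open>0 < l\<close>, of C S])
  show "(C has_real_derivative - (- 1) * l^2 * S t) (at t)" for t
   unfolding C_def S_def by (auto intro!: derivative_eq_intros simp: power2_eq_square)
  show "(S has_real_derivative C t) (at t)" for t
   unfolding C_def S_def using \<open>0 < l\<close> by (auto intro!: derivative_eq_intros)
  show "(C t)^2 + (- 1) * l^2 * (S t)^2 = 1" for t
   using \<open>0 < l\<close> by (simp add: C_def S_def power_divide cosh_square_eq)
 qed (use c \<open>cosh l = - hdot x y\<close> in \<open>auto simp: C_def S_def\<close>)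
 then show ?thesis by (simp add: algebra_simps)
qed

section \<open>Calculus of smooth maps\<close>

lemma has_derivative_cong_open:
 assumes "open U" "x \<in> U" "!!z. z \<in> U ==> f z = g z"
 shows "(f has_derivative D) (at x) \<longleftrightarrow> (g has_derivative D) (at x)"
 using has_derivative_transform_within_open[of f D x UNIV U g]
  has_derivative_transform_within_open[of g D x UNIV U f] assms by auto

lemma frechet_derivative_cong_open:
 assumes "open U" "x \<in> U" "!!z. z \<in> U ==> f z = g z"
 shows "fderiv f x = fderiv g x"
 unfolding frechet_derivative_def using has_derivative_cong_open[OF assms] by simp

lemma Ck_on_cong_imp:
 assumes "open U"
 shows "(!!z. z \<in> U ==> f z = g z) ==> Ck_on k f U ==> Ck_on k g U"
proof (induction k arbitrary: f g)
 case 0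
 then show ?case using continuous_on_cong[of U U f g] by simp
next
 case (Suc k)
 have "g differentiable (at x)" if "x \<in> U" for x
 proof -
  have "f differentiable (at x)" using Suc.prems(2) that by simp
  then obtain D where "(f has_derivative D) (at x)" unfolding differentiable_def by (elim exE)
  then have "(g has_derivative D) (at x)"
   by (subst (asm) has_derivative_cong_open[OF assms that Suc.prems(1)])
  then show ?thesis by (rule differentiableI)
 qed
 moreover have "Ck_on k (%x. fderiv g x h) U" for h
  by (rule Suc.IH[of "%x. fderiv f x h"])
    (use Suc.prems frechet_derivative_cong_open[OF assms _ Suc.prems(1)] in auto)
 ultimately show ?case by simp
qed

lemma Ck_on_has_derivative: "Ck_on (Suc k) f U ==> x \<in> U ==> (f has_derivative fderiv f x) (at x)"
 by (simp add: frechet_derivative_works)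

lemma Ck_on_SucI:
 assumes "open U" "!!x. x \<in> U ==> (f has_derivative f' x) (at x)" "!!h. Ck_on k (%x. f' x h) U"
 shows "Ck_on (Suc k) f U"
proof -
 have "Ck_on k (%x. fderiv f x h) U" for h
  by (rule Ck_on_cong_imp[OF assms(1) _ assms(3)[of h]]) (simp add: frechet_derivative_at[OF assms(2)])
 then show ?thesis using assms(2) by (auto simp: differentiable_def)
qed

lemma Ck_on_Suc_imp: "Ck_on (Suc k) f U ==> Ck_on k f U"
proof (induction k arbitrary: f)
 case 0
 then show ?case
  by (auto intro!: continuous_at_imp_continuous_on differentiable_imp_continuous_within)
qed auto

lemma Ck_on_subset: "Ck_on k f U ==> V \<subseteq> U ==> Ck_on k f V"
 by (induction k arbitrary: f) (auto intro: continuous_on_subset)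

lemma Ck_on_local:
 "(!!x. x \<in> U ==> \<exists>V. open V \<and> x \<in> V \<and> Ck_on k f V) ==> Ck_on k f U"
proof (induction k arbitrary: f)
 case 0
 have "isCont f x" if x: "x \<in> U" for x
 proof -
  obtain V where "open V" "x \<in> V" "continuous_on V f" using 0[OF x] by auto
  then show ?thesis by (simp add: continuous_on_eq_continuous_at)
 qed
 then show ?case by (simp add: continuous_at_imp_continuous_on)
next
 case (Suc k)
 have "f differentiable (at x)" if "x \<in> U" for x using Suc.prems[OF that] by auto
 moreover have "Ck_on k (%x. fderiv f x h) U" for h
  by (rule Suc.IH) (use Suc.prems in fastforce)
 ultimately show ?case by simp
qed

lemma Ck_on_const: "Ck_on k (%x. c) U"
proof (induction k arbitrary: c)
 case (Suc k)
 then show ?case by (simp add: frechet_derivative_const)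
qed simp

lemma Ck_on_bounded_linear:
 assumes L: "bounded_linear L" and U: "open U"
 shows "Ck_on k f U ==> Ck_on k (%x. L (f x)) U"
proof (induction k arbitrary: f)
 case 0
 then show ?case using bounded_linear.continuous_on[OF L] by simp
next
 case (Suc k)
 show ?case
 proof (rule Ck_on_SucI[OF U])
  show "((%x. L (f x)) has_derivative (%h. L (fderiv f x h))) (at x)" if "x \<in> U" for x
   by (rule bounded_linear.has_derivative[OF L Ck_on_has_derivative[OF Suc.prems that]])
  show "Ck_on k (%x. L (fderiv f x h)) U" for h
   by (rule Suc.IH) (use Suc.prems in simp)
 qed
qed

lemma Ck_on_id: "open U ==> Ck_on k (%x. x) U"
proof (cases k)
 case (Suc m)
 assume "open U"
 then show ?thesis
  unfolding Suc by (rule Ck_on_SucI) (auto intro!: derivative_eq_intros Ck_on_const)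
qed simp

lemma Ck_on_add:
 assumes U: "open U"
 shows "Ck_on k f U ==> Ck_on k g U ==> Ck_on k (%x. f x + g x) U"
proof (induction k arbitrary: f g)
 case 0
 then show ?case by (simp add: continuous_on_add)
next
 case (Suc k)
 show ?case
 proof (rule Ck_on_SucI[OF U])
  show "((%x. f x + g x) has_derivative (%h. fderiv f x h + fderiv g x h)) (at x)"
   if "x \<in> U" for x
   by (rule has_derivative_add) (use Suc.prems that Ck_on_has_derivative in blast)+
  show "Ck_on k (%x. fderiv f x h + fderiv g x h) U" for h
   by (rule Suc.IH) (use Suc.prems in auto)
 qed
qed

lemma Ck_on_bilinear:
 assumes P: "bounded_bilinear P" and U: "open U"
 shows "Ck_on k f U ==> Ck_on k g U ==> Ck_on k (%x. P (f x) (g x)) U"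
proof (induction k arbitrary: f g)
 case 0
 then show ?case using bounded_bilinear.continuous_on[OF P] by simp
next
 case (Suc k)
 show ?case
 proof (rule Ck_on_SucI[OF U])
  show "((%x. P (f x) (g x)) has_derivative
    (%h. P (f x) (fderiv g x h) + P (fderiv f x h) (g x))) (at x)"
   if "x \<in> U" for x
   by (rule bounded_bilinear.FDERIV[OF P]) (use Suc.prems that Ck_on_has_derivative in blast)+
  show "Ck_on k (%x. P (f x) (fderiv g x h) + P (fderiv f x h) (g x)) U" for h
   by (intro Ck_on_add[OF U] Suc.IH) (use Suc.prems Ck_on_Suc_imp in auto)
 qed
qed

lemma Ck_on_sum:
 assumes "open U" "finite A" "!!i. i \<in> A ==> Ck_on k (f i) U"
 shows "Ck_on k (%x. \<Sum>i\<in>A. f i x) U"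
 using assms(2,3) by (induction A rule: finite_induct) (auto intro: Ck_on_const Ck_on_add[OF assms(1)])

lemma frechet_derivative_basis_expansion:
 fixes f :: "'a::euclidean_space => 'b::real_normed_vector"
 assumes "f differentiable (at x)"
 shows "fderiv f x v = (\<Sum>b\<in>Basis. (v \<bullet> b) *\<^sub>R fderiv f x b)"
proof -
 have "linear (fderiv f x)"
  using assms by (rule linear_frechet_derivative)
 from linear_sum[OF this, of "%b. (v \<bullet> b) *\<^sub>R b" Basis] linear_scale[OF this]
 show ?thesis by (simp add: euclidean_representation)
qed

text \<open>
 Induction on \<open>k\<close> by the chain rule, the derivative of \<open>f\<close> being expanded in a basis so that only directional
 derivatives along constant vectors occur.
\<close>

lemma Ck_on_compose:
 fixes f :: "'a::euclidean_space => 'b::real_normed_vector" and g :: "'c::real_normed_vector => 'a"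
 assumes U: "open U" and V: "open V" and gU: "g ` U \<subseteq> V"
 shows "Ck_on k f V ==> Ck_on k g U ==> Ck_on k (%x. f (g x)) U"
proof (induction k arbitrary: f)
 case 0
 then show ?case using continuous_on_compose2[OF _ _ gU] by auto
next
 case (Suc k)
 have fd: "f differentiable (at (g x))" if "x \<in> U" for x using that gU Suc.prems(1) by auto
 show ?case
 proof (rule Ck_on_SucI[OF U])
  show "((%x. f (g x)) has_derivative
    (%h. \<Sum>b\<in>Basis. (fderiv g x h \<bullet> b) *\<^sub>R frechet_derivative f (at (g x)) b)) (at x)"
   if x: "x \<in> U" for x
  proof -
   have "((%x. f (g x)) has_derivative (%h. frechet_derivative f (at (g x)) (fderiv g x h))) (at x)"
    by (rule has_derivative_compose[OF Ck_on_has_derivative[OF Suc.prems(2) x]])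
      (simp add: fd[OF x] frechet_derivative_works[symmetric])
   then show ?thesis
    by (subst (asm) frechet_derivative_basis_expansion[OF fd[OF x]])
  qed
  show "Ck_on k (%x. \<Sum>b\<in>Basis. (fderiv g x h \<bullet> b) *\<^sub>R frechet_derivative f (at (g x)) b) U" for h
  proof (rule Ck_on_sum[OF U finite_Basis])
   fix b :: 'a
   have "Ck_on k (%x. fderiv g x h \<bullet> b) U"
    by (rule Ck_on_bounded_linear[OF bounded_linear_inner_left U]) (use Suc.prems in simp)
   moreover have "Ck_on k (%x. frechet_derivative f (at (g x)) b) U"
    by (rule Suc.IH) (use Suc.prems Ck_on_Suc_imp in auto)
   ultimately show "Ck_on k (%x. (fderiv g x h \<bullet> b) *\<^sub>R frechet_derivative f (at (g x)) b) U"
    by (rule Ck_on_bilinear[OF bounded_bilinear_scaleR U])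
  qed
 qed
qed

lemma Ck_on_powr: "Ck_on k (%t::real. t powr a) {0<..}"
proof (induction k arbitrary: a)
 case 0
 then show ?case by (auto intro!: continuous_intros)
next
 case (Suc k)
 show ?case
 proof (rule Ck_on_SucI)
  show "((%t. t powr a) has_derivative (%h. h * (a * t powr (a - 1)))) (at t)" if "t \<in> {0<..}" for t :: real
   using DERIV_powr[of "%t. t" 1 t "%_. a" 0] has_real_derivative_powr[of t a] that
   by (simp add: has_field_derivative_def mult_commute_abs)
  show "Ck_on k (%t. h * (a * t powr (a - 1))) {0<..}" for h
   by (rule Ck_on_bounded_linear[OF bounded_linear_mult_right _ Ck_on_bounded_linear[OF bounded_linear_mult_right _ Suc.IH]])
     auto
 qed simp
qed

lemma Cinf_on_cong: "open U ==> (!!z. z \<in> U ==> f z = g z) ==> Cinf_on f U ==> Cinf_on g U"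
 unfolding Cinf_on_def using Ck_on_cong_imp by blast

lemma Cinf_on_subset: "Cinf_on f U ==> V \<subseteq> U ==> Cinf_on f V"
 unfolding Cinf_on_def using Ck_on_subset by blast

lemma Cinf_on_const: "Cinf_on (%x. c) U"
 unfolding Cinf_on_def using Ck_on_const by blast

lemma Cinf_on_id: "open U ==> Cinf_on (%x. x) U"
 unfolding Cinf_on_def using Ck_on_id by blast

lemma Cinf_on_add: "open U ==> Cinf_on f U ==> Cinf_on g U ==> Cinf_on (%x. f x + g x) U"
 unfolding Cinf_on_def using Ck_on_add by blast

lemma Cinf_on_bounded_linear: "bounded_linear L ==> open U ==> Cinf_on f U ==> Cinf_on (%x. L (f x)) U"
 unfolding Cinf_on_def using Ck_on_bounded_linear by blast

lemma Cinf_on_bilinear: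
 "bounded_bilinear P ==> open U ==> Cinf_on f U ==> Cinf_on g U ==> Cinf_on (%x. P (f x) (g x)) U"
 unfolding Cinf_on_def using Ck_on_bilinear by blast

lemma Cinf_on_sum: "open U ==> finite A ==> (!!i. i \<in> A ==> Cinf_on (f i) U) ==> Cinf_on (%x. \<Sum>i\<in>A. f i x) U"
 unfolding Cinf_on_def using Ck_on_sum[of U A _ f] by simp

lemma Cinf_on_compose:
 fixes f :: "'a::euclidean_space => 'b::real_normed_vector"
 shows "open U ==> open V ==> g ` U \<subseteq> V ==> Cinf_on f V ==> Cinf_on g U ==> Cinf_on (%x. f (g x)) U"
 unfolding Cinf_on_def using Ck_on_compose by blast

lemma Cinf_on_mult:
 fixes f g :: "'a::real_normed_vector => real"
 shows "open U ==> Cinf_on f U ==> Cinf_on g U ==> Cinf_on (%x. f x * g x) U"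
 by (rule Cinf_on_bilinear[OF bounded_bilinear_mult])

lemma Cinf_on_cmult:
 fixes f :: "'a::real_normed_vector => real"
 shows "open U ==> Cinf_on f U ==> Cinf_on (%x. c * f x) U"
 by (rule Cinf_on_mult) (auto intro: Cinf_on_const)

lemma Cinf_on_uminus: "open U ==> Cinf_on f U ==> Cinf_on (%x. - f x) U"
 by (rule Cinf_on_bounded_linear[OF bounded_linear_minus[OF bounded_linear_ident]])

lemma Cinf_on_diff: "open U ==> Cinf_on f U ==> Cinf_on g U ==> Cinf_on (%x. f x - g x) U"
 using Cinf_on_add[OF _ _ Cinf_on_uminus, of U f g] by simp

lemma Cinf_on_scaleR: "open U ==> Cinf_on f U ==> Cinf_on g U ==> Cinf_on (%x. f x *\<^sub>R g x) U"
 by (rule Cinf_on_bilinear[OF bounded_bilinear_scaleR])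

lemma Cinf_on_inner:
 fixes f g :: "'a::real_normed_vector => 'b::real_inner"
 shows "open U ==> Cinf_on f U ==> Cinf_on g U ==> Cinf_on (%x. f x \<bullet> g x) U"
 by (rule Cinf_on_bilinear[OF bounded_bilinear_inner])

lemma Cinf_on_powr:
 assumes "open U" "Cinf_on f U" "!!x. x \<in> U ==> f x > (0::real)"
 shows "Cinf_on (%x. f x powr a) U"
proof (rule Cinf_on_compose[OF assms(1) _ _ _ assms(2), of "{0<..}"])
 show "Cinf_on (%t::real. t powr a) {0<..}" unfolding Cinf_on_def using Ck_on_powr by blast
qed (use assms(3) in auto)

lemma Cinf_on_derivative:
 "Cinf_on f U ==> Cinf_on (%x. fderiv f x h) U"
 unfolding Cinf_on_def by (metis Ck_on.simps(2))

lemma Cinf_on_differentiable: "Cinf_on f U ==> x \<in> U ==> f differentiable (at x)"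
 unfolding Cinf_on_def by (metis Ck_on.simps(2))

lemma Cinf_on_has_derivative:
 "Cinf_on f U ==> x \<in> U ==> (f has_derivative fderiv f x) (at x)"
 using Cinf_on_differentiable frechet_derivative_works by blast

lemma Cinf_on_continuous: "Cinf_on f U ==> continuous_on U f"
 unfolding Cinf_on_def by (metis Ck_on.simps(1))

lemma Cinf_on_directional:
 fixes f :: "'a::euclidean_space => 'b::real_normed_vector"
 assumes U: "open U" and f: "Cinf_on f U" and w: "Cinf_on w U"
 shows "Cinf_on (%x. fderiv f x (w x)) U"
proof (rule Cinf_on_cong[OF U])
 show "(\<Sum>b\<in>Basis. (w x \<bullet> b) *\<^sub>R fderiv f x b) = fderiv f x (w x)"
  if "x \<in> U" for x
  by (rule frechet_derivative_basis_expansion[OF Cinf_on_differentiable[OF f that], symmetric])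
 show "Cinf_on (%x. \<Sum>b\<in>Basis. (w x \<bullet> b) *\<^sub>R fderiv f x b) U"
  by (intro Cinf_on_sum[OF U] Cinf_on_scaleR[OF U] Cinf_on_derivative f Cinf_on_inner[OF U] w Cinf_on_const)
    simp
qed

lemma directional_has_derivative:
 fixes f :: "'a::euclidean_space => 'b::real_normed_vector"
 assumes U: "open U" and f: "Cinf_on f U" and x: "x \<in> U" and w: "(w has_derivative w') (at x)"
 shows "((%z. fderiv f z (w z)) has_derivative
   (%h. fderiv f x (w' h) + frechet_derivative (%z. fderiv f z (w x)) (at x) h)) (at x)"
proof -
 let ?D = "%b z. fderiv f z b"
 have Db: "(?D b has_derivative frechet_derivative (?D b) (at x)) (at x)" for b
  by (rule Cinf_on_has_derivative[OF Cinf_on_derivative[OF f] x])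
 have fd: "f differentiable (at z)" if "z \<in> U" for z by (rule Cinf_on_differentiable[OF f that])
 have lin: "(?D c has_derivative (%h. \<Sum>b\<in>Basis. (c \<bullet> b) *\<^sub>R frechet_derivative (?D b) (at x) h)) (at x)" for c
 proof -
  have "((%z. \<Sum>b\<in>Basis. (c \<bullet> b) *\<^sub>R ?D b z) has_derivative
    (%h. \<Sum>b\<in>Basis. (c \<bullet> b) *\<^sub>R frechet_derivative (?D b) (at x) h)) (at x)"
   by (auto intro!: derivative_eq_intros Db)
  then show ?thesis
   by (rule has_derivative_transform_within_open[OF _ U x])
     (simp add: frechet_derivative_basis_expansion[OF fd, symmetric])
 qed
 have "((%z. \<Sum>b\<in>Basis. (w z \<bullet> b) *\<^sub>R ?D b z) has_derivative
   (%h. \<Sum>b\<in>Basis. (w x \<bullet> b) *\<^sub>R frechet_derivative (?D b) (at x) h + (w' h \<bullet> b) *\<^sub>R ?D b x)) (at x)"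
  by (intro has_derivative_sum has_derivative_scaleR Db has_derivative_inner_left w)
 then have "((%z. ?D (w z) z) has_derivative
   (%h. \<Sum>b\<in>Basis. (w x \<bullet> b) *\<^sub>R frechet_derivative (?D b) (at x) h + (w' h \<bullet> b) *\<^sub>R ?D b x)) (at x)"
  by (rule has_derivative_transform_within_open[OF _ U x])
    (simp add: frechet_derivative_basis_expansion[OF fd, symmetric])
 moreover have "(%h. \<Sum>b\<in>Basis. (w x \<bullet> b) *\<^sub>R frechet_derivative (?D b) (at x) h + (w' h \<bullet> b) *\<^sub>R ?D b x)
  = (%h. fderiv f x (w' h) + frechet_derivative (?D (w x)) (at x) h)"
 proof
  fix h
  have "frechet_derivative (?D (w x)) (at x) h = (\<Sum>b\<in>Basis. (w x \<bullet> b) *\<^sub>R frechet_derivative (?D b) (at x) h)"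
   by (rule fun_cong[OF frechet_derivative_at[OF lin, symmetric]])
  moreover have "fderiv f x (w' h) = (\<Sum>b\<in>Basis. (w' h \<bullet> b) *\<^sub>R ?D b x)"
   by (rule frechet_derivative_basis_expansion[OF fd[OF x]])
  ultimately show "(\<Sum>b\<in>Basis. (w x \<bullet> b) *\<^sub>R frechet_derivative (?D b) (at x) h + (w' h \<bullet> b) *\<^sub>R ?D b x)
   = fderiv f x (w' h) + frechet_derivative (?D (w x)) (at x) h"
   by (simp only: sum.distrib add.commute)
 qed
 ultimately show ?thesis by simp
qed

text \<open>
 The second difference \<open>F (x + s h + s k) - F (x + s h) - F (x + s k) + F x\<close> equals \<open>s^2\<close> times either
 mixed derivative at nearby points, by the mean value theorem applied in either order.
\<close>

lemma second_difference_mean_value: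
 fixes F :: "'a::euclidean_space => real"
 assumes F: "Cinf_on F U" and s: "s > 0"
  and seg: "!!a b. 0 <= a ==> a <= s ==> 0 <= b ==> b <= s ==> x + a *\<^sub>R h + b *\<^sub>R k \<in> U"
 shows "\<exists>a b. 0 < a \<and> a < s \<and> 0 < b \<and> b < s \<and>
  F (x + s *\<^sub>R h + s *\<^sub>R k) - F (x + s *\<^sub>R h) - F (x + s *\<^sub>R k) + F x
  = s^2 * frechet_derivative (%z. fderiv F z h) (at (x + a *\<^sub>R h + b *\<^sub>R k)) k"
proof -
 define G where "G a = F (x + a *\<^sub>R h + s *\<^sub>R k) - F (x + a *\<^sub>R h)" for a
 define G' where "G' a = frechet_derivative F (at (x + a *\<^sub>R h + s *\<^sub>R k)) h - frechet_derivative F (at (x + a *\<^sub>R h)) h" for a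
 have along_line: "((%a. f (l a)) has_real_derivative frechet_derivative f (at (l a)) v) (at a)"
  if f: "Cinf_on f U" "l a \<in> U" and l: "(l has_derivative (%t. t *\<^sub>R v)) (at a)"
  for f :: "'a => real" and l a v
 proof -
  have "((%a. f (l a)) has_derivative (%t. frechet_derivative f (at (l a)) (t *\<^sub>R v))) (at a)"
   by (rule has_derivative_compose[OF l Cinf_on_has_derivative[OF f]])
  moreover have "frechet_derivative f (at (l a)) (t *\<^sub>R v) = frechet_derivative f (at (l a)) v * t" for t
   using linear_scale[OF linear_frechet_derivative[OF Cinf_on_differentiable[OF f]]] by (simp add: mult.commute)
  ultimately show ?thesis by (simp add: has_field_derivative_def)
 qed
 have dF: "((%a. F (x + a *\<^sub>R h + b *\<^sub>R k)) has_real_derivative frechet_derivative F (at (x + a *\<^sub>R h + b *\<^sub>R k)) h) (at a)"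
  if "0 <= a" "a <= s" "0 <= b" "b <= s" for a b
  by (rule along_line[where f = F and l = "%a. x + a *\<^sub>R h + b *\<^sub>R k", OF F seg[OF that]])
    (auto intro!: derivative_eq_intros)
 have "\<exists>a. 0 < a \<and> a < s \<and> G s - G 0 = (s - 0) * G' a"
  by (rule MVT2[OF s])
    (use dF[of _ s] dF[of _ 0] s in \<open>auto simp: G_def G'_def intro!: derivative_eq_intros\<close>)
 then obtain a where a: "0 < a" "a < s" "G s - G 0 = s * G' a" by auto
 define H where "H b = frechet_derivative F (at (x + a *\<^sub>R h + b *\<^sub>R k)) h" for b
 define H' where "H' b = frechet_derivative (%z. fderiv F z h) (at (x + a *\<^sub>R h + b *\<^sub>R k)) k" for b
 have F': "Cinf_on (%z. fderiv F z h) U" by (rule Cinf_on_derivative[OF F])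
 have "\<exists>b. 0 < b \<and> b < s \<and> H s - H 0 = (s - 0) * H' b"
 proof (rule MVT2[OF s])
  fix b assume b: "0 <= b" "b <= s"
  have z: "x + a *\<^sub>R h + b *\<^sub>R k \<in> U" using a b by (intro seg) auto
  show "(H has_real_derivative H' b) (at b)"
   unfolding H_def H'_def
   by (rule along_line[where f = "%z. fderiv F z h" and l = "%b. x + a *\<^sub>R h + b *\<^sub>R k", OF F' z])
     (auto intro!: derivative_eq_intros)
 qed
 then obtain b where b: "0 < b" "b < s" "H s - H 0 = s * H' b" by auto
 have "G' a = H s - H 0" by (simp add: G'_def H_def)
 then have "G s - G 0 = s^2 * H' b" using a(3) b(3) by (simp add: power2_eq_square)
 moreover have "G s - G 0 = F (x + s *\<^sub>R h + s *\<^sub>R k) - F (x + s *\<^sub>R h) - F (x + s *\<^sub>R k) + F x"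
  by (simp add: G_def)
 ultimately show ?thesis using a b unfolding H'_def by metis
qed

lemma second_derivative_symmetric:
 fixes F :: "'a::euclidean_space => real"
 assumes U: "open U" and F: "Cinf_on F U" and x: "x \<in> U"
 shows "frechet_derivative (%z. fderiv F z h) (at x) k
    = frechet_derivative (%z. fderiv F z k) (at x) h"
proof -
 let ?A = "%y. frechet_derivative (%z. fderiv F z h) (at y) k"
 let ?B = "%y. frechet_derivative (%z. fderiv F z k) (at y) h"
 obtain e where e: "e > 0" "ball x e \<subseteq> U" using U x open_contains_ball by blast
 define N where "N = norm h + norm k + 1"
 have N: "N > 0" unfolding N_def by (smt (verit) norm_ge_zero)
 define s where "s n = (e / N) * inverse (real (Suc (Suc n)))" for n
 have s0: "s n > 0" for n using e N by (simp add: s_def)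
 have s1: "s n * N < e" for n
 proof -
  have "inverse (real (Suc (Suc n))) < 1" by (simp add: field_simps)
  then have "e * inverse (real (Suc (Suc n))) < e * 1" by (rule mult_strict_left_mono[OF _ e(1)])
  then show ?thesis using N by (simp add: s_def)
 qed
 have close: "norm (a *\<^sub>R h' + b *\<^sub>R k') <= s n * N"
  if "0 <= a" "a <= s n" "0 <= b" "b <= s n" "(h' = h \<and> k' = k) \<or> (h' = k \<and> k' = h)" for a b n h' k'
 proof -
  have "norm (a *\<^sub>R h' + b *\<^sub>R k') <= a * norm h' + b * norm k'"
   using norm_triangle_ineq[of "a *\<^sub>R h'" "b *\<^sub>R k'"] that by simp
  also have "\<dots> <= s n * norm h' + s n * norm k'"
   using that by (intro add_mono mult_right_mono) auto
  also have "\<dots> <= s n * N" using that(5) s0[of n] by (auto simp: N_def algebra_simps)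
  finally show ?thesis .
 qed
 have seg: "x + a *\<^sub>R h' + b *\<^sub>R k' \<in> U"
  if "0 <= a" "a <= s n" "0 <= b" "b <= s n" "(h' = h \<and> k' = k) \<or> (h' = k \<and> k' = h)" for a b n h' k'
 proof -
  have "dist x (x + (a *\<^sub>R h' + b *\<^sub>R k')) < e"
   using close[OF that] s1[of n] unfolding dist_norm norm_minus_commute[of x] by simp
  then show ?thesis using e(2) by (auto simp: add.assoc)
 qed
 let ?d = "%n. F (x + s n *\<^sub>R h + s n *\<^sub>R k) - F (x + s n *\<^sub>R h) - F (x + s n *\<^sub>R k) + F x"
 have "\<exists>p. norm p <= s n * N \<and> ?d n = (s n)^2 * ?A (x + p)" for n
 proof -
  from second_difference_mean_value[OF F s0[of n] seg[where n = n and h' = h and k' = k]]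
  obtain a b where "0 < a" "a < s n" "0 < b" "b < s n" "?d n = (s n)^2 * ?A (x + a *\<^sub>R h + b *\<^sub>R k)" by auto
  then show ?thesis using close[of a n b h k] by (intro exI[of _ "a *\<^sub>R h + b *\<^sub>R k"]) (simp add: add.assoc)
 qed
 then obtain p where p: "!!n. norm (p n) <= s n * N" "!!n. ?d n = (s n)^2 * ?A (x + p n)" by metis
 have "\<exists>q. norm q <= s n * N \<and> ?d n = (s n)^2 * ?B (x + q)" for n
 proof -
  from second_difference_mean_value[OF F s0[of n] seg[where n = n and h' = k and k' = h]]
  obtain a b where "0 < a" "a < s n" "0 < b" "b < s n"
   "F (x + s n *\<^sub>R k + s n *\<^sub>R h) - F (x + s n *\<^sub>R k) - F (x + s n *\<^sub>R h) + F x = (s n)^2 * ?B (x + a *\<^sub>R k + b *\<^sub>R h)" by auto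
  then show ?thesis using close[of a n b k h]
   by (intro exI[of _ "a *\<^sub>R k + b *\<^sub>R h"]) (simp add: algebra_simps)
 qed
 then obtain q where q: "!!n. norm (q n) <= s n * N" "!!n. ?d n = (s n)^2 * ?B (x + q n)" by metis
 have AB: "?A (x + p n) = ?B (x + q n)" for n
  using p(2)[of n] q(2)[of n] s0[of n] by simp
 have "(%n. e / N * inverse (real (Suc (Suc n))) * N) \<longlonglongrightarrow> e / N * 0 * N"
  by (intro tendsto_intros LIMSEQ_Suc[OF LIMSEQ_inverse_real_of_nat])
 then have sN: "(%n. s n * N) \<longlonglongrightarrow> 0" by (simp add: s_def)
 have lim: "(%n. x + r n) \<longlonglongrightarrow> x" if "!!n. norm (r n) <= s n * N" for r
 proof -
  have "r \<longlonglongrightarrow> 0" by (rule Lim_null_comparison[OF _ sN]) (use that in simp)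
  from tendsto_add[OF tendsto_const[of x] this] show ?thesis by simp
 qed
 have cA: "isCont ?A x" and cB: "isCont ?B x"
  using Cinf_on_continuous[OF Cinf_on_derivative[OF Cinf_on_derivative[OF F]]] U x
  by (auto simp: continuous_on_eq_continuous_at)
 have "(%n. ?A (x + p n)) \<longlonglongrightarrow> ?A x" by (rule isCont_tendsto_compose[OF cA lim[OF p(1)]])
 moreover have "(%n. ?A (x + p n)) \<longlonglongrightarrow> ?B x"
  unfolding AB by (rule isCont_tendsto_compose[OF cB lim[OF q(1)]])
 ultimately show ?thesis by (rule LIMSEQ_unique)
qed

subsection \<open>Functions on the three-sphere\<close>

lemma Cinf_on_normalize: "Cinf_on (%x::'a::euclidean_space. x /\<^sub>R norm x) (- {0})"
proof (rule Cinf_on_cong)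
 have "Cinf_on (%x::'a. (x \<bullet> x) powr (- (1/2))) (- {0})"
  by (intro Cinf_on_powr Cinf_on_inner Cinf_on_id) auto
 then show "Cinf_on (%x::'a. ((x \<bullet> x) powr (- (1/2))) *\<^sub>R x) (- {0})"
  by (intro Cinf_on_scaleR Cinf_on_id) auto
 show "((z \<bullet> z) powr (- (1/2))) *\<^sub>R z = z /\<^sub>R norm z" if "z \<in> - {0}" for z :: 'a
  using that by (simp add: powr_minus powr_half_sqrt norm_eq_sqrt_inner)
qed auto

text \<open>
 A smooth map on the sphere extends to the punctured space by homogeneity of degree 0. So ordinary derivatives
 of functions on an open set are available throughout.
\<close>

lemma smooth_map_on_S3_extend:
 fixes f :: "R4 => 'b::real_normed_vector"
 assumes "smooth_map_on S3 f"
 shows "Cinf_on (%x. f (x /\<^sub>R norm x)) (- {0})"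
 unfolding Cinf_on_def
proof (intro allI Ck_on_local)
 fix k and x :: R4 assume x: "x \<in> - {0}"
 then have nx: "x /\<^sub>R norm x \<in> S3" by (simp add: S3_def)
 from bspec[OF assms[unfolded smooth_map_on_def] this]
 obtain U F where UF: "open U \<and> x /\<^sub>R norm x \<in> U \<and> Cinf_on F U \<and> (\<forall>z\<in>S3 \<inter> U. F z = f z)"
  by (elim exE)
 then have U: "open U" "x /\<^sub>R norm x \<in> U" and F: "Cinf_on F U" "!!z. z \<in> S3 \<inter> U ==> F z = f z"
  by simp_all
 define V where "V = (%z::R4. z /\<^sub>R norm z) -` U \<inter> - {0}"
 have V: "open V" unfolding V_def
  by (rule continuous_on_open_vimage[THEN iffD1, rule_format])
    (use Cinf_on_continuous[OF Cinf_on_normalize] U in auto)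
 have "Cinf_on (%z. F (z /\<^sub>R norm z)) V"
  by (rule Cinf_on_compose[OF V U(1) _ F(1)]) (auto simp: V_def intro: Cinf_on_subset[OF Cinf_on_normalize])
 then have "Cinf_on (%z. f (z /\<^sub>R norm z)) V"
  by (rule Cinf_on_cong[OF V, rotated]) (auto simp: V_def S3_def intro!: F(2))
 then show "\<exists>V. open V \<and> x \<in> V \<and> Ck_on k (%x. f (x /\<^sub>R norm x)) V"
  using V U(2) x by (intro exI[of _ V]) (auto simp: V_def Cinf_on_def)
qed

lemma smooth_map_on_S3_I:
 assumes "Cinf_on F (- {0})" "!!z. z \<in> S3 ==> F z = f z"
 shows "smooth_map_on S3 f"
 unfolding smooth_map_on_def using assms
 by (intro ballI exI[of _ "- {0}"] exI[of _ F]) (auto simp: S3_def)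

definition Lie :: "R4 => (R4 => real) => R4 => real" where
 "Lie p F y = fderiv F y (qmult y p)"

abbreviation "punctured \<equiv> (- {0 :: R4})"

abbreviation smooth :: "(R4 => 'b::real_normed_vector) => bool" where
 "smooth F \<equiv> Cinf_on F punctured"

lemma open_punctured [simp]: "open punctured"
 by (rule open_Compl) simp

lemma S3_subset_punctured: "x \<in> S3 ==> x \<in> punctured"
 by (auto simp: S3_def)

lemma Cinf_on_Lie: "smooth F ==> smooth (Lie p F)"
 unfolding Lie_def[abs_def]
 by (rule Cinf_on_directional)
   (auto intro!: Cinf_on_bounded_linear[OF qmult.bounded_linear_left] Cinf_on_id)

text \<open>\<open>Lie p\<close> is a derivation along \<open>y \<mapsto> y exp (t p)\<close>, so these derivations obey the commutation relations of the Lie algebra.\<close>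

lemma Lie_commutator:
 assumes F: "smooth F" and y: "y \<in> punctured"
 shows "Lie p (Lie q F) y - Lie q (Lie p F) y = Lie (qmult p q - qmult q p) F y"
proof -
 have *: "Lie p (Lie q F) y = fderiv F y (qmult (qmult y p) q)
   + frechet_derivative (%z. fderiv F z (qmult y q)) (at y) (qmult y p)" for p q
 proof -
  have "(Lie q F has_derivative (%h. fderiv F y (qmult h q)
    + frechet_derivative (%z. fderiv F z (qmult y q)) (at y) h)) (at y)"
   unfolding Lie_def[abs_def]
   by (rule directional_has_derivative[OF open_punctured F y])
     (rule bounded_linear.has_derivative[OF qmult.bounded_linear_left has_derivative_ident])
  from frechet_derivative_at[OF this, symmetric] show ?thesis by (simp add: Lie_def[of p])
 qed
 have "linear (fderiv F y)"
  by (rule linear_frechet_derivative[OF Cinf_on_differentiable[OF F y]])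
 from linear_diff[OF this]
 show ?thesis
  unfolding *
  using second_derivative_symmetric[OF open_punctured F y, of "qmult y q" "qmult y p"]
  by (simp add: Lie_def qmult_assoc)
qed

section \<open>Riemannian volume\<close>

lemma prod_Basis_vec:
 "(\<Prod>b\<in>Basis. f (b :: real^'n)) = (\<Prod>i\<in>UNIV. f (axis i 1))"
proof -
 have B: "Basis = range (%i. axis i (1::real) :: real^'n)" by (auto simp: Basis_vec_def)
 have "inj (%i. axis i (1::real) :: real^'n)" by (auto simp: inj_on_def axis_eq_axis)
 then show ?thesis unfolding B by (simp add: prod.reindex)
qed

lemma vector_3_eq_iff: "(x :: real^3) = y \<longleftrightarrow> x$1 = y$1 \<and> x$2 = y$2 \<and> x$3 = y$3"
 by (simp add: vec_eq_iff forall_3)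

definition spatial :: "R4 => real^3" where "spatial z = vector [z$2, z$3, z$4]"

definition R4_of :: "real => real^3 => R4" where "R4_of t u = vector [t, u$1, u$2, u$3]"

lemma R4_of_nth [simp]: "R4_of t u $ 1 = t" "R4_of t u $ 2 = u$1" "R4_of t u $ 3 = u$2" "R4_of t u $ 4 = u$3"
 by (simp_all add: R4_of_def)

lemma spatial_R4_of [simp]: "spatial (R4_of t u) = u"
 by (simp add: spatial_def vector_3_eq_iff vector_3)

lemma R4_of_spatial [simp]: "R4_of (z$1) (spatial z) = z"
 by (simp add: R4_eq_iff spatial_def vector_3)

lemma bounded_linear_spatial: "bounded_linear spatial"
proof -
 have "linear spatial"
  by (rule linearI) (simp_all add: spatial_def vector_3_eq_iff vector_3)
 then show ?thesis by (rule linear_conv_bounded_linear[THEN iffD1])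
qed

lemma inner_R3: "(u :: real^3) \<bullet> v = u$1 * v$1 + u$2 * v$2 + u$3 * v$3"
 by (simp add: inner_vec_def sum_3)

lemma R4_of_eq: "R4_of t u = t *\<^sub>R axis 1 1 + R4_of 0 u"
 by (simp add: R4_eq_iff)

lemma bounded_linear_R4_of: "bounded_linear (R4_of 0)"
proof -
 have "linear (R4_of 0)" by (rule linearI) (simp_all add: R4_eq_iff)
 then show ?thesis by (rule linear_conv_bounded_linear[THEN iffD1])
qed

lemma continuous_on_R4_of [continuous_intros]:
 "continuous_on S f ==> continuous_on S g ==> continuous_on S (%x. R4_of (f x) (g x))"
 by (subst R4_of_eq) (intro continuous_intros bounded_linear.continuous_on[OF bounded_linear_R4_of])

lemma measurable_R4_of [measurable]: "(%(t, u). R4_of t u) \<in> borel \<Otimes>\<^sub>M borel \<rightarrow>\<^sub>M borel"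
 unfolding borel_prod
 by (intro borel_measurable_continuous_onI)
   (auto simp: case_prod_beta intro!: continuous_intros)

text \<open>Lebesgue measure as a product of the time axis and the space coordinates, to apply Fubini to graphs over the latter.\<close>

lemma lborel_R4: "(lborel :: R4 measure) = distr (lborel \<Otimes>\<^sub>M lborel) borel (%(t, u). R4_of t u)"
proof (rule lborel_eqI)
 fix l u :: R4 assume le: "!!b. b \<in> Basis ==> l \<bullet> b <= u \<bullet> b"
 have le': "l $ i <= u $ i" for i
  using le[of "axis i 1"] by (auto simp: inner_axis Basis_vec_def)
 have "(%(t, u). R4_of t u) -` box l u \<inter> space (lborel \<Otimes>\<^sub>M lborel)
   = box (l$1) (u$1) \<times> box (spatial l) (spatial u)"
  by (auto simp: mem_box_cart forall_4 forall_3 space_pair_measure spatial_def vector_3)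
 then have "emeasure (distr (lborel \<Otimes>\<^sub>M lborel) borel (%(t, u). R4_of t u)) (box l u)
   = emeasure lborel (box (l$1) (u$1)) * emeasure lborel (box (spatial l) (spatial u))"
  by (subst emeasure_distr) (auto simp: lborel.emeasure_pair_measure_Times)
 also have "\<dots> = ennreal (u$1 - l$1) * ennreal (\<Prod>b\<in>Basis. (spatial u - spatial l) \<bullet> b)"
 proof -
  have "spatial l \<bullet> b <= spatial u \<bullet> b" if "b \<in> Basis" for b
  proof -
   have "spatial l $ i <= spatial u $ i" for i
    using le' exhaust_3[of i] by (auto simp: spatial_def vector_3)
   then show ?thesis using that by (auto simp: Basis_vec_def inner_axis)
  qed
  then show ?thesis using le' by (simp add: emeasure_lborel_box)
 qed
 also have "\<dots> = ennreal (\<Prod>b\<in>Basis. (u - l) \<bullet> b)"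
 proof -
  have "(\<Prod>b\<in>Basis. (spatial u - spatial l) \<bullet> b) = (u$2 - l$2) * (u$3 - l$3) * (u$4 - l$4)"
   unfolding prod_Basis_vec UNIV_3 by (simp add: inner_axis spatial_def vector_3)
  moreover have "(\<Prod>b\<in>Basis. (u - l) \<bullet> b) = (u$1 - l$1) * ((u$2 - l$2) * (u$3 - l$3) * (u$4 - l$4))"
   unfolding prod_Basis_vec UNIV_4 by (simp add: inner_axis)
  moreover have "0 <= u$1 - l$1" "0 <= (u$2 - l$2) * (u$3 - l$3) * (u$4 - l$4)"
   using le' by (simp_all add: mult_nonneg_nonneg)
  ultimately show ?thesis by (simp only: ennreal_mult)
 qed
 finally show "emeasure (distr (lborel \<Otimes>\<^sub>M lborel) borel (%(t, u). R4_of t u)) (box l u)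
   = ennreal (\<Prod>b\<in>Basis. (u - l) \<bullet> b)" .
qed simp

lemma nn_integral_R4:
 assumes "F \<in> borel_measurable borel"
 shows "(\<integral>\<^sup>+z. F z \<partial>(lborel :: R4 measure)) = (\<integral>\<^sup>+u. \<integral>\<^sup>+t. F (R4_of t u) \<partial>lborel \<partial>lborel)"
proof -
 have [measurable]: "F \<in> borel_measurable borel" by fact
 have "(\<integral>\<^sup>+z. F z \<partial>(lborel :: R4 measure)) = (\<integral>\<^sup>+p. F (R4_of (fst p) (snd p)) \<partial>(lborel \<Otimes>\<^sub>M lborel))"
  by (subst lborel_R4, subst nn_integral_distr) (auto simp: case_prod_beta)
 also have "\<dots> = (\<integral>\<^sup>+u. \<integral>\<^sup>+t. F (R4_of t u) \<partial>lborel \<partial>lborel)"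
  by (subst lborel_pair.nn_integral_snd[symmetric]) (auto simp: case_prod_beta)
 finally show ?thesis .
qed

text \<open>
 Existence of the volume is shown by an explicit measure: four times Lebesgue measure of the cone over a set,
 cut off at radius 1. Uniqueness follows because countably many charts cover \<open>M\<close>.
\<close>

locale riemannian_volume = space_form +
 assumes gram: "!!x f. B x x = \<sigma> ==> (!!i::3. B x (f i) = 0) ==>
   det (\<chi> i j. B (f i) (f j) :: real^3^3) = (det4 x (f 1) (f 2) (f 3))^2"
  and closed_M: "closed M"
  and charts: "\<exists>U f. (\<forall>n::nat. parametrization M (U n) (f n)) \<and> M \<subseteq> (\<Union>n. f n ` U n)"
begin

definition radius :: "R4 => real" where "radius z = sqrt (\<sigma> * B z z)"

definition cone :: "R4 set => R4 set" where
 "cone A = {z. 0 < radius z \<and> radius z < 1 \<and> z /\<^sub>R radius z \<in> A}"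

lemma radius_scaleR: "x \<in> M ==> t > 0 ==> radius (t *\<^sub>R x) = t"
 by (simp add: radius_def level mult.commute[of \<sigma>] mult.assoc flip: power2_eq_square)
   (simp add: power2_eq_square)

lemma cone_eq: "A \<subseteq> M ==> cone A = {t *\<^sub>R x | t x. 0 < t \<and> t < 1 \<and> x \<in> A}"
proof safe
 fix z assume "z \<in> cone A"
 then show "\<exists>t x. z = t *\<^sub>R x \<and> 0 < t \<and> t < 1 \<and> x \<in> A"
  by (intro exI[of _ "radius z"] exI[of _ "z /\<^sub>R radius z"]) (auto simp: cone_def)
next
 fix t :: real and x assume "A \<subseteq> M" "0 < t" "t < 1" "x \<in> A"
 then show "t *\<^sub>R x \<in> cone A" using radius_scaleR[of x t] by (auto simp: cone_def)
qed

lemma radius_measurable [measurable]: "radius \<in> borel_measurable borel"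
 unfolding radius_def
 by (intro borel_measurable_continuous_onI continuous_intros B.continuous_on)

lemma cone_sets: "A \<in> sets borel ==> cone A \<in> sets borel"
proof -
 assume [measurable]: "A \<in> sets borel"
 have "{z \<in> space borel. 0 < radius z \<and> radius z < 1 \<and> z /\<^sub>R radius z \<in> A} \<in> sets borel" by measurable
 then show ?thesis by (simp add: cone_def)
qed

lemma chart_tangent:
 assumes p: "parametrization M U f" and u: "u \<in> U"
 shows "B (f u) (fderiv f u h) = 0"
proof -
 have U: "open U" and d: "(f has_derivative fderiv f u) (at u)"
  using p Cinf_on_has_derivative[OF _ u] by (auto simp: parametrization_def)
 have "((%z. B (f z) (f z)) has_derivative (%h. B (f u) (fderiv f u h) + B (fderiv f u h) (f u))) (at u)"
  by (rule B.FDERIV[OF d d])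
 moreover have "((%z. B (f z) (f z)) has_derivative (%h. 0)) (at u)"
  by (rule has_derivative_transform_within_open[OF has_derivative_const[of \<sigma>] U u])
    (use p in \<open>auto simp: parametrization_def level\<close>)
 ultimately have "(%h. B (f u) (fderiv f u h) + B (fderiv f u h) (f u)) = (%h. 0)"
  by (rule has_derivative_unique)
 from fun_cong[OF this, of h] show ?thesis
  using comm[of "fderiv f u h" "f u"] by simp
qed

definition chart_density :: "(real^3 => R4) => real^3 => real" where
 "chart_density f u = (let D = fderiv f u
   in \<bar>det4 (f u) (D (axis 1 1)) (D (axis 2 1)) (D (axis 3 1))\<bar>)"

lemma sqrt_det_metric:
 assumes p: "parametrization M U f" and u: "u \<in> U"
 shows "sqrt (det (metric_matrix B f u)) = chart_density f u"
proof -
 have "f u \<in> M" using p u by (auto simp: parametrization_def)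
 from gram[OF level[OF this], of "%i. fderiv f u (axis i 1)"] chart_tangent[OF p u]
 show ?thesis by (simp add: metric_matrix_def chart_density_def Let_def)
qed

lemma chart_density_continuous: "parametrization M U f ==> continuous_on U (chart_density f)"
 unfolding chart_density_def Let_def det_4 vector_4_nth parametrization_def
 by (intro continuous_intros Cinf_on_continuous Cinf_on_derivative) auto

lemma chart_preimage_sets:
 assumes p: "parametrization M U f" and A: "A \<in> sets borel"
 shows "{u \<in> U. f u \<in> A} \<in> sets borel"
proof -
 have U: "open U" and c: "continuous_on U f"
  using p Cinf_on_continuous by (auto simp: parametrization_def)
 have [measurable]: "U \<in> sets borel" using U by simp
 have "f -` A \<inter> space (restrict_space borel U) \<in> sets (restrict_space borel U)"
  by (rule measurable_sets[OF borel_measurable_continuous_on_restrict[OF c] A])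
 then have "f -` A \<inter> U \<in> sets borel"
  by (auto simp: sets_restrict_space_iff space_restrict_space)
 moreover have "f -` A \<inter> U = {u \<in> U. f u \<in> A}" by auto
 ultimately show ?thesis by simp
qed

text \<open>
 In the coordinates \<open>(t, u) \<mapsto> t f u\<close> of the cone, the Jacobian determinant is \<open>t\<^sup>3\<close> times the density
 of the chart, and \<open>t\<^sup>3\<close> integrates to \<open>1/4\<close>. So Lebesgue measure of cones induces a volume on \<open>M\<close>
 that is independent of charts.
\<close>

lemma cone_emeasure_chart_bounded:
 assumes p: "parametrization M U f" and A: "A \<in> sets borel" "A \<subseteq> f ` U" "bounded A"
 shows "4 * emeasure lborel (cone A) = (\<integral>\<^sup>+u. ennreal (chart_density f u) * indicator {u\<in>U. f u \<in> A} u \<partial>lborel)"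
proof -
 have U: "open U" and inj: "inj_on f U" and fM: "f ` U \<subseteq> M"
  using p by (auto simp: parametrization_def)
 define D where "D u = fderiv f u" for u
 have d: "(f has_derivative D u) (at u)" if "u \<in> U" for u
  using p Cinf_on_has_derivative[OF _ that] by (auto simp: parametrization_def D_def)
 have AM: "A \<subseteq> M" using A fM by auto
 define V where "V = {u \<in> U. f u \<in> A}"
 have V [measurable]: "V \<in> sets borel" unfolding V_def by (rule chart_preimage_sets[OF p A(1)])
 define S where "S = {z :: R4. 0 < z$1 \<and> z$1 < 1 \<and> spatial z \<in> V}"
 have sp [measurable]: "spatial \<in> borel_measurable borel"
  by (intro borel_measurable_continuous_onI linear_continuous_on bounded_linear_spatial)
 have nth1 [measurable]: "(%z::R4. z $ 1) \<in> borel_measurable borel"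
  by (intro borel_measurable_continuous_onI continuous_intros)
 have "{z \<in> space borel. 0 < z$1 \<and> z$1 < 1 \<and> spatial z \<in> V} \<in> sets borel" by measurable
 then have S: "S \<in> sets borel" by (simp add: S_def)
 \<comment> \<open>Polar coordinates: the first coordinate is the radius, the others parametrize the base of the cone.\<close>
 define g where "g z = z$1 *\<^sub>R f (spatial z)" for z :: R4
 define g' where "g' z h = z$1 *\<^sub>R D (spatial z) (spatial h) + h$1 *\<^sub>R f (spatial z)" for z h :: R4
 have dg: "(g has_derivative g' z) (at z within S)" if "z \<in> S" for z
 proof -
  have "((%z. f (spatial z)) has_derivative (%h. D (spatial z) (spatial h))) (at z)"
   by (rule has_derivative_compose[OF bounded_linear_imp_has_derivative[OF bounded_linear_spatial] d])
     (use that in \<open>auto simp: S_def V_def\<close>)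
  from has_derivative_at_withinI[OF has_derivative_scaleR[OF bounded_linear_imp_has_derivative[OF bounded_linear_vec_nth[of 1]] this]]
  show ?thesis unfolding g_def[abs_def] g'_def[abs_def] .
 qed
 have injg: "inj_on g S"
 proof (rule inj_onI)
  fix z z' assume z: "z \<in> S" "z' \<in> S" and eq: "g z = g z'"
  have m: "f (spatial z) \<in> M" "f (spatial z') \<in> M" using z fM by (auto simp: S_def V_def)
  have "radius (g z) = z$1" "radius (g z') = z'$1"
   unfolding g_def using z m by (auto simp: S_def intro!: radius_scaleR)
  with eq have t: "z$1 = z'$1" by simp
  then have "f (spatial z) = f (spatial z')" using eq z by (simp add: g_def S_def)
  then have "spatial z = spatial z'" using inj z by (auto simp: S_def V_def inj_on_def)
  then show "z = z'" using t by (metis R4_of_spatial)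
 qed
 have img: "g ` S = cone A"
 proof -
  have "g ` S = {t *\<^sub>R x | t x. 0 < t \<and> t < 1 \<and> x \<in> A}"
  proof safe
   fix z assume "z \<in> S"
   then show "\<exists>t x. g z = t *\<^sub>R x \<and> 0 < t \<and> t < 1 \<and> x \<in> A"
    by (intro exI[of _ "z$1"] exI[of _ "f (spatial z)"]) (auto simp: S_def V_def g_def)
  next
   fix t x assume t: "0 < t" "t < (1::real)" and "x \<in> A"
   then obtain u where u: "u \<in> U" "x = f u" using A by auto
   show "t *\<^sub>R x \<in> g ` S"
    by (rule image_eqI[of _ _ "R4_of t u"]) (use t u \<open>x \<in> A\<close> in \<open>auto simp: g_def S_def V_def\<close>)
  qed
  then show ?thesis using cone_eq[OF AM] by simp
 qed
 have detg: "\<bar>det (matrix (g' z))\<bar> = (z$1)^3 * chart_density f (spatial z)" if "z \<in> S" for z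
 proof -
  let ?u = "spatial z"
  have D0: "D ?u 0 = 0" using d[of ?u] that by (auto simp: S_def V_def has_derivative_def intro!: linear_simps)
  have sp: "spatial (axis 1 1) = 0" "spatial (axis 2 1) = axis 1 1" "spatial (axis 3 1) = axis 2 1"
   "spatial (axis 4 1) = axis 3 1"
   by (simp_all add: spatial_def vector_3_eq_iff vector_3 axis_def)
  have "transpose (matrix (g' z)) = vector [g' z (axis 1 1), g' z (axis 2 1), g' z (axis 3 1), g' z (axis 4 1)]"
   by (simp add: vec_eq_iff forall_4 transpose_def matrix_def)
  also have "\<dots> = vector [f ?u, z$1 *\<^sub>R D ?u (axis 1 1), z$1 *\<^sub>R D ?u (axis 2 1), z$1 *\<^sub>R D ?u (axis 3 1)]"
   by (simp add: g'_def sp D0)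
  finally have "det (matrix (g' z)) = det4 (f ?u) (z$1 *\<^sub>R D ?u (axis 1 1)) (z$1 *\<^sub>R D ?u (axis 2 1)) (z$1 *\<^sub>R D ?u (axis 3 1))"
   by (metis det_transpose)
  also have "\<dots> = (z$1)^3 * det4 (f ?u) (D ?u (axis 1 1)) (D ?u (axis 2 1)) (D ?u (axis 3 1))"
   unfolding det_4 vector_4_nth vector_scaleR_component real_scaleR_def power3_eq_cube
   by (simp add: algebra_simps)
  finally show ?thesis using that by (simp add: chart_density_def Let_def D_def abs_mult S_def)
 qed
 have bdd: "bounded (cone A)"
 proof -
  obtain b where b: "!!x. x \<in> A ==> norm x <= b" using A(3) by (auto simp: bounded_iff)
  have "norm z <= b" if z: "z \<in> cone A" for z
  proof -
   obtain t x where tx: "z = t *\<^sub>R x" "0 < t" "t < 1" "x \<in> A" using z unfolding cone_eq[OF AM] by blast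
   have "norm z <= 1 * norm x" unfolding tx(1) norm_scaleR using tx by (intro mult_right_mono) auto
   then show ?thesis using b[OF tx(4)] by simp
  qed
  then show ?thesis by (auto simp: bounded_iff)
 qed
 have cs: "cone A \<in> sets borel" by (rule cone_sets[OF A(1)])
 have fin: "emeasure lborel (cone A) < \<infinity>" by (rule emeasure_bounded_finite[OF bdd])
 have lm: "cone A \<in> lmeasurable" using cs by (intro bounded_set_imp_lmeasurable[OF bdd] sets_completionI_sets) simp
 have "((%z. \<bar>det (matrix (g' z))\<bar>) has_integral measure lebesgue (cone A)) S"
  using has_measure_differentiable_image[OF sets_completionI_sets dg injg, of "measure lebesgue (cone A)"] S lm
  by (simp add: img)
 then have "(\<integral>\<^sup>+z. ennreal \<bar>det (matrix (g' z))\<bar> * indicator S z \<partial>lborel) = ennreal (measure lebesgue (cone A))"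
  by (intro nn_integral_has_integral_lebesgue') auto
 also have "ennreal (measure lebesgue (cone A)) = emeasure lborel (cone A)"
  using fin cs by (simp add: emeasure_eq_ennreal_measure)
 finally have eq1: "emeasure lborel (cone A) = (\<integral>\<^sup>+z. ennreal \<bar>det (matrix (g' z))\<bar> * indicator S z \<partial>lborel)" ..
 define K where "K u = ennreal (chart_density f u) * indicator V u" for u
 have K [measurable]: "K \<in> borel_measurable borel"
 proof -
  have "(%u. indicator U u *\<^sub>R chart_density f u) \<in> borel_measurable borel"
   by (rule borel_measurable_continuous_on_indicator[OF _ chart_density_continuous[OF p]]) (use U in simp)
  then have [measurable]: "(%u. indicator U u *\<^sub>R chart_density f u) \<in> borel_measurable borel" .
  have "K = (%u. ennreal (indicator U u *\<^sub>R chart_density f u) * indicator V u)"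
   by (auto simp: K_def V_def indicator_def)
  moreover have "\<dots> \<in> borel_measurable borel" by measurable
  ultimately show ?thesis by simp
 qed
 have "(\<integral>\<^sup>+z. ennreal \<bar>det (matrix (g' z))\<bar> * indicator S z \<partial>lborel)
   = (\<integral>\<^sup>+z. (ennreal ((z$1)^3) * indicator {0<..<1} (z$1)) * K (spatial z) \<partial>lborel)"
 proof (rule nn_integral_cong)
  fix z :: R4
  show "ennreal \<bar>det (matrix (g' z))\<bar> * indicator S z = (ennreal ((z$1)^3) * indicator {0<..<1} (z$1)) * K (spatial z)"
  proof (cases "z \<in> S")
   case True
   then show ?thesis
    by (simp add: detg) (simp add: K_def S_def ennreal_mult chart_density_def Let_def)
  qed (auto simp: S_def K_def indicator_def)
 qed
 also have "\<dots> = (\<integral>\<^sup>+u. \<integral>\<^sup>+t. (ennreal (t^3) * indicator {0<..<1} t) * K u \<partial>lborel \<partial>lborel)"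
  by (subst nn_integral_R4) auto
 also have "\<dots> = (\<integral>\<^sup>+u. (\<integral>\<^sup>+t. ennreal (t^3) * indicator {0<..<1} t \<partial>lborel) * K u \<partial>lborel)"
  by (intro nn_integral_cong nn_integral_multc) measurable
 also have "(\<integral>\<^sup>+t. ennreal (t^3) * indicator {0<..<1::real} t \<partial>lborel) = ennreal (1/4)"
 proof -
  have "((%t::real. t^3) has_integral (1^4/4 - 0^4/4)) {0..1}"
   by (rule fundamental_theorem_of_calculus)
     (auto intro!: derivative_eq_intros simp: has_real_derivative_iff_has_vector_derivative[symmetric])
  then have "((%t::real. t^3) has_integral (1/4)) {0<..<1}"
   by (simp add: has_integral_Icc_iff_Ioo)
  then show ?thesis by (intro nn_integral_has_integral_lebesgue') auto
 qed
 also have "(\<integral>\<^sup>+u. ennreal (1/4) * K u \<partial>lborel) = ennreal (1/4) * (\<integral>\<^sup>+u. K u \<partial>lborel)"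
  by (rule nn_integral_cmult) measurable
 finally have "4 * emeasure lborel (cone A) = (4 * ennreal (1/4)) * (\<integral>\<^sup>+u. K u \<partial>lborel)"
  unfolding eq1 by (simp only: mult.assoc)
 also have "4 * ennreal (1/4) = 1"
  by (metis ennreal_1 ennreal_mult ennreal_numeral mult.commute nonzero_divide_eq_eq zero_le_divide_1_iff zero_le_numeral zero_neq_numeral)
 finally show ?thesis by (simp add: K_def V_def)
qed

lemma cone_emeasure_chart:
 assumes p: "parametrization M U f" and A: "A \<in> sets borel" "A \<subseteq> f ` U"
 shows "4 * emeasure lborel (cone A) = (\<integral>\<^sup>+u\<in>{u\<in>U. f u \<in> A}. ennreal (sqrt (det (metric_matrix B f u))) \<partial>lborel)"
proof -
 define A' where "A' n = A \<inter> cball 0 (real n)" for n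
 have A'U: "(\<Union>n. A' n) = A"
 proof -
  have "\<exists>n. norm x <= real n" for x :: R4 using real_arch_simple by blast
  then show ?thesis by (auto simp: A'_def)
 qed
 have A': "A' n \<in> sets borel" "A' n \<subseteq> f ` U" "bounded (A' n)" for n
  using A by (auto simp: A'_def intro: bounded_subset[OF bounded_cball])
 have inc: "A' m \<subseteq> A' n" if "m <= n" for m n using that by (auto simp: A'_def)
 have [measurable]: "U \<in> sets borel" using p by (simp add: parametrization_def)
 have dm: "(%u. indicator U u *\<^sub>R chart_density f u) \<in> borel_measurable borel"
  by (rule borel_measurable_continuous_on_indicator[OF _ chart_density_continuous[OF p]]) simp
 define N where "N = density lborel (%u. ennreal (indicator U u *\<^sub>R chart_density f u))"
 have dm' [measurable]: "(%u. ennreal (indicator U u *\<^sub>R chart_density f u)) \<in> borel_measurable lborel"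
  using dm by measurable
 have eN: "emeasure N {u\<in>U. f u \<in> A} = (\<integral>\<^sup>+u. ennreal (chart_density f u) * indicator {u\<in>U. f u \<in> A} u \<partial>lborel)"
  if "A \<in> sets borel" for A
  unfolding N_def using chart_preimage_sets[OF p that]
  by (subst emeasure_density[OF dm']) (auto intro!: nn_integral_cong simp: indicator_def)
 have l1: "(%n. emeasure N {u\<in>U. f u \<in> A' n}) \<longlonglongrightarrow> emeasure N (\<Union>n. {u\<in>U. f u \<in> A' n})"
  by (rule Lim_emeasure_incseq) (use chart_preimage_sets[OF p A'(1)] inc in \<open>auto simp: N_def incseq_def\<close>)
 have l2: "(%n. emeasure lborel (cone (A' n))) \<longlonglongrightarrow> emeasure lborel (\<Union>n. cone (A' n))"
  by (rule Lim_emeasure_incseq) (use cone_sets[OF A'(1)] inc in \<open>auto simp: incseq_def cone_def\<close>)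
 have "(%n. 4 * emeasure lborel (cone (A' n))) \<longlonglongrightarrow> 4 * emeasure lborel (\<Union>n. cone (A' n))"
  by (rule ennreal_tendsto_cmult[OF _ l2]) simp
 moreover have "4 * emeasure lborel (cone (A' n)) = emeasure N {u\<in>U. f u \<in> A' n}" for n
  by (simp add: cone_emeasure_chart_bounded[OF p A'] eN[OF A'(1)])
 ultimately have "4 * emeasure lborel (\<Union>n. cone (A' n)) = emeasure N (\<Union>n. {u\<in>U. f u \<in> A' n})"
  using LIMSEQ_unique[OF l1] by simp
 also have "(\<Union>n. cone (A' n)) = cone A" unfolding A'U[symmetric] by (auto simp: cone_def)
 also have "(\<Union>n. {u\<in>U. f u \<in> A' n}) = {u\<in>U. f u \<in> A}" unfolding A'U[symmetric] by auto
 finally have "4 * emeasure lborel (cone A) = (\<integral>\<^sup>+u. ennreal (chart_density f u) * indicator {u\<in>U. f u \<in> A} u \<partial>lborel)"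
  by (simp add: eN[OF A(1)])
 also have "\<dots> = (\<integral>\<^sup>+u\<in>{u\<in>U. f u \<in> A}. ennreal (sqrt (det (metric_matrix B f u))) \<partial>lborel)"
  by (rule nn_integral_cong) (auto simp: indicator_def sqrt_det_metric[OF p])
 finally show ?thesis .
qed

lemma M_sets [measurable]: "M \<in> sets borel"
 using closed_M by simp

lemma chart_image_sets:
 assumes p: "parametrization M U f"
 shows "f ` U \<in> sets borel"
proof -
 have U: "open U" and c: "continuous_on U f"
  using p Cinf_on_continuous by (auto simp: parametrization_def)
 obtain C where C: "!!n::nat. compact (C n)" "!!n. C n \<subseteq> U" "\<Union>(range C) = U"
  using open_Union_compact_subsets[OF U] by metis
 have "f ` U = (\<Union>n. f ` C n)" using C(3) by auto
 moreover have "compact (f ` C n)" for n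
  by (rule compact_continuous_image[OF continuous_on_subset[OF c C(2)] C(1)])
 then have "f ` C n \<in> sets borel" for n by (simp add: borel_closed compact_imp_closed)
 ultimately show ?thesis by auto
qed

definition volume_property :: "R4 measure => bool" where
 "volume_property \<mu> \<longleftrightarrow> sets \<mu> = sets (restrict_space borel M) \<and>
   (\<forall>U f. parametrization M U f --> (\<forall>A\<in>sets \<mu>. A \<subseteq> f ` U -->
    emeasure \<mu> A = (\<integral>\<^sup>+u\<in>{u\<in>U. f u \<in> A}. ennreal (sqrt (det (metric_matrix B f u))) \<partial>lborel)))"

text \<open>Both measures have the prescribed values on subsets of single charts. Cut a set into countably many of these.\<close>

lemma volume_unique:
 assumes \<mu>: "volume_property \<mu>" and \<nu>: "volume_property \<nu>"
 shows "\<mu> = \<nu>"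
proof (rule measure_eqI)
 show s: "sets \<mu> = sets \<nu>" using \<mu> \<nu> by (simp add: volume_property_def)
 fix A assume A: "A \<in> sets \<mu>"
 have sm: "sets \<mu> = sets (restrict_space borel M)" using \<mu> by (simp add: volume_property_def)
 have AM: "A \<subseteq> M" "A \<in> sets borel" using A unfolding sm by (auto simp: sets_restrict_space_iff)
 obtain U f where UF: "!!n::nat. parametrization M (U n) (f n)" "M \<subseteq> (\<Union>n. f n ` U n)"
  using charts by blast
 define C where "C n = disjointed (%n. f n ` U n) n" for n
 have Cs: "C n \<in> sets borel" for n
  unfolding C_def using sets.range_disjointed_sets[of "%n. f n ` U n" borel] chart_image_sets[OF UF(1)] by auto
 have Cn: "C n \<subseteq> f n ` U n" for n unfolding C_def by (rule disjointed_subset)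
 have disj: "disjoint_family (%n. A \<inter> C n)"
  using disjoint_family_disjointed[of "%n. f n ` U n"] by (auto simp: disjoint_family_on_def C_def)
 have AU: "(\<Union>n. A \<inter> C n) = A"
  using UF(2) AM unfolding C_def by (auto simp flip: UN_disjointed_eq[of "%n. f n ` U n"])
 have AC: "A \<inter> C n \<in> sets \<mu>" for n
  unfolding sm using AM Cs[of n] by (auto simp: sets_restrict_space_iff)
 have eq: "emeasure \<mu> (A \<inter> C n) = emeasure \<nu> (A \<inter> C n)" for n
 proof -
  have sub: "A \<inter> C n \<subseteq> f n ` U n" using Cn[of n] by blast
  have "emeasure \<rho> (A \<inter> C n) = (\<integral>\<^sup>+u\<in>{u\<in>U n. f n u \<in> A \<inter> C n}. ennreal (sqrt (det (metric_matrix B (f n) u))) \<partial>lborel)"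
   if "volume_property \<rho>" "A \<inter> C n \<in> sets \<rho>" for \<rho>
   using that(1)[unfolded volume_property_def, THEN conjunct2, rule_format, OF UF(1) that(2) sub] .
  then show ?thesis using \<mu> \<nu> AC[of n] s by simp
 qed
 have "emeasure \<mu> A = (\<Sum>n. emeasure \<mu> (A \<inter> C n))"
  by (subst suminf_emeasure) (use AC disj AU in auto)
 also have "\<dots> = emeasure \<nu> A"
  unfolding eq by (subst suminf_emeasure) (use AC disj AU s in auto)
 finally show "emeasure \<mu> A = emeasure \<nu> A" .
qed

definition cone_measure :: "R4 measure" where
 "cone_measure = scale_measure 4 (distr (restrict_space lborel (cone M)) (restrict_space borel M) (%z. z /\<^sub>R radius z))"

lemma sets_cone_measure: "sets cone_measure = sets (restrict_space borel M)"
 by (simp add: cone_measure_def)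

lemma emeasure_cone_measure:
 assumes "A \<in> sets (restrict_space borel M)"
 shows "emeasure cone_measure A = 4 * emeasure lborel (cone A)"
proof -
 have A: "A \<subseteq> M" "A \<in> sets borel" using assms by (auto simp: sets_restrict_space_iff)
 have cM: "cone M \<in> sets borel" by (rule cone_sets[OF M_sets])
 have m: "(%z. z /\<^sub>R radius z) \<in> restrict_space lborel (cone M) \<rightarrow>\<^sub>M restrict_space borel M"
  by (rule measurable_restrict_space3) (auto simp: cone_def)
 have "(%z. z /\<^sub>R radius z) -` A \<inter> space (restrict_space lborel (cone M)) = cone A"
  using A by (auto simp: space_restrict_space cone_def)
 moreover have "cone A \<subseteq> cone M" using A by (auto simp: cone_def)
 ultimately show ?thesis
  unfolding cone_measure_def
  by (simp add: emeasure_distr[OF m assms] emeasure_restrict_space cM)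
qed

lemma volume_eq_cone_measure: "volume B M = cone_measure"
proof -
 have "volume_property cone_measure"
  unfolding volume_property_def
 proof (intro conjI allI impI ballI)
  show "sets cone_measure = sets (restrict_space borel M)" by (rule sets_cone_measure)
  fix U f A assume p: "parametrization M U f" and A: "A \<in> sets cone_measure" "A \<subseteq> f ` U"
  have "A \<in> sets borel" using A(1) unfolding sets_cone_measure by (auto simp: sets_restrict_space_iff)
  from cone_emeasure_chart[OF p this A(2)]
  show "emeasure cone_measure A = (\<integral>\<^sup>+u\<in>{u\<in>U. f u \<in> A}. ennreal (sqrt (det (metric_matrix B f u))) \<partial>lborel)"
   using A(1) unfolding sets_cone_measure by (simp add: emeasure_cone_measure)
 qed
 then have "(THE \<mu>. volume_property \<mu>) = cone_measure"
  using volume_unique by (intro the_equality)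
 then show ?thesis by (simp add: volume_def volume_property_def)
qed

lemma volume_property_volume: "volume_property (volume B M)"
proof -
 have "volume_property cone_measure"
  unfolding volume_property_def
 proof (intro conjI allI impI ballI)
  show "sets cone_measure = sets (restrict_space borel M)" by (rule sets_cone_measure)
  fix U f A assume p: "parametrization M U f" and A: "A \<in> sets cone_measure" "A \<subseteq> f ` U"
  have "A \<in> sets borel" using A(1) unfolding sets_cone_measure by (auto simp: sets_restrict_space_iff)
  from cone_emeasure_chart[OF p this A(2)]
  show "emeasure cone_measure A = (\<integral>\<^sup>+u\<in>{u\<in>U. f u \<in> A}. ennreal (sqrt (det (metric_matrix B f u))) \<partial>lborel)"
   using A(1) unfolding sets_cone_measure by (simp add: emeasure_cone_measure)
 qed
 then show ?thesis by (simp add: volume_eq_cone_measure)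
qed

lemma sets_volume: "sets (volume B M) = sets (restrict_space borel M)"
 by (simp add: volume_eq_cone_measure sets_cone_measure)

lemma space_volume: "space (volume B M) = M"
 using sets_eq_imp_space_eq[OF sets_volume] by (simp add: space_restrict_space)

lemma emeasure_volume:
 "A \<in> sets (restrict_space borel M) ==> emeasure (volume B M) A = 4 * emeasure lborel (cone A)"
 by (simp add: volume_eq_cone_measure emeasure_cone_measure)

lemma emeasure_volume_chart:
 "parametrization M U f ==> A \<in> sets (restrict_space borel M) ==> A \<subseteq> f ` U ==>
  emeasure (volume B M) A = (\<integral>\<^sup>+u\<in>{u\<in>U. f u \<in> A}. ennreal (sqrt (det (metric_matrix B f u))) \<partial>lborel)"
 using volume_property_volume by (simp add: volume_property_def)

end

subsection \<open>Charts by orthogonal projection\<close>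

text \<open>
 The graph over the space coordinates: the hyperboloid for \<open>s = 1\<close>, the open upper half sphere for \<open>s = - 1\<close>.
 Rotated by the units \<open>1, i, j, k\<close> and their negatives, half spheres cover the sphere.
\<close>

definition graph_chart :: "real => real^3 => R4" where
 "graph_chart s u = R4_of (sqrt (1 + s * (u \<bullet> u))) u"

lemma spatial_graph_chart [simp]: "spatial (graph_chart s u) = u"
 by (simp add: graph_chart_def)

lemma Cinf_on_graph_chart:
 assumes "open U" "!!u. u \<in> U ==> 1 + s * (u \<bullet> u) > 0"
 shows "Cinf_on (graph_chart s) U"
proof (rule Cinf_on_cong[OF assms(1)])
 have "Cinf_on (%u. (1 + s * (u \<bullet> u)) powr (1/2)) U"
  by (intro Cinf_on_powr assms Cinf_on_add Cinf_on_cmult Cinf_on_inner Cinf_on_id Cinf_on_const)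
 then show "Cinf_on (%u. ((1 + s * (u \<bullet> u)) powr (1/2)) *\<^sub>R axis 1 1 + R4_of 0 u) U"
  by (intro Cinf_on_add Cinf_on_scaleR Cinf_on_const assms(1) Cinf_on_bounded_linear[OF bounded_linear_R4_of] Cinf_on_id)
 show "((1 + s * (u \<bullet> u)) powr (1/2)) *\<^sub>R axis 1 1 + R4_of 0 u = graph_chart s u" if "u \<in> U" for u
  using assms(2)[OF that] unfolding graph_chart_def by (subst (2) R4_of_eq) (simp add: powr_half_sqrt)
qed

lemma parametrization_left_inverse:
 assumes U: "open U" and f: "Cinf_on f U" and M: "f ` U \<subseteq> M" and g: "bounded_linear g" "!!u. u \<in> U ==> g (f u) = u"
 shows "parametrization M U f"
 unfolding parametrization_def
proof (intro conjI ballI U f M)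
 show "inj_on f U" using g(2) by (metis inj_onI)
 fix u assume u: "u \<in> U"
 have d: "(f has_derivative fderiv f u) (at u)" by (rule Cinf_on_has_derivative[OF f u])
 have "((%u. g (f u)) has_derivative (%h. g (fderiv f u h))) (at u)"
  by (rule bounded_linear.has_derivative[OF g(1) d])
 moreover have "((%u. g (f u)) has_derivative (%h. h)) (at u)"
  by (rule has_derivative_transform_within_open[OF has_derivative_ident U u]) (simp add: g(2))
 ultimately have "(%h. g (fderiv f u h)) = (%h. h)" by (rule has_derivative_unique)
 then show "inj (fderiv f u)" by (metis injI)
qed

lemma graph_chart_S3:
 assumes q: "q \<in> S3"
 shows "parametrization S3 (ball 0 1) (%u. qmult q (graph_chart (- 1) u))"
proof (rule parametrization_left_inverse)
 have b: "u \<bullet> u < 1" if "u \<in> ball 0 1" for u :: "real^3"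
  using that by (simp add: power2_norm_eq_inner[symmetric] abs_square_less_1)
 show "Cinf_on (%u. qmult q (graph_chart (- 1) u)) (ball 0 1)"
  by (rule Cinf_on_bounded_linear[OF qmult.bounded_linear_right _ Cinf_on_graph_chart]) (use b in auto)
 have "graph_chart (- 1) u \<in> S3" if "u \<in> ball 0 1" for u
  using b[OF that] by (simp add: S3_iff_inner inner_R4 graph_chart_def inner_R3)
 then show "(%u. qmult q (graph_chart (- 1) u)) ` ball 0 1 \<subseteq> S3" using qmult_in_S3[OF q] by blast
 show "bounded_linear (%x. spatial (qmult (qconj q) x))"
  by (rule bounded_linear_compose[OF bounded_linear_spatial qmult.bounded_linear_right])
 show "spatial (qmult (qconj q) (qmult q (graph_chart (- 1) u))) = u" for u
  by (simp add: qconj_cancel q)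
qed simp

lemma graph_chart_S3_cover:
 assumes q: "q \<in> S3" and x: "x \<in> S3" and pos: "q \<bullet> x > 0"
 shows "x \<in> (%u. qmult q (graph_chart (- 1) u)) ` ball 0 1"
proof (rule image_eqI)
 define y where "y = qmult (qconj q) x"
 have y: "y \<in> S3" unfolding y_def by (intro qmult_in_S3 qconj_in_S3 q x)
 have y1: "y$1 > 0" using pos by (simp add: y_def qcoords)
 have sq: "(y$1)^2 = 1 - spatial y \<bullet> spatial y"
  using y by (simp add: S3_iff_inner inner_R4 inner_R3 spatial_def vector_3 power2_eq_square)
 have "graph_chart (- 1) (spatial y) = y"
  using y1 unfolding graph_chart_def by (simp flip: sq)
 then show "x = qmult q (graph_chart (- 1) (spatial y))" by (simp add: y_def qconj_cancel q)
 have "spatial y \<bullet> spatial y < 1" using sq y1 by (smt (verit) zero_less_power)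
 then show "spatial y \<in> ball 0 1" by (simp add: norm_eq_sqrt_inner)
qed

lemma graph_chart_H3: "parametrization H3 UNIV (graph_chart 1)"
proof (rule parametrization_left_inverse[OF _ _ _ bounded_linear_spatial])
 have pos: "1 + 1 * (u \<bullet> u) > 0" for u :: "real^3" by (simp add: add_pos_nonneg)
 show "Cinf_on (graph_chart 1) UNIV" by (rule Cinf_on_graph_chart) (use pos in auto)
 show "graph_chart 1 ` UNIV \<subseteq> H3"
  using pos by (auto simp: H3_iff hdot_R4 graph_chart_def inner_R3 add_nonneg_nonneg)
qed auto

lemma graph_chart_H3_spatial: "x \<in> H3 ==> graph_chart 1 (spatial x) = x"
proof -
 assume x: "x \<in> H3"
 have sq: "1 + spatial x \<bullet> spatial x = (x$1)^2"
  using x by (simp add: H3_iff hdot_R4 inner_R3 spatial_def vector_3 power2_eq_square)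
 show ?thesis using x unfolding graph_chart_def by (simp add: sq H3_iff)
qed

interpretation S3: riemannian_volume "(\<bullet>)" S3 1
proof
 show "det (\<chi> i j. f i \<bullet> f j :: real^3^3) = (det4 x (f 1) (f 2) (f 3))^2"
  if "x \<bullet> x = 1" "!!i. x \<bullet> f i = 0" for x :: R4 and f :: "3 => R4"
  using that by (rule det_gram_S3)
 have "S3 = sphere 0 1" by (auto simp: S3_def)
 then show "closed S3" using closed_sphere by metis
 define Q where "Q = [qone, - qone, qi, - qi, qj, - qj, qk, - qk]"
 define q where "q n = Q ! (n mod 8)" for n
 have qQ: "q n \<in> set Q" for n unfolding q_def by (rule nth_mem) (simp add: Q_def)
 have qS: "q n \<in> S3" for n using qQ[of n] qunit_in_S3 by (auto simp: Q_def S3_def)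
 have surj: "\<exists>n. q n = p" if p: "p \<in> set Q" for p
 proof -
  obtain n where "n < length Q \<and> Q ! n = p" using p unfolding in_set_conv_nth by (elim exE)
  then show ?thesis by (intro exI[of _ n]) (simp add: q_def Q_def)
 qed
 show "\<exists>U f. (\<forall>n::nat. parametrization S3 (U n) (f n)) \<and> S3 \<subseteq> (\<Union>n. f n ` U n)"
 proof (intro exI conjI allI subsetI)
  show "parametrization S3 (ball 0 1) (%u. qmult (q n) (graph_chart (- 1) u))" for n
   by (rule graph_chart_S3[OF qS])
  fix x assume x: "x \<in> S3"
  have "\<exists>p\<in>set Q. p \<bullet> x > 0"
  proof (rule ccontr)
   assume "\<not> ?thesis"
   then have "x$1 = 0" "x$2 = 0" "x$3 = 0" "x$4 = 0" by (auto simp: Q_def inner_R4 not_less)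
   then show False using x by (simp add: S3_iff_inner inner_R4)
  qed
  then obtain n where "q n \<bullet> x > 0" using surj by metis
  then show "x \<in> (\<Union>n. (%u. qmult (q n) (graph_chart (- 1) u)) ` ball 0 1)"
   using graph_chart_S3_cover[OF qS x] by blast
 qed
qed

interpretation H3: riemannian_volume hdot H3 "- 1"
proof
 show "det (\<chi> i j. hdot (f i) (f j) :: real^3^3) = (det4 x (f 1) (f 2) (f 3))^2"
  if "hdot x x = - 1" "!!i. hdot x (f i) = 0" for x :: R4 and f :: "3 => R4"
  using that by (rule det_gram_H3)
 have "H3 = {x. hdot x x = - 1} \<inter> {x. x$1 \<ge> 0}"
 proof -
  have "x$1 ~= 0" if "hdot x x = - 1" for x :: R4
  proof
   assume "x$1 = 0"
   then have "hdot x x = x$2 * x$2 + x$3 * x$3 + x$4 * x$4" by (simp add: hdot_R4)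
   then show False using that zero_le_square[of "x$2"] zero_le_square[of "x$3"] zero_le_square[of "x$4"] by linarith
  qed
  then show ?thesis by (force simp: H3_iff)
 qed
 moreover have "closed ({x. hdot x x = - 1} \<inter> {x. x$1 \<ge> 0})"
  by (intro closed_Int closed_Collect_eq closed_Collect_le continuous_intros)
 ultimately show "closed H3" by simp
 show "\<exists>U f. (\<forall>n::nat. parametrization H3 (U n) (f n)) \<and> H3 \<subseteq> (\<Union>n. f n ` U n)"
 proof (intro exI conjI allI subsetI)
  show "parametrization H3 UNIV (graph_chart 1)" by (rule graph_chart_H3)
  fix x assume "x \<in> H3"
  from graph_chart_H3_spatial[OF this] show "x \<in> (\<Union>n::nat. range (graph_chart 1))" by (metis UN_I UNIV_I rangeI)
 qed
qed

subsection \<open>The volume of the three-sphere\<close>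

lemma S3_sets [measurable]: "S3 \<in> sets borel"
 by (rule S3.M_sets)

lemma S3_radius: "S3.radius z = norm z"
 by (simp add: S3.radius_def norm_eq_sqrt_inner)

lemma emeasure_vol_S3: "emeasure vol_S3 S3 = ennreal (2 * pi^2)"
proof -
 have "S3.cone S3 = ball 0 1 - {0}" by (auto simp: S3.cone_def S3_radius S3_def)
 then have "emeasure lborel (S3.cone S3) = emeasure lborel (ball (0::R4) 1)"
  by (simp add: emeasure_Diff)
 also have "\<dots> = ennreal (pi^2 / 2)"
  by (simp add: emeasure_ball unit_ball_vol_numeral fact_numeral)
 finally have "emeasure vol_S3 S3 = 4 * ennreal (pi^2 / 2)"
  by (subst S3.emeasure_volume) (auto simp: sets_restrict_space_iff)
 also have "\<dots> = ennreal (2 * pi^2)"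
  by (subst ennreal_numeral[symmetric], subst ennreal_mult[symmetric]) auto
 finally show ?thesis .
qed

interpretation vol_S3: finite_measure vol_S3
 by standard (simp add: S3.space_volume emeasure_vol_S3)

lemma measure_vol_S3: "measure vol_S3 S3 = 2 * pi^2"
 by (simp add: measure_def emeasure_vol_S3)

text \<open>Rotations preserve Lebesgue measure and map cones to cones.\<close>

lemma vol_S3_orthogonal_invariant:
 assumes R: "orthogonal_transformation R" and RS: "!!x. x \<in> S3 ==> R x \<in> S3"
 shows "distr vol_S3 vol_S3 R = vol_S3"
proof (rule measure_eqI)
 have cR: "continuous_on UNIV R" 
  by (rule linear_continuous_on[OF linear_conv_bounded_linear[THEN iffD1, OF orthogonal_transformation_linear[OF R]]])
 then have [measurable]: "R \<in> borel_measurable borel" by (rule borel_measurable_continuous_onI)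
 have mR: "R \<in> vol_S3 \<rightarrow>\<^sub>M vol_S3"
  unfolding measurable_cong_sets[OF S3.sets_volume S3.sets_volume]
  by (rule measurable_restrict_space3) (use RS in auto)
 fix A assume "A \<in> sets (distr vol_S3 vol_S3 R)"
 then have A: "A \<in> sets (restrict_space borel S3)" by (simp add: S3.sets_volume)
 then have A': "A \<subseteq> S3" "A \<in> sets borel" by (auto simp: sets_restrict_space_iff)
 define P where "P = R -` A \<inter> S3"
 have P: "P \<in> sets (restrict_space borel S3)"
  using measurable_sets[OF mR, of A] A unfolding P_def by (simp add: S3.sets_volume S3.space_volume)
 have P': "P \<subseteq> S3" "P \<in> sets borel" using P by (auto simp: sets_restrict_space_iff)
 have lin: "linear R" by (rule orthogonal_transformation_linear[OF R])
 have nR: "norm (R z) = norm z" for z by (rule orthogonal_transformation_norm[OF R])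
 have surj: "surj R" by (rule orthogonal_transformation_surj[OF R])
 have "S3.cone A = R ` S3.cone P"
 proof safe
  fix z assume z: "z \<in> S3.cone A"
  obtain w where w: "z = R w" using surj by blast
  have "w ~= 0" using z w linear_0[OF lin] by (auto simp: S3.cone_def S3_radius)
  have "R (w /\<^sub>R norm w) = z /\<^sub>R norm z" using w by (simp add: linear_scale[OF lin] nR)
  moreover have "w /\<^sub>R norm w \<in> S3" using \<open>w ~= 0\<close> by (simp add: S3_def)
  ultimately have "w \<in> S3.cone P" using z w nR[of w] by (auto simp: S3.cone_def S3_radius P_def)
  then show "z \<in> R ` S3.cone P" using w by simp
 next
  fix w assume w: "w \<in> S3.cone P"
  then have "R w ~= 0" using nR[of w] by (auto simp: S3.cone_def S3_radius)
  with w show "R w \<in> S3.cone A" by (simp add: S3.cone_def S3_radius P_def nR flip: linear_scale[OF lin])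
 qed
 moreover have fin: "S3.cone X \<in> lmeasurable" "emeasure lborel (S3.cone X) = ennreal (measure lebesgue (S3.cone X))"
  if "X \<in> sets borel" for X
 proof -
  have b: "bounded (S3.cone X)"
   by (rule bounded_subset[OF bounded_ball[of 0 1]]) (auto simp: S3.cone_def S3_radius)
  have s: "S3.cone X \<in> sets borel" by (rule S3.cone_sets[OF that])
  show "S3.cone X \<in> lmeasurable" using s by (intro bounded_set_imp_lmeasurable[OF b] sets_completionI_sets) simp
  show "emeasure lborel (S3.cone X) = ennreal (measure lebesgue (S3.cone X))"
   using emeasure_bounded_finite[OF b] s by (simp add: emeasure_eq_ennreal_measure)
 qed
 ultimately have "emeasure lborel (S3.cone A) = emeasure lborel (S3.cone P)"
  using measure_orthogonal_image[OF R fin(1)[OF P'(2)]] fin(2)[OF P'(2)] fin(2)[OF A'(2)] by simp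
 then show "emeasure (distr vol_S3 vol_S3 R) A = emeasure vol_S3 A"
  using A P by (simp add: emeasure_distr[OF mR] S3.sets_volume S3.space_volume S3.emeasure_volume flip: P_def)
qed simp

subsection \<open>The volume of hyperbolic space\<close>

lemma H3_sets [measurable]: "H3 \<in> sets borel"
 by (rule H3.M_sets)

lemma graph_chart_H3_has_derivative:
 "(graph_chart 1 has_derivative (%h. R4_of ((u \<bullet> h) / sqrt (1 + u \<bullet> u)) h)) (at u)"
proof -
 have pos: "1 + u \<bullet> u > 0" by (simp add: add_pos_nonneg)
 have d1: "((%u. 1 + u \<bullet> u) has_derivative (%h. 2 * (u \<bullet> h))) (at u)"
  by (auto intro!: derivative_eq_intros simp: inner_commute)
 have d2: "((%u. sqrt (1 + u \<bullet> u)) has_derivative (%h. (u \<bullet> h) / sqrt (1 + u \<bullet> u))) (at u)"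
  using has_derivative_compose[OF d1 DERIV_real_sqrt[OF pos, unfolded has_field_derivative_def]]
  by (simp add: field_simps)
 have "((%u. sqrt (1 + u \<bullet> u) *\<^sub>R (axis 1 1 :: R4) + R4_of 0 u) has_derivative
   (%h. ((u \<bullet> h) / sqrt (1 + u \<bullet> u)) *\<^sub>R (axis 1 1 :: R4) + R4_of 0 h)) (at u)"
  by (rule has_derivative_add[OF has_derivative_scaleR_left[OF d2] bounded_linear_imp_has_derivative[OF bounded_linear_R4_of]])
 then show ?thesis
  unfolding graph_chart_def[abs_def] by (simp flip: R4_of_eq)
qed

lemma vol_H3_eq:
 "vol_H3 = distr (density lborel (%u. ennreal (1 / sqrt (1 + u \<bullet> u)))) (restrict_space borel H3) (graph_chart 1)"
proof (rule measure_eqI)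
 show "sets vol_H3 = sets (distr (density lborel (%u. ennreal (1 / sqrt (1 + u \<bullet> u)))) (restrict_space borel H3) (graph_chart 1))"
  by (simp add: H3.sets_volume)
 have c: "continuous_on UNIV (graph_chart 1)"
  by (rule Cinf_on_continuous) (use graph_chart_H3 in \<open>simp add: parametrization_def\<close>)
 have mb: "graph_chart 1 \<in> borel \<rightarrow>\<^sub>M borel" using borel_measurable_continuous_onI[OF c] .
 have gH: "graph_chart 1 u \<in> H3" for u using graph_chart_H3 by (auto simp: parametrization_def)
 have m: "graph_chart 1 \<in> density lborel (%u. ennreal (1 / sqrt (1 + u \<bullet> u))) \<rightarrow>\<^sub>M restrict_space borel H3"
  by (rule measurable_restrict_space2) (use mb gH in auto)
 fix A assume "A \<in> sets vol_H3"
 then have A: "A \<in> sets (restrict_space borel H3)" by (simp add: H3.sets_volume)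
 have A': "A \<in> sets borel" "A \<subseteq> H3" using A by (auto simp: sets_restrict_space_iff)
 have AU: "A \<subseteq> range (graph_chart 1)" using A' graph_chart_H3_spatial by (metis rangeI subset_iff)
 have dens: "H3.chart_density (graph_chart 1) u = 1 / sqrt (1 + u \<bullet> u)" for u
 proof -
  define s where "s = sqrt (1 + u \<bullet> u)"
  have "1 + u \<bullet> u > 0" by (simp add: add_pos_nonneg)
  then have s: "s > 0" "s * s = 1 + u \<bullet> u" by (simp_all add: s_def)
  have uax: "u \<bullet> axis 1 1 = u$1" "u \<bullet> axis 2 1 = u$2" "u \<bullet> axis 3 1 = u$3" by (simp_all add: inner_axis)
  have ax: "(axis 1 1 :: real^3) $ 1 = 1" "(axis 1 1 :: real^3) $ 2 = 0" "(axis 1 1 :: real^3) $ 3 = 0"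
   "(axis 2 1 :: real^3) $ 1 = 0" "(axis 2 1 :: real^3) $ 2 = 1" "(axis 2 1 :: real^3) $ 3 = 0"
   "(axis 3 1 :: real^3) $ 1 = 0" "(axis 3 1 :: real^3) $ 2 = 0" "(axis 3 1 :: real^3) $ 3 = 1"
   by (simp_all add: axis_def)
  have "det4 (R4_of s u) (R4_of (u$1 / s) (axis 1 1)) (R4_of (u$2 / s) (axis 2 1)) (R4_of (u$3 / s) (axis 3 1))
    = s - (u$1 * u$1 + u$2 * u$2 + u$3 * u$3) / s"
   unfolding det_4 vector_4_nth R4_of_nth ax by (simp add: add_divide_distrib)
  also have "\<dots> = 1 / s"
   using s by (simp add: field_simps inner_R3)
  finally show ?thesis
   unfolding H3.chart_density_def frechet_derivative_at[OF graph_chart_H3_has_derivative, symmetric] Let_def uax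
   using s(1) by (simp add: graph_chart_def s_def)
 qed
 have "emeasure vol_H3 A = (\<integral>\<^sup>+u. ennreal (1 / sqrt (1 + u \<bullet> u)) * indicator (graph_chart 1 -` A) u \<partial>lborel)"
  unfolding H3.emeasure_volume_chart[OF graph_chart_H3 A AU]
  by (rule nn_integral_cong) (simp add: H3.sqrt_det_metric[OF graph_chart_H3] dens indicator_def)
 also have "\<dots> = emeasure (distr (density lborel (%u. ennreal (1 / sqrt (1 + u \<bullet> u)))) (restrict_space borel H3) (graph_chart 1)) A"
  using measurable_sets[OF mb A'(1)] by (subst emeasure_distr[OF m A], subst emeasure_density) auto
 finally show "emeasure vol_H3 A = emeasure (distr (density lborel (%u. ennreal (1 / sqrt (1 + u \<bullet> u)))) (restrict_space borel H3) (graph_chart 1)) A" .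
qed

section \<open>Gradients\<close>

context space_form
begin

text \<open>
 Every tangent vector is the velocity of the radial projection to \<open>M\<close> of a straight line; such curves determine
 derivatives within \<open>M\<close> on tangent vectors.
\<close>

lemma tangent_curve:
 assumes y: "y \<in> M" and h: "B y h = 0"
 shows "\<exists>\<gamma>. \<gamma> 0 = y \<and> (\<gamma> has_vector_derivative h) (at 0) \<and> (\<forall>t::real. \<gamma> t \<in> M)"
proof -
 define b where "b = \<sigma> * B h h"
 define \<rho> where "\<rho> t = 1 / sqrt (1 + b * t^2)" for t
 define \<gamma> where "\<gamma> t = (if 1 + b * t^2 > 0 then \<rho> t *\<^sub>R (y + t *\<^sub>R h) else y)" for t
 have hy: "B h y = 0" using h comm by metis
 have "\<gamma> t \<in> M" for t
 proof (cases "1 + b * t^2 > 0")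
  case True
  have "B (y + t *\<^sub>R h) (y + t *\<^sub>R h) = \<sigma> * (1 + b * t^2)"
   by (simp add: level[OF y] h hy b_def power2_eq_square algebra_simps)
  moreover have "\<rho> t * \<rho> t * (1 + b * t^2) = 1" using True by (simp add: \<rho>_def)
  ultimately have "B (\<rho> t *\<^sub>R (y + t *\<^sub>R h)) (\<rho> t *\<^sub>R (y + t *\<^sub>R h)) = \<sigma>"
   by (metis B.scaleR_left B.scaleR_right mult.assoc mult.commute mult.right_neutral real_scaleR_def)
  moreover have "B y (\<rho> t *\<^sub>R (y + t *\<^sub>R h)) = \<rho> t * \<sigma>" by (simp add: level[OF y] h)
  moreover have "\<rho> t > 0" using True by (simp add: \<rho>_def)
  ultimately show ?thesis
   using component[OF y, of "\<rho> t *\<^sub>R (y + t *\<^sub>R h)"] sigma True by (auto simp: \<gamma>_def)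
 qed (simp add: \<gamma>_def y)
 moreover have "\<gamma> 0 = y" by (simp add: \<gamma>_def \<rho>_def)
 moreover have "(\<gamma> has_vector_derivative h) (at 0)"
 proof -
  have d\<rho>: "(\<rho> has_real_derivative 0) (at 0)"
   unfolding \<rho>_def by (auto intro!: derivative_eq_intros)
  have "((%t. \<rho> t *\<^sub>R (y + t *\<^sub>R h)) has_vector_derivative (\<rho> 0 *\<^sub>R (0 + 1 *\<^sub>R h) + 0 *\<^sub>R (y + 0 *\<^sub>R h))) (at 0)"
   by (rule has_vector_derivative_scaleR[OF d\<rho>]) (auto intro!: derivative_eq_intros)
  then have "((%t. \<rho> t *\<^sub>R (y + t *\<^sub>R h)) has_vector_derivative h) (at 0)" by (simp add: \<rho>_def)
  then show ?thesis
  proof (rule has_vector_derivative_transform_within_open)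
   show "open {t. 1 + b * t^2 > 0}" by (intro open_Collect_less continuous_intros)
  qed (auto simp: \<gamma>_def)
 qed
 ultimately show ?thesis by blast
qed

lemma derivative_within_unique:
 assumes y: "y \<in> M" and h: "B y h = 0"
  and D: "(f has_derivative D) (at y within M)" and D': "(f has_derivative D') (at y within M)"
 shows "D h = D' h"
proof -
 obtain \<gamma> where \<gamma>: "\<gamma> 0 = y" "(\<gamma> has_vector_derivative h) (at 0)" "!!t::real. \<gamma> t \<in> M"
  using tangent_curve[OF y h] by blast
 have *: "((%t. f (\<gamma> t)) has_derivative (%t. E (t *\<^sub>R h))) (at 0)" if "(f has_derivative E) (at y within M)" for E
 proof (rule has_derivative_in_compose[OF \<gamma>(2)[unfolded has_vector_derivative_def], of f E])
  show "(f has_derivative E) (at (\<gamma> 0) within range \<gamma>)"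
   unfolding \<gamma>(1) by (rule has_derivative_subset[OF that]) (use \<gamma>(3) in auto)
 qed
 have "(%t. D (t *\<^sub>R h)) = (%t. D' (t *\<^sub>R h))"
  by (rule has_derivative_unique[OF *[OF D] *[OF D']])
 from fun_cong[OF this, of 1] show ?thesis by simp
qed

text \<open>
 On \<open>M\<close> the function \<open>z \<mapsto> B y z\<close> is \<open>\<sigma> - B (z - y) (z - y) / 2\<close>, hence stationary at \<open>y\<close>; so a
 derivative within \<open>M\<close> at \<open>y\<close> may be changed by multiples of \<open>B y\<close>.
\<close>

lemma grad_eqI:
 assumes y: "y \<in> M" and g: "B y g = 0" and F: "(F has_derivative D) (at y within M)"
  and eq: "!!h. B y h = 0 ==> B g h = D h"
 shows "grad B M F y = g"
 unfolding grad_def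
proof (rule the_or_zero_eqI)
 have "((%z. \<sigma> - (1/2) * B (z - y) (z - y)) has_derivative (%h. 0)) (at y within M)"
  by (auto intro!: derivative_eq_intros B.FDERIV)
 then have d0: "((%z. B y z) has_derivative (%h. 0)) (at y within M)"
 proof (rule has_derivative_transform[OF y, rotated])
  fix z assume z: "z \<in> M"
  have eq: "B (z - y) (z - y) = 2 * \<sigma> - 2 * B y z"
   using level[OF z] level[OF y] comm[of z y] by simp
  show "B y z = \<sigma> - (1/2) * B (z - y) (z - y)" unfolding eq by (simp add: algebra_simps)
 qed
 have d1: "((%z. B y z) has_derivative B y) (at y within M)"
  by (rule bounded_linear_imp_has_derivative[OF B.bounded_linear_right])
 define c where "c = \<sigma> * D y"
 have lin: "linear D" using F by (simp add: has_derivative_def bounded_linear.linear)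
 have "D h - c * B y h = B g h" for h
 proof -
  define k where "k = h - (\<sigma> * B y h) *\<^sub>R y"
  have "B y k = 0" by (simp add: k_def level[OF y] algebra_simps)
  from eq[OF this] have "B g k = D k" .
  moreover have "B g k = B g h" using g comm[of g y] by (simp add: k_def)
  moreover have "D k = D h - c * B y h"
   unfolding k_def c_def by (simp add: linear_diff[OF lin] linear_scale[OF lin] mult_ac)
  ultimately show ?thesis by simp
 qed
 then have Bg: "B g = (%h. D h - c * B y h)" by auto
 have "((%z. F z - c * B y z + c * B y z) has_derivative (%h. D h - c * B y h + c * 0)) (at y within M)"
  by (intro has_derivative_add has_derivative_diff has_derivative_mult_right F d0 d1)
 then have "(F has_derivative B g) (at y within M)" unfolding Bg by simp
 then show "g \<in> tangent B y \<and> (F has_derivative B g) (at y within M)"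
  using g by (simp add: tangent_def)
 fix g' assume g': "g' \<in> tangent B y \<and> (F has_derivative B g') (at y within M)"
 have t: "B y (g' - g) = 0" using g g' by (simp add: tangent_def)
 have "B g' (g' - g) = D (g' - g)" using derivative_within_unique[OF y t _ F] g' by blast
 then have "B (g' - g) (g' - g) = 0" using eq[OF t] by simp
 then show "g' = g" using tangent_definite[OF y t] by simp
qed

lemma grad_eq_0I: "\<not> continuous (at y within M) F ==> grad B M F y = 0"
 unfolding grad_def the_or_zero_def using has_derivative_continuous by (metis (mono_tags, lifting))

lemma not_continuous_withinI:
 assumes l: "(l \<longlongrightarrow> y) G" and G: "G ~= bot" and M: "!!t. l t \<in> M"
  and e: "e > 0" and far: "eventually (%t. \<bar>F (l t) - F y\<bar> \<ge> e) G"
 shows "\<not> continuous (at y within M) (F :: R4 => real)"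
proof
 assume "continuous (at y within M) F"
 then have "((%t. F (l t)) \<longlongrightarrow> F y) G"
  by (rule continuous_within_tendsto_compose) (use M l in auto)
 then have "eventually (%t. dist (F (l t)) (F y) < e) G" using e by (rule tendstoD)
 with far have "eventually (%t. False) G" by eventually_elim (simp add: dist_real_def)
 then show False using G by simp
qed

end

lemma grad_S3_inner:
 assumes y: "y \<in> S3" and F: "(F has_derivative D) (at y within S3)" and h: "y \<bullet> h = 0"
 shows "grad_S3 F y \<bullet> h = D h"
proof -
 define w where "w = (\<Sum>b\<in>Basis. D b *\<^sub>R b)"
 have lin: "linear D" using F by (simp add: has_derivative_def bounded_linear.linear)
 have w: "w \<bullet> k = D k" for k
 proof -
  have "D k = D (\<Sum>b\<in>Basis. (k \<bullet> b) *\<^sub>R b)" by (simp add: euclidean_representation)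
  also have "\<dots> = w \<bullet> k"
   unfolding linear_sum[OF lin] linear_scale[OF lin] w_def inner_sum_left
   by (rule sum.cong) (simp_all add: inner_commute)
  finally show ?thesis by simp
 qed
 define g where "g = w - (w \<bullet> y) *\<^sub>R y"
 have "grad_S3 F y = g"
 proof (rule S3.grad_eqI[OF y _ F])
  show "y \<bullet> g = 0" using y by (simp add: g_def inner_diff_right S3_iff_inner inner_commute)
  show "g \<bullet> h = D h" if "y \<bullet> h = 0" for h using that by (simp add: g_def inner_diff_left w)
 qed
 then show ?thesis using h by (simp add: g_def inner_diff_left w)
qed

section \<open>The kernels on the three-sphere\<close>

text \<open>
 Radial kernels are written as functions of \<open>c = cos \<alpha> = x \<cdot> y\<close>. Division by 0 makes those with a
 denominator vanish at \<open>c = 1\<close> and \<open>c = - 1\<close>.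
\<close>

text \<open>The distance to the antipodal point, \<open>\<pi> - \<alpha>\<close>, and \<open>sin \<alpha>\<close>, as functions of \<open>c\<close>.\<close>

definition coangle :: "real => real" where "coangle c = pi - arccos c"
definition sn :: "real => real" where "sn c = sqrt (1 - c^2)"

text \<open>
 \<open>green0\<close> is \<open>\<phi>\<^sub>0\<close> and \<open>green1\<close> is \<open>\<phi>\<^sub>1\<close>: indeed \<open>\<alpha> (2 \<pi> - \<alpha>) = \<pi>^2 - (\<pi> - \<alpha>)^2\<close>. Primes denote
 derivatives with respect to \<open>c\<close>. The form of \<open>green0''\<close> is the differential equation solved for it.
\<close>

definition green0 :: "real => real" where
 "green0 c = - (1 / (4 * pi^2)) * (coangle c * c / sn c)"
definition green0' :: "real => real" where
 "green0' c = - (1 / (4 * pi^2)) * ((c * sn c + coangle c) / (sn c)^3)"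
definition green0'' :: "real => real" where
 "green0'' c = (3 * c * green0' c - 1 / (2 * pi^2)) / (1 - c^2)"
definition green1 :: "real => real" where
 "green1 c = - (1 / (16 * pi^2)) * (pi^2 - (coangle c)^2)"
definition green1' :: "real => real" where
 "green1' c = 1 / (8 * pi^2) * (coangle c / sn c)"
definition green1'' :: "real => real" where
 "green1'' c = 1 / (8 * pi^2) * ((sn c + coangle c * c) / (sn c)^3)"

lemma sn_pos: "\<bar>c\<bar> < 1 ==> sn c > 0" "\<bar>c\<bar> < 1 ==> sn c * sn c = 1 - c^2"
proof -
 assume "\<bar>c\<bar> < 1"
 then have "c^2 < 1" using abs_square_less_1 by blast
 then show "sn c > 0" "sn c * sn c = 1 - c^2" by (simp_all add: sn_def)
qed

lemma sn_end [simp]: "sn 1 = 0" "sn (- 1) = 0"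
 by (simp_all add: sn_def)

lemma coangle_end [simp]: "coangle (- 1) = 0" "coangle 1 = pi"
 by (simp_all add: coangle_def)

lemma coangle_nonneg: "\<bar>c\<bar> <= 1 ==> 0 <= coangle c \<and> coangle c <= pi"
 using arccos_bounded[of c] by (auto simp: coangle_def abs_le_iff)

lemma DERIV_coangle: "\<bar>c\<bar> < 1 ==> (coangle has_real_derivative 1 / sn c) (at c)"
 unfolding coangle_def[abs_def] sn_def
 by (auto intro!: derivative_eq_intros simp: abs_less_iff divide_inverse)

lemma DERIV_sn: "\<bar>c\<bar> < 1 ==> (sn has_real_derivative - c / sn c) (at c)"
proof -
 assume "\<bar>c\<bar> < 1"
 then have "c^2 < 1" using abs_square_less_1 by blast
 then show ?thesis
  unfolding sn_def[abs_def] by (auto intro!: derivative_eq_intros simp: field_simps)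
qed

lemma continuous_on_coangle: "continuous_on {- 1..1} coangle"
 unfolding coangle_def[abs_def] by (intro continuous_intros continuous_on_arccos') auto

lemma continuous_on_sn: "continuous_on S sn"
 unfolding sn_def[abs_def] by (intro continuous_intros)

lemma DERIV_green0: "\<bar>c\<bar> < 1 ==> (green0 has_real_derivative green0' c) (at c)"
proof -
 assume c: "\<bar>c\<bar> < 1"
 have s: "sn c ~= 0" "sn c * sn c = 1 - c^2" using sn_pos[OF c] by auto
 have "((coangle c * 1 + 1 / sn c * c) * sn c - coangle c * c * (- c / sn c)) / (sn c * sn c) = (c * sn c + coangle c) / (sn c)^3"
  using s by (simp add: divide_simps) algebra
 from DERIV_cong[OF DERIV_divide[OF DERIV_mult'[OF DERIV_coangle[OF c] DERIV_ident] DERIV_sn[OF c] s(1)] this]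
 show ?thesis unfolding green0_def[abs_def] green0'_def by (rule DERIV_cmult)
qed

lemma DERIV_green0': "\<bar>c\<bar> < 1 ==> (green0' has_real_derivative green0'' c) (at c)"
proof -
 assume c: "\<bar>c\<bar> < 1"
 define s where "s = sn c"
 have s: "s ~= 0" "s * s = 1 - c^2" using sn_pos[OF c] by (auto simp: s_def)
 have d3: "((%c. (sn c)^3) has_real_derivative - 3 * c * s) (at c)"
  using DERIV_power[OF DERIV_sn[OF c], of 3] s(1) by (simp add: s_def power2_eq_square mult.assoc)
 have "((c * (- c / s) + 1 * s + 1 / s) * s^3 - (c * s + coangle c) * (- 3 * c * s)) / (s^3 * s^3)
   = (2 + 3 * c * ((c * s + coangle c) / s^3)) / (1 - c^2)"
  unfolding s(2)[symmetric] using s by (simp add: divide_simps) algebra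
 moreover have "- (1 / (4 * pi^2)) * ((2 + 3 * c * ((c * s + coangle c) / s^3)) / (1 - c^2)) = green0'' c"
  unfolding green0''_def green0'_def s_def[symmetric] times_divide_eq_right[of _ _ "1 - c^2"]
  by (rule arg_cong[where f = "%t. t / (1 - c^2)"]) (simp add: field_simps)
 ultimately have eq: "- (1 / (4 * pi^2)) * (((c * (- c / s) + 1 * s + 1 / s) * s^3 - (c * s + coangle c) * (- 3 * c * s)) / (s^3 * s^3)) = green0'' c"
  by simp
 have ne: "(sn c)^3 ~= 0" using s(1) by (simp add: s_def)
 show ?thesis
  unfolding green0'_def[abs_def] eq[symmetric] unfolding s_def
  by (rule DERIV_cmult[OF DERIV_divide[OF DERIV_add[OF DERIV_mult'[OF DERIV_ident DERIV_sn[OF c]] DERIV_coangle[OF c]] d3[unfolded s_def] ne]])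
qed

lemma DERIV_green1: "\<bar>c\<bar> < 1 ==> (green1 has_real_derivative green1' c) (at c)"
proof -
 assume c: "\<bar>c\<bar> < 1"
 have "((%c. pi^2 - (coangle c)^2) has_real_derivative - (2 * coangle c / sn c)) (at c)"
  using DERIV_diff[OF DERIV_const DERIV_power[OF DERIV_coangle[OF c], of 2], of "pi^2"] by simp
 from DERIV_cmult[OF this, of "- (1 / (16 * pi^2))"]
 show ?thesis unfolding green1_def[abs_def] green1'_def by simp
qed

lemma DERIV_green1': "\<bar>c\<bar> < 1 ==> (green1' has_real_derivative green1'' c) (at c)"
proof -
 assume c: "\<bar>c\<bar> < 1"
 have s: "sn c ~= 0" using sn_pos[OF c] by auto
 have "((1 / sn c) * sn c - coangle c * (- c / sn c)) / (sn c * sn c) = (sn c + coangle c * c) / (sn c)^3"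
  using s by (simp add: divide_simps) algebra
 from DERIV_cong[OF DERIV_divide[OF DERIV_coangle[OF c] DERIV_sn[OF c] s] this]
 show ?thesis unfolding green1'_def[abs_def] green1''_def by (rule DERIV_cmult)
qed

text \<open>The Laplacian of a function \<open>f (x \<cdot> y)\<close> of \<open>x\<close> on the sphere is \<open>(1 - c^2) f'' - 3 c f'\<close>.\<close>

lemma green0_laplace: "\<bar>c\<bar> < 1 ==> (1 - c^2) * green0'' c - 3 * c * green0' c = - 1 / (2 * pi^2)"
proof -
 assume "\<bar>c\<bar> < 1"
 then have "1 - c^2 ~= 0" using abs_square_less_1[of c] by auto
 then show ?thesis by (simp add: green0''_def)
qed

lemma green1_laplace:
 assumes c: "\<bar>c\<bar> < 1"
 shows "(1 - c^2) * green1'' c - 3 * c * green1' c = green0 c + 1 / (8 * pi^2)"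
 unfolding green1''_def green1'_def green0_def sn_pos(2)[OF c, symmetric]
 using sn_pos(1)[OF c] by (simp add: divide_simps) (simp add: algebra_simps power3_eq_cube)

lemma sn_le_coangle:
 assumes "\<bar>c\<bar> < 1" shows "sn c <= coangle c"
proof -
 have "sn c = sin (coangle c)" using assms by (simp add: coangle_def sn_def sin_arccos abs_less_iff)
 also have "\<dots> <= coangle c" using coangle_nonneg[of c] assms by (intro sin_x_le_x) auto
 finally show ?thesis .
qed

lemma coangle_le_sn:
 assumes "- 1 <= c" "c < 1" shows "- c * coangle c <= sn c"
proof -
 define h where "h c = sn c + c * coangle c" for c
 have "h (- 1) <= h c"
 proof (rule DERIV_nonneg_imp_increasing_open[OF assms(1)])
  fix t assume t: "- 1 < t" "t < c"
  then have t1: "\<bar>t\<bar> < 1" using assms by auto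
  have "(h has_real_derivative coangle t) (at t)"
   unfolding h_def[abs_def] using sn_pos(1)[OF t1]
   by (auto intro!: derivative_eq_intros DERIV_coangle DERIV_sn t1)
  then show "\<exists>y. (h has_real_derivative y) (at t) \<and> 0 <= y"
   using coangle_nonneg[of t] t1 by auto
 next
  show "continuous_on {- 1..c} h"
   unfolding h_def[abs_def]
   by (intro continuous_intros continuous_on_sn continuous_on_subset[OF continuous_on_coangle]) (use assms in auto)
 qed
 then show ?thesis by (simp add: h_def)
qed

lemma green1'_ge: "\<bar>c\<bar> < 1 ==> green1' c \<ge> 1 / (8 * pi^2)"
 using sn_le_coangle[of c] sn_pos(1)[of c] by (simp add: green1'_def field_simps)

lemma green1'_le:
 assumes "- 1 < c" "c < 0" shows "green1' c <= 1 / (8 * pi^2) * (1 / (- c))"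
proof -
 have "\<bar>c\<bar> < 1" using assms by auto
 then have "coangle c / sn c <= 1 / (- c)"
  using coangle_le_sn[of c] sn_pos(1)[of c] assms by (simp add: field_simps)
 then show ?thesis unfolding green1'_def by (intro mult_left_mono) auto
qed

subsection \<open>Gradients of radial functions\<close>

lemma grad_S3_radial:
 assumes y: "y \<in> S3" and c: "\<bar>x \<bullet> y\<bar> < 1"
  and F: "!!z. z \<in> S3 ==> F z = f (x \<bullet> z)" and f: "(f has_real_derivative f' (x \<bullet> y)) (at (x \<bullet> y))"
 shows "grad_S3 F y = f' (x \<bullet> y) *\<^sub>R (x - (x \<bullet> y) *\<^sub>R y)"
proof (rule S3.grad_eqI[OF y])
 show "y \<bullet> (f' (x \<bullet> y) *\<^sub>R (x - (x \<bullet> y) *\<^sub>R y)) = 0"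
  using y by (simp add: inner_diff_right S3_iff_inner inner_commute)
 have "((%z. x \<bullet> z) has_derivative (%h. x \<bullet> h)) (at y within S3)"
  by (rule bounded_linear_imp_has_derivative[OF bounded_linear_inner_right])
 from has_derivative_compose[OF this f[unfolded has_field_derivative_def]]
 have "((%z. f (x \<bullet> z)) has_derivative (%h. f' (x \<bullet> y) * (x \<bullet> h))) (at y within S3)" .
 then show "(F has_derivative (%h. f' (x \<bullet> y) * (x \<bullet> h))) (at y within S3)"
  by (rule has_derivative_transform[OF y F, rotated])
 show "f' (x \<bullet> y) *\<^sub>R (x - (x \<bullet> y) *\<^sub>R y) \<bullet> h = f' (x \<bullet> y) * (x \<bullet> h)" if "y \<bullet> h = 0" for h
  using that by (simp add: inner_diff_left)
qed

lemma great_circle: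
 assumes y: "y \<in> S3" and e: "e \<in> S3" "y \<bullet> e = 0"
 shows "cos t *\<^sub>R y + sin t *\<^sub>R e \<in> S3" (is ?g1) "((%t. cos t *\<^sub>R y + sin t *\<^sub>R e) \<longlongrightarrow> y) (at_right 0)" (is ?g2)
proof -
 have "e \<bullet> y = 0" using e by (simp add: inner_commute)
 then have "(cos t *\<^sub>R y + sin t *\<^sub>R e) \<bullet> (cos t *\<^sub>R y + sin t *\<^sub>R e) = (cos t)^2 + (sin t)^2"
  using y e by (simp add: inner_add S3_iff_inner power2_eq_square)
 then show ?g1 by (simp add: S3_iff_inner)
 have "((%t. cos t *\<^sub>R y + sin t *\<^sub>R e) \<longlongrightarrow> cos 0 *\<^sub>R y + sin 0 *\<^sub>R e) (at_right 0)"
  by (intro tendsto_intros)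
 then show ?g2 by simp
qed

text \<open>
 At \<open>x\<close> and \<open>- x\<close> the kernels jump, since division by 0 gives 0 there while nearby values stay away
 from it. So the gradient takes its default value.
\<close>

lemma radial_grad_S3_pole:
 assumes x: "x \<in> S3" and y: "y = x \<or> y = - x" and e: "e > 0" and d: "d < 1"
  and F: "!!z. z \<in> S3 ==> d < (x \<bullet> y) * (x \<bullet> z) ==> (x \<bullet> y) * (x \<bullet> z) < 1 ==> \<bar>F z - F y\<bar> \<ge> e"
 shows "grad_S3 F y = 0"
proof (rule S3.grad_eq_0I)
 have yS: "y \<in> S3" using x y by (auto simp: S3_def)
 define s where "s = x \<bullet> y"
 have s: "s * s = 1" "y = s *\<^sub>R x" using x y by (auto simp: s_def S3_iff_inner)
 have q: "qmult y qi \<in> S3" "y \<bullet> qmult y qi = 0"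
  using qmult_in_S3[OF yS qunit_in_S3(2)] by (simp_all add: qcoords)
 have xq: "x \<bullet> qmult y qi = 0" using y by (auto simp: qcoords)
 note gc = great_circle[OF yS q]
 show "\<not> continuous (at y within S3) F"
 proof (rule S3.not_continuous_withinI[OF gc(2) _ gc(1) e])
  have "(cos \<longlongrightarrow> cos (0::real)) (at_right 0)" by (intro tendsto_intros)
  then have "eventually (%t::real. d < cos t) (at_right 0)"
   using d by (intro order_tendstoD) auto
  moreover have "eventually (%t::real. t \<in> {0<..<1}) (at_right 0)"
   by (rule eventually_at_right_real) simp
  ultimately show "eventually (%t. \<bar>F (cos t *\<^sub>R y + sin t *\<^sub>R qmult y qi) - F y\<bar> \<ge> e) (at_right 0)"
  proof eventually_elim
   case (elim t)
   have "(x \<bullet> y) * (x \<bullet> (cos t *\<^sub>R y + sin t *\<^sub>R qmult y qi)) = cos t"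
    using s(1) xq by (simp add: inner_add_right s_def)
   moreover have "cos t < 1" using elim cos_monotone_0_pi[of 0 t] pi_gt3 by simp
   ultimately show ?case using elim by (intro F gc(1)) auto
  qed
 qed simp
qed

lemma S3_inner_cases:
 assumes "x \<in> S3" "y \<in> S3"
 obtains "\<bar>x \<bullet> y\<bar> < 1" | "y = x" "x \<bullet> y = 1" | "y = - x" "x \<bullet> y = - 1"
 using S3_inner_bounds[OF assms] S3_inner_eq_1[OF assms] S3_inner_eq_m1[OF assms]
 by (metis abs_less_iff less_eq_real_def minus_less_iff neg_equal_iff_equal verit_minus_simplify(4))

lemma phi_cot_eq:
 assumes "x \<in> S3" "z \<in> S3"
 shows "(pi - dist_S3 x z) * cot (dist_S3 x z) = coangle (x \<bullet> z) * (x \<bullet> z) / sn (x \<bullet> z)"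
 using S3_inner_bounds[OF assms]
 by (simp add: dist_S3_eq assms coangle_def sn_def cot_def sin_arccos)

lemma phi_csc_eq:
 assumes "x \<in> S3" "z \<in> S3"
 shows "(pi - dist_S3 x z) * (1 / sin (dist_S3 x z)) = coangle (x \<bullet> z) / sn (x \<bullet> z)"
 using S3_inner_bounds[OF assms]
 by (simp add: dist_S3_eq assms coangle_def sn_def sin_arccos)

lemma phi_1_eq:
 assumes "x \<in> S3" "z \<in> S3"
 shows "- (1 / (16 * pi^2)) * dist_S3 x z * (2 * pi - dist_S3 x z) = green1 (x \<bullet> z)"
 unfolding green1_def coangle_def dist_S3_eq[OF assms] mult.assoc
 by (rule arg_cong[where f = "%t. - (1 / (16 * pi^2)) * t"]) (simp add: power2_eq_square algebra_simps)

lemma left_transport_eq: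
 assumes "x \<in> S3"
 shows "left_transport y x u = qmult y (qmult (qconj x) u)"
proof -
 have "qinv x = qconj x" using assms by (simp add: qinv_def qconj_def S3_def)
 then have "left_transport y x = qmult (qmult y (qconj x))"
  unfolding left_transport_def
  by (metis bounded_linear_imp_has_derivative frechet_derivative_at qmult.bounded_linear_right)
 then show ?thesis by (simp add: qmult_assoc)
qed

section \<open>The integrands on the three-sphere\<close>

text \<open>
 Off the poles, the gradient of a radial function points along the projection of \<open>x\<close>, and the triple product
 is a determinant in which \<open>x\<close> may replace this projection. At the poles both sides vanish.
\<close>

lemma integrand_left_1:
 assumes x: "x \<in> S3" and y: "y \<in> S3" and ux: "x \<bullet> v x = 0"
 shows "cross_S3 y (left_transport y x (v x)) (v y)
      \<bullet> grad_S3 (%z. 1 / (4 * pi^2) * (pi - dist_S3 x z) * cot (dist_S3 x z)) y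
   = - green0' (x \<bullet> y) * det4 y (qmult y (qmult (qconj x) (v x))) (v y) x"
proof -
 let ?F = "%z. 1 / (4 * pi^2) * (pi - dist_S3 x z) * cot (dist_S3 x z)"
 have F: "?F z = - green0 (x \<bullet> z)" if "z \<in> S3" for z
  unfolding green0_def mult.assoc phi_cot_eq[OF x that] by simp
 show ?thesis
 proof (cases rule: S3_inner_cases[OF x y])
  case 1
  have "grad_S3 ?F y = (- green0' (x \<bullet> y)) *\<^sub>R (x - (x \<bullet> y) *\<^sub>R y)"
   by (rule grad_S3_radial[where F = ?F and f = "%c. - green0 c" and f' = "%c. - green0' c", OF y 1 F])
     (auto intro!: derivative_eq_intros DERIV_green0 1)
  then show ?thesis
   by (simp add: left_transport_eq[OF x] inner_diff_right cross_S3_inner det_repeated)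
 next
  case 2
  have "left_transport y x (v x) = v y" using 2 by (simp add: left_transport_eq[OF x] qconj_cancel x)
  moreover have "qmult y (qmult (qconj x) (v x)) = v y" using 2 by (simp add: qconj_cancel x)
  ultimately show ?thesis by (simp add: cross_S3_inner det_repeated)
 next
  case 3
  have "grad_S3 ?F y = 0"
  proof (rule radial_grad_S3_pole[OF x, of y "1 / (8 * pi^2)" "1 / 2"])
   fix z assume z: "z \<in> S3" "1 / 2 < (x \<bullet> y) * (x \<bullet> z)" "(x \<bullet> y) * (x \<bullet> z) < 1"
   then have c: "x \<bullet> z < - 1 / 2" "\<bar>x \<bullet> z\<bar> < 1" using 3 by auto
   have "1 <= coangle (x \<bullet> z) / sn (x \<bullet> z)" using sn_le_coangle[OF c(2)] sn_pos(1)[OF c(2)] by simp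
   then have "1 * (1/2) <= (coangle (x \<bullet> z) / sn (x \<bullet> z)) * (- (x \<bullet> z))" using c by (intro mult_mono) auto
   then have "1 / (4 * pi^2) * (1/2) <= 1 / (4 * pi^2) * ((coangle (x \<bullet> z) / sn (x \<bullet> z)) * (- (x \<bullet> z)))"
    by (intro mult_left_mono) auto
   then have "green0 (x \<bullet> z) \<ge> 1 / (8 * pi^2)" by (simp add: green0_def)
   moreover have "?F y = 0" unfolding F[OF y] using 3 by (simp add: green0_def)
   ultimately show "1 / (8 * pi^2) <= \<bar>?F z - ?F y\<bar>" unfolding F[OF z(1)] by linarith
  qed (use 3 in auto)
  moreover have "green0' (x \<bullet> y) = 0" using 3 by (simp add: green0'_def)
  ultimately show ?thesis by simp
 qed
qed

lemma integrand_parallel: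
 assumes x: "x \<in> S3" and y: "y \<in> S3" and ux: "x \<bullet> v x = 0"
 shows "cross_S3 y (transport_S3 y x (v x)) (v y)
      \<bullet> grad_S3 (%z. 1 / (4 * pi^2) * (pi - dist_S3 x z) * (1 / sin (dist_S3 x z))) y
   = 2 * green1'' (x \<bullet> y) * det4 y (v x) (v y) x"
proof -
 let ?F = "%z. 1 / (4 * pi^2) * (pi - dist_S3 x z) * (1 / sin (dist_S3 x z))"
 have F: "?F z = 2 * green1' (x \<bullet> z)" if "z \<in> S3" for z
  unfolding green1'_def mult.assoc phi_csc_eq[OF x that] by simp
 have pole: "grad_S3 ?F y = 0" if "y = x \<or> y = - x"
 proof (rule radial_grad_S3_pole[OF x that, of "1 / (4 * pi^2)" 0])
  have c: "x \<bullet> y = 1 \<or> x \<bullet> y = - 1" using that x by (auto simp: S3_iff_inner)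
  fix z assume z: "z \<in> S3" "0 < (x \<bullet> y) * (x \<bullet> z)" "(x \<bullet> y) * (x \<bullet> z) < 1"
  then have "\<bar>x \<bullet> z\<bar> < 1" using c by auto
  from green1'_ge[OF this] have "1 / (4 * pi^2) <= ?F z" unfolding F[OF z(1)] by (simp add: field_simps)
  moreover have "?F y = 0" unfolding F[OF y] using c by (auto simp: green1'_def)
  ultimately show "1 / (4 * pi^2) <= \<bar>?F z - ?F y\<bar>" by linarith
 qed auto
 show ?thesis
 proof (cases rule: S3_inner_cases[OF x y])
  case 1
  have "grad_S3 ?F y = (2 * green1'' (x \<bullet> y)) *\<^sub>R (x - (x \<bullet> y) *\<^sub>R y)"
   by (rule grad_S3_radial[where F = ?F and f = "%c. 2 * green1' c" and f' = "%c. 2 * green1'' c", OF y 1 F])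
     (auto intro!: derivative_eq_intros DERIV_green1' 1)
  moreover have "det4 y (v x - k *\<^sub>R (x + y)) (v y) x = det4 y (v x) (v y) x" for k
   unfolding det_4 vector_4_nth by (simp add: algebra_simps)
  ultimately show ?thesis
   by (simp add: transport_S3_eq[OF x y ux 1] inner_diff_right cross_S3_inner det_repeated)
 next
  case 2
  then show ?thesis using pole by (simp add: green1''_def)
 next
  case 3
  then show ?thesis using pole by (simp add: green1''_def)
 qed
qed

lemma integrand_potential:
 assumes x: "x \<in> S3" and z: "z \<in> S3" and ux: "x \<bullet> v x = 0"
 shows "v x \<bullet> grad_S3 (%s. phi0_S3 (dist_S3 s z)) x = green0' (x \<bullet> z) * (v x \<bullet> z)"
proof -
 let ?F = "%s. phi0_S3 (dist_S3 s z)"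
 have F: "?F s = green0 (z \<bullet> s)" if "s \<in> S3" for s
  unfolding phi0_S3_def green0_def mult.assoc phi_cot_eq[OF that z] inner_commute[of z] ..
 show ?thesis
 proof (cases rule: S3_inner_cases[OF z x])
  case 1
  have "grad_S3 ?F x = green0' (z \<bullet> x) *\<^sub>R (z - (z \<bullet> x) *\<^sub>R x)"
   by (rule grad_S3_radial[where F = ?F and f = green0 and f' = green0', OF x 1 F DERIV_green0[OF 1]])
  then show ?thesis using ux by (simp add: inner_diff_right inner_commute)
 next
  case 2
  then have "v x \<bullet> grad_S3 ?F x = v x \<bullet> grad_S3 ?F z" by simp
  have "grad_S3 ?F x = 0"
  proof (rule radial_grad_S3_pole[OF z, of x "1 / (8 * pi^2)" "1 / 2"])
   fix s assume s: "s \<in> S3" "1 / 2 < (z \<bullet> x) * (z \<bullet> s)" "(z \<bullet> x) * (z \<bullet> s) < 1"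
   then have c: "1 / 2 < z \<bullet> s" "\<bar>z \<bullet> s\<bar> < 1" using 2 by auto
   have "1 <= coangle (z \<bullet> s) / sn (z \<bullet> s)" using sn_le_coangle[OF c(2)] sn_pos(1)[OF c(2)] by simp
   then have "1 * (1/2) <= (coangle (z \<bullet> s) / sn (z \<bullet> s)) * (z \<bullet> s)" using c by (intro mult_mono) auto
   then have "1 / (4 * pi^2) * (1/2) <= 1 / (4 * pi^2) * ((coangle (z \<bullet> s) / sn (z \<bullet> s)) * (z \<bullet> s))"
    by (intro mult_left_mono) auto
   then have "green0 (z \<bullet> s) <= - (1 / (8 * pi^2))" by (simp add: green0_def)
   moreover have "?F x = 0" unfolding F[OF x] using 2 by (simp add: green0_def)
   ultimately show "1 / (8 * pi^2) <= \<bar>?F s - ?F x\<bar>" unfolding F[OF s(1)] by linarith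
  qed (use 2 in auto)
  moreover have "x \<bullet> z = 1" using 2 x by (simp add: S3_iff_inner)
  ultimately show ?thesis by (simp add: green0'_def)
 next
  case 3
  have "v x \<bullet> z = 0" using 3 ux by (simp add: inner_commute)
  have "grad_S3 ?F x = 0"
  proof (rule radial_grad_S3_pole[OF z, of x "1 / (8 * pi^2)" "1 / 2"])
   fix s assume s: "s \<in> S3" "1 / 2 < (z \<bullet> x) * (z \<bullet> s)" "(z \<bullet> x) * (z \<bullet> s) < 1"
   then have c: "z \<bullet> s < - 1 / 2" "\<bar>z \<bullet> s\<bar> < 1" using 3 by auto
   have "1 <= coangle (z \<bullet> s) / sn (z \<bullet> s)" using sn_le_coangle[OF c(2)] sn_pos(1)[OF c(2)] by simp
   then have "1 * (1/2) <= (coangle (z \<bullet> s) / sn (z \<bullet> s)) * (- (z \<bullet> s))" using c by (intro mult_mono) auto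
   then have "1 / (4 * pi^2) * (1/2) <= 1 / (4 * pi^2) * ((coangle (z \<bullet> s) / sn (z \<bullet> s)) * (- (z \<bullet> s)))"
    by (intro mult_left_mono) auto
   then have "green0 (z \<bullet> s) \<ge> 1 / (8 * pi^2)" by (simp add: green0_def)
   moreover have "?F x = 0" unfolding F[OF x] using 3 by (simp add: green0_def)
   ultimately show "1 / (8 * pi^2) <= \<bar>?F s - ?F x\<bar>" unfolding F[OF s(1)] by linarith
  qed (use 3 in auto)
  then show ?thesis using \<open>v x \<bullet> z = 0\<close> by simp
 qed
qed

text \<open>
 The divergence-type integrand. At \<open>y = - x\<close> the factor \<open>green1'\<close> has the limit \<open>1 / (8 \<pi>^2)\<close>, and the other
 factor is linear and vanishes, so that only this limit matters. At \<open>y = x\<close> the function to be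
 differentiated jumps, unless \<open>v x = 0\<close>.
\<close>

definition integrand_left_3_explicit :: "(R4 => R4) => R4 => R4 => real" where
 "integrand_left_3_explicit v x y =
   green1'' (x \<bullet> y) * (x \<bullet> v y) * (qmult y (qmult (qconj x) (v x)) \<bullet> x)
   + (if x \<bullet> y = - 1 then 1 / (8 * pi^2) else green1' (x \<bullet> y)) * (qmult (v y) (qmult (qconj x) (v x)) \<bullet> x)"

lemma has_derivative_times_vanishing:
 fixes m :: "'a::real_normed_vector => real"
 assumes m: "bounded_linear m" "m y = 0" and k: "(k \<longlongrightarrow> k0) (at y within S)"
 shows "((%z. k z * m z) has_derivative (%h. k0 * m h)) (at y within S)"
proof (unfold has_derivative_within, intro conjI)
 show "bounded_linear (%h. k0 * m h)" by (rule bounded_linear_mult_right[THEN bounded_linear_compose, OF m(1)])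
 obtain C where C0: "C \<ge> 0" and C: "!!z. norm (m z) <= norm z * C"
  using bounded_linear.nonneg_bounded[OF m(1)] by blast
 have md: "m (z - y) = m z" for z using linear_diff[OF bounded_linear.linear[OF m(1)]] m(2) by simp
 have "((%z. \<bar>k z - k0\<bar> * C) \<longlongrightarrow> \<bar>k0 - k0\<bar> * C) (at y within S)"
  by (intro tendsto_intros k)
 then have lim: "((%z. \<bar>k z - k0\<bar> * C) \<longlongrightarrow> 0) (at y within S)" by simp
 show "((%z. (1 / norm (z - y)) *\<^sub>R (k z * m z - (k y * m y + k0 * m (z - y)))) \<longlongrightarrow> 0) (at y within S)"
 proof (rule Lim_null_comparison[OF always_eventually lim], rule allI)
  fix z
  show "norm ((1 / norm (z - y)) *\<^sub>R (k z * m z - (k y * m y + k0 * m (z - y)))) <= \<bar>k z - k0\<bar> * C"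
  proof (cases "z = y")
   case False
   have "k z * m z - (k y * m y + k0 * m (z - y)) = (k z - k0) * m (z - y)"
    by (simp add: m(2) md algebra_simps)
   moreover have "\<bar>m (z - y)\<bar> / norm (z - y) <= C"
    using C[of "z - y"] False by (simp add: field_simps)
   then have "\<bar>k z - k0\<bar> * (\<bar>m (z - y)\<bar> / norm (z - y)) <= \<bar>k z - k0\<bar> * C" by (intro mult_left_mono) auto
   ultimately show ?thesis by (simp add: abs_mult mult.commute)
  next
  qed (use C0 in simp)
 qed
qed

lemma inner_qmult_imaginary: "a$1 = 0 ==> qmult z a \<bullet> z = 0"
 by (simp add: qcoords algebra_simps)

text \<open>Near \<open>- x\<close> the function \<open>green1\<close> is a constant plus a multiple of \<open>(\<pi> - \<alpha>)^2\<close>, hence stationary.\<close>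

lemma grad_green1_antipode:
 assumes x: "x \<in> S3" and F: "!!s. s \<in> S3 ==> F s = green1 (x \<bullet> s)"
 shows "grad_S3 F (- x) = 0"
proof (rule S3.grad_eqI[where D = "%h. 0"])
 show y: "- x \<in> S3" using x by (simp add: S3_def)
 have Fy: "F (- x) = - (1 / 16)" using F[OF y] x by (simp add: green1_def S3_iff_inner)
 have bd: "\<bar>F s - F (- x)\<bar> <= (norm (s - - x))^2" if s: "s \<in> S3" "x \<bullet> s < - 1 / 2" for s
 proof -
  define c where "c = x \<bullet> s"
  have c: "- 1 <= c" "c < - 1 / 2" using S3_inner_bounds[OF x s(1)] s(2) by (auto simp: c_def)
  have n: "(norm (s - - x))^2 = 2 + 2 * c"
   unfolding power2_norm_eq_inner using x s(1) by (simp add: inner_add S3_iff_inner c_def inner_commute)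
  have "(1/2) * coangle c <= (- c) * coangle c" using c coangle_nonneg[of c] by (intro mult_right_mono) auto
  also have "\<dots> <= sn c" using coangle_le_sn[of c] c by simp
  finally have "coangle c <= 2 * sn c" by simp
  then have "(coangle c)^2 <= (2 * sn c)^2" using coangle_nonneg[of c] c by (intro power_mono) auto
  also have "\<dots> = 4 * (1 - c^2)" using c by (simp add: sn_def power_mult_distrib abs_square_le_1 abs_le_iff)
  also have "\<dots> = 4 * ((1 - c) * (1 + c))" by (simp add: power2_eq_square algebra_simps)
  also have "\<dots> <= 4 * (2 * (1 + c))" using c by (intro mult_left_mono mult_right_mono) auto
  finally have a: "(coangle c)^2 <= 4 * (2 + 2 * c)" by simp
  have "F s - F (- x) = 1 / (16 * pi^2) * (coangle c)^2"
   unfolding Fy F[OF s(1)] green1_def c_def by (simp add: field_simps)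
  then have "\<bar>F s - F (- x)\<bar> = 1 / (16 * pi^2) * (coangle c)^2" by simp
  also have "1 / (16 * pi^2) * (coangle c)^2 <= 1 / 4 * (4 * (2 + 2 * c))"
  proof (intro mult_mono a)
   have "1 <= pi" using pi_gt3 by simp
   then have "1 <= pi^2" by simp
   then show "1 / (16 * pi^2) <= 1 / 4" by (simp add: field_simps)
  qed auto
  also have "1 / 4 * (4 * (2 + 2 * c)) = (norm (s - - x))^2" unfolding n by simp
  finally show ?thesis .
 qed
 show "(F has_derivative (%h. 0)) (at (- x) within S3)"
 proof (unfold has_derivative_within, intro conjI)
  show "bounded_linear (%h::R4. 0::real)" by simp
  have lim: "((%s. norm (s - - x)) \<longlongrightarrow> 0) (at (- x) within S3)"
   by (auto intro!: tendsto_eq_intros)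
  have "((%s. x \<bullet> s) \<longlongrightarrow> x \<bullet> (- x)) (at (- x) within S3)" by (intro tendsto_intros)
  then have "eventually (%s. x \<bullet> s < - 1 / 2) (at (- x) within S3)"
   using x by (intro order_tendstoD) (auto simp: S3_iff_inner)
  moreover have "eventually (%s. s \<in> S3 \<and> s ~= - x) (at (- x) within S3)"
   by (auto simp: eventually_at_filter)
  ultimately have "eventually (%s. norm ((1 / norm (s - - x)) *\<^sub>R (F s - (F (- x) + 0))) <= norm (s - - x)) (at (- x) within S3)"
  proof eventually_elim
   case (elim s)
   then have "norm (s - - x) > 0" by (simp add: add_eq_0_iff2)
   then show ?case using bd[of s] elim by (simp add: field_simps power2_eq_square)
  qed
  then show "((%s. (1 / norm (s - - x)) *\<^sub>R (F s - (F (- x) + 0))) \<longlongrightarrow> 0) (at (- x) within S3)"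
   by (rule Lim_null_comparison[OF _ lim])
 qed
qed auto

lemma green1'_antipode_limit:
 assumes x: "x \<in> S3"
 shows "((%z. green1' (x \<bullet> z)) \<longlongrightarrow> 1 / (8 * pi^2)) (at (- x) within S3)"
proof (rule tendsto_sandwich)
 have lim: "((%s. x \<bullet> s) \<longlongrightarrow> x \<bullet> (- x)) (at (- x) within S3)" by (intro tendsto_intros)
 then have "eventually (%s. x \<bullet> s < 0) (at (- x) within S3)"
  using x by (intro order_tendstoD) (auto simp: S3_iff_inner)
 moreover have "eventually (%s. s \<in> S3 \<and> s ~= - x) (at (- x) within S3)"
  by (auto simp: eventually_at_filter)
 ultimately have ev: "eventually (%s. - 1 < x \<bullet> s \<and> x \<bullet> s < 0) (at (- x) within S3)"
 proof eventually_elim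
  case (elim s)
  then show ?case using S3_inner_bounds[OF x, of s] S3_inner_eq_m1[OF x, of s] by fastforce
 qed
 show "eventually (%s. 1 / (8 * pi^2) <= green1' (x \<bullet> s)) (at (- x) within S3)"
  using ev by eventually_elim (rule green1'_ge, auto)
 show "eventually (%s. green1' (x \<bullet> s) <= 1 / (8 * pi^2) * (1 / (- (x \<bullet> s)))) (at (- x) within S3)"
  using ev by eventually_elim (rule green1'_le, auto)
 have "((%s. 1 / (8 * pi^2) * (1 / (- (x \<bullet> s)))) \<longlongrightarrow> 1 / (8 * pi^2) * (1 / (- (x \<bullet> (- x))))) (at (- x) within S3)"
  using x by (intro tendsto_intros) (auto simp: S3_iff_inner)
 then show "((%s. 1 / (8 * pi^2) * (1 / (- (x \<bullet> s)))) \<longlongrightarrow> 1 / (8 * pi^2)) (at (- x) within S3)"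
  using x by (simp add: S3_iff_inner)
qed simp

lemma integrand_left_3:
 assumes x: "x \<in> S3" and y: "y \<in> S3" and ux: "x \<bullet> v x = 0" and uy: "y \<bullet> v y = 0"
 shows "grad_S3 (%z. left_transport z x (v x)
       \<bullet> grad_S3 (%s. - (1 / (16 * pi^2)) * dist_S3 x s * (2 * pi - dist_S3 x s)) z) y \<bullet> v y
   = integrand_left_3_explicit v x y"
proof -
 define a where "a = qmult (qconj x) (v x)"
 have a1: "a $ 1 = 0" using ux by (simp add: a_def qcoords)
 have vx: "v x = qmult x a" by (simp add: a_def qconj_cancel x)
 let ?f = "%s. - (1 / (16 * pi^2)) * dist_S3 x s * (2 * pi - dist_S3 x s)"
 define m where "m z = qmult z a \<bullet> x" for z
 have m: "bounded_linear m"
  unfolding m_def[abs_def]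
  by (rule bounded_linear_compose[OF bounded_linear_inner_left qmult.bounded_linear_left])
 let ?M = "%z. left_transport z x (v x) \<bullet> grad_S3 ?f z"
 have f: "?f s = green1 (x \<bullet> s)" if "s \<in> S3" for s by (rule phi_1_eq[OF x that])
 have M: "?M z = green1' (x \<bullet> z) * m z" if z: "z \<in> S3" and c: "\<bar>x \<bullet> z\<bar> < 1" for z
 proof -
  have "grad_S3 ?f z = green1' (x \<bullet> z) *\<^sub>R (x - (x \<bullet> z) *\<^sub>R z)"
   by (rule grad_S3_radial[where F = ?f and f = green1 and f' = green1', OF z c f DERIV_green1[OF c]])
  then show ?thesis
   by (simp add: left_transport_eq[OF x] inner_diff_right inner_qmult_imaginary a1 m_def flip: a_def)
 qed
 have Mm: "?M (- x) = 0" using grad_green1_antipode[OF x f] by simp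
 show ?thesis
 proof (cases rule: S3_inner_cases[OF x y])
  case 1
  define c where "c = x \<bullet> y"
  have "((%z. green1' (x \<bullet> z) * m z) has_derivative
    (%h. green1' (x \<bullet> y) * m h + green1'' (x \<bullet> y) * (x \<bullet> h) * m y)) (at y within S3)"
  proof (rule has_derivative_mult)
   show "(m has_derivative m) (at y within S3)" by (rule bounded_linear_imp_has_derivative[OF m])
   show "((%z. green1' (x \<bullet> z)) has_derivative (%h. green1'' (x \<bullet> y) * (x \<bullet> h))) (at y within S3)"
    by (rule has_derivative_compose[OF bounded_linear_imp_has_derivative[OF bounded_linear_inner_right]
       DERIV_green1'[OF 1, unfolded has_field_derivative_def]])
  qed
  then have "(?M has_derivative (%h. green1' (x \<bullet> y) * m h + green1'' (x \<bullet> y) * (x \<bullet> h) * m y)) (at y within S3)"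
  proof (rule has_derivative_transform_eventually)
   have "((%z. \<bar>x \<bullet> z\<bar>) \<longlongrightarrow> \<bar>x \<bullet> y\<bar>) (at y within S3)" by (intro tendsto_intros)
   then have "eventually (%z. \<bar>x \<bullet> z\<bar> < 1) (at y within S3)" by (rule order_tendstoD) (rule 1)
   moreover have "eventually (%z. z \<in> S3) (at y within S3)" by (auto simp: eventually_at_filter)
   ultimately show "eventually (%z. green1' (x \<bullet> z) * m z = ?M z) (at y within S3)"
    by eventually_elim (simp only: M)
  qed (use y M[OF y 1] in simp_all)
  from grad_S3_inner[OF y this uy] show ?thesis
   using 1 by (auto simp: integrand_left_3_explicit_def m_def simp flip: a_def)
 next
  case 2
  show ?thesis
  proof (cases "v x = 0")
   case True
   then show ?thesis using 2 by (simp add: integrand_left_3_explicit_def)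
  next
   case False
   define e where "e = qmult x (a /\<^sub>R norm a)"
   have a0: "a ~= 0" using False vx by auto
   have e: "e \<in> S3" "x \<bullet> e = 0"
    using a0 a1 x by (simp_all add: e_def S3_def norm_qmult inner_qmult_imaginary inner_commute[of x])
   have me: "m e = - norm a" "m x = 0"
   proof -
    have "qmult (qmult x a) a \<bullet> x = - ((x \<bullet> x) * (a \<bullet> a))"
     using a1 by (simp add: qcoords algebra_simps)
    then have "m e = - (a \<bullet> a) / norm a"
     using x by (simp add: m_def e_def S3_iff_inner divide_inverse mult.commute)
    then show "m e = - norm a" using a0 by (simp add: power2_norm_eq_inner[symmetric] power2_eq_square)
    show "m x = 0" by (simp add: m_def inner_qmult_imaginary a1)
   qed
   let ?l = "%t. cos t *\<^sub>R x + sin t *\<^sub>R e"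
   have Ml: "?M (?l t) = - (green1' (cos t) * sin t * norm a)" if "0 < \<bar>t\<bar>" "\<bar>t\<bar> < 1" for t
   proof -
    have xl: "x \<bullet> ?l t = cos t" using x e by (simp add: inner_add_right S3_iff_inner)
    have "cos \<bar>t\<bar> < 1" using cos_monotone_0_pi[of 0 "\<bar>t\<bar>"] that pi_gt3 by simp
    moreover have "cos \<bar>t\<bar> > 0" using cos_gt_zero[of "\<bar>t\<bar>"] that pi_gt3 by simp
    ultimately have c1: "\<bar>x \<bullet> ?l t\<bar> < 1" unfolding xl by simp
    have "?M (?l t) = green1' (x \<bullet> ?l t) * m (?l t)"
     by (rule M[OF great_circle(1)[OF x e] c1])
    then show ?thesis
     unfolding xl using me by (simp add: linear_add[OF bounded_linear.linear[OF m]] linear_scale[OF bounded_linear.linear[OF m]])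
   qed
   have gs: "green1' (cos t) * sin t \<ge> 1 / (16 * pi)" if "0 < t" "t < 1" for t
   proof -
    have st: "sin t > 0" using that pi_gt3 by (intro sin_gt_zero) auto
    have "sn (cos t) = sin t" using st by (simp add: sn_def sin_squared_eq[symmetric])
    then have "green1' (cos t) * sin t = 1 / (8 * pi^2) * (pi - t)"
     using st that pi_gt3 by (simp add: green1'_def coangle_def arccos_cos)
    also have "\<dots> \<ge> 1 / (8 * pi^2) * (pi / 2)" using that pi_gt3 by (intro mult_left_mono) auto
    finally have "1 / (8 * pi^2) * (pi / 2) <= green1' (cos t) * sin t" .
    moreover have "1 / (8 * pi^2) * (pi / 2) = 1 / (16 * pi)" by (simp add: power2_eq_square)
    ultimately show ?thesis by simp
   qed
   \<comment> \<open>The one-sided limits along a great circle differ, by the sign of \<open>sin t\<close>.\<close>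
   have "grad_S3 ?M y = 0"
   proof (rule S3.grad_eq_0I, rule notI)
    assume "continuous (at y within S3) ?M"
    then have c: "continuous (at x within S3) ?M" using 2 by simp
    have l1: "((%t. ?M (?l t)) \<longlongrightarrow> ?M x) (at_right 0)"
     by (rule continuous_within_tendsto_compose[OF c _ great_circle(2)[OF x e]])
       (simp add: great_circle(1)[OF x e])
    have em: "- e \<in> S3" "x \<bullet> - e = 0" using e by (simp_all add: S3_def)
    have "((%t. ?M (cos t *\<^sub>R x + sin t *\<^sub>R (- e))) \<longlongrightarrow> ?M x) (at_right 0)"
     by (rule continuous_within_tendsto_compose[OF c _ great_circle(2)[OF x em]])
       (simp add: great_circle(1)[OF x em, simplified])
    then have "((%t. ?M (?l (- t))) \<longlongrightarrow> ?M x) (at_right 0)" by simp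
    from tendsto_diff[OF this l1]
    have "((%t. ?M (?l (- t)) - ?M (?l t)) \<longlongrightarrow> 0) (at_right 0)" by simp
    then have "eventually (%t. ?M (?l (- t)) - ?M (?l t) < norm a / (16 * pi)) (at_right 0)"
     by (rule order_tendstoD) (use a0 in simp)
    moreover have "eventually (%t::real. t \<in> {0<..<1}) (at_right 0)"
     by (rule eventually_at_right_real) simp
    ultimately have "eventually (%t::real. False) (at_right 0)"
    proof eventually_elim
     case (elim t)
     then have "1 / (16 * pi) * norm a <= green1' (cos t) * sin t * norm a"
      by (intro mult_right_mono gs) auto
     moreover have "?M (?l (- t)) - ?M (?l t) = 2 * (green1' (cos t) * sin t * norm a)"
      using elim by (subst (1 2) Ml) auto
     moreover have "0 <= norm a / (16 * pi)" by simp
     ultimately show ?case using elim(1) by simp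
    qed
    then show False by simp
   qed
   moreover have "integrand_left_3_explicit v x y = 0"
    using 2 by (simp add: integrand_left_3_explicit_def green1'_def green1''_def)
   ultimately show ?thesis by simp
  qed
 next
  case 3
  have m0: "m y = 0" using 3 by (simp add: m_def inner_qmult_imaginary a1)
  have "((%z. green1' (x \<bullet> z) * m z) has_derivative (%h. 1 / (8 * pi^2) * m h)) (at y within S3)"
   by (rule has_derivative_times_vanishing[OF m m0]) (use green1'_antipode_limit[OF x] 3 in simp)
  then have "(?M has_derivative (%h. 1 / (8 * pi^2) * m h)) (at y within S3)"
  proof (rule has_derivative_transform_eventually)
   have "((%z. x \<bullet> z) \<longlongrightarrow> x \<bullet> y) (at y within S3)" by (intro tendsto_intros)
   then have "eventually (%z. x \<bullet> z < 1) (at y within S3)" by (rule order_tendstoD) (use 3 in simp)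
   moreover have "eventually (%z. z \<in> S3 \<and> z ~= y) (at y within S3)" by (auto simp: eventually_at_filter)
   ultimately show "eventually (%z. green1' (x \<bullet> z) * m z = ?M z) (at y within S3)"
   proof eventually_elim
    case (elim z)
    then have zS: "z \<in> S3" by simp
    have "\<bar>x \<bullet> z\<bar> < 1"
     by (cases rule: S3_inner_cases[OF x zS]) (use elim 3 in simp_all)
    then show ?case using M elim by simp
   qed
  qed (use y m0 Mm 3 in simp_all)
  from grad_S3_inner[OF y this uy] show ?thesis
   using 3 by (simp add: integrand_left_3_explicit_def green1''_def m_def flip: a_def)
 qed
qed

section \<open>Integration on the three-sphere\<close>

abbreviation intS3 :: "(R4 => real) => real" where "intS3 F \<equiv> integral\<^sup>L vol_S3 F"

lemma intS3_cong: "(!!x. x \<in> S3 ==> f x = g x) ==> intS3 f = intS3 g"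
 by (rule Bochner_Integration.integral_cong) (simp_all add: S3.space_volume)

lemma measurable_S3_ident [measurable]: "(%x. x) \<in> vol_S3 \<rightarrow>\<^sub>M borel"
 unfolding measurable_cong_sets[OF S3.sets_volume refl] by (rule measurable_restrict_space1) simp

lemma measurable_S3_continuous:
 fixes F :: "R4 => 'b::{second_countable_topology, topological_space}"
 shows "continuous_on S3 F ==> F \<in> borel_measurable vol_S3"
 unfolding measurable_cong_sets[OF S3.sets_volume refl] by (rule borel_measurable_continuous_on_restrict)

lemma compact_S3: "compact S3"
proof -
 have "S3 = sphere 0 1" by (auto simp: S3_def)
 then show ?thesis using compact_sphere by metis
qed

lemma S3_bounded:
 fixes F :: "R4 => real"
 assumes "continuous_on S3 F"
 obtains C where "C > 0" "!!x. x \<in> S3 ==> \<bar>F x\<bar> <= C"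
proof -
 have "bounded (F ` S3)" by (rule compact_imp_bounded[OF compact_continuous_image[OF assms compact_S3]])
 then obtain C where "C > 0" "\<forall>z\<in>F ` S3. norm z <= C" using bounded_pos by blast
 then show ?thesis using that by auto
qed

lemma integrable_S3_continuous:
 fixes F :: "R4 => real"
 assumes "continuous_on S3 F"
 shows "integrable vol_S3 F"
proof -
 obtain C where C: "C > 0" "!!x. x \<in> S3 ==> \<bar>F x\<bar> <= C" using S3_bounded[OF assms] by blast
 show ?thesis
  by (rule vol_S3.integrable_const_bound[of _ C])
    (use C measurable_S3_continuous[OF assms] in \<open>auto simp: S3.space_volume\<close>)
qed

lemma intS3_orthogonal:
 fixes F :: "R4 => real"
 assumes R: "orthogonal_transformation R" "!!x. x \<in> S3 ==> R x \<in> S3" and F: "F \<in> borel_measurable vol_S3"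
 shows "intS3 (%x. F (R x)) = intS3 F" (is ?g1)
  and "(\<integral>\<^sup>+x. ennreal (F (R x)) \<partial>vol_S3) = (\<integral>\<^sup>+x. ennreal (F x) \<partial>vol_S3)" (is ?g2)
proof -
 have "continuous_on S3 R"
  by (rule linear_continuous_on[OF linear_conv_bounded_linear[THEN iffD1, OF orthogonal_transformation_linear[OF R(1)]]])
 then have "R \<in> borel_measurable vol_S3" by (rule measurable_S3_continuous)
 then have mR: "R \<in> vol_S3 \<rightarrow>\<^sub>M vol_S3"
  unfolding measurable_cong_sets[OF refl S3.sets_volume]
  by (rule measurable_restrict_space2[rotated]) (use R(2) in \<open>auto simp: S3.space_volume\<close>)
 have e: "distr vol_S3 vol_S3 R = vol_S3" by (rule vol_S3_orthogonal_invariant[OF R])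
 show ?g1
  by (subst (2) e[symmetric]) (rule integral_distr[OF mR F, symmetric])
 have "(%x. ennreal (F x)) \<in> borel_measurable vol_S3" using F by measurable
 then show ?g2
  by (subst (2) e[symmetric]) (rule nn_integral_distr[OF mR, symmetric], simp)
qed

lemma orthogonal_qmult:
 assumes "q \<in> S3"
 shows "orthogonal_transformation (%x. qmult x q)" "orthogonal_transformation (%x. qmult q x)"
 using assms qmult.bounded_linear_left[of q] qmult.bounded_linear_right[of q]
 by (auto simp: orthogonal_transformation_def bounded_linear.linear inner_qmult_same_left inner_qmult_same_right S3_iff_inner)

lemma intS3_right_mult:
 "q \<in> S3 ==> F \<in> borel_measurable vol_S3 ==> intS3 (%x. F (qmult x q)) = intS3 F"
 by (rule intS3_orthogonal(1)[OF orthogonal_qmult(1)]) (auto intro: qmult_in_S3)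

lemma qmult_continuous_S3 [continuous_intros]:
 "continuous_on S (%x. qmult x q)" "continuous_on S (%x. qmult q x)"
 by (intro qmult.continuous_on continuous_intros)+

subsection \<open>Integration by parts\<close>

definition imag_unit :: "R4 => bool" where "imag_unit p \<longleftrightarrow> p$1 = 0 \<and> p \<bullet> p = 1"

lemma imag_unit_ijk [simp]: "imag_unit qi" "imag_unit qj" "imag_unit qk"
 by (simp_all add: imag_unit_def inner_R4)

definition qrot :: "R4 => real => R4" where "qrot p t = cos t *\<^sub>R qone + sin t *\<^sub>R p"

lemma imag_unit_square: "imag_unit p ==> qmult p p = - qone"
 by (auto simp: imag_unit_def qcoords; linarith)

lemma qrot_add: "imag_unit p ==> qmult (qrot p s) (qrot p t) = qrot p (s + t)"
 by (simp add: qrot_def imag_unit_square cos_add sin_add algebra_simps)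

lemma qrot_in_S3: "imag_unit p ==> qrot p t \<in> S3"
proof -
 assume "imag_unit p"
 then have "p$1 = 0" "p \<bullet> p = 1" by (simp_all add: imag_unit_def)
 moreover have "qone \<bullet> p = p$1" "p \<bullet> qone = p$1" "qone \<bullet> qone = 1" by (simp_all add: inner_R4)
 ultimately have "qone \<bullet> p = 0" "p \<bullet> qone = 0" "p \<bullet> p = 1" "qone \<bullet> qone = 1" by simp_all
 then have "qrot p t \<bullet> qrot p t = (cos t)^2 + (sin t)^2"
  unfolding qrot_def by (simp add: inner_add power2_eq_square)
 then show ?thesis by (simp add: S3_iff_inner)
qed

lemma qrot_0 [simp]: "qrot p 0 = qone"
 by (simp add: qrot_def)

lemma qrot_has_derivative: "((%t. qmult x (qrot p t)) has_vector_derivative qmult x p) (at 0)"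
proof -
 have "((%t. cos t *\<^sub>R x + sin t *\<^sub>R qmult x p) has_vector_derivative ((- sin 0) *\<^sub>R x + cos 0 *\<^sub>R qmult x p)) (at 0)"
  by (auto intro!: derivative_eq_intros)
 then show ?thesis by (simp add: qrot_def)
qed

text \<open>Differentiability along the one-parameter groups involves only the values on the sphere.\<close>

definition has_Lie :: "R4 => (R4 => real) => (R4 => real) => bool" where
 "has_Lie p u d \<longleftrightarrow> (\<forall>x\<in>S3. ((%t. u (qmult x (qrot p t))) has_real_derivative d x) (at 0))"

lemma has_Lie_mult:
 "has_Lie p u d ==> has_Lie p w e ==> has_Lie p (%x. u x * w x) (%x. d x * w x + u x * e x)"
 unfolding has_Lie_def by (auto intro!: derivative_eq_intros)

lemma has_Lie_cmult: "has_Lie p u d ==> has_Lie p (%x. c * u x) (%x. c * d x)"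
 unfolding has_Lie_def by (auto intro!: derivative_eq_intros)

lemma has_Lie_smooth:
 assumes "smooth F"
 shows "has_Lie p F (Lie p F)"
 unfolding has_Lie_def
proof
 fix x assume x: "x \<in> S3"
 have d: "(F has_derivative fderiv F x) (at x)"
  by (rule Cinf_on_has_derivative[OF assms S3_subset_punctured[OF x]])
 have "((%t. F (qmult x (qrot p t))) has_derivative (%t. fderiv F x (t *\<^sub>R qmult x p))) (at 0)"
  by (rule has_derivative_compose[OF qrot_has_derivative[unfolded has_vector_derivative_def]]) (simp add: d)
 moreover have "fderiv F x (t *\<^sub>R qmult x p) = Lie p F x * t" for t
  using linear_scale[OF bounded_linear.linear[OF has_derivative_bounded_linear[OF d]]]
  by (simp add: Lie_def mult.commute)
 ultimately show "((%t. F (qmult x (qrot p t))) has_real_derivative Lie p F x) (at 0)"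
  by (simp add: has_field_derivative_def)
qed

lemma Lie_unique:
 assumes "has_Lie p u d" "has_Lie p w e" "!!x. x \<in> S3 ==> u x = w x" "imag_unit p" "x \<in> S3"
 shows "d x = e x"
proof -
 have "(%t. u (qmult x (qrot p t))) = (%t. w (qmult x (qrot p t)))"
  using assms(3) qmult_in_S3[OF assms(5) qrot_in_S3[OF assms(4)]] by auto
 then show ?thesis using assms(1,2,5) unfolding has_Lie_def by (metis DERIV_unique)
qed

lemma has_Lie_linear:
 "has_Lie p (%x. qmult x q \<bullet> y) (%x. qmult (qmult x p) q \<bullet> y)"
 unfolding has_Lie_def has_real_derivative_iff_has_vector_derivative
 by (intro ballI bounded_linear.has_vector_derivative[OF bounded_linear_compose[OF bounded_linear_inner_left qmult.bounded_linear_left]] qrot_has_derivative)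

lemma S3_scaled_inner_bound: "x \<in> S3 ==> y \<in> S3 ==> 0 <= r ==> r < 1 ==> \<bar>r * (x \<bullet> y)\<bar> < 1"
proof -
 assume a: "x \<in> S3" "y \<in> S3" "0 <= r" "r < 1"
 have "\<bar>x \<bullet> y\<bar> <= 1" using S3_inner_bounds[OF a(1,2)] by (simp add: abs_le_iff)
 then have "\<bar>r\<bar> * \<bar>x \<bullet> y\<bar> <= \<bar>r\<bar> * 1" by (intro mult_left_mono) auto
 then show ?thesis using a unfolding abs_mult by linarith
qed

text \<open>The chain rule, for \<open>x \<mapsto> x \<cdot> y\<close> is the restriction of a linear form.\<close>

lemma has_Lie_kernel:
 assumes f: "!!s. \<bar>s\<bar> < 1 ==> (f has_real_derivative f' s) (at s)" and y: "y \<in> S3" and r: "0 <= r" "r < 1"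
 shows "has_Lie p (%x. f (r * (x \<bullet> y))) (%x. f' (r * (x \<bullet> y)) * (r * (qmult x p \<bullet> y)))"
 unfolding has_Lie_def
proof
 fix x assume x: "x \<in> S3"
 have "has_Lie p (%x. qmult x qone \<bullet> y) (%x. qmult (qmult x p) qone \<bullet> y)" by (rule has_Lie_linear)
 then have "((%t. r * (qmult x (qrot p t) \<bullet> y)) has_real_derivative r * (qmult x p \<bullet> y)) (at 0)"
  using x by (auto simp: has_Lie_def intro!: derivative_eq_intros)
 moreover have "(f has_real_derivative f' (r * (x \<bullet> y))) (at (r * (qmult x (qrot p 0) \<bullet> y)))"
  using f[OF S3_scaled_inner_bound[OF x y r]] by simp
 ultimately show "((%t. f (r * (qmult x (qrot p t) \<bullet> y))) has_real_derivative f' (r * (x \<bullet> y)) * (r * (qmult x p \<bullet> y))) (at 0)"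
  by (rule DERIV_chain2[rotated])
qed

text \<open>
 The integral of \<open>x \<mapsto> u (x exp (t p))\<close> does not depend on \<open>t\<close>, by invariance of the volume under
 right translations.
\<close>

lemma integral_Lie_zero:
 assumes p: "imag_unit p" and d: "has_Lie p u d" and cu: "continuous_on S3 u" and cd: "continuous_on S3 d"
 shows "intS3 d = 0"
proof -
 obtain C where C: "C > 0" "!!x. x \<in> S3 ==> \<bar>d x\<bar> <= C" using S3_bounded[OF cd] by blast
 define \<tau> where "\<tau> n = inverse (real (Suc n))" for n
 have \<tau>: "\<tau> n > 0" for n by (simp add: \<tau>_def)
 define s where "s n x = (u (qmult x (qrot p (\<tau> n))) - u x) / \<tau> n" for n x
 have mu [measurable]: "u \<in> borel_measurable vol_S3" by (rule measurable_S3_continuous[OF cu])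
 have cut: "continuous_on S3 (%x. u (qmult x (qrot p t)))" for t
  by (rule continuous_on_compose2[OF cu]) (auto intro!: continuous_intros qmult_in_S3 qrot_in_S3[OF p])
 have dt: "((%t. u (qmult x (qrot p t))) has_real_derivative d (qmult x (qrot p t))) (at t)" if x: "x \<in> S3" for x t
 proof -
  have "qmult x (qrot p t) \<in> S3" using x qrot_in_S3[OF p] by (intro qmult_in_S3)
  then have "((%s. u (qmult (qmult x (qrot p t)) (qrot p s))) has_real_derivative d (qmult x (qrot p t))) (at 0)"
   using d by (simp add: has_Lie_def)
  then have "((%s. u (qmult x (qrot p (t + s)))) has_real_derivative d (qmult x (qrot p t))) (at 0)"
   by (simp add: qmult_assoc qrot_add[OF p])
  then show ?thesis
   using DERIV_shift[of "%t. u (qmult x (qrot p t))" "d (qmult x (qrot p t))" 0 t] by (simp add: add.commute)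
 qed
 have bd: "\<bar>s n x\<bar> <= C" if x: "x \<in> S3" for n x
 proof -
  obtain z where z: "u (qmult x (qrot p (\<tau> n))) - u (qmult x (qrot p 0)) = (\<tau> n - 0) * d (qmult x (qrot p z))"
   using MVT2[OF \<tau>[of n], of "%t. u (qmult x (qrot p t))" "%t. d (qmult x (qrot p t))"] dt[OF x] by blast
  then have "s n x = d (qmult x (qrot p z))" using \<tau>[of n] by (simp add: s_def)
  then show ?thesis using C(2) x qrot_in_S3[OF p] by (simp add: qmult_in_S3)
 qed
 have "(%n. integral\<^sup>L vol_S3 (s n)) \<longlonglongrightarrow> integral\<^sup>L vol_S3 d"
 proof (rule integral_dominated_convergence[where w = "%x. C"])
  show "d \<in> borel_measurable vol_S3" by (rule measurable_S3_continuous[OF cd])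
  show "s n \<in> borel_measurable vol_S3" for n
   unfolding s_def[abs_def] using measurable_S3_continuous[OF cut] by measurable
  show "AE x in vol_S3. norm (s n x) <= C" for n using bd by (auto simp: S3.space_volume)
  show "AE x in vol_S3. (%n. s n x) \<longlonglongrightarrow> d x"
  proof (rule AE_I2)
   fix x assume "x \<in> space vol_S3"
   then have x: "x \<in> S3" by (simp add: S3.space_volume)
   have "((%t. (u (qmult x (qrot p (0 + t))) - u (qmult x (qrot p 0))) / t) \<longlongrightarrow> d x) (at 0)"
    using dt[OF x, of 0] by (simp add: DERIV_def)
   moreover have "filterlim \<tau> (at 0) sequentially"
    unfolding filterlim_at using LIMSEQ_inverse_real_of_nat \<tau> by (auto simp: \<tau>_def[abs_def] less_imp_neq[symmetric])
   ultimately have "(%n. (u (qmult x (qrot p (0 + \<tau> n))) - u (qmult x (qrot p 0))) / \<tau> n) \<longlonglongrightarrow> d x"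
    by (rule filterlim_compose)
   then show "(%n. s n x) \<longlonglongrightarrow> d x" by (simp add: s_def)
  qed
 qed simp
 moreover have "integral\<^sup>L vol_S3 (s n) = 0" for n
 proof -
  have "integral\<^sup>L vol_S3 (s n) = (intS3 (%x. u (qmult x (qrot p (\<tau> n)))) - intS3 u) / \<tau> n"
   unfolding s_def[abs_def]
   by (simp add: integrable_S3_continuous[OF cut] integrable_S3_continuous[OF cu])
  also have "\<dots> = 0" using intS3_right_mult[OF qrot_in_S3[OF p] mu] by simp
  finally show ?thesis .
 qed
 ultimately show ?thesis by (simp add: LIMSEQ_const_iff)
qed

lemma lie_integration_by_parts:
 assumes p: "imag_unit p" and u: "has_Lie p u d" and w: "has_Lie p w e"
  and c: "continuous_on S3 u" "continuous_on S3 d" "continuous_on S3 w" "continuous_on S3 e"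
 shows "intS3 (%x. u x * e x) = - intS3 (%x. d x * w x)"
proof -
 have "intS3 (%x. d x * w x + u x * e x) = 0"
  by (rule integral_Lie_zero[OF p has_Lie_mult[OF u w]]) (intro continuous_intros c)+
 moreover have "intS3 (%x. d x * w x + u x * e x) = intS3 (%x. d x * w x) + intS3 (%x. u x * e x)"
  by (intro Bochner_Integration.integral_add integrable_S3_continuous continuous_intros c)
 ultimately show ?thesis by simp
qed

lemma continuous_S3_smooth: "smooth F ==> continuous_on S3 F"
 by (rule continuous_on_subset[OF Cinf_on_continuous]) (auto simp: S3_def)

lemma continuous_S3_kernel:
 assumes f: "continuous_on {-1<..<1} f" and y: "y \<in> S3" and r: "0 <= r" "r < 1"
 shows "continuous_on S3 (%x. f (r * (x \<bullet> y)))"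
 by (rule continuous_on_compose2[OF f])
   (use S3_scaled_inner_bound[OF _ y r] in \<open>auto intro!: continuous_intros simp: abs_less_iff\<close>)

text \<open>
 \<open>f (r (x \<cdot> y))\<close> with \<open>r < 1\<close> is a regularization of the kernel \<open>f (x \<cdot> y)\<close>, smooth even if \<open>f\<close> is
 singular at \<open>1\<close> and \<open>- 1\<close>.
\<close>

locale regularized_kernel =
 fixes f f' f'' :: "real => real" and y :: R4 and r :: real
 assumes df: "!!s. \<bar>s\<bar> < 1 ==> (f has_real_derivative f' s) (at s)"
  and df': "!!s. \<bar>s\<bar> < 1 ==> (f' has_real_derivative f'' s) (at s)"
  and cf'': "continuous_on {-1<..<1} f''"
  and y: "y \<in> S3" and r: "0 <= r" "r < 1"
begin

lemma cont: "continuous_on S3 (%x. f (r * (x \<bullet> y)))" "continuous_on S3 (%x. f' (r * (x \<bullet> y)))"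
 "continuous_on S3 (%x. f'' (r * (x \<bullet> y)))"
 by (intro continuous_S3_kernel y r cf'' DERIV_continuous_on[where D = f'] DERIV_continuous_on[where D = f''];
   use df df' in \<open>auto intro: DERIV_subset simp: abs_less_iff\<close>)+

lemma first_order:
 assumes p: "imag_unit p" and g: "smooth g"
 shows "intS3 (%x. f (r * (x \<bullet> y)) * Lie p g x) = - intS3 (%x. f' (r * (x \<bullet> y)) * (r * (qmult x p \<bullet> y)) * g x)"
 by (rule lie_integration_by_parts[OF p has_Lie_kernel[OF df y r] has_Lie_smooth[OF g]])
   (assumption | intro continuous_intros cont continuous_S3_smooth Cinf_on_Lie g)+

lemma second_order:
 assumes p: "imag_unit p" and q: "imag_unit q" and g: "smooth g"
 shows "intS3 (%x. f (r * (x \<bullet> y)) * Lie p (Lie q g) x)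
  = intS3 (%x. (f'' (r * (x \<bullet> y)) * (r^2 * (qmult x p \<bullet> y) * (qmult x q \<bullet> y))
    + f' (r * (x \<bullet> y)) * (r * (qmult (qmult x q) p \<bullet> y))) * g x)"
proof -
 have "intS3 (%x. f (r * (x \<bullet> y)) * Lie p (Lie q g) x)
  = - intS3 (%x. f' (r * (x \<bullet> y)) * (r * (qmult x p \<bullet> y)) * Lie q g x)"
  by (rule first_order[OF p Cinf_on_Lie[OF g]])
 also have "\<dots> = intS3 (%x. (f'' (r * (x \<bullet> y)) * (r * (qmult x q \<bullet> y)) * (r * (qmult x p \<bullet> y))
    + f' (r * (x \<bullet> y)) * (r * (qmult (qmult x q) p \<bullet> y))) * g x)"
  by (subst lie_integration_by_parts[OF q
     has_Lie_mult[OF has_Lie_kernel[OF df' y r] has_Lie_cmult[OF has_Lie_linear]]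
     has_Lie_smooth[OF g]])
    (intro continuous_intros cont continuous_S3_smooth Cinf_on_Lie g | simp)+
 finally show ?thesis by (simp add: power2_eq_square mult_ac)
qed

end

definition laplacian :: "(R4 => real) => R4 => real" where
 "laplacian g x = Lie qi (Lie qi g) x + Lie qj (Lie qj g) x + Lie qk (Lie qk g) x"

lemma Cinf_on_laplacian: "smooth g ==> smooth (laplacian g)"
 unfolding laplacian_def[abs_def] by (intro Cinf_on_add open_punctured Cinf_on_Lie)

text \<open>\<open>x, x i, x j, x k\<close> is an orthonormal basis of the ambient space.\<close>

lemma frame_squares:
 assumes "x \<in> S3"
 shows "(x \<bullet> y)^2 + (qmult x qi \<bullet> y)^2 + (qmult x qj \<bullet> y)^2 + (qmult x qk \<bullet> y)^2 = y \<bullet> y"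
proof -
 have "(x \<bullet> y)^2 + (qmult x qi \<bullet> y)^2 + (qmult x qj \<bullet> y)^2 + (qmult x qk \<bullet> y)^2 = (x \<bullet> x) * (y \<bullet> y)"
  by (simp add: qcoords power2_eq_square) algebra
 then show ?thesis using assms by (simp add: S3_iff_inner)
qed

text \<open>
 In the sum over the frame, \<open>f''\<close> gets the factor \<open>r^2 (1 - (x \<cdot> y)^2)\<close> by Parseval. It is rewritten as
 \<open>(1 - (r (x \<cdot> y))^2) - (1 - r^2)\<close>, so that the radial Laplacian at \<open>r (x \<cdot> y)\<close> appears and the rest tends to 0.
\<close>

lemma (in regularized_kernel) laplace:
 assumes g: "smooth g"
 shows "intS3 (%x. f (r * (x \<bullet> y)) * laplacian g x)
  = intS3 (%x. ((1 - (r * (x \<bullet> y))^2) * f'' (r * (x \<bullet> y)) - 3 * (r * (x \<bullet> y)) * f' (r * (x \<bullet> y))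
    - (1 - r^2) * f'' (r * (x \<bullet> y))) * g x)"
proof -
 let ?k = "%p x. (f'' (r * (x \<bullet> y)) * (r^2 * (qmult x p \<bullet> y) * (qmult x p \<bullet> y))
    + f' (r * (x \<bullet> y)) * (r * (qmult (qmult x p) p \<bullet> y))) * g x"
 have c: "continuous_on S3 (%x. f (r * (x \<bullet> y)) * Lie p (Lie p g) x)" "continuous_on S3 (?k p)" for p
  by (intro continuous_intros cont continuous_S3_smooth Cinf_on_Lie g)+
 have "intS3 (%x. f (r * (x \<bullet> y)) * laplacian g x)
  = intS3 (%x. f (r * (x \<bullet> y)) * Lie qi (Lie qi g) x + f (r * (x \<bullet> y)) * Lie qj (Lie qj g) x
    + f (r * (x \<bullet> y)) * Lie qk (Lie qk g) x)"
  by (simp add: laplacian_def distrib_left)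
 also have "\<dots> = intS3 (?k qi) + intS3 (?k qj) + intS3 (?k qk)"
  using second_order[OF imag_unit_ijk(1) imag_unit_ijk(1) g] second_order[OF imag_unit_ijk(2) imag_unit_ijk(2) g]
   second_order[OF imag_unit_ijk(3) imag_unit_ijk(3) g]
  by (simp add: Bochner_Integration.integral_add integrable_S3_continuous[OF c(1)] Bochner_Integration.integrable_add)
 also have "\<dots> = intS3 (%x. ?k qi x + ?k qj x + ?k qk x)"
  by (simp add: Bochner_Integration.integral_add integrable_S3_continuous[OF c(2)] Bochner_Integration.integrable_add)
 also have "\<dots> = intS3 (%x. ((1 - (r * (x \<bullet> y))^2) * f'' (r * (x \<bullet> y)) - 3 * (r * (x \<bullet> y)) * f' (r * (x \<bullet> y))
    - (1 - r^2) * f'' (r * (x \<bullet> y))) * g x)"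
 proof (rule intS3_cong)
  fix x assume x: "x \<in> S3"
  define F where "F = f'' (r * (x \<bullet> y))"
  define F' where "F' = f' (r * (x \<bullet> y))"
  define a where "a = (qmult x qi \<bullet> y)^2 + (qmult x qj \<bullet> y)^2 + (qmult x qk \<bullet> y)^2"
  have a: "a = 1 - (x \<bullet> y)^2" using frame_squares[OF x, of y] y by (simp add: a_def S3_iff_inner)
  have "qmult (qmult x qi) qi \<bullet> y = - (x \<bullet> y)" "qmult (qmult x qj) qj \<bullet> y = - (x \<bullet> y)" "qmult (qmult x qk) qk \<bullet> y = - (x \<bullet> y)"
   by (simp_all add: qmult_assoc qunit_table)
  then have "?k qi x + ?k qj x + ?k qk x = (F * r^2 * a - 3 * (F' * (r * (x \<bullet> y)))) * g x"
   by (simp add: F_def F'_def a_def power2_eq_square algebra_simps)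
  also have "\<dots> = ((1 - (r * (x \<bullet> y))^2) * F - 3 * (r * (x \<bullet> y)) * F' - (1 - r^2) * F) * g x"
   unfolding a by (simp add: power2_eq_square algebra_simps)
  finally show "?k qi x + ?k qj x + ?k qk x = ((1 - (r * (x \<bullet> y))^2) * f'' (r * (x \<bullet> y)) - 3 * (r * (x \<bullet> y)) * f' (r * (x \<bullet> y))
    - (1 - r^2) * f'' (r * (x \<bullet> y))) * g x" by (simp only: F_def F'_def)
 qed
 finally show ?thesis .
qed

subsection \<open>Domination of the kernels\<close>

lemma Lie_const [simp]: "Lie p (%x. c) = (%x. 0)"
 by (simp add: Lie_def[abs_def] frechet_derivative_const)

text \<open>
 The Laplacian of \<open>ln (1 - r (x \<cdot> y))\<close>, whose integral vanishes, is at least \<open>1 / (1 - r (x \<cdot> y)) - 2\<close>.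
 So the integrals of \<open>1 / (1 - r (x \<cdot> y))\<close> stay bounded as \<open>r\<close> tends to 1.
\<close>

lemma log_kernel_bound:
 assumes y: "y \<in> S3" and r: "0 <= r" "r < 1"
 shows "intS3 (%x. 1 / (1 - r * (x \<bullet> y))) <= 4 * pi^2"
proof -
 interpret regularized_kernel "%c. ln (1 - c)" "%c. - 1 / (1 - c)" "%c. - 1 / (1 - c)^2" y r
 proof
  show "((%c. ln (1 - c)) has_real_derivative - 1 / (1 - s)) (at s)"
   and "((%c. - 1 / (1 - c)) has_real_derivative - 1 / (1 - s)^2) (at s)" if "\<bar>s\<bar> < 1" for s :: real
   using that by (auto intro!: derivative_eq_intros simp: power2_eq_square)
  show "continuous_on {- 1<..<1} (%c::real. - 1 / (1 - c)^2)" by (intro continuous_intros) auto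
 qed (use y r in auto)
 let ?c = "%x. r * (x \<bullet> y)"
 let ?L = "%x. (1 - (?c x)^2) * (- 1 / (1 - ?c x)^2) - 3 * ?c x * (- 1 / (1 - ?c x)) - (1 - r^2) * (- 1 / (1 - ?c x)^2)"
 have "intS3 (%x. ln (1 - ?c x) * laplacian (%x. 1) x) = intS3 (%x. ?L x * 1)"
  by (rule laplace[OF Cinf_on_const])
 then have L0: "intS3 ?L = 0" by (simp add: laplacian_def)
 have c1: "continuous_on S3 (%x. 1 / (1 - ?c x))" using continuous_on_minus[OF cont(2)] by simp
 have cc: "continuous_on S3 (%x. x \<bullet> y)" by (intro continuous_intros)
 have cL: "continuous_on S3 ?L"
  by (intro continuous_on_diff continuous_on_mult continuous_on_power continuous_on_const cont(2) cont(3) cc)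
 have le: "1 / (1 - ?c x) - 2 <= ?L x" if x: "x \<in> S3" for x
 proof -
  define s where "s = ?c x"
  have s: "\<bar>s\<bar> < 1" unfolding s_def by (rule S3_scaled_inner_bound[OF x y r])
  then have p: "1 - s > 0" by auto
  have "(1 - s^2) / (1 - s)^2 = (1 + s) / (1 - s)"
  proof -
   have "1 - s^2 = (1 - s) * (1 + s)" "(1 - s)^2 = (1 - s) * (1 - s)"
    by (simp_all add: power2_eq_square algebra_simps)
   then show ?thesis using p by simp
  qed
  then have "(1 - s^2) * (- 1 / (1 - s)^2) = - ((1 + s) / (1 - s))" by simp
  then have "(1 - s^2) * (- 1 / (1 - s)^2) = - (1 + s) / (1 - s)" by (simp only: minus_divide_left)
  then have "?L x = - (1 + s) / (1 - s) + 3 * s / (1 - s) + (1 - r^2) / (1 - s)^2" by (simp add: s_def)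
  also have "- (1 + s) / (1 - s) + 3 * s / (1 - s) = 1 / (1 - s) - 2"
  proof -
   have "1 / (1 - s) - 2 = (1 - 2 * (1 - s)) / (1 - s)" 
    using nonzero_mult_div_cancel_right[of "1 - s" 2] p by (simp only: diff_divide_distrib)
   then show ?thesis by (simp add: add_divide_distrib[symmetric])
  qed
  finally have "?L x = 1 / (1 - s) - 2 + (1 - r^2) / (1 - s)^2" .
  moreover have "r^2 <= 1" using r by (simp add: power_le_one)
  then have "(1 - r^2) / (1 - s)^2 \<ge> 0" by (intro divide_nonneg_nonneg) auto
  ultimately show ?thesis by (simp add: s_def)
 qed
 have "intS3 (%x. 1 / (1 - ?c x) - 2) <= intS3 ?L"
  by (rule integral_mono) (use le cL c1 in \<open>auto simp: S3.space_volume intro!: integrable_S3_continuous continuous_intros\<close>)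
 moreover have "intS3 (%x. 1 / (1 - ?c x) - 2) = intS3 (%x. 1 / (1 - ?c x)) - 2 * (2 * pi^2)"
  using integrable_S3_continuous[OF c1] measure_vol_S3
  by (simp add: Bochner_Integration.integral_diff S3.space_volume)
 ultimately show ?thesis using L0 by simp
qed

text \<open>Any sequence in \<open>(0, 1)\<close> that tends to 1 would do.\<close>

definition reg :: "nat => real" where "reg n = 1 - inverse (real (Suc (Suc n)))"

lemma reg: "0 <= reg n" "reg n < 1" "0 < reg n"
 by (auto simp: reg_def inverse_eq_divide)

lemma reg_tendsto: "reg \<longlonglongrightarrow> 1"
proof -
 have "reg \<longlonglongrightarrow> 1 - 0" unfolding reg_def
  by (intro tendsto_diff tendsto_const LIMSEQ_Suc[OF LIMSEQ_inverse_real_of_nat])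
 then show ?thesis by simp
qed

lemma singular_kernel_nn_integral:
 assumes y: "y \<in> S3"
 shows "(\<integral>\<^sup>+x. (if x \<bullet> y = 1 then \<infinity> else ennreal (1 / (1 - x \<bullet> y))) \<partial>vol_S3) <= ennreal (4 * pi^2)"
proof -
 let ?h = "%n x. ennreal (1 / (1 - reg n * (x \<bullet> y)))"
 have p: "1 - reg n * (x \<bullet> y) > 0" if "x \<in> S3" for x n
  using S3_scaled_inner_bound[OF that y reg(1,2)[of n]] by auto
 have c: "continuous_on S3 (%x. 1 / (1 - reg n * (x \<bullet> y)))" for n
  using p by (intro continuous_intros) (auto simp: less_imp_neq[symmetric])
 have m [measurable]: "?h n \<in> borel_measurable vol_S3" for n
  using measurable_S3_continuous[OF c[of n]] by measurable
 have lim: "(if x \<bullet> y = 1 then \<infinity> else ennreal (1 / (1 - x \<bullet> y))) = liminf (%n. ?h n x)" if x: "x \<in> S3" for x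
 proof (cases "x \<bullet> y = 1")
  case True
  have "(%n. ?h n x) \<longlonglongrightarrow> \<infinity>"
  proof -
   have "1 / (1 - reg n * (x \<bullet> y)) = real (Suc (Suc n))" for n using True by (simp add: reg_def inverse_eq_divide)
   moreover have "(%n. ennreal (real (Suc (Suc n)))) \<longlonglongrightarrow> \<infinity>"
    using LIMSEQ_Suc[OF LIMSEQ_Suc[OF of_nat_tendsto_top_ennreal]] by (simp add: ennreal_of_nat_eq_real_of_nat)
   ultimately show ?thesis by simp
  qed
  then show ?thesis using True by (simp add: lim_imp_Liminf)
 next
  case False
  have "(%n. 1 / (1 - reg n * (x \<bullet> y))) \<longlonglongrightarrow> 1 / (1 - 1 * (x \<bullet> y))"
   using False by (intro tendsto_intros reg_tendsto) auto
  then have "(%n. ?h n x) \<longlonglongrightarrow> ennreal (1 / (1 - x \<bullet> y))" by (intro tendsto_ennrealI) simp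
  then show ?thesis using False by (simp add: lim_imp_Liminf)
 qed
 have "(\<integral>\<^sup>+x. (if x \<bullet> y = 1 then \<infinity> else ennreal (1 / (1 - x \<bullet> y))) \<partial>vol_S3) = (\<integral>\<^sup>+x. liminf (%n. ?h n x) \<partial>vol_S3)"
  by (rule nn_integral_cong) (simp only: lim S3.space_volume)
 also have "\<dots> <= liminf (%n. \<integral>\<^sup>+x. ?h n x \<partial>vol_S3)"
  by (rule nn_integral_liminf) simp
 also have "\<dots> <= liminf (%n. ennreal (4 * pi^2))"
 proof (rule Liminf_mono, rule always_eventually, rule allI)
  fix n
  have "(\<integral>\<^sup>+x. ?h n x \<partial>vol_S3) = ennreal (intS3 (%x. 1 / (1 - reg n * (x \<bullet> y))))"
   by (rule nn_integral_eq_integral[OF integrable_S3_continuous[OF c]])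
     (use p in \<open>auto simp: S3.space_volume less_imp_le\<close>)
  also have "\<dots> <= ennreal (4 * pi^2)" using log_kernel_bound[OF y reg(1,2)] by (rule ennreal_leI)
  finally show "(\<integral>\<^sup>+x. ?h n x \<partial>vol_S3) <= ennreal (4 * pi^2)" .
 qed
 also have "\<dots> = ennreal (4 * pi^2)" by (simp add: Liminf_const)
 finally show ?thesis .
qed

lemma AE_S3_not_pole:
 assumes y: "y \<in> S3"
 shows "AE x in vol_S3. \<bar>x \<bullet> y\<bar> < 1"
proof -
 have one: "AE x in vol_S3. x \<bullet> z ~= 1" if z: "z \<in> S3" for z
 proof -
  have "(%x. x \<bullet> z) \<in> borel_measurable vol_S3" by (intro measurable_S3_continuous continuous_intros)
  then have m: "(%x. if x \<bullet> z = 1 then \<infinity> else ennreal (1 / (1 - x \<bullet> z))) \<in> borel_measurable vol_S3" by measurable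
  have "(\<integral>\<^sup>+x. (if x \<bullet> z = 1 then \<infinity> else ennreal (1 / (1 - x \<bullet> z))) \<partial>vol_S3) ~= \<infinity>"
   using singular_kernel_nn_integral[OF z] by (auto simp: top_unique)
  from nn_integral_PInf_AE[OF m this] show ?thesis by eventually_elim (auto split: if_splits)
 qed
 have "- y \<in> S3" using y by (simp add: S3_def)
 from one[OF y] one[OF this] AE_space show ?thesis
 proof eventually_elim
  case (elim x)
  then have "x \<in> S3" by (simp add: S3.space_volume)
  with elim S3_inner_bounds[OF this y] show ?case by (auto simp: abs_less_iff less_le)
 qed
qed

text \<open>\<open>1 / sin^2 \<alpha>\<close>, the common integrable majorant of all kernels below.\<close>

definition pole_weight :: "real => real" where "pole_weight c = 1 / (1 - c^2)"

text \<open>Partial fractions: \<open>2 / (1 - c^2) = 1 / (1 - c) + 1 / (1 + c)\<close>.\<close>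

lemma pole_weight_nn_integral:
 assumes y: "y \<in> S3"
 shows "(\<integral>\<^sup>+x. ennreal (pole_weight (x \<bullet> y)) \<partial>vol_S3) <= ennreal (8 * pi^2)"
proof -
 have y': "- y \<in> S3" using y by (simp add: S3_def)
 let ?k = "%y x. if x \<bullet> y = 1 then \<infinity> else ennreal (1 / (1 - x \<bullet> y))"
 have m: "?k z \<in> borel_measurable vol_S3" for z
 proof -
  have "(%x. x \<bullet> z) \<in> borel_measurable vol_S3" by (intro measurable_S3_continuous continuous_intros)
  then show ?thesis by measurable
 qed
 have "(\<integral>\<^sup>+x. ennreal (pole_weight (x \<bullet> y)) \<partial>vol_S3) <= (\<integral>\<^sup>+x. ?k y x + ?k (- y) x \<partial>vol_S3)"
 proof (rule nn_integral_mono)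
  fix x assume "x \<in> space vol_S3"
  then have x: "x \<in> S3" by (simp add: S3.space_volume)
  define c where "c = x \<bullet> y"
  have c: "- 1 <= c" "c <= 1" using S3_inner_bounds[OF x y] by (auto simp: c_def)
  show "ennreal (pole_weight (x \<bullet> y)) <= ?k y x + ?k (- y) x"
  proof (cases "\<bar>c\<bar> = 1")
   case True
   then show ?thesis by (auto simp: c_def[symmetric] abs_if split: if_splits)
  next
   case False
   then have c': "1 - c > 0" "1 + c > 0" using c by auto
   have "pole_weight c <= 1 / (1 - c) + 1 / (1 + c)"
   proof -
    have "1 - c^2 = (1 - c) * (1 + c)" by (simp add: power2_eq_square algebra_simps)
    then have "1 / (1 - c) + 1 / (1 + c) = 2 * pole_weight c"
     unfolding pole_weight_def using c' by (simp add: divide_simps)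
    moreover have "pole_weight c \<ge> 0" unfolding pole_weight_def \<open>1 - c^2 = (1 - c) * (1 + c)\<close> using c' by simp
    ultimately show ?thesis by simp
   qed
   then have "ennreal (pole_weight c) <= ennreal (1 / (1 - c)) + ennreal (1 / (1 + c))"
    using c' by (simp add: ennreal_leI flip: ennreal_plus)
   moreover have "c ~= 1" "- c ~= 1" using False by auto
   ultimately show ?thesis by (simp add: c_def[symmetric])
  qed
 qed
 also have "\<dots> = (\<integral>\<^sup>+x. ?k y x \<partial>vol_S3) + (\<integral>\<^sup>+x. ?k (- y) x \<partial>vol_S3)"
  by (rule nn_integral_add[OF m m])
 also have "\<dots> <= ennreal (4 * pi^2) + ennreal (4 * pi^2)"
  by (intro add_mono singular_kernel_nn_integral y y')
 also have "\<dots> = ennreal (8 * pi^2)" by (subst ennreal_plus[symmetric]) auto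
 finally show ?thesis .
qed

lemma pole_weight_integrable:
 assumes y: "y \<in> S3"
 shows "integrable vol_S3 (%x. pole_weight (x \<bullet> y))"
proof (rule integrableI_nonneg)
 have m: "(%x. x \<bullet> y) \<in> borel_measurable vol_S3" by (intro measurable_S3_continuous continuous_intros)
 then show "(%x. pole_weight (x \<bullet> y)) \<in> borel_measurable vol_S3" unfolding pole_weight_def by measurable
 show "AE x in vol_S3. 0 <= pole_weight (x \<bullet> y)"
  using S3_inner_bounds[OF _ y] by (auto simp: S3.space_volume pole_weight_def abs_square_le_1 abs_le_iff intro!: AE_I2)
 show "(\<integral>\<^sup>+x. ennreal (pole_weight (x \<bullet> y)) \<partial>vol_S3) < \<infinity>"
  using pole_weight_nn_integral[OF y] by (rule order.strict_trans1) simp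
qed

lemma S3_dominated_convergence:
 assumes y: "y \<in> S3" and m: "!!n. k n \<in> borel_measurable vol_S3" "l \<in> borel_measurable vol_S3"
  and bd: "!!n x. x \<in> S3 ==> \<bar>x \<bullet> y\<bar> < 1 ==> \<bar>k n x\<bar> <= C * pole_weight (x \<bullet> y)"
  and lim: "!!x. x \<in> S3 ==> \<bar>x \<bullet> y\<bar> < 1 ==> (%n. k n x) \<longlonglongrightarrow> l x"
 shows "integrable vol_S3 l" "(%n. intS3 (k n)) \<longlonglongrightarrow> intS3 l" (is ?g2)
proof -
 have I: "integrable vol_S3 (%x. C * pole_weight (x \<bullet> y))" by (simp add: pole_weight_integrable[OF y])
 have b: "AE x in vol_S3. norm (k n x) <= C * pole_weight (x \<bullet> y)" for n
  using AE_S3_not_pole[OF y] AE_space by eventually_elim (simp add: bd S3.space_volume)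
 have c: "AE x in vol_S3. (%n. k n x) \<longlonglongrightarrow> l x"
  using AE_S3_not_pole[OF y] AE_space by eventually_elim (simp add: lim S3.space_volume)
 show "integrable vol_S3 l" by (rule integrable_dominated_convergence[OF m(2,1) I c b])
 show ?g2 by (rule integral_dominated_convergence[OF m(2,1) I c b])
qed

section \<open>Green's identities on the three-sphere\<close>

lemma sn_scaled_ge:
 assumes c: "\<bar>c\<bar> < 1" and r: "0 <= r" "r < 1"
 shows "sn c <= sn (r * c)" "\<bar>r * c\<bar> < 1" "sn (r * c) > 0" "sn c > 0"
  "1 / (sn (r * c) * sn (r * c)) <= pole_weight c" (is ?g5) "1 - r^2 <= sn (r * c) * sn (r * c)" (is ?g6)
proof -
 have r2: "r^2 <= 1" using r by (simp add: power_le_one)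
 have c2: "c^2 <= 1" using c by (simp add: abs_square_le_1)
 have "r^2 * c^2 <= 1 * c^2" using r2 by (intro mult_right_mono) auto
 then show le: "sn c <= sn (r * c)" by (simp add: sn_def power_mult_distrib)
 have "\<bar>r\<bar> * \<bar>c\<bar> <= 1 * \<bar>c\<bar>" using r by (intro mult_right_mono) auto
 then show rc: "\<bar>r * c\<bar> < 1" using c unfolding abs_mult by linarith
 show p: "sn (r * c) > 0" "sn c > 0" using sn_pos(1) rc c by auto
 have "sn c * sn c <= sn (r * c) * sn (r * c)" using le p by (intro mult_mono) auto
 then show ?g5
  unfolding pole_weight_def sn_pos(2)[OF c, symmetric] using p by (intro divide_left_mono) auto
 have "r^2 * c^2 <= r^2 * 1" using c2 by (intro mult_left_mono) auto
 then show ?g6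
  unfolding sn_pos(2)[OF rc] by (simp add: power_mult_distrib)
qed

lemma sn_le_1: "sn c <= 1"
 by (simp add: sn_def)

lemma coangle_bounds: "\<bar>c\<bar> < 1 ==> 0 <= coangle c" "\<bar>c\<bar> < 1 ==> coangle c <= 4"
 using coangle_nonneg[of c] pi_less_4 by auto

lemma inv_pi_square_le: "1 / (4 * pi^2) <= 1" "1 / (8 * pi^2) <= 1" "1 / (2 * pi^2) <= 1" "1 / (16 * pi^2) <= 1"
proof -
 have "1 <= pi" using pi_gt3 by simp
 then have "1 <= pi^2" by simp
 then show "1 / (4 * pi^2) <= 1" "1 / (8 * pi^2) <= 1" "1 / (2 * pi^2) <= 1" "1 / (16 * pi^2) <= 1"
  by (simp_all add: field_simps)
qed

lemma green0_bound:
 assumes c: "\<bar>c\<bar> < 1" shows "\<bar>green0 c\<bar> * sn c <= 4"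
proof -
 have "\<bar>green0 c\<bar> * sn c = (1 / (4 * pi^2)) * (coangle c * \<bar>c\<bar>)"
  using sn_pos(1)[OF c] coangle_bounds[OF c] by (simp add: green0_def abs_mult)
 also have "\<dots> <= 1 * (4 * 1)"
  using coangle_bounds[OF c] c inv_pi_square_le by (intro mult_mono) auto
 finally show ?thesis by simp
qed

lemma green0'_bound:
 assumes c: "\<bar>c\<bar> < 1" shows "\<bar>green0' c\<bar> * (sn c)^3 <= 5"
proof -
 have "\<bar>green0' c\<bar> * (sn c)^3 = (1 / (4 * pi^2)) * \<bar>c * sn c + coangle c\<bar>"
  using sn_pos(1)[OF c] by (simp add: green0'_def abs_mult)
 also have "\<dots> <= 1 * (1 * 1 + 4)"
 proof (intro mult_mono)
  have "\<bar>c * sn c\<bar> <= 1 * 1" unfolding abs_mult using c sn_le_1[of c] sn_pos(1)[OF c] by (intro mult_mono) auto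
  then show "\<bar>c * sn c + coangle c\<bar> <= 1 * 1 + 4" using coangle_bounds[OF c] by linarith
 qed (use inv_pi_square_le in auto)
 finally show ?thesis by simp
qed

lemma green0''_bound:
 assumes c: "\<bar>c\<bar> < 1" shows "\<bar>green0'' c\<bar> * (sn c)^5 <= 16"
proof -
 have s: "sn c > 0" "sn c * sn c = 1 - c^2" using sn_pos[OF c] by auto
 have "\<bar>green0'' c\<bar> * (sn c)^5 = \<bar>3 * c * green0' c - 1 / (2 * pi^2)\<bar> * (sn c)^3"
  unfolding green0''_def s(2)[symmetric] using s(1) by (simp add: abs_mult power_numeral_reduce)
 also have "\<dots> <= (3 * \<bar>green0' c\<bar> + 1) * (sn c)^3"
 proof (intro mult_right_mono)
  have "\<bar>3 * c * green0' c\<bar> <= 3 * \<bar>green0' c\<bar>"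
   unfolding abs_mult using c by (simp add: mult_left_le_one_le)
  moreover have "0 <= 1 / (2 * pi^2)" by simp
  ultimately show "\<bar>3 * c * green0' c - 1 / (2 * pi^2)\<bar> <= 3 * \<bar>green0' c\<bar> + 1"
   using inv_pi_square_le(3) by linarith
 qed (use s in auto)
 also have "\<dots> = 3 * (\<bar>green0' c\<bar> * (sn c)^3) + (sn c)^3" by (simp add: algebra_simps)
 also have "\<dots> <= 3 * 5 + 1"
  using green0'_bound[OF c] power_le_one[of "sn c" 3] s(1) sn_le_1[of c] by linarith
 finally show ?thesis by simp
qed

text \<open>Near \<open>c = - 1\<close> the singularity is only apparent.\<close>

lemma green0'_bound_left:
 assumes c: "- 1 < c" "c <= 0" shows "\<bar>green0' c\<bar> <= 2"
proof -
 define g where "g t = t * sn t + coangle t" for t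
 define h where "h t = 2 * (1 + t) * sn t - g t" for t
 have dg: "(g has_real_derivative 2 * sn t) (at t)" if t: "\<bar>t\<bar> < 1" for t
 proof -
  have e: "t * (- t / sn t) + 1 * sn t + 1 / sn t = 2 * sn t"
   using sn_pos[OF t] by (simp add: divide_simps) (simp add: power2_eq_square)
  show ?thesis unfolding g_def[abs_def]
   by (rule DERIV_cong[OF DERIV_add[OF DERIV_mult'[OF DERIV_ident DERIV_sn[OF t]] DERIV_coangle[OF t]] e])
 qed
 have cont: "continuous_on {- 1..c} g" "continuous_on {- 1..c} h"
  unfolding g_def[abs_def] h_def[abs_def]
  by (intro continuous_intros continuous_on_sn continuous_on_subset[OF continuous_on_coangle]; use c in auto)+
 have "g (- 1) <= g c"
 proof (rule DERIV_nonneg_imp_increasing_open[OF _ _ cont(1)])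
  fix t assume "- 1 < t" "t < c"
  then have t1: "\<bar>t\<bar> < 1" using c by auto
  show "\<exists>y. (g has_real_derivative y) (at t) \<and> 0 <= y"
   by (rule exI[of _ "2 * sn t"]) (use dg[OF t1] sn_pos(1)[OF t1] in simp)
 qed (use c in auto)
 then have g0: "0 <= g c" by (simp add: g_def)
 have "h (- 1) <= h c"
 proof (rule DERIV_nonneg_imp_increasing_open[OF _ _ cont(2)])
  fix t assume t: "- 1 < t" "t < c"
  then have t1: "\<bar>t\<bar> < 1" using c by auto
  have "(h has_real_derivative (2 * sn t + (2 * (1 + t)) * (- t / sn t)) - 2 * sn t) (at t)"
   unfolding h_def[abs_def]
   by (auto intro!: derivative_eq_intros DERIV_sn[OF t1] dg[OF t1])
  moreover have "0 <= (2 * (1 + t)) * (- t / sn t)"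
   using t c sn_pos(1)[OF t1] by (intro mult_nonneg_nonneg divide_nonneg_pos) auto
  ultimately show "\<exists>y. (h has_real_derivative y) (at t) \<and> 0 <= y" by (intro exI conjI) auto
 qed (use c in auto)
 then have gh: "g c <= 2 * (1 + c) * sn c" by (simp add: h_def g_def)
 have c1: "\<bar>c\<bar> < 1" using c by auto
 have s: "sn c > 0" "sn c * sn c = 1 - c^2" using sn_pos[OF c1] by auto
 have "(1 + c) * 1 <= (1 + c) * (1 - c)" using c by (intro mult_left_mono) auto
 also have "\<dots> = sn c * sn c" using s by (simp add: power2_eq_square algebra_simps)
 finally have "2 * (1 + c) * sn c <= 2 * (sn c * sn c) * sn c" using s(1) by (intro mult_right_mono) auto
 with gh have "g c <= 2 * (sn c)^3" by (simp add: power3_eq_cube)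
 then have "g c / (sn c)^3 <= 2" using s(1) by (simp add: field_simps)
 moreover have "0 <= g c / (sn c)^3" using g0 s(1) by simp
 ultimately have "(1 / (4 * pi^2)) * (g c / (sn c)^3) <= 1 * 2" using inv_pi_square_le by (intro mult_mono) auto
 moreover have "\<bar>green0' c\<bar> = (1 / (4 * pi^2)) * (g c / (sn c)^3)"
  using g0 s(1) by (simp add: green0'_def g_def abs_mult)
 ultimately show ?thesis by simp
qed

lemma green1_bound:
 assumes c: "\<bar>c\<bar> < 1" shows "\<bar>green1 c\<bar> <= 16"
proof -
 have "(coangle c)^2 <= pi^2" using coangle_nonneg[of c] c by (intro power_mono) auto
 then have "\<bar>green1 c\<bar> = 1 / (16 * pi^2) * (pi^2 - (coangle c)^2)" by (simp add: green1_def abs_mult)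
 also have "\<dots> <= 1 * 4\<^sup>2"
 proof (intro mult_mono)
  have "pi^2 <= 4\<^sup>2" using pi_less_4 by (intro power_mono) auto
  then show "pi^2 - (coangle c)^2 <= 4\<^sup>2" using zero_le_power2[of "coangle c"] by linarith
 qed (use inv_pi_square_le \<open>(coangle c)^2 <= pi^2\<close> in auto)
 finally show ?thesis by simp
qed

lemma green1'_bound:
 assumes c: "\<bar>c\<bar> < 1" shows "\<bar>green1' c\<bar> * sn c <= 4"
proof -
 have "\<bar>green1' c\<bar> * sn c = (1 / (8 * pi^2)) * coangle c"
  using sn_pos(1)[OF c] coangle_bounds[OF c] by (simp add: green1'_def abs_mult)
 also have "\<dots> <= 1 * 4"
  using coangle_bounds[OF c] inv_pi_square_le by (intro mult_mono) auto
 finally show ?thesis by simp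
qed

lemma green1''_bound:
 assumes c: "\<bar>c\<bar> < 1" shows "\<bar>green1'' c\<bar> * (sn c)^3 <= 5"
proof -
 have "\<bar>green1'' c\<bar> * (sn c)^3 = (1 / (8 * pi^2)) * \<bar>sn c + coangle c * c\<bar>"
  using sn_pos(1)[OF c] by (simp add: green1''_def abs_mult)
 also have "\<dots> <= 1 * (1 + 4 * 1)"
 proof (intro mult_mono)
  have "\<bar>coangle c * c\<bar> <= 4 * 1" unfolding abs_mult using c coangle_bounds[OF c] by (intro mult_mono) auto
  then show "\<bar>sn c + coangle c * c\<bar> <= 1 + 4 * 1" using sn_le_1[of c] sn_pos(1)[OF c] by linarith
 qed (use inv_pi_square_le in auto)
 finally show ?thesis by simp
qed

lemma green_continuous:
 "continuous_on {-1<..<1} green0" "continuous_on {-1<..<1} green0'" "continuous_on {-1<..<1} green0''" (is ?g3)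
 "continuous_on {-1<..<1} green1" "continuous_on {-1<..<1} green1'" "continuous_on {-1<..<1} green1''" (is ?g6)
proof -
 have s: "\<bar>t\<bar> < 1" if "t \<in> {-1<..<1}" for t :: real using that by auto
 show 1: "continuous_on {-1<..<1} green0" by (rule DERIV_continuous_on[OF DERIV_subset[OF DERIV_green0[OF s]]]) auto
 show 2: "continuous_on {-1<..<1} green0'" by (rule DERIV_continuous_on[OF DERIV_subset[OF DERIV_green0'[OF s]]]) auto
 have "1 - t^2 ~= 0" if "t \<in> {-1<..<1}" for t :: real
  using s[OF that] abs_square_less_1[of t] by auto
 then show ?g3
  unfolding green0''_def[abs_def] by (intro continuous_intros 2) auto
 show 3: "continuous_on {-1<..<1} green1" by (rule DERIV_continuous_on[OF DERIV_subset[OF DERIV_green1[OF s]]]) auto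
 show 4: "continuous_on {-1<..<1} green1'" by (rule DERIV_continuous_on[OF DERIV_subset[OF DERIV_green1'[OF s]]]) auto
 show ?g6
  unfolding green1''_def[abs_def]
  by (intro continuous_intros continuous_on_sn continuous_on_subset[OF continuous_on_coangle])
    (use sn_pos(1)[OF s] in \<open>auto simp: less_imp_neq[symmetric]\<close>)
qed

lemma green0_reg: "y \<in> S3 ==> regularized_kernel green0 green0' green0'' y (reg n)"
 by unfold_locales (auto simp: DERIV_green0 DERIV_green0' green_continuous reg)

lemma green1_reg: "y \<in> S3 ==> regularized_kernel green1 green1' green1'' y (reg n)"
 by unfold_locales (auto simp: DERIV_green1 DERIV_green1' green_continuous reg)

subsection \<open>Limits of regularized kernels\<close>

lemma coangle_measurable: "(%c. coangle (max (- 1) (min 1 c))) \<in> borel_measurable borel"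
 by (intro borel_measurable_continuous_onI continuous_on_compose2[OF continuous_on_coangle] continuous_intros) auto

lemma sn_measurable [measurable]: "sn \<in> borel_measurable borel"
 by (intro borel_measurable_continuous_onI continuous_on_sn)

lemma measurable_coangle_inner:
 assumes f: "f \<in> N \<rightarrow>\<^sub>M borel" and g: "g \<in> N \<rightarrow>\<^sub>M borel"
  and S: "!!z. z \<in> space N ==> f z \<in> S3" "!!z. z \<in> space N ==> g z \<in> S3"
 shows "(%z. coangle (f z \<bullet> g z)) \<in> borel_measurable N"
proof -
 note f [measurable] g [measurable] coangle_measurable [measurable]
 have "(%z. coangle (max (- 1) (min 1 (f z \<bullet> g z)))) \<in> borel_measurable N" by measurable
 moreover have "coangle (max (- 1) (min 1 (f z \<bullet> g z))) = coangle (f z \<bullet> g z)" if "z \<in> space N" for z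
 proof -
  have "max (- 1) (min 1 (f z \<bullet> g z)) = f z \<bullet> g z"
   using S3_inner_bounds[OF S[OF that]] by (simp add: min_absorb2 max_absorb2)
  then show ?thesis by simp
 qed
 ultimately show ?thesis by (simp cong: measurable_cong)
qed

lemma green_measurable:
 assumes f: "f \<in> N \<rightarrow>\<^sub>M borel" and g: "g \<in> N \<rightarrow>\<^sub>M borel"
  and S: "!!z. z \<in> space N ==> f z \<in> S3" "!!z. z \<in> space N ==> g z \<in> S3"
 shows "(%z. green0 (f z \<bullet> g z)) \<in> borel_measurable N" (is ?g1) "(%z. green0' (f z \<bullet> g z)) \<in> borel_measurable N" (is ?g2)
  "(%z. green1 (f z \<bullet> g z)) \<in> borel_measurable N" (is ?g3) "(%z. green1' (f z \<bullet> g z)) \<in> borel_measurable N" (is ?g4)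
  "(%z. green1'' (f z \<bullet> g z)) \<in> borel_measurable N" (is ?g5)
proof -
 note f [measurable] g [measurable] measurable_coangle_inner[OF f g S, measurable]
 show ?g1 ?g2
  ?g3 ?g4
  ?g5
  unfolding green0_def green0'_def green1_def green1'_def green1''_def by measurable
qed

lemma green_measurable_S3:
 assumes "y \<in> S3"
 shows "(%x. green0 (x \<bullet> y)) \<in> borel_measurable vol_S3" "(%x. green0' (x \<bullet> y)) \<in> borel_measurable vol_S3"
  "(%x. green1 (x \<bullet> y)) \<in> borel_measurable vol_S3" "(%x. green1' (x \<bullet> y)) \<in> borel_measurable vol_S3"
  "(%x. green1'' (x \<bullet> y)) \<in> borel_measurable vol_S3"
 by (rule green_measurable[where g = "%_. y"]; use assms in \<open>simp add: S3.space_volume\<close>)+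

text \<open>A kernel of order \<open>sn\<^sup>-\<^sup>m\<^sup>-\<^sup>2\<close> is integrable against functions vanishing to order \<open>m\<close> at the poles.\<close>

lemma kernel_limit:
 assumes y: "y \<in> S3" and f: "continuous_on {-1<..<1} f" and mf: "(%x. f (x \<bullet> y)) \<in> borel_measurable vol_S3"
  and bd: "!!s. \<bar>s\<bar> < 1 ==> \<bar>f s\<bar> * (sn s)^(m + 2) <= C"
  and w: "continuous_on S3 w" and wb: "!!x. x \<in> S3 ==> \<bar>x \<bullet> y\<bar> < 1 ==> \<bar>w x\<bar> <= K * (sn (x \<bullet> y))^m" and K: "K \<ge> 0"
  and g: "continuous_on S3 g"
 shows "integrable vol_S3 (%x. f (x \<bullet> y) * w x * g x)" (is ?g1)
  "(%n. intS3 (%x. f (reg n * (x \<bullet> y)) * w x * g x)) \<longlonglongrightarrow> intS3 (%x. f (x \<bullet> y) * w x * g x)" (is ?g2)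
proof -
 obtain G where G: "G > 0" "!!x. x \<in> S3 ==> \<bar>g x\<bar> <= G" using S3_bounded[OF g] by blast
 have m1: "(%x. f (reg n * (x \<bullet> y)) * w x * g x) \<in> borel_measurable vol_S3" for n
  by (intro measurable_S3_continuous continuous_intros continuous_S3_kernel[OF f y reg(1,2)] w g)
 note mf [measurable] measurable_S3_continuous[OF w, measurable] measurable_S3_continuous[OF g, measurable]
 have m2: "(%x. f (x \<bullet> y) * w x * g x) \<in> borel_measurable vol_S3" by measurable
 have b: "\<bar>f (reg n * (x \<bullet> y)) * w x * g x\<bar> <= (C * K * G) * pole_weight (x \<bullet> y)"
  if x: "x \<in> S3" "\<bar>x \<bullet> y\<bar> < 1" for n x
 proof -
  define c where "c = x \<bullet> y"
  define s where "s = sn (reg n * c)"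
  note S = sn_scaled_ge[OF x(2) reg(1,2)[of n], folded c_def, folded s_def]
  have C: "\<bar>f (reg n * c)\<bar> * s^(m + 2) <= C" unfolding s_def by (rule bd[OF S(2)])
  have C0: "C \<ge> 0" using order_trans[OF _ C] S(3) by simp
  have "\<bar>f (reg n * (x \<bullet> y)) * w x * g x\<bar> <= \<bar>f (reg n * c)\<bar> * (K * s^m) * G"
  proof -
   have "\<bar>w x\<bar> <= K * (sn c)^m" using wb[OF x] by (simp add: c_def)
   also have "\<dots> <= K * s^m" using S K by (intro mult_left_mono power_mono) auto
   finally show ?thesis unfolding abs_mult c_def[symmetric] using G(2)[OF x(1)] K S(3) by (intro mult_mono) auto
  qed
  also have "\<dots> = (K * G) * ((\<bar>f (reg n * c)\<bar> * s^(m + 2)) * (1 / (s * s)))"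
   using S(3) by (simp add: power_add power2_eq_square)
  also have "\<dots> <= (K * G) * (C * pole_weight c)"
   using S C C0 K G(1) by (intro mult_left_mono mult_mono) auto
  finally show ?thesis by (simp add: c_def mult_ac)
 qed
 have l: "(%n. f (reg n * (x \<bullet> y)) * w x * g x) \<longlonglongrightarrow> f (x \<bullet> y) * w x * g x"
  if x: "x \<in> S3" "\<bar>x \<bullet> y\<bar> < 1" for x
 proof -
  have "isCont f (x \<bullet> y)"
   using f x(2) by (auto simp: continuous_on_eq_continuous_at abs_less_iff)
  moreover have "(%n. reg n * (x \<bullet> y)) \<longlonglongrightarrow> 1 * (x \<bullet> y)" by (intro tendsto_intros reg_tendsto)
  ultimately have "(%n. f (reg n * (x \<bullet> y))) \<longlonglongrightarrow> f (x \<bullet> y)"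
   by (metis isCont_tendsto_compose mult_1)
  then show ?thesis by (intro tendsto_intros)
 qed
 show ?g1
  ?g2
  using S3_dominated_convergence[OF y m1 m2 b l] by auto
qed

text \<open>A vector tangent at \<open>y\<close> sees only the tangential part of \<open>x\<close>, whose length is the sine of the distance.\<close>

lemma tangent_inner_bound:
 assumes x: "x \<in> S3" and y: "y \<in> S3" and w: "w \<bullet> y = 0"
 shows "\<bar>w \<bullet> x\<bar> <= norm w * sn (x \<bullet> y)"
proof -
 have "w \<bullet> x = w \<bullet> (x - (x \<bullet> y) *\<^sub>R y)" using w by (simp add: inner_diff_right)
 also have "\<bar>\<dots>\<bar> <= norm w * norm (x - (x \<bullet> y) *\<^sub>R y)" by (rule Cauchy_Schwarz_ineq2)
 also have "norm (x - (x \<bullet> y) *\<^sub>R y) = sn (x \<bullet> y)"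
  using x y unfolding norm_eq_sqrt_inner sn_def
  by (intro arg_cong[where f = sqrt]) (simp add: S3_iff_inner inner_diff_left inner_diff_right inner_commute power2_eq_square)
 finally show ?thesis .
qed

lemma tangential_bound:
 assumes x: "x \<in> S3" and y: "y \<in> S3" and p: "imag_unit p"
 shows "\<bar>qmult x p \<bullet> y\<bar> <= sn (x \<bullet> y)"
proof -
 have "norm x = 1" "norm p = 1" using x p by (simp_all add: S3_def imag_unit_def norm_eq_1)
 then have "norm (qmult x p) = 1" by (simp add: norm_qmult)
 moreover have "qmult x p \<bullet> x = 0" using p by (simp add: inner_qmult_imaginary imag_unit_def)
 ultimately show ?thesis using tangent_inner_bound[OF y x, of "qmult x p"] by (simp add: inner_commute)
qed

lemma abs_inner_S3_le: "x \<in> S3 ==> y \<in> S3 ==> \<bar>x \<bullet> y\<bar> <= 1"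
 using S3_inner_bounds[of x y] by (simp add: abs_le_iff)

lemma imag_unit_in_S3: "imag_unit p ==> p \<in> S3"
 by (simp add: imag_unit_def S3_iff_inner)

lemma power_bound_weaken: "X * sn c ^ k <= C ==> 0 <= X ==> \<bar>c\<bar> < 1 ==> k <= n ==> X * sn c ^ n <= C"
proof -
 assume a: "X * sn c ^ k <= C" "0 <= X" "\<bar>c\<bar> < 1" "k <= n"
 have "sn c ^ n <= sn c ^ k" using sn_pos(1)[OF a(3)] sn_le_1[of c] a(4) by (intro power_decreasing) auto
 then have "X * sn c ^ n <= X * sn c ^ k" using a(2) by (intro mult_left_mono)
 with a(1) show ?thesis by simp
qed

lemma green0_limit:
 assumes "y \<in> S3" "continuous_on S3 g"
 shows "integrable vol_S3 (%x. green0 (x \<bullet> y) * g x)" (is ?g1)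
  "(%n. intS3 (%x. green0 (reg n * (x \<bullet> y)) * g x)) \<longlonglongrightarrow> intS3 (%x. green0 (x \<bullet> y) * g x)" (is ?g2)
proof -
 have "\<bar>green0 s\<bar> * sn s ^ (0 + 2) <= 4" if "\<bar>s\<bar> < 1" for s
  by (rule power_bound_weaken[of _ _ 1]) (use green0_bound[OF that] that in auto)
 from kernel_limit[OF assms(1) green_continuous(1) green_measurable_S3(1)[OF assms(1)] this, of "%x. 1" 1 g] assms(2)
 show ?g1
  ?g2
  by simp_all
qed

lemma green1_limit:
 assumes "y \<in> S3" "continuous_on S3 g"
 shows "integrable vol_S3 (%x. green1 (x \<bullet> y) * g x)" (is ?g1)
  "(%n. intS3 (%x. green1 (reg n * (x \<bullet> y)) * g x)) \<longlonglongrightarrow> intS3 (%x. green1 (x \<bullet> y) * g x)" (is ?g2)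
proof -
 have "\<bar>green1 s\<bar> * sn s ^ (0 + 2) <= 16" if "\<bar>s\<bar> < 1" for s
  by (rule power_bound_weaken[of _ _ 0]) (use green1_bound[OF that] that in auto)
 from kernel_limit[OF assms(1) green_continuous(4) green_measurable_S3(3)[OF assms(1)] this, of "%x. 1" 1 g] assms(2)
 show ?g1
  ?g2
  by simp_all
qed

lemma green0'_limit:
 assumes y: "y \<in> S3" and p: "imag_unit p" and g: "continuous_on S3 g"
 shows "integrable vol_S3 (%x. green0' (x \<bullet> y) * (qmult x p \<bullet> y) * g x)" (is ?g1)
  "(%n. intS3 (%x. green0' (reg n * (x \<bullet> y)) * (qmult x p \<bullet> y) * g x))
    \<longlonglongrightarrow> intS3 (%x. green0' (x \<bullet> y) * (qmult x p \<bullet> y) * g x)" (is ?g2)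
proof -
 have b: "\<bar>green0' s\<bar> * sn s ^ (1 + 2) <= 5" if "\<bar>s\<bar> < 1" for s
  using green0'_bound[OF that] by (simp add: numeral_3_eq_3)
 have w: "continuous_on S3 (%x. qmult x p \<bullet> y)" by (intro continuous_intros)
 have wb: "\<bar>qmult x p \<bullet> y\<bar> <= 1 * sn (x \<bullet> y) ^ 1" if "x \<in> S3" "\<bar>x \<bullet> y\<bar> < 1" for x
  using tangential_bound[OF that(1) y p] by simp
 show ?g1
  ?g2
  using kernel_limit[OF y green_continuous(2) green_measurable_S3(2)[OF y] b w wb _ g] by auto
qed

lemma green1'_limit:
 assumes y: "y \<in> S3" and q: "q \<in> S3" and g: "continuous_on S3 g"
 shows "integrable vol_S3 (%x. green1' (x \<bullet> y) * (qmult x q \<bullet> y) * g x)" (is ?g1)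
  "(%n. intS3 (%x. green1' (reg n * (x \<bullet> y)) * (qmult x q \<bullet> y) * g x))
    \<longlonglongrightarrow> intS3 (%x. green1' (x \<bullet> y) * (qmult x q \<bullet> y) * g x)" (is ?g2)
proof -
 have b: "\<bar>green1' s\<bar> * sn s ^ (0 + 2) <= 4" if "\<bar>s\<bar> < 1" for s
  by (rule power_bound_weaken[of _ _ 1]) (use green1'_bound[OF that] that in auto)
 have w: "continuous_on S3 (%x. qmult x q \<bullet> y)" by (intro continuous_intros)
 have wb: "\<bar>qmult x q \<bullet> y\<bar> <= 1 * sn (x \<bullet> y) ^ 0" if "x \<in> S3" "\<bar>x \<bullet> y\<bar> < 1" for x
  using abs_inner_S3_le[OF qmult_in_S3[OF that(1) q] y] by simp
 show ?g1
  ?g2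
  using kernel_limit[OF y green_continuous(5) green_measurable_S3(4)[OF y] b w wb _ g] by auto
qed

lemma green1''_limit:
 assumes y: "y \<in> S3" and p: "imag_unit p" and q: "imag_unit q" and g: "continuous_on S3 g"
 shows "integrable vol_S3 (%x. green1'' (x \<bullet> y) * ((qmult x p \<bullet> y) * (qmult x q \<bullet> y)) * g x)" (is ?g1)
  "(%n. intS3 (%x. green1'' (reg n * (x \<bullet> y)) * ((qmult x p \<bullet> y) * (qmult x q \<bullet> y)) * g x))
    \<longlonglongrightarrow> intS3 (%x. green1'' (x \<bullet> y) * ((qmult x p \<bullet> y) * (qmult x q \<bullet> y)) * g x)" (is ?g2)
proof -
 have b: "\<bar>green1'' s\<bar> * sn s ^ (2 + 2) <= 5" if "\<bar>s\<bar> < 1" for s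
  by (rule power_bound_weaken[of _ _ 3]) (use green1''_bound[OF that] that in auto)
 have w: "continuous_on S3 (%x. (qmult x p \<bullet> y) * (qmult x q \<bullet> y))" by (intro continuous_intros)
 have wb: "\<bar>(qmult x p \<bullet> y) * (qmult x q \<bullet> y)\<bar> <= 1 * sn (x \<bullet> y) ^ 2" if "x \<in> S3" "\<bar>x \<bullet> y\<bar> < 1" for x
  unfolding abs_mult power2_eq_square
  using tangential_bound[OF that(1) y p] tangential_bound[OF that(1) y q] by (simp add: mult_mono)
 show ?g1
  ?g2
  using kernel_limit[OF y green_continuous(6) green_measurable_S3(5)[OF y] b w wb _ g] by auto
qed

lemma green0_by_parts:
 assumes y: "y \<in> S3" and p: "imag_unit p" and g: "smooth g"
 shows "intS3 (%x. green0 (x \<bullet> y) * Lie p g x) = - intS3 (%x. green0' (x \<bullet> y) * (qmult x p \<bullet> y) * g x)"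
proof (rule LIMSEQ_unique)
 show "(%n. intS3 (%x. green0 (reg n * (x \<bullet> y)) * Lie p g x)) \<longlonglongrightarrow> intS3 (%x. green0 (x \<bullet> y) * Lie p g x)"
  by (rule green0_limit(2)[OF y continuous_S3_smooth[OF Cinf_on_Lie[OF g]]])
 have eq: "intS3 (%x. green0 (reg n * (x \<bullet> y)) * Lie p g x)
   = - (reg n * intS3 (%x. green0' (reg n * (x \<bullet> y)) * (qmult x p \<bullet> y) * g x))" for n
  unfolding regularized_kernel.first_order[OF green0_reg[OF y] p g]
  by (subst integral_mult_right_zero[symmetric]) (simp add: mult_ac)
 have "(%n. - (reg n * intS3 (%x. green0' (reg n * (x \<bullet> y)) * (qmult x p \<bullet> y) * g x)))
   \<longlonglongrightarrow> - (1 * intS3 (%x. green0' (x \<bullet> y) * (qmult x p \<bullet> y) * g x))"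
  by (intro tendsto_intros reg_tendsto green0'_limit(2)[OF y p continuous_S3_smooth[OF g]])
 then show "(%n. intS3 (%x. green0 (reg n * (x \<bullet> y)) * Lie p g x))
   \<longlonglongrightarrow> - intS3 (%x. green0' (x \<bullet> y) * (qmult x p \<bullet> y) * g x)"
  unfolding eq by simp
qed

text \<open>Integrate the regularized kernels by parts twice and pass to the limit.\<close>

lemma green1_by_parts:
 assumes y: "y \<in> S3" and p: "imag_unit p" and q: "imag_unit q" and g: "smooth g"
 shows "intS3 (%x. green1 (x \<bullet> y) * Lie p (Lie q g) x)
  = intS3 (%x. green1'' (x \<bullet> y) * ((qmult x p \<bullet> y) * (qmult x q \<bullet> y)) * g x)
  + intS3 (%x. green1' (x \<bullet> y) * (qmult x (qmult q p) \<bullet> y) * g x)" (is "_ = ?A + ?B")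
proof (rule LIMSEQ_unique)
 have qp: "qmult q p \<in> S3" by (intro qmult_in_S3 imag_unit_in_S3 p q)
 note cg = continuous_S3_smooth[OF g]
 show "(%n. intS3 (%x. green1 (reg n * (x \<bullet> y)) * Lie p (Lie q g) x))
   \<longlonglongrightarrow> intS3 (%x. green1 (x \<bullet> y) * Lie p (Lie q g) x)"
  by (rule green1_limit(2)[OF y continuous_S3_smooth[OF Cinf_on_Lie[OF Cinf_on_Lie[OF g]]]])
 let ?a = "%n x. green1'' (reg n * (x \<bullet> y)) * ((qmult x p \<bullet> y) * (qmult x q \<bullet> y)) * g x"
 let ?b = "%n x. green1' (reg n * (x \<bullet> y)) * (qmult x (qmult q p) \<bullet> y) * g x"
 have eq: "intS3 (%x. green1 (reg n * (x \<bullet> y)) * Lie p (Lie q g) x)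
   = (reg n)^2 * intS3 (?a n) + reg n * intS3 (?b n)" for n
 proof -
  have I: "integrable vol_S3 (?a n)" "integrable vol_S3 (?b n)"
   by (intro integrable_S3_continuous continuous_intros cg
      continuous_S3_kernel[OF green_continuous(5) y reg(1,2)] continuous_S3_kernel[OF green_continuous(6) y reg(1,2)])+
  have "intS3 (%x. green1 (reg n * (x \<bullet> y)) * Lie p (Lie q g) x)
    = intS3 (%x. (reg n)^2 * ?a n x + reg n * ?b n x)"
   unfolding regularized_kernel.second_order[OF green1_reg[OF y] p q g]
   by (rule intS3_cong) (auto simp: qmult_assoc algebra_simps)
  then show ?thesis using I by simp
 qed
 have "(%n. (reg n)^2 * intS3 (?a n) + reg n * intS3 (?b n)) \<longlonglongrightarrow> 1\<^sup>2 * ?A + 1 * ?B"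
  by (intro tendsto_intros reg_tendsto green1''_limit(2)[OF y p q cg] green1'_limit(2)[OF y qp cg])
 then show "(%n. intS3 (%x. green1 (reg n * (x \<bullet> y)) * Lie p (Lie q g) x)) \<longlonglongrightarrow> ?A + ?B"
  unfolding eq by simp
qed

text \<open>
 The equation \<open>\<Delta> \<phi>\<^sub>1 = \<phi>\<^sub>0 + 1 / (8 \<pi>^2)\<close> in weak form. The singularity of \<open>\<phi>\<^sub>1\<close> is too weak to
 produce a delta function.
\<close>

lemma green1_laplacian:
 assumes y: "y \<in> S3" and g: "smooth g"
 shows "intS3 (%x. green1 (x \<bullet> y) * laplacian g x)
  = intS3 (%x. green0 (x \<bullet> y) * g x) + 1 / (8 * pi^2) * intS3 g"
proof (rule LIMSEQ_unique)
 note cg = continuous_S3_smooth[OF g]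
 show "(%n. intS3 (%x. green1 (reg n * (x \<bullet> y)) * laplacian g x)) \<longlonglongrightarrow> intS3 (%x. green1 (x \<bullet> y) * laplacian g x)"
  by (rule green1_limit(2)[OF y continuous_S3_smooth[OF Cinf_on_laplacian[OF g]]])
 let ?e = "%n x. (1 - (reg n)^2) * green1'' (reg n * (x \<bullet> y)) * g x"
 have ce: "continuous_on S3 (?e n)" for n
  by (intro continuous_intros cg continuous_S3_kernel[OF green_continuous(6) y reg(1,2)])
 have eq: "intS3 (%x. green1 (reg n * (x \<bullet> y)) * laplacian g x)
   = intS3 (%x. green0 (reg n * (x \<bullet> y)) * g x) + 1 / (8 * pi^2) * intS3 g - intS3 (?e n)" for n
 proof -
  have I: "integrable vol_S3 (%x. green0 (reg n * (x \<bullet> y)) * g x)"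
   by (intro integrable_S3_continuous continuous_intros cg continuous_S3_kernel[OF green_continuous(1) y reg(1,2)])
  have "intS3 (%x. green1 (reg n * (x \<bullet> y)) * laplacian g x)
   = intS3 (%x. (green0 (reg n * (x \<bullet> y)) * g x + 1 / (8 * pi^2) * g x) - ?e n x)"
   unfolding regularized_kernel.laplace[OF green1_reg[OF y] g]
  proof (rule intS3_cong)
   fix x assume "x \<in> S3"
   then have "\<bar>reg n * (x \<bullet> y)\<bar> < 1" using S3_scaled_inner_bound[OF _ y reg(1,2)] by simp
   from green1_laplace[OF this]
   show "((1 - (reg n * (x \<bullet> y))^2) * green1'' (reg n * (x \<bullet> y)) - 3 * (reg n * (x \<bullet> y)) * green1' (reg n * (x \<bullet> y))
     - (1 - (reg n)^2) * green1'' (reg n * (x \<bullet> y))) * g x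
    = (green0 (reg n * (x \<bullet> y)) * g x + 1 / (8 * pi^2) * g x) - ?e n x" by (simp only: left_diff_distrib distrib_right)
  qed
  then show ?thesis using I integrable_S3_continuous[OF cg] integrable_S3_continuous[OF ce] by simp
 qed
 obtain G where G: "G > 0" "!!x. x \<in> S3 ==> \<bar>g x\<bar> <= G" using S3_bounded[OF cg] by blast
 have e0: "(%n. intS3 (?e n)) \<longlonglongrightarrow> intS3 (%x. 0)"
 proof (rule S3_dominated_convergence(2)[OF y])
  show "?e n \<in> borel_measurable vol_S3" for n by (rule measurable_S3_continuous[OF ce])
  fix x assume x: "x \<in> S3" "\<bar>x \<bullet> y\<bar> < 1"
  show "\<bar>?e n x\<bar> <= (5 * G) * pole_weight (x \<bullet> y)" for n
  proof -
   define s where "s = sn (reg n * (x \<bullet> y))"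
   note S = sn_scaled_ge[OF x(2) reg(1,2)[of n], folded s_def]
   have s1: "s <= 1" unfolding s_def by (rule sn_le_1)
   have r0: "0 <= 1 - (reg n)^2" using reg[of n] by (simp add: power_le_one)
   define X where "X = \<bar>green1'' (reg n * (x \<bullet> y))\<bar>"
   have X: "X * s^3 <= 5" "X \<ge> 0" using green1''_bound[OF S(2)] by (auto simp: X_def s_def)
   have "\<bar>?e n x\<bar> <= (s * s) * X * G"
    unfolding abs_mult X_def using S(6) r0 G(2)[OF x(1)] by (intro mult_mono) auto
   also have "\<dots> = (X * s^3) * (1 / (s * s)) * s * G" using S(3) by (simp add: power3_eq_cube)
   also have "\<dots> <= 5 * pole_weight (x \<bullet> y) * 1 * G"
    using X S s1 G(1) x(2) by (intro mult_mono) (auto intro!: mult_nonneg_nonneg simp: pole_weight_def abs_square_le_1)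
   finally show ?thesis by (simp add: mult_ac)
  qed
  have "isCont green1'' (x \<bullet> y)"
   using green_continuous(6) x(2) by (auto simp: continuous_on_eq_continuous_at abs_less_iff)
  moreover have "(%n. reg n * (x \<bullet> y)) \<longlonglongrightarrow> 1 * (x \<bullet> y)" by (intro tendsto_intros reg_tendsto)
  ultimately have "(%n. green1'' (reg n * (x \<bullet> y))) \<longlonglongrightarrow> green1'' (x \<bullet> y)"
   by (metis isCont_tendsto_compose mult_1)
  then have "(%n. ?e n x) \<longlonglongrightarrow> (1 - 1\<^sup>2) * green1'' (x \<bullet> y) * g x" by (intro tendsto_intros reg_tendsto)
  then show "(%n. ?e n x) \<longlonglongrightarrow> 0" by simp
 qed simp
 have "(%n. intS3 (%x. green0 (reg n * (x \<bullet> y)) * g x) + 1 / (8 * pi^2) * intS3 g - intS3 (?e n))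
  \<longlonglongrightarrow> intS3 (%x. green0 (x \<bullet> y) * g x) + 1 / (8 * pi^2) * intS3 g - intS3 (%x. 0)"
  by (intro tendsto_intros green0_limit(2)[OF y cg] e0)
 then show "(%n. intS3 (%x. green1 (reg n * (x \<bullet> y)) * laplacian g x))
  \<longlonglongrightarrow> intS3 (%x. green0 (x \<bullet> y) * g x) + 1 / (8 * pi^2) * intS3 g"
  unfolding eq by simp
qed

lemma frechet_derivative_gradient:
 fixes f :: "'a::euclidean_space => real"
 assumes "f differentiable (at z)"
 shows "fderiv f z h = (\<Sum>b\<in>Basis. fderiv f z b *\<^sub>R b) \<bullet> h"
 unfolding frechet_derivative_basis_expansion[OF assms, of h] inner_sum_left
 by (rule sum.cong) (simp_all add: inner_commute)

text \<open>
 The chord from \<open>x\<close> to \<open>y\<close> avoids the origin when \<open>x\<close> lies in the hemisphere of \<open>y\<close>, so that the mean value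
 theorem applies to the extension of \<open>g\<close>; and the chord is at most a multiple of the sine of the distance.
\<close>

lemma smooth_lipschitz_hemisphere:
 assumes g: "smooth g" and y: "y \<in> S3"
 obtains L where "L > 0" "!!x. x \<in> S3 ==> 0 <= x \<bullet> y ==> x \<bullet> y < 1 ==> \<bar>g x - g y\<bar> <= L * sn (x \<bullet> y)"
proof -
 define G where "G z = (\<Sum>b\<in>Basis. fderiv g z b *\<^sub>R b)" for z
 have dg: "(g has_derivative (%h. G z \<bullet> h)) (at z)" if "z \<in> punctured" for z
 proof -
  have "fderiv g z = (%h. G z \<bullet> h)"
   unfolding G_def by (rule ext) (rule frechet_derivative_gradient[OF Cinf_on_differentiable[OF g that]])
  then show ?thesis using Cinf_on_has_derivative[OF g that] by simp
 qed
 have cG: "continuous_on punctured G"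
  unfolding G_def by (intro continuous_intros Cinf_on_continuous Cinf_on_derivative g)
 define K where "K = cball (0::R4) 1 \<inter> {z. 1 / 2 <= z \<bullet> z}"
 have K: "compact K" unfolding K_def
  by (intro compact_Int_closed compact_cball closed_Collect_le continuous_intros)
 have "K \<subseteq> punctured" by (auto simp: K_def)
 then have "bounded (G ` K)" by (intro compact_imp_bounded compact_continuous_image[OF continuous_on_subset[OF cG] K])
 then obtain C where C: "C > 0" "!!z. z \<in> K ==> norm (G z) <= C" unfolding bounded_pos by auto
 show ?thesis
 proof (rule that[of "C * 2"])
  fix x assume x: "x \<in> S3" "0 <= x \<bullet> y" "x \<bullet> y < 1"
  define l where "l t = y + t *\<^sub>R (x - y)" for t
  have lK: "l t \<in> K" if t: "0 <= t" "t <= 1" for t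
  proof -
   have ll: "l t = (1 - t) *\<^sub>R y + t *\<^sub>R x" by (simp add: l_def algebra_simps)
   have e: "l t \<bullet> l t = (1 - t)^2 + t^2 + 2 * (t * (1 - t)) * (x \<bullet> y)"
    unfolding ll using x(1) y by (simp add: inner_add S3_iff_inner inner_commute[of y x] power2_eq_square algebra_simps)
   have "0 <= 2 * (t * (1 - t)) * (x \<bullet> y)" using t x by simp
   moreover have "1 / 2 <= (1 - t)^2 + t^2"
    using zero_le_power2[of "2 * t - 1"] by (simp add: power2_eq_square algebra_simps)
   ultimately have "1 / 2 <= l t \<bullet> l t" using e by linarith
   moreover have "norm (l t) <= (1 - t) * 1 + t * 1"
    unfolding ll by (rule order_trans[OF norm_triangle_ineq]) (use t x(1) y in \<open>simp add: S3_def\<close>)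
   ultimately show ?thesis by (simp add: K_def)
  qed
  have dl: "((%t. g (l t)) has_real_derivative G (l t) \<bullet> (x - y)) (at t)" if "0 <= t" "t <= 1" for t
  proof -
   have "(l has_derivative (%s. s *\<^sub>R (x - y))) (at t)" unfolding l_def by (auto intro!: derivative_eq_intros)
   from has_derivative_compose[OF this dg] lK[OF that] \<open>K \<subseteq> punctured\<close>
   have "((%t. g (l t)) has_derivative (%s. G (l t) \<bullet> (s *\<^sub>R (x - y)))) (at t)" by blast
   then show ?thesis by (simp add: has_field_derivative_def mult_commute_abs)
  qed
  obtain t where t: "0 < t" "t < 1" "g (l 1) - g (l 0) = (1 - 0) * (G (l t) \<bullet> (x - y))"
   using MVT2[of 0 1 "%t. g (l t)" "%t. G (l t) \<bullet> (x - y)"] dl by auto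
  then have "\<bar>g x - g y\<bar> = \<bar>G (l t) \<bullet> (x - y)\<bar>" by (simp add: l_def)
  also have "\<dots> <= norm (G (l t)) * norm (x - y)" by (rule Cauchy_Schwarz_ineq2)
  also have "\<dots> <= C * (2 * sn (x \<bullet> y))"
  proof (rule mult_mono)
   show "norm (G (l t)) <= C" using C(2) lK[of t] t by simp
   have c: "\<bar>x \<bullet> y\<bar> < 1" using x by simp
   have "(norm (x - y))^2 = 2 * (1 - x \<bullet> y)"
    unfolding power2_norm_eq_inner using x(1) y by (simp add: inner_diff S3_iff_inner inner_commute[of y x])
   also have "\<dots> <= 2 * (1 - (x \<bullet> y)^2)"
    using x mult_right_mono[of "x \<bullet> y" 1 "x \<bullet> y"] by (simp add: power2_eq_square)
   also have "\<dots> <= (2 * sn (x \<bullet> y))^2"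
    using sn_pos(2)[OF c] zero_le_square[of "sn (x \<bullet> y)"] unfolding power_mult_distrib power2_eq_square[of "sn _"] by simp
   finally show "norm (x - y) <= 2 * sn (x \<bullet> y)"
    by (rule power2_le_imp_le) (use sn_pos(1)[OF c] in simp)
  qed (use C in auto)
  finally show "\<bar>g x - g y\<bar> <= C * 2 * sn (x \<bullet> y)" by simp
 qed (use C in simp)
qed

text \<open>
 For \<open>f = green0\<close> the Laplacian of \<open>f (r (x \<cdot> y))\<close> is \<open>- 1 / (2 \<pi>^2) - (1 - r^2) f'' (r (x \<cdot> y))\<close>. Its integral
 vanishes, hence \<open>- (1 - r^2) f'' (r (x \<cdot> y))\<close> has integral 1; it tends to 0 away from \<open>x = y\<close> as \<open>r\<close> tends to 1:
 an approximation of the delta function.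
\<close>

lemma green0_laplacian:
 assumes y: "y \<in> S3" and g: "smooth g"
 shows "intS3 (%x. green0 (x \<bullet> y) * laplacian g x) = g y - 1 / (2 * pi^2) * intS3 g"
proof (rule LIMSEQ_unique)
 note cg = continuous_S3_smooth[OF g]
 show "(%n. intS3 (%x. green0 (reg n * (x \<bullet> y)) * laplacian g x)) \<longlonglongrightarrow> intS3 (%x. green0 (x \<bullet> y) * laplacian g x)"
  by (rule green0_limit(2)[OF y continuous_S3_smooth[OF Cinf_on_laplacian[OF g]]])
 define E where "E n h = intS3 (%x. (1 - (reg n)^2) * green0'' (reg n * (x \<bullet> y)) * h x)" for n h
 have ce: "continuous_on S3 (%x. (1 - (reg n)^2) * green0'' (reg n * (x \<bullet> y)) * h x)" if "continuous_on S3 h" for n h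
  by (intro continuous_intros that continuous_S3_kernel[OF green_continuous(3) y reg(1,2)])
 have eq: "intS3 (%x. green0 (reg n * (x \<bullet> y)) * laplacian h x) = - 1 / (2 * pi^2) * intS3 h - E n h"
  if h: "smooth h" for n h
 proof -
  note ch = continuous_S3_smooth[OF h]
  have "intS3 (%x. green0 (reg n * (x \<bullet> y)) * laplacian h x)
   = intS3 (%x. - 1 / (2 * pi^2) * h x - (1 - (reg n)^2) * green0'' (reg n * (x \<bullet> y)) * h x)"
   unfolding regularized_kernel.laplace[OF green0_reg[OF y] h]
  proof (rule intS3_cong)
   fix x assume "x \<in> S3"
   then have "\<bar>reg n * (x \<bullet> y)\<bar> < 1" using S3_scaled_inner_bound[OF _ y reg(1,2)] by simp
   from green0_laplace[OF this]
   show "((1 - (reg n * (x \<bullet> y))^2) * green0'' (reg n * (x \<bullet> y)) - 3 * (reg n * (x \<bullet> y)) * green0' (reg n * (x \<bullet> y))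
     - (1 - (reg n)^2) * green0'' (reg n * (x \<bullet> y))) * h x
    = - 1 / (2 * pi^2) * h x - (1 - (reg n)^2) * green0'' (reg n * (x \<bullet> y)) * h x"
    by (simp only: left_diff_distrib)
  qed
  also have "\<dots> = intS3 (%x. - 1 / (2 * pi^2) * h x) - E n h"
   unfolding E_def
   by (rule Bochner_Integration.integral_diff)
     (intro integrable_S3_continuous continuous_intros ch ce[OF ch])+
  finally show ?thesis by simp
 qed
 \<comment> \<open>The constant function shows that the kernel has total mass - 1.\<close>
 have E1: "E n (%x. 1) = - 1" for n
  using eq[OF Cinf_on_const, of n 1] measure_vol_S3 by (simp add: laplacian_def S3.space_volume)
 have Eg: "E n g = E n (%x. g x - g y) - g y" for n
 proof -
  have c0: "continuous_on S3 (%x. g x - g y)" by (intro continuous_intros cg)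
  have "E n g = intS3 (%x. (1 - (reg n)^2) * green0'' (reg n * (x \<bullet> y)) * (g x - g y)
    + g y * ((1 - (reg n)^2) * green0'' (reg n * (x \<bullet> y)) * 1))"
   unfolding E_def by (rule intS3_cong) (auto simp: algebra_simps)
  also have "\<dots> = E n (%x. g x - g y) + g y * E n (%x. 1)"
   unfolding E_def
   using integrable_S3_continuous[OF ce[OF c0, of n]] integrable_S3_continuous[OF ce[OF continuous_on_const[of _ 1], of n]]
   by (subst Bochner_Integration.integral_add) (auto intro!: integrable_mult_right)
  finally show ?thesis by (simp add: E1)
 qed
 obtain L where L: "L > 0" "!!x. x \<in> S3 ==> 0 <= x \<bullet> y ==> x \<bullet> y < 1 ==> \<bar>g x - g y\<bar> <= L * sn (x \<bullet> y)"
  using smooth_lipschitz_hemisphere[OF g y] by blast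
 have c0: "continuous_on S3 (%x. g x - g y)" by (intro continuous_intros cg)
 obtain G where G: "G > 0" "!!x. x \<in> S3 ==> \<bar>g x - g y\<bar> <= G" using S3_bounded[OF c0] by blast
 have E0: "(%n. E n (%x. g x - g y)) \<longlonglongrightarrow> intS3 (%x. 0)"
  unfolding E_def
 proof (rule S3_dominated_convergence(2)[OF y])
  show "(%x. (1 - (reg n)^2) * green0'' (reg n * (x \<bullet> y)) * (g x - g y)) \<in> borel_measurable vol_S3" for n
   by (rule measurable_S3_continuous[OF ce[OF c0]])
  fix x assume x: "x \<in> S3" "\<bar>x \<bullet> y\<bar> < 1"
  define W where "W = pole_weight (x \<bullet> y)"
  have W: "W \<ge> 0" using x by (simp add: W_def pole_weight_def abs_square_le_1)
  show "\<bar>(1 - (reg n)^2) * green0'' (reg n * (x \<bullet> y)) * (g x - g y)\<bar> <= (16 * L + 7 * G) * pole_weight (x \<bullet> y)" for n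
  proof -
   define t where "t = reg n * (x \<bullet> y)"
   define s where "s = sn t"
   note S = sn_scaled_ge[OF x(2) reg(1,2)[of n], folded t_def, folded s_def, folded W_def]
   have r0: "0 <= 1 - (reg n)^2" "1 - (reg n)^2 <= 1" using reg[of n] by (auto simp: power_le_one)
   define X where "X = \<bar>green0'' t\<bar>"
   show ?thesis
   \<comment> \<open>Near \<open>y\<close> the Lipschitz bound gains a factor \<open>sn\<close>; in the other hemisphere \<open>green0''\<close> is of lower order.\<close>
   proof (cases "0 <= x \<bullet> y")
    case True
    have X: "X * s^5 <= 16" "X \<ge> 0" using green0''_bound[OF S(2)] by (auto simp: X_def s_def)
    have "\<bar>g x - g y\<bar> <= L * s"
     using L(2)[OF x(1) True] x(2) S(1) L(1) by (smt (verit) mult_left_mono)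
    then have "\<bar>(1 - (reg n)^2) * green0'' t * (g x - g y)\<bar> <= (s * s) * X * (L * s)"
     unfolding abs_mult X_def using S(3,6) r0 by (intro mult_mono) auto
    also have "\<dots> = L * ((X * s^5) * (1 / (s * s)))" using S(3) by (simp add: power_numeral_reduce)
    also have "\<dots> <= L * (16 * W)"
     using X S L(1) W by (intro mult_left_mono mult_mono) auto
    also have "\<dots> <= (16 * L + 7 * G) * W" using G(1) W by (simp add: algebra_simps)
    finally show ?thesis by (simp add: t_def W_def)
   next
    case False
    have tn: "- 1 < t" "t <= 0" using S(2) False reg[of n] by (auto simp: t_def abs_less_iff mult_nonneg_nonpos)
    have "\<bar>3 * t * green0' t\<bar> <= 3 * 1 * 2"
     unfolding abs_mult using green0'_bound_left[OF tn] S(2) by (intro mult_mono) auto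
    moreover have "0 <= 1 / (2 * pi^2)" by simp
    ultimately have n7: "\<bar>3 * t * green0' t - 1 / (2 * pi^2)\<bar> <= 7" using inv_pi_square_le(3) by linarith
    have "X = \<bar>3 * t * green0' t - 1 / (2 * pi^2)\<bar> * (1 / (s * s))"
     unfolding X_def green0''_def s_def sn_pos(2)[OF S(2)] using sn_pos(2)[OF S(2)]
     by (simp add: abs_mult flip: sn_pos(2)[OF S(2)])
    also have "\<dots> <= 7 * W" using n7 S by (intro mult_mono) auto
    finally have X: "X <= 7 * W" .
    have "\<bar>(1 - (reg n)^2) * green0'' t * (g x - g y)\<bar> <= 1 * (7 * W) * G"
     unfolding abs_mult using X r0 G(2)[OF x(1)] W by (intro mult_mono) (auto simp: X_def)
    also have "\<dots> <= (16 * L + 7 * G) * W" using L(1) W by (simp add: algebra_simps)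
    finally show ?thesis by (simp add: t_def W_def)
   qed
  qed
  have "isCont green0'' (x \<bullet> y)"
   using green_continuous(3) x(2) by (auto simp: continuous_on_eq_continuous_at abs_less_iff)
  moreover have "(%n. reg n * (x \<bullet> y)) \<longlonglongrightarrow> 1 * (x \<bullet> y)" by (intro tendsto_intros reg_tendsto)
  ultimately have "(%n. green0'' (reg n * (x \<bullet> y))) \<longlonglongrightarrow> green0'' (x \<bullet> y)"
   by (metis isCont_tendsto_compose mult_1)
  then have "(%n. (1 - (reg n)^2) * green0'' (reg n * (x \<bullet> y)) * (g x - g y))
    \<longlonglongrightarrow> (1 - 1\<^sup>2) * green0'' (x \<bullet> y) * (g x - g y)" by (intro tendsto_intros reg_tendsto)
  then show "(%n. (1 - (reg n)^2) * green0'' (reg n * (x \<bullet> y)) * (g x - g y)) \<longlonglongrightarrow> 0" by simp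
 qed simp
 have "(%n. - 1 / (2 * pi^2) * intS3 g - (E n (%x. g x - g y) - g y))
  \<longlonglongrightarrow> - 1 / (2 * pi^2) * intS3 g - (intS3 (%x. 0) - g y)"
  by (intro tendsto_intros E0)
 then show "(%n. intS3 (%x. green0 (reg n * (x \<bullet> y)) * laplacian g x)) \<longlonglongrightarrow> g y - 1 / (2 * pi^2) * intS3 g"
  unfolding eq[OF g] Eg by simp
qed

section \<open>Convolutions\<close>

text \<open>The convolution on the group, written so that \<open>y\<close> occurs in the smooth factor only: all derivatives fall on \<open>F\<close>.\<close>

definition conv :: "(R4 => real) => (R4 => real) => R4 => real" where
 "conv \<kappa> F y = intS3 (%g. \<kappa> g * F (qmult g y))"

lemma qmult_S3_punctured: "g \<in> S3 ==> y \<in> punctured ==> qmult g y \<in> punctured"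
 using norm_qmult[of g y] by (auto simp: S3_def)

lemma conv_integrable:
 fixes F :: "R4 => real"
 assumes k: "integrable vol_S3 \<kappa>" and F: "continuous_on S3 F"
 shows "integrable vol_S3 (%g. \<kappa> g * F g)"
proof -
 obtain C where C: "C > 0" "!!x. x \<in> S3 ==> \<bar>F x\<bar> <= C" using S3_bounded[OF F] by blast
 note measurable_S3_continuous[OF F, measurable] borel_measurable_integrable[OF k, measurable]
 show ?thesis
 proof (rule Bochner_Integration.integrable_bound[of _ "%g. C * \<kappa> g"])
  show "integrable vol_S3 (%g. C * \<kappa> g)" using k by simp
  show "AE g in vol_S3. norm (\<kappa> g * F g) <= norm (C * \<kappa> g)"
  proof (rule AE_I2)
   fix g assume "g \<in> space vol_S3"
   then have "\<bar>F g\<bar> * \<bar>\<kappa> g\<bar> <= C * \<bar>\<kappa> g\<bar>" using C(2) by (intro mult_right_mono) (auto simp: S3.space_volume)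
   then show "norm (\<kappa> g * F g) <= norm (C * \<kappa> g)" using C(1) by (simp add: abs_mult mult.commute)
  qed
 qed measurable
qed

lemma continuous_translate:
 fixes F :: "R4 => 'b::topological_space"
 assumes "continuous_on punctured F" "y \<in> punctured"
 shows "continuous_on S3 (%g. F (qmult g y))"
proof (rule continuous_on_compose2[OF assms(1)])
 show "(%g. qmult g y) ` S3 \<subseteq> punctured" by (rule image_subsetI) (rule qmult_S3_punctured[OF _ assms(2)])
qed (intro continuous_intros)

text \<open>
 Differentiation under the integral sign: on compact sets the remainder of the first order Taylor
 expansion of \<open>F\<close> is uniformly small.
\<close>

lemma conv_has_derivative:
 assumes k: "integrable vol_S3 \<kappa>" and F: "smooth F" and y: "y \<in> punctured"
 shows "(conv \<kappa> F has_derivative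
  (%h. intS3 (%g. \<kappa> g * frechet_derivative F (at (qmult g y)) (qmult g h)))) (at y)"
proof -
 define G where "G z = (\<Sum>b\<in>Basis. fderiv F z b *\<^sub>R b)" for z
 have G: "fderiv F z h = G z \<bullet> h" if "z \<in> punctured" for z h
  unfolding G_def by (rule frechet_derivative_gradient[OF Cinf_on_differentiable[OF F that]])
 have dF: "(F has_derivative (%h. G z \<bullet> h)) (at z)" if "z \<in> punctured" for z
 proof -
  have "fderiv F z = (%h. G z \<bullet> h)" using G[OF that] by (rule ext)
  then show ?thesis using Cinf_on_has_derivative[OF F that] by simp
 qed
 have cG: "continuous_on punctured G"
  unfolding G_def by (intro continuous_intros Cinf_on_continuous Cinf_on_derivative F)
 have cF: "continuous_on punctured F" by (rule Cinf_on_continuous[OF F])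
 have gy: "qmult g y \<in> punctured" if "g \<in> S3" for g by (rule qmult_S3_punctured[OF that y])
 define D where "D h = intS3 (%g. \<kappa> g * (G (qmult g y) \<bullet> qmult g h))" for h
 have D: "intS3 (%g. \<kappa> g * frechet_derivative F (at (qmult g y)) (qmult g h)) = D h" for h
  unfolding D_def by (rule intS3_cong) (auto simp: G[OF gy])
 have ID: "integrable vol_S3 (%g. \<kappa> g * (G (qmult g y) \<bullet> qmult g h))" for h
  by (rule conv_integrable[OF k]) (intro continuous_intros continuous_translate[OF cG y])
 have IF: "integrable vol_S3 (%g. \<kappa> g * F (qmult g z))" if "z \<in> punctured" for z
  by (rule conv_integrable[OF k continuous_translate[OF cF that]])
 have "linear D"
 proof (rule linearI)
  show "D (h + h') = D h + D h'" for h h'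
   unfolding D_def by (subst Bochner_Integration.integral_add[symmetric, OF ID ID]) (simp add: inner_add_right distrib_left)
  show "D (c *\<^sub>R h) = c *\<^sub>R D h" for c h
   unfolding D_def by (simp add: mult.left_commute)
 qed
 then have blD: "bounded_linear D" by (rule linear_conv_bounded_linear[THEN iffD1])
 have "(conv \<kappa> F has_derivative D) (at y)"
  unfolding has_derivative_at_alt
 proof (intro conjI allI impI blD)
  fix e :: real assume e: "e > 0"
  define N where "N = intS3 (%g. \<bar>\<kappa> g\<bar>)"
  have N: "N \<ge> 0" unfolding N_def by (rule Bochner_Integration.integral_nonneg) simp
  define \<epsilon> where "\<epsilon> = e / (N + 1)"
  have \<epsilon>: "\<epsilon> > 0" using e N by (simp add: \<epsilon>_def)
  have y0: "norm y > 0" using y by simp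
  \<comment> \<open>A compact set that contains the segments from \<open>g y\<close> to \<open>g z\<close> for all \<open>g\<close>, if \<open>z\<close> is near \<open>y\<close>.\<close>
  define K where "K = cball (0::R4) (2 * norm y) - ball 0 (norm y / 2)"
  have K: "compact K" unfolding K_def by (intro compact_diff compact_cball open_ball)
  have KP: "K \<subseteq> punctured" using y0 by (auto simp: K_def)
  have "uniformly_continuous_on K G"
   by (rule compact_uniformly_continuous[OF continuous_on_subset[OF cG KP] K])
  then obtain \<delta> where \<delta>: "\<delta> > 0" "!!z z'. z \<in> K ==> z' \<in> K ==> dist z' z < \<delta> ==> dist (G z') (G z) < \<epsilon>"
   using \<epsilon> unfolding uniformly_continuous_on_def by metis
  define d where "d = min \<delta> (norm y / 2)"
  have d: "d > 0" using \<delta>(1) y0 by (simp add: d_def)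
  have main: "norm (conv \<kappa> F z - conv \<kappa> F y - D (z - y)) <= e * norm (z - y)" if z: "norm (z - y) < d" for z
  proof -
   define h where "h = z - y"
   have hd: "norm h < \<delta>" "norm h < norm y / 2" using z by (auto simp: h_def d_def)
   have zP: "z \<in> punctured"
    using hd(2) y0 norm_triangle_ineq2[of y "y - z"] by (auto simp: h_def norm_minus_commute)
   have est: "\<bar>F (qmult g z) - F (qmult g y) - G (qmult g y) \<bullet> qmult g h\<bar> <= \<epsilon> * norm h" if g: "g \<in> S3" for g
   proof -
    define l where "l t = qmult g y + t *\<^sub>R qmult g h" for t
    have ng: "norm (qmult g x) = norm x" for x using g by (simp add: norm_qmult S3_def)
    have lK: "l t \<in> K" "dist (l t) (l 0) < \<delta>" if t: "0 <= t" "t <= 1" for t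
    proof -
     have th: "norm (t *\<^sub>R qmult g h) <= norm h" using t mult_left_le_one_le[of "norm h" t] by (simp add: ng)
     have "norm (l t) <= norm y + norm h"
      unfolding l_def using norm_triangle_ineq[of "qmult g y" "t *\<^sub>R qmult g h"] th ng by simp
     moreover have "norm (l t) \<ge> norm y - norm h"
      unfolding l_def using norm_diff_ineq[of "qmult g y" "t *\<^sub>R qmult g h"] th ng by simp
     ultimately show "l t \<in> K" using hd(2) by (simp add: K_def)
     show "dist (l t) (l 0) < \<delta>" using th hd(1) by (simp add: l_def dist_norm)
    qed
    have dl: "((%t. F (l t)) has_real_derivative G (l t) \<bullet> qmult g h) (at t)" if "0 <= t" "t <= 1" for t
    proof -
     have "(l has_derivative (%s. s *\<^sub>R qmult g h)) (at t)" unfolding l_def by (auto intro!: derivative_eq_intros)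
     from has_derivative_compose[OF this dF] lK(1)[OF that] KP
     have "((%t. F (l t)) has_derivative (%s. G (l t) \<bullet> (s *\<^sub>R qmult g h))) (at t)" by blast
     then show ?thesis by (simp add: has_field_derivative_def mult_commute_abs)
    qed
    obtain t where t: "0 < t" "t < 1" "F (l 1) - F (l 0) = (1 - 0) * (G (l t) \<bullet> qmult g h)"
     using MVT2[of 0 1 "%t. F (l t)" "%t. G (l t) \<bullet> qmult g h"] dl by auto
    have l01: "l 1 = qmult g z" "l 0 = qmult g y" by (simp_all add: l_def h_def)
    have "F (qmult g z) - F (qmult g y) - G (qmult g y) \<bullet> qmult g h = (G (l t) - G (l 0)) \<bullet> qmult g h"
     using t(3) unfolding l01 by (simp add: inner_diff_left)
    also have "\<bar>\<dots>\<bar> <= norm (G (l t) - G (l 0)) * norm (qmult g h)" by (rule Cauchy_Schwarz_ineq2)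
    also have "\<dots> <= \<epsilon> * norm h"
     unfolding ng using \<delta>(2)[OF lK(1)[of 0] lK(1)[of t] lK(2)[of t]] t
     by (intro mult_right_mono) (auto simp: dist_norm)
    finally show ?thesis .
   qed
   have IR: "integrable vol_S3 (%g. \<kappa> g * F (qmult g z) - \<kappa> g * F (qmult g y) - \<kappa> g * (G (qmult g y) \<bullet> qmult g h))"
    by (intro Bochner_Integration.integrable_diff IF ID zP y)
   have "conv \<kappa> F z - conv \<kappa> F y - D h
     = intS3 (%g. \<kappa> g * F (qmult g z) - \<kappa> g * F (qmult g y) - \<kappa> g * (G (qmult g y) \<bullet> qmult g h))"
    unfolding conv_def D_def
    by (simp add: Bochner_Integration.integral_diff Bochner_Integration.integrable_diff IF[OF zP] IF[OF y] ID)
   also have "\<bar>\<dots>\<bar> <= intS3 (%g. \<bar>\<kappa> g\<bar> * (\<epsilon> * norm h))"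
   proof (rule order_trans[OF integral_abs_bound integral_mono])
    show "integrable vol_S3 (%g. \<bar>\<kappa> g * F (qmult g z) - \<kappa> g * F (qmult g y) - \<kappa> g * (G (qmult g y) \<bullet> qmult g h)\<bar>)"
     by (rule integrable_abs[OF IR])
    show "integrable vol_S3 (%g. \<bar>\<kappa> g\<bar> * (\<epsilon> * norm h))" using k by simp
    fix g assume "g \<in> space vol_S3"
    then have g: "g \<in> S3" by (simp add: S3.space_volume)
    have "\<bar>\<kappa> g * F (qmult g z) - \<kappa> g * F (qmult g y) - \<kappa> g * (G (qmult g y) \<bullet> qmult g h)\<bar>
      = \<bar>\<kappa> g\<bar> * \<bar>F (qmult g z) - F (qmult g y) - G (qmult g y) \<bullet> qmult g h\<bar>"
     by (simp only: abs_mult[symmetric] right_diff_distrib)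
    also have "\<dots> <= \<bar>\<kappa> g\<bar> * (\<epsilon> * norm h)" by (rule mult_left_mono[OF est[OF g]]) simp
    finally show "\<bar>\<kappa> g * F (qmult g z) - \<kappa> g * F (qmult g y) - \<kappa> g * (G (qmult g y) \<bullet> qmult g h)\<bar> <= \<bar>\<kappa> g\<bar> * (\<epsilon> * norm h)" .
   qed
   also have "\<dots> = N * (\<epsilon> * norm h)" by (simp add: N_def)
   also have "\<dots> <= e * norm h"
   proof -
    have "N * \<epsilon> <= e" using e N unfolding \<epsilon>_def by (simp add: divide_le_eq algebra_simps)
    then have "(N * \<epsilon>) * norm h <= e * norm h" by (rule mult_right_mono) simp
    then show ?thesis by simp
   qed
   finally show ?thesis by (simp add: h_def)
  qed
  then show "\<exists>d>0. \<forall>z. norm (z - y) < d --> norm (conv \<kappa> F z - conv \<kappa> F y - D (z - y)) <= e * norm (z - y)"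
   using d by blast
 qed
 then show ?thesis by (simp add: D)
qed

lemma conv_Ck: "integrable vol_S3 \<kappa> ==> smooth F ==> Ck_on n (conv \<kappa> F) punctured"
proof (induction n arbitrary: \<kappa> F)
 case 0
 then show ?case
  by (auto intro!: continuous_at_imp_continuous_on has_derivative_continuous[OF conv_has_derivative])
next
 case (Suc n)
 show ?case
 proof (rule Ck_on_SucI[OF open_punctured])
  show "(conv \<kappa> F has_derivative
   (%h. intS3 (%g. \<kappa> g * frechet_derivative F (at (qmult g y)) (qmult g h)))) (at y)" if "y \<in> punctured" for y
   by (rule conv_has_derivative[OF Suc.prems that])
  fix h
  have k: "integrable vol_S3 (%g. \<kappa> g * (qmult g h \<bullet> b))" for b
   by (rule conv_integrable[OF Suc.prems(1)]) (intro continuous_intros)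
  have F: "smooth (%z. fderiv F z b)" for b
   by (rule Cinf_on_derivative[OF Suc.prems(2)])
  show "Ck_on n (%y. intS3 (%g. \<kappa> g * frechet_derivative F (at (qmult g y)) (qmult g h))) punctured"
  proof (rule Ck_on_cong_imp[OF open_punctured])
   show "Ck_on n (%y. \<Sum>b\<in>Basis. conv (%g. \<kappa> g * (qmult g h \<bullet> b)) (%z. fderiv F z b) y) punctured"
    by (rule Ck_on_sum[OF open_punctured finite_Basis]) (rule Suc.IH[OF k F])
   fix y assume y: "y \<in> punctured"
   have I: "integrable vol_S3 (%g. (\<kappa> g * (qmult g h \<bullet> b)) * frechet_derivative F (at (qmult g y)) b)" for b
    by (rule conv_integrable[OF k continuous_translate[OF Cinf_on_continuous[OF F] y]])
   have "(\<Sum>b\<in>Basis. conv (%g. \<kappa> g * (qmult g h \<bullet> b)) (%z. fderiv F z b) y)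
     = intS3 (%g. \<Sum>b\<in>Basis. (\<kappa> g * (qmult g h \<bullet> b)) * frechet_derivative F (at (qmult g y)) b)"
    unfolding conv_def by (rule Bochner_Integration.integral_sum[symmetric]) (rule I)
   also have "\<dots> = intS3 (%g. \<kappa> g * frechet_derivative F (at (qmult g y)) (qmult g h))"
   proof (rule intS3_cong)
    fix g assume "g \<in> S3"
    then have "qmult g y \<in> punctured" using qmult_S3_punctured[OF _ y] by simp
    then have "frechet_derivative F (at (qmult g y)) (qmult g h)
     = (\<Sum>b\<in>Basis. (qmult g h \<bullet> b) *\<^sub>R frechet_derivative F (at (qmult g y)) b)"
     by (intro frechet_derivative_basis_expansion Cinf_on_differentiable[OF Suc.prems(2)])
    then show "(\<Sum>b\<in>Basis. (\<kappa> g * (qmult g h \<bullet> b)) * frechet_derivative F (at (qmult g y)) b)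
     = \<kappa> g * frechet_derivative F (at (qmult g y)) (qmult g h)"
     by (simp only: sum_distrib_left real_scaleR_def mult.assoc)
   qed
   finally show "(\<Sum>b\<in>Basis. conv (%g. \<kappa> g * (qmult g h \<bullet> b)) (%z. fderiv F z b) y)
    = intS3 (%g. \<kappa> g * frechet_derivative F (at (qmult g y)) (qmult g h))" .
  qed
 qed
qed

lemma Cinf_on_conv: "integrable vol_S3 \<kappa> ==> smooth F ==> smooth (conv \<kappa> F)"
 unfolding Cinf_on_def[of "conv \<kappa> F"] using conv_Ck by blast

text \<open>Left-invariant derivatives commute with convolutions from the left.\<close>

lemma Lie_conv:
 assumes "integrable vol_S3 \<kappa>" "smooth F" "y \<in> punctured"
 shows "Lie p (conv \<kappa> F) y = conv \<kappa> (Lie p F) y"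
 unfolding Lie_def[of p "conv \<kappa> F"] frechet_derivative_at[OF conv_has_derivative[OF assms], symmetric]
 by (simp add: conv_def Lie_def qmult_assoc)

text \<open>
 Substitute \<open>x = g y\<close>: then \<open>x \<cdot> y = g \<cdot> 1\<close>. So convolution with a function of the real part is integration against
 a kernel that depends on the distance only.
\<close>

lemma conv_class_function:
 assumes y: "y \<in> S3" and m: "(%x. f (x \<bullet> y)) \<in> borel_measurable vol_S3" "F \<in> borel_measurable vol_S3"
 shows "conv (%g. f (g $ 1)) F y = intS3 (%x. f (x \<bullet> y) * F x)"
proof -
 have "qmult g y \<bullet> y = g $ 1" for g
  using y by (simp add: inner_qmult_left qconj_mult_self S3_iff_inner) (simp add: inner_R4)
 moreover have "intS3 (%g. f (qmult g y \<bullet> y) * F (qmult g y)) = intS3 (%x. f (x \<bullet> y) * F x)"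
  by (rule intS3_right_mult[OF y]) (use m in measurable)
 ultimately show ?thesis by (simp add: conv_def)
qed

lemma inner_qone: "x \<bullet> qone = x $ 1"
 by (simp add: inner_R4)

lemma green_class_integrable:
 "integrable vol_S3 (%g. green0 (g $ 1))" "integrable vol_S3 (%g. green1 (g $ 1))"
 using green0_limit(1)[OF qunit_in_S3(1) continuous_on_const[of _ 1]]
  green1_limit(1)[OF qunit_in_S3(1) continuous_on_const[of _ 1]]
 by (simp_all add: inner_qone)

definition G0 :: "(R4 => real) => R4 => real" where "G0 = conv (%g. green0 (g $ 1))"
definition G1 :: "(R4 => real) => R4 => real" where "G1 = conv (%g. green1 (g $ 1))"

lemma Cinf_on_G [intro]:
 "smooth F ==> smooth (G0 F)" "smooth F ==> smooth (G1 F)"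
 unfolding G0_def G1_def by (intro Cinf_on_conv green_class_integrable; assumption)+

lemma Lie_G:
 assumes "smooth F" "y \<in> punctured"
 shows "Lie p (G0 F) y = G0 (Lie p F) y" "Lie p (G1 F) y = G1 (Lie p F) y"
 unfolding G0_def G1_def using Lie_conv[OF _ assms] green_class_integrable by auto

lemma G_eq:
 assumes "y \<in> S3" "continuous_on S3 F"
 shows "G0 F y = intS3 (%x. green0 (x \<bullet> y) * F x)" "G1 F y = intS3 (%x. green1 (x \<bullet> y) * F x)"
 unfolding G0_def G1_def
 using conv_class_function[OF assms(1) green_measurable_S3(1)[OF assms(1)] measurable_S3_continuous[OF assms(2)]]
  conv_class_function[OF assms(1) green_measurable_S3(3)[OF assms(1)] measurable_S3_continuous[OF assms(2)]] by auto

section \<open>Vector fields in the left-invariant frame\<close>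

text \<open>Components are extended to the punctured space with degree 0, to make them smooth functions on an open set.\<close>

definition frame_comp :: "(R4 => R4) => R4 => R4 => real" where
 "frame_comp w p z = w (z /\<^sub>R norm z) \<bullet> qmult (z /\<^sub>R norm z) p"

definition frame_field :: "(R4 => real) => (R4 => real) => (R4 => real) => R4 => R4" where
 "frame_field a b c y = a y *\<^sub>R qmult y qi + b y *\<^sub>R qmult y qj + c y *\<^sub>R qmult y qk"

lemma frame_comp_S3: "x \<in> S3 ==> frame_comp w p x = w x \<bullet> qmult x p"
 by (simp add: frame_comp_def S3_def)

lemma Cinf_on_frame_comp: "smooth_map_on S3 w ==> smooth (frame_comp w p)"
 unfolding frame_comp_def[abs_def]
 by (intro Cinf_on_inner open_punctured smooth_map_on_S3_extend
   Cinf_on_bounded_linear[OF qmult.bounded_linear_left] Cinf_on_normalize)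

lemma frame_field_eq_qmult:
 "frame_field a b c y = qmult y (vector [0, a y, b y, c y])"
 by (simp add: frame_field_def qcoords algebra_simps)

lemma tangent_as_qmult:
 assumes "y \<in> S3" "y \<bullet> h = 0"
 obtains p where "h = qmult y p" "p $ 1 = 0"
 by (rule that[of "qmult (qconj y) h"]) (use assms in \<open>auto simp: qconj_cancel qcoords\<close>)

lemma inner_qmult_imag: "p $ 1 = 0 ==> y \<bullet> qmult y p = 0"
 by (simp add: inner_commute[of y] inner_qmult_imaginary)

lemma frame_expansion:
 assumes y: "y \<in> S3" and t: "y \<bullet> w y = 0"
 shows "w y = frame_field (frame_comp w qi) (frame_comp w qj) (frame_comp w qk) y"
proof -
 obtain p where p: "w y = qmult y p" "p $ 1 = 0" using tangent_as_qmult[OF y t] by blast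
 have "qmult y p \<bullet> qmult y q = p \<bullet> q" for q
  using y by (simp add: inner_qmult_same_left S3_iff_inner)
 then have "vector [0, frame_comp w qi y, frame_comp w qj y, frame_comp w qk y] = p"
  using p(2) by (simp add: R4_eq_iff frame_comp_S3[OF y] p(1) inner_R4)
 then show ?thesis by (simp add: frame_field_eq_qmult p(1))
qed

lemma frame_comp_frame_field:
 assumes y: "y \<in> S3"
 shows "frame_field a b c y \<bullet> qmult y qi = a y" "frame_field a b c y \<bullet> qmult y qj = b y"
  "frame_field a b c y \<bullet> qmult y qk = c y"
 using y by (simp_all add: frame_field_eq_qmult inner_qmult_same_left S3_iff_inner inner_R4[of _ qi] inner_R4[of _ qj] inner_R4[of _ qk])

lemma frame_field_tangent: "y \<bullet> frame_field a b c y = 0"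
 by (simp add: frame_field_eq_qmult inner_qmult_imag)

lemma Cinf_on_frame_field:
 "smooth a ==> smooth b ==> smooth c ==> smooth (frame_field a b c)"
 unfolding frame_field_def[abs_def]
 by (intro Cinf_on_add Cinf_on_scaleR open_punctured Cinf_on_bounded_linear[OF qmult.bounded_linear_left] Cinf_on_id)

lemma Lie_imag:
 assumes F: "smooth F" and y: "y \<in> S3" and p: "p $ 1 = 0"
 shows "Lie p F y = p$2 * Lie qi F y + p$3 * Lie qj F y + p$4 * Lie qk F y"
proof -
 have lin: "linear (fderiv F y)"
  by (rule linear_frechet_derivative[OF Cinf_on_differentiable[OF F S3_subset_punctured[OF y]]])
 have "p = p$2 *\<^sub>R qi + p$3 *\<^sub>R qj + p$4 *\<^sub>R qk" using p by (simp add: R4_eq_iff)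
 then have "qmult y p = p$2 *\<^sub>R qmult y qi + p$3 *\<^sub>R qmult y qj + p$4 *\<^sub>R qmult y qk"
  by (metis qmult_lin(2) qmult_lin(6))
 then show ?thesis by (simp add: Lie_def linear_add[OF lin] linear_scale[OF lin])
qed

lemma frame_field_derivative:
 assumes a: "smooth a" and b: "smooth b" and c: "smooth c"
  and w: "!!z. z \<in> S3 ==> w z = frame_field a b c z" and y: "y \<in> S3" and p: "p $ 1 = 0"
 shows "frechet_derivative w (at y within S3) (qmult y p)
  = qmult y (vector [0, Lie p a y, Lie p b y, Lie p c y] + qmult p (vector [0, a y, b y, c y]))"
proof -
 have d: "(f has_derivative fderiv f y) (at y)" if "smooth f" for f :: "R4 => real"
  by (rule Cinf_on_has_derivative[OF that S3_subset_punctured[OF y]])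
 have l: "((%z. qmult z q) has_derivative (%h. qmult h q)) (at y)" for q
  by (rule bounded_linear_imp_has_derivative[OF qmult.bounded_linear_left])
 let ?D = "%h. (a y *\<^sub>R qmult h qi + fderiv a y h *\<^sub>R qmult y qi)
   + (b y *\<^sub>R qmult h qj + fderiv b y h *\<^sub>R qmult y qj)
   + (c y *\<^sub>R qmult h qk + fderiv c y h *\<^sub>R qmult y qk)"
 have "(frame_field a b c has_derivative ?D) (at y)"
  unfolding frame_field_def[abs_def] by (intro has_derivative_add has_derivative_scaleR d l a b c)
 then have "(frame_field a b c has_derivative ?D) (at y within S3)" by (rule has_derivative_at_withinI)
 then have D: "(w has_derivative ?D) (at y within S3)"
  by (rule has_derivative_transform[OF y w, rotated])
 then have "(w has_derivative frechet_derivative w (at y within S3)) (at y within S3)"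
  using differentiableI frechet_derivative_works by blast
 then have "frechet_derivative w (at y within S3) (qmult y p) = ?D (qmult y p)"
  by (rule S3.derivative_within_unique[OF y inner_qmult_imag[OF p] _ D])
 also have "\<dots> = qmult y (vector [0, Lie p a y, Lie p b y, Lie p c y] + qmult p (vector [0, a y, b y, c y]))"
 proof -
  have v: "vector [0, s, t, u] = s *\<^sub>R qi + t *\<^sub>R qj + u *\<^sub>R qk" for s t u by (simp add: R4_eq_iff)
  show ?thesis unfolding v by (simp add: Lie_def qmult_assoc algebra_simps)
 qed
 finally show ?thesis .
qed

definition curl_comp :: "(R4 => real) => (R4 => real) => (R4 => real) => (R4 => R4)" where
 "curl_comp a b c y = vector [0,
   Lie qj c y - Lie qk b y - 2 * a y,
   Lie qk a y - Lie qi c y - 2 * b y,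
   Lie qi b y - Lie qj a y - 2 * c y]"

text \<open>
 The first order part of the curl is that of flat space; the zero order part comes from the rotation
 of the frame: left-invariant fields have curl \<open>- 2\<close> times themselves.
\<close>

lemma curl_S3_frame_field:
 assumes a: "smooth a" and b: "smooth b" and c: "smooth c"
  and w: "!!z. z \<in> S3 ==> w z = frame_field a b c z" and y: "y \<in> S3"
 shows "curl_S3 w y = qmult y (curl_comp a b c y)"
 unfolding curl_S3_def Let_def
proof (rule the_equality)
 let ?D = "frechet_derivative w (at y within S3)"
 have ip: "qmult y q \<bullet> qmult y r = q \<bullet> r" for q r using y by (simp add: inner_qmult_same_left S3_iff_inner)
 have fd: "?D (qmult y p) = qmult y (vector [0, Lie p a y, Lie p b y, Lie p c y] + qmult p (vector [0, a y, b y, c y]))"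
  if "p $ 1 = 0" for p
  by (rule frame_field_derivative[OF a b c _ y that]) (rule w)
 have D: "?D (qmult y p) \<bullet> qmult y q - ?D (qmult y q) \<bullet> qmult y p
   = qmult y (curl_comp a b c y) \<bullet> cross_S3 y (qmult y p) (qmult y q)" if p: "p $ 1 = 0" and q: "q $ 1 = 0" for p q
 proof -
  have "qmult y (curl_comp a b c y) \<bullet> cross_S3 y (qmult y p) (qmult y q)
    = det4 y (qmult y p) (qmult y q) (qmult y (curl_comp a b c y))"
   by (subst inner_commute) (rule cross_S3_inner)
  also have "\<dots> = p$2 * (q$3 * curl_comp a b c y$4 - q$4 * curl_comp a b c y$3)
    - p$3 * (q$2 * curl_comp a b c y$4 - q$4 * curl_comp a b c y$2)
    + p$4 * (q$2 * curl_comp a b c y$3 - q$3 * curl_comp a b c y$2)"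
   by (rule det_frame[OF y])
  also have "\<dots> = ?D (qmult y p) \<bullet> qmult y q - ?D (qmult y q) \<bullet> qmult y p"
   unfolding fd[OF p] fd[OF q] ip
    Lie_imag[OF a y p] Lie_imag[OF b y p] Lie_imag[OF c y p]
    Lie_imag[OF a y q] Lie_imag[OF b y q] Lie_imag[OF c y q]
   using p q by (simp add: inner_R4 qmult_nth curl_comp_def algebra_simps)
  finally show ?thesis by (rule sym)
 qed
 show "qmult y (curl_comp a b c y) \<in> tangent (\<bullet>) y \<and> (\<forall>h\<in>tangent (\<bullet>) y. \<forall>k\<in>tangent (\<bullet>) y.
   ?D h \<bullet> k - ?D k \<bullet> h = qmult y (curl_comp a b c y) \<bullet> cross_S3 y h k)"
 proof (intro conjI ballI)
  show "qmult y (curl_comp a b c y) \<in> tangent (\<bullet>) y"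
   by (simp add: tangent_def inner_qmult_imag curl_comp_def)
  fix h k assume "h \<in> tangent (\<bullet>) y" "k \<in> tangent (\<bullet>) y"
  then have "y \<bullet> h = 0" "y \<bullet> k = 0" by (auto simp: tangent_def)
  then obtain p q where "h = qmult y p" "p $ 1 = 0" "k = qmult y q" "q $ 1 = 0"
   using tangent_as_qmult[OF y] by metis
  then show "?D h \<bullet> k - ?D k \<bullet> h = qmult y (curl_comp a b c y) \<bullet> cross_S3 y h k" using D by simp
 qed
 fix z assume z: "z \<in> tangent (\<bullet>) y \<and> (\<forall>h\<in>tangent (\<bullet>) y. \<forall>k\<in>tangent (\<bullet>) y.
   ?D h \<bullet> k - ?D k \<bullet> h = z \<bullet> cross_S3 y h k)"
 then have "y \<bullet> z = 0" by (simp add: tangent_def)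
 then obtain r where r: "z = qmult y r" "r $ 1 = 0" using tangent_as_qmult[OF y] by blast
 have tq: "qmult y p \<in> tangent (\<bullet>) y" if "p $ 1 = 0" for p
  using that by (simp add: tangent_def inner_qmult_imag)
 have eq: "qmult y r \<bullet> cross_S3 y (qmult y p) (qmult y q) = qmult y (curl_comp a b c y) \<bullet> cross_S3 y (qmult y p) (qmult y q)"
  if "p $ 1 = 0" "q $ 1 = 0" for p q
  using z tq[OF that(1)] tq[OF that(2)] D[OF that] unfolding r(1) by (metis (no_types, lifting))
 have cr: "qmult y s \<bullet> cross_S3 y (qmult y p) (qmult y q)
   = p$2 * (q$3 * s$4 - q$4 * s$3) - p$3 * (q$2 * s$4 - q$4 * s$2) + p$4 * (q$2 * s$3 - q$3 * s$2)"
  if "p $ 1 = 0" "q $ 1 = 0" "s $ 1 = 0" for p q s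
  by (subst inner_commute, subst cross_S3_inner) (rule det_frame[OF y])
 have c1: "curl_comp a b c y $ 1 = 0" by (simp add: curl_comp_def)
 have "r = curl_comp a b c y"
  using eq[of qj qk] eq[of qk qi] eq[of qi qj] r(2) c1
  by (simp add: cr R4_eq_iff)
 then show "z = qmult y (curl_comp a b c y)" by (simp add: r(1))
qed

text \<open>The rows of an orthogonal matrix are orthonormal, hence so are its columns.\<close>

lemma orthonormal_triple_completeness:
 fixes p q r :: R4
 assumes "p $ 1 = 0" "q $ 1 = 0" "r $ 1 = 0"
  and "p \<bullet> p = 1" "q \<bullet> q = 1" "r \<bullet> r = 1" "p \<bullet> q = 0" "p \<bullet> r = 0" "q \<bullet> r = 0"
 shows "p$2 * p$2 + q$2 * q$2 + r$2 * r$2 = 1" (is ?g1) "p$3 * p$3 + q$3 * q$3 + r$3 * r$3 = 1" (is ?g2) "p$4 * p$4 + q$4 * q$4 + r$4 * r$4 = 1" (is ?g3)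
  "p$2 * p$3 + q$2 * q$3 + r$2 * r$3 = 0" (is ?g4) "p$2 * p$4 + q$2 * q$4 + r$2 * r$4 = 0" (is ?g5) "p$3 * p$4 + q$3 * q$4 + r$3 * r$4 = 0" (is ?g6)
proof -
 define A :: "real^3^3" where "A = vector [spatial p, spatial q, spatial r]"
 have A: "A$1 = spatial p" "A$2 = spatial q" "A$3 = spatial r" by (simp_all add: A_def vector_3)
 have sp: "spatial p $ 1 = p$2" "spatial p $ 2 = p$3" "spatial p $ 3 = p$4"
   "spatial q $ 1 = q$2" "spatial q $ 2 = q$3" "spatial q $ 3 = q$4"
   "spatial r $ 1 = r$2" "spatial r $ 2 = r$3" "spatial r $ 3 = r$4"
  by (simp_all add: spatial_def vector_3)
 have "A ** transpose A = mat 1"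
  using assms by (simp add: vec_eq_iff forall_3 matrix_matrix_mult_def transpose_def mat_def sum_3 A sp inner_R4 mult.commute)
 then have "transpose A ** A = mat 1" by (simp add: matrix_left_right_inverse)
 then have "!!i j. (transpose A ** A) $ i $ j = (mat 1 :: real^3^3) $ i $ j" by simp
 from this[of 1 1] this[of 2 2] this[of 3 3] this[of 1 2] this[of 1 3] this[of 2 3]
 show ?g1 ?g2 ?g3
  ?g4 ?g5 ?g6
  by (simp_all add: matrix_matrix_mult_def transpose_def mat_def sum_3 A sp)
qed

lemma div_S3_frame_field:
 assumes a: "smooth a" and b: "smooth b" and c: "smooth c"
  and w: "!!z. z \<in> S3 ==> w z = frame_field a b c z" and y: "y \<in> S3"
 shows "div_S3 w y = Lie qi a y + Lie qj b y + Lie qk c y"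
 unfolding div_S3_def Let_def
proof (rule the_equality)
 let ?D = "frechet_derivative w (at y within S3)"
 let ?d = "Lie qi a y + Lie qj b y + Lie qk c y"
 have ip: "qmult y q \<bullet> qmult y r = q \<bullet> r" for q r using y by (simp add: inner_qmult_same_left S3_iff_inner)
 have fd: "?D (qmult y p) = qmult y (vector [0, Lie p a y, Lie p b y, Lie p c y] + qmult p (vector [0, a y, b y, c y]))"
  if "p $ 1 = 0" for p
  by (rule frame_field_derivative[OF a b c _ y that]) (rule w)
 have D: "?D (qmult y p) \<bullet> qmult y p = p$2 * Lie p a y + p$3 * Lie p b y + p$4 * Lie p c y"
  if p: "p $ 1 = 0" for p
  unfolding fd[OF p] ip using p by (simp add: inner_R4 qmult_nth algebra_simps)
 show "\<forall>h\<in>tangent (\<bullet>) y. \<forall>k\<in>tangent (\<bullet>) y. \<forall>l\<in>tangent (\<bullet>) y.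
   norm h = 1 \<and> norm k = 1 \<and> norm l = 1 \<and> h \<bullet> k = 0 \<and> h \<bullet> l = 0 \<and> k \<bullet> l = 0 -->
   ?d = ?D h \<bullet> h + ?D k \<bullet> k + ?D l \<bullet> l"
 proof (intro ballI impI)
  fix h k l assume t: "h \<in> tangent (\<bullet>) y" "k \<in> tangent (\<bullet>) y" "l \<in> tangent (\<bullet>) y"
   and o: "norm h = 1 \<and> norm k = 1 \<and> norm l = 1 \<and> h \<bullet> k = 0 \<and> h \<bullet> l = 0 \<and> k \<bullet> l = 0"
  from t have "y \<bullet> h = 0" "y \<bullet> k = 0" "y \<bullet> l = 0" by (auto simp: tangent_def)
  then obtain p q r where pqr: "h = qmult y p" "p $ 1 = 0" "k = qmult y q" "q $ 1 = 0" "l = qmult y r" "r $ 1 = 0"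
   using tangent_as_qmult[OF y] by metis
  have on: "p \<bullet> p = 1" "q \<bullet> q = 1" "r \<bullet> r = 1" "p \<bullet> q = 0" "p \<bullet> r = 0" "q \<bullet> r = 0"
   using o unfolding pqr norm_eq_1 ip by auto
  note C = orthonormal_triple_completeness[OF pqr(2,4,6) on]
  define X where "X s f = Lie s f y" for s f
  have "?D h \<bullet> h + ?D k \<bullet> k + ?D l \<bullet> l
   = (p$2 * p$2 + q$2 * q$2 + r$2 * r$2) * X qi a + (p$3 * p$3 + q$3 * q$3 + r$3 * r$3) * X qj b
   + (p$4 * p$4 + q$4 * q$4 + r$4 * r$4) * X qk c
   + (p$2 * p$3 + q$2 * q$3 + r$2 * r$3) * (X qj a + X qi b)
   + (p$2 * p$4 + q$2 * q$4 + r$2 * r$4) * (X qk a + X qi c)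
   + (p$3 * p$4 + q$3 * q$4 + r$3 * r$4) * (X qk b + X qj c)"
   unfolding pqr D[OF pqr(2)] D[OF pqr(4)] D[OF pqr(6)]
    Lie_imag[OF a y pqr(2)] Lie_imag[OF b y pqr(2)] Lie_imag[OF c y pqr(2)]
    Lie_imag[OF a y pqr(4)] Lie_imag[OF b y pqr(4)] Lie_imag[OF c y pqr(4)]
    Lie_imag[OF a y pqr(6)] Lie_imag[OF b y pqr(6)] Lie_imag[OF c y pqr(6)]
   unfolding X_def[symmetric]
   by (simp add: algebra_simps)
  then show "?d = ?D h \<bullet> h + ?D k \<bullet> k + ?D l \<bullet> l" unfolding C by (simp add: X_def)
 qed
 fix d assume d: "\<forall>h\<in>tangent (\<bullet>) y. \<forall>k\<in>tangent (\<bullet>) y. \<forall>l\<in>tangent (\<bullet>) y.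
   norm h = 1 \<and> norm k = 1 \<and> norm l = 1 \<and> h \<bullet> k = 0 \<and> h \<bullet> l = 0 \<and> k \<bullet> l = 0 -->
   d = ?D h \<bullet> h + ?D k \<bullet> k + ?D l \<bullet> l"
 have "d = ?D (qmult y qi) \<bullet> qmult y qi + ?D (qmult y qj) \<bullet> qmult y qj + ?D (qmult y qk) \<bullet> qmult y qk"
  using d[THEN bspec, of "qmult y qi", THEN bspec, of "qmult y qj", THEN bspec, of "qmult y qk"]
  by (simp add: tangent_def inner_qmult_imag norm_eq_1 ip) (simp add: inner_R4)
 then show "d = ?d" by (simp add: D)
qed

subsection \<open>Identities between iterated derivatives\<close>

lemma Lie_cong_S3:
 assumes "smooth F" "smooth H" "!!x. x \<in> S3 ==> F x = H x" "imag_unit p" "x \<in> S3"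
 shows "Lie p F x = Lie p H x"
 by (rule Lie_unique[OF has_Lie_smooth[OF assms(1)] has_Lie_smooth[OF assms(2)] assms(3-5)])

lemma Lie_add:
 assumes "smooth F" "smooth H" "y \<in> S3"
 shows "Lie p (%x. F x + H x) y = Lie p F y + Lie p H y" (is ?g1)
  "Lie p (%x. F x - H x) y = Lie p F y - Lie p H y" (is ?g2)
  "Lie p (%x. c * F x) y = c * Lie p F y" (is ?g3)
  "Lie p (%x. - F x) y = - Lie p F y" (is ?g4)
proof -
 note d = Cinf_on_has_derivative[OF assms(1) S3_subset_punctured[OF assms(3)]]
  Cinf_on_has_derivative[OF assms(2) S3_subset_punctured[OF assms(3)]]
 show ?g1
  unfolding Lie_def frechet_derivative_at[OF has_derivative_add[OF d], symmetric] ..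
 show ?g2
  unfolding Lie_def frechet_derivative_at[OF has_derivative_diff[OF d], symmetric] ..
 show ?g3
  unfolding Lie_def frechet_derivative_at[OF has_derivative_mult_right[OF d(1)], symmetric] ..
 show ?g4
  unfolding Lie_def frechet_derivative_at[OF has_derivative_minus[OF d(1)], symmetric] ..
qed

text \<open>The commutators of the units are \<open>i j - j i = 2 k\<close> and its cyclic permutations.\<close>

lemma frame_commutators:
 assumes F: "smooth F" and y: "y \<in> S3"
 shows "Lie qi (Lie qj F) y = Lie qj (Lie qi F) y + 2 * Lie qk F y" (is ?g1)
  "Lie qj (Lie qk F) y = Lie qk (Lie qj F) y + 2 * Lie qi F y" (is ?g2)
  "Lie qk (Lie qi F) y = Lie qi (Lie qk F) y + 2 * Lie qj F y" (is ?g3)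
proof -
 have lin: "linear (fderiv F y)"
  by (rule linear_frechet_derivative[OF Cinf_on_differentiable[OF F S3_subset_punctured[OF y]]])
 have two: "Lie (p - - p) F y = 2 * Lie p F y" for p
 proof -
  have "p - - p = 2 *\<^sub>R p" by (simp add: scaleR_2)
  then show ?thesis by (simp only: Lie_def qmult_lin linear_scale[OF lin] real_scaleR_def)
 qed
 note c = Lie_commutator[OF F S3_subset_punctured[OF y]]
 show ?g1
  using c[of qi qj] two[of qk] by (simp add: qunit_table)
 show ?g2
  using c[of qj qk] two[of qi] by (simp add: qunit_table)
 show ?g3
  using c[of qk qi] two[of qj] by (simp add: qunit_table)
qed

locale frame_functions =
 fixes a1 a2 a3 :: "R4 => real"
 assumes a: "smooth a1" "smooth a2" "smooth a3"
begin

definition dv :: "R4 => real" where "dv x = Lie qi a1 x + Lie qj a2 x + Lie qk a3 x"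
definition c1 :: "R4 => real" where "c1 x = Lie qj a3 x - Lie qk a2 x"
definition c2 :: "R4 => real" where "c2 x = Lie qk a1 x - Lie qi a3 x"
definition c3 :: "R4 => real" where "c3 x = Lie qi a2 x - Lie qj a1 x"

lemma Cinf_dc: "smooth dv" "smooth c1" "smooth c2" "smooth c3"
 unfolding dv_def[abs_def] c1_def[abs_def] c2_def[abs_def] c3_def[abs_def]
 by (intro Cinf_on_add Cinf_on_diff open_punctured Cinf_on_Lie a)+

lemma Lie_dc:
 assumes y: "y \<in> S3"
 shows "Lie p dv y = Lie p (Lie qi a1) y + Lie p (Lie qj a2) y + Lie p (Lie qk a3) y" (is ?g1)
  "Lie p c1 y = Lie p (Lie qj a3) y - Lie p (Lie qk a2) y" (is ?g2)
  "Lie p c2 y = Lie p (Lie qk a1) y - Lie p (Lie qi a3) y" (is ?g3)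
  "Lie p c3 y = Lie p (Lie qi a2) y - Lie p (Lie qj a1) y" (is ?g4)
proof -
 note L = Cinf_on_Lie[OF a(1)] Cinf_on_Lie[OF a(2)] Cinf_on_Lie[OF a(3)]
 show ?g1
  unfolding dv_def[abs_def]
  by (simp add: Lie_add(1)[OF Cinf_on_add[OF open_punctured L(1) L(2)] L(3) y] Lie_add(1)[OF L(1) L(2) y])
 show ?g2
  unfolding c1_def[abs_def] by (rule Lie_add(2)[OF L(3) L(2) y])
 show ?g3
  unfolding c2_def[abs_def] by (rule Lie_add(2)[OF L(1) L(3) y])
 show ?g4
  unfolding c3_def[abs_def] by (rule Lie_add(2)[OF L(2) L(1) y])
qed

text \<open>With \<open>C\<close> for the flat curl in the frame: \<open>div C = 2 div\<close> and \<open>C C = grad div - Laplacian + 2 C\<close>.\<close>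

lemma div_curl: "y \<in> S3 ==> Lie qi c1 y + Lie qj c2 y + Lie qk c3 y = 2 * dv y"
 by (simp add: Lie_dc frame_commutators a dv_def)

lemma curl_curl:
 assumes "y \<in> S3"
 shows "Lie qj c3 y - Lie qk c2 y = Lie qi dv y - laplacian a1 y + 2 * c1 y"
  "Lie qk c1 y - Lie qi c3 y = Lie qj dv y - laplacian a2 y + 2 * c2 y"
  "Lie qi c2 y - Lie qj c1 y = Lie qk dv y - laplacian a3 y + 2 * c3 y"
 using assms by (simp_all add: Lie_dc frame_commutators a laplacian_def c1_def c2_def c3_def)

lemma integral_dv: "intS3 dv = 0"
proof -
 have z: "intS3 (Lie p f) = 0" if "smooth f" "imag_unit p" for p f
  by (rule integral_Lie_zero[OF that(2) has_Lie_smooth[OF that(1)]])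
    (intro continuous_S3_smooth Cinf_on_Lie that)+
 have I: "integrable vol_S3 (Lie p f)" if "smooth f" for p f
  by (intro integrable_S3_continuous continuous_S3_smooth Cinf_on_Lie that)
 show ?thesis unfolding dv_def[abs_def] using a by (simp add: I z)
qed

end

lemma G_linear:
 assumes y: "y \<in> S3" and F: "continuous_on S3 F" "continuous_on S3 H"
 shows "G0 (%x. F x + H x) y = G0 F y + G0 H y" (is ?g1) "G1 (%x. F x + H x) y = G1 F y + G1 H y" (is ?g2)
  "G0 (%x. F x - H x) y = G0 F y - G0 H y" (is ?g3) "G1 (%x. F x - H x) y = G1 F y - G1 H y" (is ?g4)
  "G0 (%x. c * F x) y = c * G0 F y" (is ?g5) "G1 (%x. c * F x) y = c * G1 F y" (is ?g6)
proof -
 have c: "continuous_on S3 (%x. F x + H x)" "continuous_on S3 (%x. F x - H x)" "continuous_on S3 (%x. c * F x)"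
  by (intro continuous_intros F)+
 note I = green0_limit(1)[OF y F(1)] green0_limit(1)[OF y F(2)] green1_limit(1)[OF y F(1)] green1_limit(1)[OF y F(2)]
 show ?g1 ?g2
  ?g3 ?g4
  using I by (simp_all add: G_eq[OF y] c F distrib_left right_diff_distrib)
 show ?g5 ?g6
  by (simp_all add: G_eq[OF y] c F mult.left_commute)
qed

lemma G_cong:
 assumes y: "y \<in> S3" and F: "continuous_on S3 F" "continuous_on S3 H" and eq: "!!x. x \<in> S3 ==> F x = H x"
 shows "G0 F y = G0 H y" "G1 F y = G1 H y"
 unfolding G_eq[OF y F(1)] G_eq[OF y F(2)]
 by (rule intS3_cong; simp add: eq)+

section \<open>The Biot--Savart field on the three-sphere\<close>

locale S3_field =
 fixes v :: "R4 => R4"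
 assumes v: "smooth_vector_field (\<bullet>) S3 v"
begin

abbreviation "v1 \<equiv> frame_comp v qi"
abbreviation "v2 \<equiv> frame_comp v qj"
abbreviation "v3 \<equiv> frame_comp v qk"

lemma v_tangent: "x \<in> S3 ==> x \<bullet> v x = 0"
 using v by (simp add: smooth_vector_field_def tangent_def)

lemma v_comp: "smooth (frame_comp v p)"
 using v by (intro Cinf_on_frame_comp) (simp add: smooth_vector_field_def)

sublocale frame_functions v1 v2 v3
 by unfold_locales (rule v_comp)+

lemma v_expansion: "x \<in> S3 ==> v x = frame_field v1 v2 v3 x"
 by (rule frame_expansion[OF _ v_tangent])

text \<open>The components of the solution \<open>- G\<^sub>0 C v + 2 grad G\<^sub>1 div v - (mean v) / 2\<close>; the sphere has volume \<open>2 \<pi>^2\<close>.\<close>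

definition w1 :: "R4 => real" where "w1 y = 2 * G1 (Lie qi dv) y - G0 c1 y - 1 / (4 * pi^2) * intS3 v1"
definition w2 :: "R4 => real" where "w2 y = 2 * G1 (Lie qj dv) y - G0 c2 y - 1 / (4 * pi^2) * intS3 v2"
definition w3 :: "R4 => real" where "w3 y = 2 * G1 (Lie qk dv) y - G0 c3 y - 1 / (4 * pi^2) * intS3 v3"

lemma Cinf_w: "smooth w1" "smooth w2" "smooth w3"
 unfolding w1_def[abs_def] w2_def[abs_def] w3_def[abs_def]
 by (intro Cinf_on_diff Cinf_on_cmult Cinf_on_const open_punctured Cinf_on_G Cinf_on_Lie Cinf_dc)+

lemma Lie_w:
 assumes y: "y \<in> S3"
 shows "Lie p w1 y = 2 * G1 (Lie p (Lie qi dv)) y - G0 (Lie p c1) y" (is ?g1)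
  "Lie p w2 y = 2 * G1 (Lie p (Lie qj dv)) y - G0 (Lie p c2) y" (is ?g2)
  "Lie p w3 y = 2 * G1 (Lie p (Lie qk dv)) y - G0 (Lie p c3) y" (is ?g3)
proof -
 have *: "Lie p (%y. 2 * G1 F y - G0 H y - k) y = 2 * G1 (Lie p F) y - G0 (Lie p H) y"
  if F: "smooth F" and H: "smooth H" for F H k
 proof -
  note GF = Cinf_on_G(2)[OF F] and GH = Cinf_on_G(1)[OF H]
  have c: "smooth (%y. 2 * G1 F y)" by (rule Cinf_on_cmult[OF open_punctured GF])
  show ?thesis
   using Lie_add(2)[OF Cinf_on_diff[OF open_punctured c GH] Cinf_on_const[of k punctured] y, of p]
    Lie_add(2)[OF c GH y, of p] Lie_add(3)[OF GF GF y, of p 2]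
    Lie_G(2)[OF F S3_subset_punctured[OF y]] Lie_G(1)[OF H S3_subset_punctured[OF y]]
   by simp
 qed
 show ?g1
  ?g2
  ?g3
  unfolding w1_def[abs_def] w2_def[abs_def] w3_def[abs_def]
  by (intro * Cinf_on_Lie Cinf_dc)+
qed

lemma cont_lie: "smooth F ==> continuous_on S3 (Lie p F)"
 by (intro continuous_S3_smooth Cinf_on_Lie)

text \<open>The terms cancel: \<open>div C v = 2 div v\<close>, while \<open>div grad G\<^sub>1 div v = G\<^sub>1 \<Delta> div v = G\<^sub>0 div v\<close> because \<open>div v\<close> has mean 0.\<close>

lemma div_w:
 assumes y: "y \<in> S3"
 shows "Lie qi w1 y + Lie qj w2 y + Lie qk w3 y = 0"
proof -
 note D = Cinf_on_Lie[OF Cinf_dc(1)]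
 have "G1 (Lie qi (Lie qi dv)) y + G1 (Lie qj (Lie qj dv)) y + G1 (Lie qk (Lie qk dv)) y
   = G1 (laplacian dv) y"
  unfolding laplacian_def[abs_def]
  by (simp add: G_linear[OF y] cont_lie[OF D] continuous_on_add)
 also have "\<dots> = G0 dv y"
  using green1_laplacian[OF y Cinf_dc(1)] integral_dv
  by (simp add: G_eq[OF y] continuous_S3_smooth Cinf_on_laplacian Cinf_dc)
 finally have 1: "G1 (Lie qi (Lie qi dv)) y + G1 (Lie qj (Lie qj dv)) y + G1 (Lie qk (Lie qk dv)) y
   = G0 dv y" .
 have "G0 (Lie qi c1) y + G0 (Lie qj c2) y + G0 (Lie qk c3) y
   = G0 (%x. Lie qi c1 x + Lie qj c2 x + Lie qk c3 x) y"
  by (simp add: G_linear[OF y] cont_lie Cinf_dc continuous_on_add)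
 also have "\<dots> = G0 (%x. 2 * dv x) y"
  by (intro G_cong(1)[OF y] continuous_on_add cont_lie Cinf_dc continuous_S3_smooth Cinf_on_cmult[OF open_punctured]) (rule div_curl)
 also have "\<dots> = 2 * G0 dv y"
  by (simp add: G_linear(5)[OF y continuous_S3_smooth[OF Cinf_dc(1)] continuous_S3_smooth[OF Cinf_dc(1)]])
 finally show ?thesis using 1 by (simp add: Lie_w[OF y])
qed

text \<open>
 One component of \<open>C w - 2 w\<close>, with \<open>p, q, r\<close> a cyclic permutation of \<open>i, j, k\<close>. The commutator relation
 disposes of the terms with \<open>G\<^sub>1\<close>; expanding \<open>C C\<close> leaves \<open>G\<^sub>0 (\<Delta> a)\<close>, which reproduces \<open>a\<close> up to its mean.
\<close>

lemma curl_w_component: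
 assumes y: "y \<in> S3" and a: "smooth a" and e: "smooth e" "smooth f" "smooth c"
  and cc: "!!x. x \<in> S3 ==> Lie q f x - Lie r e x = Lie p dv x - laplacian a x + 2 * c x"
  and com: "!!x. x \<in> S3 ==> Lie q (Lie r dv) x = Lie r (Lie q dv) x + 2 * Lie p dv x"
 shows "(2 * G1 (Lie q (Lie r dv)) y - G0 (Lie q f) y)
   - (2 * G1 (Lie r (Lie q dv)) y - G0 (Lie r e) y)
   - 2 * (2 * G1 (Lie p dv) y - G0 c y - 1 / (4 * pi^2) * intS3 a)
  = a y - G0 (Lie p dv) y"
proof -
 note D = Cinf_on_Lie[OF Cinf_dc(1)]
 note cd = cont_lie[OF Cinf_dc(1)]
 have "G1 (Lie q (Lie r dv)) y = G1 (%x. Lie r (Lie q dv) x + 2 * Lie p dv x) y"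
  by (rule G_cong(2)[OF y]) (auto simp: com intro!: continuous_intros cont_lie D cd)
 also have "\<dots> = G1 (Lie r (Lie q dv)) y + 2 * G1 (Lie p dv) y"
  using G_linear(6)[OF y cd cd, of 2] by (subst G_linear(2)[OF y]) (auto intro!: continuous_intros cont_lie D cd)
 finally have 1: "G1 (Lie q (Lie r dv)) y = G1 (Lie r (Lie q dv)) y + 2 * G1 (Lie p dv) y" .
 have ca: "continuous_on S3 (laplacian a)" by (intro continuous_S3_smooth Cinf_on_laplacian a)
 have cc': "continuous_on S3 c" by (intro continuous_S3_smooth e)
 have "G0 (Lie q f) y - G0 (Lie r e) y = G0 (%x. Lie q f x - Lie r e x) y"
  by (rule G_linear(3)[OF y, symmetric]) (intro cont_lie e)+
 also have "\<dots> = G0 (%x. Lie p dv x - laplacian a x + 2 * c x) y"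
  by (rule G_cong(1)[OF y]) (auto simp: cc intro!: continuous_intros cont_lie Cinf_dc e ca cc')
 also have "\<dots> = G0 (Lie p dv) y - G0 (laplacian a) y + 2 * G0 c y"
  using G_linear(5)[OF y cc' cc', of 2] G_linear(3)[OF y cd ca]
  by (subst G_linear(1)[OF y]) (auto intro!: continuous_intros cd ca cc')
 also have "G0 (laplacian a) y = a y - 1 / (2 * pi^2) * intS3 a"
  using green0_laplacian[OF y a] by (simp add: G_eq[OF y ca])
 finally show ?thesis unfolding 1 by (simp add: field_simps)
qed

lemma curl_w:
 assumes y: "y \<in> S3"
 shows "curl_comp w1 w2 w3 y = vector [0, v1 y - Lie qi (G0 dv) y, v2 y - Lie qj (G0 dv) y, v3 y - Lie qk (G0 dv) y]"
proof -
 note D = Cinf_on_Lie[OF Cinf_dc(1)]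
 have G: "Lie p (G0 dv) y = G0 (Lie p dv) y" for p
  by (rule Lie_G(1)[OF Cinf_dc(1) S3_subset_punctured[OF y]])
 have "Lie qj w3 y - Lie qk w2 y - 2 * w1 y = v1 y - Lie qi (G0 dv) y"
  unfolding Lie_w[OF y] w1_def G
  by (rule curl_w_component[OF y a(1) Cinf_dc(3,4,2) curl_curl(1) frame_commutators(2)[OF Cinf_dc(1)]])
 moreover have "Lie qk w1 y - Lie qi w3 y - 2 * w2 y = v2 y - Lie qj (G0 dv) y"
  unfolding Lie_w[OF y] w2_def G
  by (rule curl_w_component[OF y a(2) Cinf_dc(4,2,3) curl_curl(2) frame_commutators(3)[OF Cinf_dc(1)]])
 moreover have "Lie qi w2 y - Lie qj w1 y - 2 * w3 y = v3 y - Lie qk (G0 dv) y"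
  unfolding Lie_w[OF y] w3_def G
  by (rule curl_w_component[OF y a(3) Cinf_dc(2,3,4) curl_curl(3) frame_commutators(1)[OF Cinf_dc(1)]])
 ultimately show ?thesis by (simp add: curl_comp_def)
qed

text \<open>Integration by parts against \<open>green0\<close> in each direction of the frame.\<close>

lemma potential_eq:
 assumes z: "z \<in> S3"
 shows "intS3 (%x. v x \<bullet> grad_S3 (%s. phi0_S3 (dist_S3 s z)) x) = - G0 dv z"
proof -
 have I: "integrable vol_S3 (%x. green0' (x \<bullet> z) * (qmult x p \<bullet> z) * frame_comp v p x)" if "imag_unit p" for p
  by (rule green0'_limit(1)[OF z that continuous_S3_smooth[OF v_comp]])
 have bp: "intS3 (%x. green0' (x \<bullet> z) * (qmult x p \<bullet> z) * frame_comp v p x) = - G0 (Lie p (frame_comp v p)) z"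
  if "imag_unit p" for p
  using green0_by_parts[OF z that v_comp] by (simp add: G_eq[OF z] cont_lie[OF v_comp])
 have "intS3 (%x. v x \<bullet> grad_S3 (%s. phi0_S3 (dist_S3 s z)) x)
  = intS3 (%x. green0' (x \<bullet> z) * (qmult x qi \<bullet> z) * v1 x + green0' (x \<bullet> z) * (qmult x qj \<bullet> z) * v2 x
     + green0' (x \<bullet> z) * (qmult x qk \<bullet> z) * v3 x)"
 proof (rule intS3_cong)
  fix x assume x: "x \<in> S3"
  have "v x \<bullet> grad_S3 (%s. phi0_S3 (dist_S3 s z)) x = green0' (x \<bullet> z) * (v x \<bullet> z)"
   by (rule integrand_potential[where v = v, OF x z v_tangent[OF x]])
  also have "v x \<bullet> z = (qmult x qi \<bullet> z) * v1 x + (qmult x qj \<bullet> z) * v2 x + (qmult x qk \<bullet> z) * v3 x"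
   by (subst v_expansion[OF x]) (simp add: frame_field_def inner_add_left mult.commute)
  finally show "v x \<bullet> grad_S3 (%s. phi0_S3 (dist_S3 s z)) x
   = green0' (x \<bullet> z) * (qmult x qi \<bullet> z) * v1 x + green0' (x \<bullet> z) * (qmult x qj \<bullet> z) * v2 x
     + green0' (x \<bullet> z) * (qmult x qk \<bullet> z) * v3 x" by (simp add: algebra_simps)
 qed
 also have "\<dots> = - G0 (Lie qi v1) z - G0 (Lie qj v2) z - G0 (Lie qk v3) z"
  by (simp add: I bp)
 also have "\<dots> = - G0 dv z"
  unfolding dv_def[abs_def] by (simp add: G_linear[OF z] cont_lie[OF v_comp] continuous_on_add)
 finally show ?thesis .
qed

lemma grad_potential:
 assumes y: "y \<in> S3"
 shows "grad_S3 (%z. \<integral>x. v x \<bullet> grad_S3 (%s. phi0_S3 (dist_S3 s z)) x \<partial>vol_S3) y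
  = qmult y (vector [0, - Lie qi (G0 dv) y, - Lie qj (G0 dv) y, - Lie qk (G0 dv) y])"
  (is "grad_S3 ?F y = qmult y ?g")
proof (rule S3.grad_eqI[OF y])
 note GC = Cinf_on_G(1)[OF Cinf_dc(1)]
 show "y \<bullet> qmult y ?g = 0" by (rule inner_qmult_imag) simp
 have "((%z. - G0 dv z) has_derivative (%h. - frechet_derivative (G0 dv) (at y) h)) (at y within S3)"
  by (rule has_derivative_at_withinI[OF has_derivative_minus[OF Cinf_on_has_derivative[OF GC S3_subset_punctured[OF y]]]])
 then show "(?F has_derivative (%h. - frechet_derivative (G0 dv) (at y) h)) (at y within S3)"
  by (rule has_derivative_transform[OF y, rotated]) (rule potential_eq)
 fix h assume "y \<bullet> h = 0"
 then obtain p where p: "h = qmult y p" "p $ 1 = 0" using tangent_as_qmult[OF y] by blast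
 have "qmult y ?g \<bullet> qmult y p = ?g \<bullet> p" using y by (simp add: inner_qmult_same_left S3_iff_inner)
 also have "\<dots> = - Lie p (G0 dv) y"
  unfolding Lie_imag[OF GC y p(2)] by (simp add: inner_R4 algebra_simps)
 finally show "qmult y ?g \<bullet> h = - frechet_derivative (G0 dv) (at y) h" by (simp add: p(1) Lie_def)
qed

definition W :: "R4 => R4" where "W y = (if y \<in> S3 then frame_field w1 w2 w3 y else 0)"

definition solves :: "(R4 => R4) => bool" where
 "solves w \<longleftrightarrow> smooth_vector_field (\<bullet>) S3 w \<and> (\<forall>y. y \<notin> S3 --> w y = 0) \<and>
   (\<forall>y\<in>S3. div_S3 w y = 0 \<and>
    curl_S3 w y = v y + grad_S3 (%z. \<integral>x. v x \<bullet> grad_S3 (%s. phi0_S3 (dist_S3 s z)) x \<partial>vol_S3) y)"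

lemma W_solves: "solves W"
 unfolding solves_def
proof (intro conjI allI impI ballI)
 have W: "W z = frame_field w1 w2 w3 z" if "z \<in> S3" for z using that by (simp add: W_def)
 show "smooth_vector_field (\<bullet>) S3 W"
  unfolding smooth_vector_field_def
  using smooth_map_on_S3_I[OF Cinf_on_frame_field[OF Cinf_w] W[symmetric]] W
  by (auto simp: tangent_def frame_field_tangent)
 show "W y = 0" if "y \<notin> S3" for y using that by (simp add: W_def)
 fix y assume y: "y \<in> S3"
 show "div_S3 W y = 0" using div_S3_frame_field[OF Cinf_w W y] div_w[OF y] by simp
 have "curl_S3 W y = qmult y (curl_comp w1 w2 w3 y)" by (rule curl_S3_frame_field[OF Cinf_w W y])
 also have "\<dots> = qmult y (vector [0, v1 y, v2 y, v3 y]
   + vector [0, - Lie qi (G0 dv) y, - Lie qj (G0 dv) y, - Lie qk (G0 dv) y])"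
  by (rule arg_cong[where f = "qmult y"]) (simp add: curl_w[OF y] R4_eq_iff)
 also have "\<dots> = v y + grad_S3 (%z. \<integral>x. v x \<bullet> grad_S3 (%s. phi0_S3 (dist_S3 s z)) x \<partial>vol_S3) y"
  unfolding grad_potential[OF y] v_expansion[OF y] frame_field_eq_qmult by simp
 finally show "curl_S3 W y = v y + grad_S3 (%z. \<integral>x. v x \<bullet> grad_S3 (%s. phi0_S3 (dist_S3 s z)) x \<partial>vol_S3) y" .
qed

text \<open>
 The difference \<open>d\<close> of two solutions satisfies \<open>div d = 0\<close> and \<open>C d = 2 d\<close>, hence \<open>Laplacian d = 0\<close>. So
 the components of \<open>d\<close> equal their mean values by Green's identity, which forces \<open>C d = 0\<close>.
\<close>

lemma solves_unique:
 assumes u: "solves u" and w: "solves w"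
 shows "u = w"
proof
 have sm: "smooth_map_on S3 u" "smooth_map_on S3 w"
  and tan: "!!y. y \<in> S3 ==> y \<bullet> u y = 0" "!!y. y \<in> S3 ==> y \<bullet> w y = 0"
  using u w by (auto simp: solves_def smooth_vector_field_def tangent_def)
 define d where "d p x = frame_comp u p x - frame_comp w p x" for p x
 have Cu: "smooth (frame_comp u p)" and Cw: "smooth (frame_comp w p)" for p
  by (intro Cinf_on_frame_comp sm)+
 have Cd: "smooth (d p)" for p
  unfolding d_def[abs_def] by (intro Cinf_on_diff open_punctured Cu Cw)
 interpret d: frame_functions "d qi" "d qj" "d qk" by unfold_locales (rule Cd)+
 have Xd: "Lie q (d p) y = Lie q (frame_comp u p) y - Lie q (frame_comp w p) y" if "y \<in> S3" for p q y
  unfolding d_def[abs_def] by (rule Lie_add(2)[OF Cu Cw that])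
 have ex: "f z = frame_field (frame_comp f qi) (frame_comp f qj) (frame_comp f qk) z"
  if "z \<in> S3" "!!y. y \<in> S3 ==> y \<bullet> f y = 0" for f z
  by (rule frame_expansion[where w = f, OF that(1) that(2)[OF that(1)]])
 have dv0: "d.dv y = 0" if y: "y \<in> S3" for y
 proof -
  have "div_S3 u y = div_S3 w y" using u w y by (simp add: solves_def)
  moreover have "div_S3 u y = Lie qi (frame_comp u qi) y + Lie qj (frame_comp u qj) y + Lie qk (frame_comp u qk) y"
   by (rule div_S3_frame_field[OF Cu Cu Cu _ y]) (rule ex[where f = u, OF _ tan(1)])
  moreover have "div_S3 w y = Lie qi (frame_comp w qi) y + Lie qj (frame_comp w qj) y + Lie qk (frame_comp w qk) y"
   by (rule div_S3_frame_field[OF Cw Cw Cw _ y]) (rule ex[where f = w, OF _ tan(2)])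
  ultimately show ?thesis by (simp add: d.dv_def Xd[OF y])
 qed
 have curl: "d.c1 y = 2 * d qi y" "d.c2 y = 2 * d qj y" "d.c3 y = 2 * d qk y" if y: "y \<in> S3" for y
 proof -
  have "curl_S3 u y = curl_S3 w y" using u w y by (simp add: solves_def)
  moreover have "curl_S3 u y = qmult y (curl_comp (frame_comp u qi) (frame_comp u qj) (frame_comp u qk) y)"
   by (rule curl_S3_frame_field[OF Cu Cu Cu _ y]) (rule ex[where f = u, OF _ tan(1)])
  moreover have "curl_S3 w y = qmult y (curl_comp (frame_comp w qi) (frame_comp w qj) (frame_comp w qk) y)"
   by (rule curl_S3_frame_field[OF Cw Cw Cw _ y]) (rule ex[where f = w, OF _ tan(2)])
  ultimately have "qmult y (curl_comp (frame_comp u qi) (frame_comp u qj) (frame_comp u qk) y)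
    = qmult y (curl_comp (frame_comp w qi) (frame_comp w qj) (frame_comp w qk) y)" by simp
  then have "curl_comp (frame_comp u qi) (frame_comp u qj) (frame_comp u qk) y
    = curl_comp (frame_comp w qi) (frame_comp w qj) (frame_comp w qk) y"
   using qconj_cancel(2)[OF y] by metis
  then show "d.c1 y = 2 * d qi y" "d.c2 y = 2 * d qj y" "d.c3 y = 2 * d qk y"
   by (simp_all add: curl_comp_def R4_eq_iff d.c1_def d.c2_def d.c3_def Xd[OF y] d_def)
 qed
 have Xc: "Lie p d.c1 y = 2 * Lie p (d qi) y" "Lie p d.c2 y = 2 * Lie p (d qj) y"
  "Lie p d.c3 y = 2 * Lie p (d qk) y" "Lie p d.dv y = 0" if "imag_unit p" "y \<in> S3" for p y
 proof -
  have C2: "smooth (%x. 2 * d q x)" for q by (rule Cinf_on_cmult[OF open_punctured Cd])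
  show "Lie p d.c1 y = 2 * Lie p (d qi) y"
   using Lie_cong_S3[OF d.Cinf_dc(2) C2 curl(1) that] Lie_add(3)[OF Cd Cd that(2)] by simp
  show "Lie p d.c2 y = 2 * Lie p (d qj) y"
   using Lie_cong_S3[OF d.Cinf_dc(3) C2 curl(2) that] Lie_add(3)[OF Cd Cd that(2)] by simp
  show "Lie p d.c3 y = 2 * Lie p (d qk) y"
   using Lie_cong_S3[OF d.Cinf_dc(4) C2 curl(3) that] Lie_add(3)[OF Cd Cd that(2)] by simp
  show "Lie p d.dv y = 0"
   using Lie_cong_S3[OF d.Cinf_dc(1) Cinf_on_const dv0 that] by simp
 qed
 have lap: "laplacian (d p) y = 0" if p: "p \<in> {qi, qj, qk}" and y: "y \<in> S3" for p y
 proof -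
  have "laplacian (d qi) y = 0" "laplacian (d qj) y = 0" "laplacian (d qk) y = 0"
   using d.curl_curl[OF y] curl[OF y] d.c1_def[of y] d.c2_def[of y] d.c3_def[of y] by (simp_all add: Xc y)
  then show ?thesis using p by auto
 qed
 have const: "d p y = 1 / (2 * pi^2) * intS3 (d p)" if p: "p \<in> {qi, qj, qk}" and y: "y \<in> S3" for p y
 proof -
  have "intS3 (%x. green0 (x \<bullet> y) * laplacian (d p) x) = intS3 (%x. 0)"
   by (rule intS3_cong) (auto simp: lap[OF p])
  then show ?thesis using green0_laplacian[OF y Cd, of p] by simp
 qed
 have X0: "Lie q (d p) y = 0" if "p \<in> {qi, qj, qk}" "imag_unit q" "y \<in> S3" for p q y
  using Lie_cong_S3[OF Cd Cinf_on_const const[OF that(1)] that(2,3)] by simp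
 fix y
 show "u y = w y"
 proof (cases "y \<in> S3")
  case True
  have "d qi y = 0" "d qj y = 0" "d qk y = 0"
   using curl[OF True] by (simp_all add: d.c1_def d.c2_def d.c3_def X0 True)
  then have "frame_comp u qi y = frame_comp w qi y" "frame_comp u qj y = frame_comp w qj y" "frame_comp u qk y = frame_comp w qk y"
   by (simp_all add: d_def)
  then show ?thesis
   using ex[where f = u, OF True tan(1)] ex[where f = w, OF True tan(2)] by (simp add: frame_field_def)
 next
  case False
  then show ?thesis using u w by (simp add: solves_def)
 qed
qed

lemma biot_savart_S3_eq: "biot_savart_S3 v = W"
proof -
 have "(THE w. solves w) = W" using W_solves solves_unique by (intro the_equality)
 then show ?thesis unfolding biot_savart_S3_def solves_def .
qed

end

section \<open>Helicity on the three-sphere\<close>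

lemma smooth_map_on_continuous:
 assumes "smooth_map_on M f"
 shows "continuous_on M f"
proof (rule continuous_on_eq_continuous_within[THEN iffD2], rule ballI)
 fix x assume x: "x \<in> M"
 obtain U F where U: "open U" "x \<in> U" "Cinf_on F U" and eq: "\<forall>z\<in>M \<inter> U. F z = f z"
  using assms x unfolding smooth_map_on_def by blast
 have "isCont F x" using Cinf_on_continuous[OF U(3)] U(1,2) by (simp add: continuous_on_eq_continuous_at)
 then have "continuous (at x within M) F" by (rule continuous_at_imp_continuous_at_within)
 then have "(F \<longlongrightarrow> f x) (at x within M)" using eq x U(2) by (simp add: continuous_within)
 moreover have "eventually (%z. F z = f z) (at x within M)"
  unfolding eventually_at_topological using U(1,2) eq by blast
 ultimately show "continuous (at x within M) f" unfolding continuous_within by (rule Lim_transform_eventually)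
qed

abbreviation "vol_S3_pair \<equiv> vol_S3 \<Otimes>\<^sub>M vol_S3"

text \<open>Fubini for kernels of order \<open>1 / sin^2 \<alpha>\<close>. Poles are null sets, so it suffices to know \<open>F\<close> away from them.\<close>

lemma S3_kernel_integral:
 fixes F :: "R4 \<times> R4 => real"
 assumes m: "F \<in> borel_measurable vol_S3_pair" and C: "C \<ge> 0"
  and b: "!!x y. x \<in> S3 ==> y \<in> S3 ==> \<bar>x \<bullet> y\<bar> < 1 ==> \<bar>F (x, y)\<bar> <= C * pole_weight (x \<bullet> y)"
  and h: "!!y. y \<in> S3 ==> has_bochner_integral vol_S3 (%x. h x y) (g y)"
  and eq: "!!x y. x \<in> S3 ==> y \<in> S3 ==> \<bar>x \<bullet> y\<bar> < 1 ==> F (x, y) = h x y"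
 shows "has_bochner_integral vol_S3_pair F (intS3 g)"
proof -
 interpret P: pair_sigma_finite vol_S3 vol_S3 ..
 have "(\<integral>\<^sup>+z. norm (F z) \<partial>vol_S3_pair) = (\<integral>\<^sup>+y. \<integral>\<^sup>+x. norm (F (x, y)) \<partial>vol_S3 \<partial>vol_S3)"
  using m by (intro P.nn_integral_snd[symmetric]) measurable
 also have "\<dots> <= (\<integral>\<^sup>+y. ennreal C * ennreal (8 * pi^2) \<partial>vol_S3)"
 proof (rule nn_integral_mono)
  fix y assume "y \<in> space vol_S3"
  then have y: "y \<in> S3" by (simp add: S3.space_volume)
  have pm: "(%x. ennreal (pole_weight (x \<bullet> y))) \<in> borel_measurable vol_S3"
   using borel_measurable_integrable[OF pole_weight_integrable[OF y]] by measurable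
  have "(\<integral>\<^sup>+x. norm (F (x, y)) \<partial>vol_S3) <= (\<integral>\<^sup>+x. ennreal C * ennreal (pole_weight (x \<bullet> y)) \<partial>vol_S3)"
  proof (rule nn_integral_mono_AE)
   show "AE x in vol_S3. ennreal (norm (F (x, y))) <= ennreal C * ennreal (pole_weight (x \<bullet> y))"
    using AE_S3_not_pole[OF y] AE_space
   proof eventually_elim
    case (elim x)
    then have "\<bar>F (x, y)\<bar> <= C * pole_weight (x \<bullet> y)" by (intro b y) (auto simp: S3.space_volume)
    then show ?case using C by (simp add: ennreal_mult'[symmetric] ennreal_leI)
   qed
  qed
  also have "\<dots> = ennreal C * (\<integral>\<^sup>+x. ennreal (pole_weight (x \<bullet> y)) \<partial>vol_S3)"
   by (rule nn_integral_cmult[OF pm])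
  also have "\<dots> <= ennreal C * ennreal (8 * pi^2)" by (intro mult_left_mono pole_weight_nn_integral y) simp
  finally show "(\<integral>\<^sup>+x. norm (F (x, y)) \<partial>vol_S3) <= ennreal C * ennreal (8 * pi^2)" .
 qed
 also have "\<dots> < \<infinity>"
  using vol_S3.emeasure_finite[of "space vol_S3"] by (simp add: ennreal_mult_eq_top_iff less_top[symmetric])
 finally have I: "integrable vol_S3_pair F" by (intro integrableI_bounded m) simp
 then have I': "integrable vol_S3_pair (%(x, y). F (x, y))" by simp
 have "integral\<^sup>L vol_S3_pair F = intS3 (%y. intS3 (%x. F (x, y)))"
  using P.integral_snd[OF I'] by simp
 also have "\<dots> = intS3 g"
 proof (rule intS3_cong)
  fix y assume y: "y \<in> S3"
  have "intS3 (%x. F (x, y)) = intS3 (%x. h x y)"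
  proof (rule integral_cong_AE)
   show "(%x. F (x, y)) \<in> borel_measurable vol_S3"
    using m y by (intro measurable_compose[OF _ m] measurable_Pair) (auto simp: S3.space_volume)
   show "(%x. h x y) \<in> borel_measurable vol_S3" using h[OF y] by (rule borel_measurable_has_bochner_integral)
   show "AE x in vol_S3. F (x, y) = h x y"
    using AE_S3_not_pole[OF y] AE_space by eventually_elim (auto simp: S3.space_volume eq y)
  qed
  then show "intS3 (%x. F (x, y)) = g y" using has_bochner_integral_integral_eq[OF h[OF y]] by simp
 qed
 finally show ?thesis using I by (simp add: has_bochner_integral_iff)
qed

lemma AE_S3_pair_not_pole: "AE z in vol_S3_pair. \<bar>fst z \<bullet> snd z\<bar> < 1"
proof -
 interpret P: pair_sigma_finite vol_S3 vol_S3 ..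
 have [measurable]: "fst \<in> vol_S3_pair \<rightarrow>\<^sub>M borel" "snd \<in> vol_S3_pair \<rightarrow>\<^sub>M borel"
  using measurable_compose[OF measurable_fst measurable_S3_ident] measurable_compose[OF measurable_snd measurable_S3_ident] by simp_all
 show ?thesis
 proof (rule P.AE_pair_measure)
  show "{z \<in> space vol_S3_pair. \<bar>fst z \<bullet> snd z\<bar> < 1} \<in> sets vol_S3_pair" by measurable
  show "AE x in vol_S3. AE y in vol_S3. \<bar>fst (x, y) \<bullet> snd (x, y)\<bar> < 1"
  proof (rule AE_I2)
   fix x assume "x \<in> space vol_S3"
   then have "x \<in> S3" by (simp add: S3.space_volume)
   from AE_S3_not_pole[OF this] show "AE y in vol_S3. \<bar>fst (x, y) \<bullet> snd (x, y)\<bar> < 1" by (simp add: inner_commute)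
  qed
 qed
qed

text \<open>The coordinates of \<open>r = y\<^sup>-\<^sup>1 x\<close>, in terms of which the integrands become polynomials.\<close>

lemma inner_coords_S3:
 assumes x: "x \<in> S3" and y: "y \<in> S3"
 obtains r where "x = qmult y r" "r \<bullet> r = 1" "x \<bullet> y = r$1" "qmult x qi \<bullet> y = - r$2" "qmult x qj \<bullet> y = - r$3" "qmult x qk \<bullet> y = - r$4"
  "!!a. qmult y a \<bullet> x = a \<bullet> r" "!!a. qmult x a \<bullet> y = qmult r a $ 1"
proof -
 define r where "r = qmult (qconj y) x"
 have xr: "x = qmult y r" by (simp add: r_def qconj_cancel y)
 have ip: "qmult y p \<bullet> qmult y q = p \<bullet> q" for p q using y by (simp add: inner_qmult_same_left S3_iff_inner)
 have b: "qmult x a \<bullet> y = qmult r a $ 1" for a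
  using ip[of "qmult r a" qone] by (simp add: xr qmult_assoc inner_R4)
 show ?thesis
 proof (rule that[of r])
  show "r \<bullet> r = 1" using x ip[of r r] by (simp add: xr S3_iff_inner)
  show "x \<bullet> y = r$1" using ip[of r qone] by (simp add: xr inner_R4)
  show "qmult y a \<bullet> x = a \<bullet> r" for a by (simp add: xr ip)
 qed (simp_all add: xr[symmetric] b qmult_nth)
qed

lemma green_relations:
 assumes c: "\<bar>c\<bar> < 1"
 shows "2 * c * green1'' c + 2 * green1' c = - green0' c" (is ?g1) "2 * (1 - c^2) * green1'' c = 1 / (4 * pi^2) + 2 * c * green1' c" (is ?g2)
proof -
 define k where "k = 1 / (8 * pi^2)"
 have k: "1 / (4 * pi^2) = 2 * k" by (simp add: k_def)
 have "c^2 < 1" using c by (simp add: abs_square_less_1)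
 then have s: "sn c > 0" "1 - c^2 = (sn c)^2" by (simp_all add: sn_def)
 have c2: "c^2 = 1 - (sn c)^2" using s(2) by simp
 have "2 * c * green1'' c + 2 * green1' c = 2 * k * ((c * sn c + coangle c * (c^2 + (sn c)^2)) / (sn c)^3)"
  using s(1) unfolding green1''_def green1'_def k_def[symmetric]
  by (simp add: divide_simps) (simp add: algebra_simps power2_eq_square power3_eq_cube)
 also have "\<dots> = - green0' c" unfolding c2 green0'_def k by simp
 finally show ?g1 .
 show ?g2
  using s(1) unfolding green1''_def green1'_def k_def[symmetric] k s(2)
  by (simp add: divide_simps) (simp add: algebra_simps power2_eq_square power3_eq_cube)
qed

context S3_field
begin

text \<open>The quaternions \<open>x\<^sup>-\<^sup>1 v(x)\<close>, which are purely imaginary.\<close>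

definition u :: "R4 => R4" where "u x = vector [0, v1 x, v2 x, v3 x]"

lemma u_nth [simp]: "u x $ 1 = 0" "u x $ 2 = v1 x" "u x $ 3 = v2 x" "u x $ 4 = v3 x"
 by (simp_all add: u_def)

lemma v_eq_u: "x \<in> S3 ==> v x = qmult x (u x)"
 by (subst v_expansion) (simp_all add: frame_field_eq_qmult u_def)

lemma u_eq: "x \<in> S3 ==> qmult (qconj x) (v x) = u x"
 by (simp add: v_eq_u qconj_cancel)

lemma v_continuous: "continuous_on S3 v"
 using v by (intro smooth_map_on_continuous) (simp add: smooth_vector_field_def)

lemma v_bound: obtains K where "K > 0" "!!x. x \<in> S3 ==> norm (v x) <= K"
 using S3_bounded[OF continuous_on_norm[OF v_continuous]] by auto

lemma measurable_pair_continuous: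
 fixes h :: "R4 \<times> R4 \<times> R4 \<times> R4 => real"
 assumes "continuous_on UNIV h"
 shows "(%z. h (fst z, snd z, v (fst z), v (snd z))) \<in> borel_measurable vol_S3_pair"
proof -
 note [measurable] = measurable_compose[OF measurable_fst measurable_S3_ident] measurable_compose[OF measurable_snd measurable_S3_ident]
  measurable_compose[OF measurable_fst measurable_S3_continuous[OF v_continuous]]
  measurable_compose[OF measurable_snd measurable_S3_continuous[OF v_continuous]]
 have "(%z. (fst z, snd z, v (fst z), v (snd z))) \<in> borel_measurable vol_S3_pair" by measurable
 then show ?thesis by (rule borel_measurable_continuous_on[OF assms])
qed

lemma green_measurable_pair:
 "(%z. green0' (fst z \<bullet> snd z)) \<in> borel_measurable vol_S3_pair" "(%z. green1' (fst z \<bullet> snd z)) \<in> borel_measurable vol_S3_pair"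
 "(%z. green1'' (fst z \<bullet> snd z)) \<in> borel_measurable vol_S3_pair"
 by (rule green_measurable[OF measurable_compose[OF measurable_fst measurable_S3_ident] measurable_compose[OF measurable_snd measurable_S3_ident]];
   auto simp: space_pair_measure S3.space_volume)+

text \<open>The integrands of the three integrals in the left-translation format, in explicit form.\<close>

definition k1 :: "R4 \<times> R4 => real" where
 "k1 = (%(x, y). - green0' (x \<bullet> y) * det4 y (qmult y (qmult (qconj x) (v x))) (v y) x)"
definition k2 :: "R4 \<times> R4 => real" where
 "k2 = (%(x, y). qmult y (qmult (qconj x) (v x)) \<bullet> v y)"
definition k3 :: "R4 \<times> R4 => real" where "k3 = (%(x, y). integrand_left_3_explicit v x y)"

lemma measurable_k: "k1 \<in> borel_measurable vol_S3_pair" (is ?g1) "k2 \<in> borel_measurable vol_S3_pair" (is ?g2) "k3 \<in> borel_measurable vol_S3_pair" (is ?g3)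
 "(%(x, y). 2 * green1'' (x \<bullet> y) * det4 y (v x) (v y) x) \<in> borel_measurable vol_S3_pair" (is ?g4)
proof -
 note M = measurable_pair_continuous[THEN measurable_cong[THEN iffD1, rotated]]
 have m1: "(%z. det4 (snd z) (qmult (snd z) (qmult (qconj (fst z)) (v (fst z)))) (v (snd z)) (fst z)) \<in> borel_measurable vol_S3_pair"
  by (rule M[of "%(x, y, u, w). det4 y (qmult y (qmult (qconj x) u)) w x"])
    (simp_all add: case_prod_unfold det_4 qmult_nth qconj_nth, intro continuous_intros)
 have m2: "(%z. det4 (snd z) (v (fst z)) (v (snd z)) (fst z)) \<in> borel_measurable vol_S3_pair"
  by (rule M[of "%(x, y, u, w). det4 y u w x"])
    (simp_all add: case_prod_unfold det_4, intro continuous_intros)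
 have m3: "(%z. qmult (snd z) (qmult (qconj (fst z)) (v (fst z))) \<bullet> v (snd z)) \<in> borel_measurable vol_S3_pair"
  by (rule M[of "%(x, y, u, w). qmult y (qmult (qconj x) u) \<bullet> w"])
    (simp_all add: case_prod_unfold inner_R4 qmult_nth qconj_nth, intro continuous_intros)
 have m4: "(%z. (fst z \<bullet> v (snd z)) * (qmult (snd z) (qmult (qconj (fst z)) (v (fst z))) \<bullet> fst z)) \<in> borel_measurable vol_S3_pair"
  by (rule M[of "%(x, y, u, w). (x \<bullet> w) * (qmult y (qmult (qconj x) u) \<bullet> x)"])
    (simp_all add: case_prod_unfold inner_R4 qmult_nth qconj_nth, intro continuous_intros)
 have m5: "(%z. qmult (v (snd z)) (qmult (qconj (fst z)) (v (fst z))) \<bullet> fst z) \<in> borel_measurable vol_S3_pair"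
  by (rule M[of "%(x, y, u, w). qmult w (qmult (qconj x) u) \<bullet> x"])
    (simp_all add: case_prod_unfold inner_R4 qmult_nth qconj_nth, intro continuous_intros)
 have m6: "(%z. fst z \<bullet> snd z) \<in> borel_measurable vol_S3_pair"
  by (rule M[of "%(x, y, u, w). x \<bullet> y"]) (simp_all add: case_prod_unfold, intro continuous_intros)
 note [measurable] = m1 m2 m3 m4 m5 m6 green_measurable_pair
 show ?g1 unfolding k1_def case_prod_unfold by measurable
 show ?g2 unfolding k2_def case_prod_unfold by measurable
 show ?g3
  unfolding k3_def integrand_left_3_explicit_def case_prod_unfold mult.assoc by measurable
 show ?g4
  unfolding case_prod_unfold by measurable
qed

lemma k1_frame:
 assumes x: "x \<in> S3" and y: "y \<in> S3"
 shows "k1 (x, y) = v1 y * (green0' (x \<bullet> y) * (qmult x qj \<bullet> y) * v3 x - green0' (x \<bullet> y) * (qmult x qk \<bullet> y) * v2 x)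
  + v2 y * (green0' (x \<bullet> y) * (qmult x qk \<bullet> y) * v1 x - green0' (x \<bullet> y) * (qmult x qi \<bullet> y) * v3 x)
  + v3 y * (green0' (x \<bullet> y) * (qmult x qi \<bullet> y) * v2 x - green0' (x \<bullet> y) * (qmult x qj \<bullet> y) * v1 x)"
proof -
 obtain r where r: "x = qmult y r" "qmult x qi \<bullet> y = - r$2" "qmult x qj \<bullet> y = - r$3" "qmult x qk \<bullet> y = - r$4"
  using inner_coords_S3[OF x y] by metis
 have "det4 y (qmult y (u x)) (v y) x
  = v1 x * (v2 y * r$4 - v3 y * r$3) - v2 x * (v1 y * r$4 - v3 y * r$2) + v3 x * (v1 y * r$3 - v2 y * r$2)"
  using det_frame[OF y, of "u x" "u y" r] by (simp only: v_eq_u[OF y] r(1)[symmetric] u_nth)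
 then show ?thesis
  unfolding k1_def case_prod_conv u_eq[OF x] r(2-4) by (simp only:) (simp add: algebra_simps)
qed

lemma k2_frame:
 assumes x: "x \<in> S3" and y: "y \<in> S3"
 shows "k2 (x, y) = v1 y * v1 x + v2 y * v2 x + v3 y * v3 x"
proof -
 have "qmult y (u x) \<bullet> qmult y (u y) = u x \<bullet> u y" using y by (simp add: inner_qmult_same_left S3_iff_inner)
 then show ?thesis unfolding k2_def case_prod_conv u_eq[OF x] v_eq_u[OF y] by (simp add: inner_R4[of "u x"] mult.commute)
qed

text \<open>The integrand of \<open>green1_by_parts\<close>.\<close>

definition e3 :: "R4 => R4 => R4 => R4 => real" where
 "e3 p q x y = green1'' (x \<bullet> y) * ((qmult x p \<bullet> y) * (qmult x q \<bullet> y)) * frame_comp v q x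
   + green1' (x \<bullet> y) * (qmult x (qmult q p) \<bullet> y) * frame_comp v q x"

lemma k3_frame:
 assumes x: "x \<in> S3" and y: "y \<in> S3" and c: "\<bar>x \<bullet> y\<bar> < 1"
 shows "k3 (x, y) = v1 y * (e3 qi qi x y + e3 qi qj x y + e3 qi qk x y)
  + v2 y * (e3 qj qi x y + e3 qj qj x y + e3 qj qk x y)
  + v3 y * (e3 qk qi x y + e3 qk qj x y + e3 qk qk x y)"
proof -
 obtain r where r: "x = qmult y r" "qmult x qi \<bullet> y = - r$2" "qmult x qj \<bullet> y = - r$3" "qmult x qk \<bullet> y = - r$4"
  "!!a. qmult y a \<bullet> x = a \<bullet> r" "!!a. qmult x a \<bullet> y = qmult r a $ 1"
  using inner_coords_S3[OF x y] by metis
 have i: "x \<bullet> v y = u y \<bullet> r" by (simp add: inner_commute[of x] v_eq_u[OF y] r(5))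
 have ii: "qmult (v y) (u x) \<bullet> x = qmult (u y) (u x) \<bullet> r" by (simp add: v_eq_u[OF y] qmult_assoc r(5))
 have c': "x \<bullet> y ~= - 1" using c by auto
 define g g' where "g = green1'' (x \<bullet> y)" and "g' = green1' (x \<bullet> y)"
 have "k3 (x, y) = g * (u y \<bullet> r) * (u x \<bullet> r) + g' * (qmult (u y) (u x) \<bullet> r)"
  unfolding k3_def case_prod_conv integrand_left_3_explicit_def u_eq[OF x] i ii r(5) if_not_P[OF c'] g_def g'_def ..
 then show ?thesis
  unfolding e3_def r(6) g_def[symmetric] g'_def[symmetric]
  by (simp add: qmult_nth inner_R4 algebra_simps)
qed

lemma sn_weight:
 assumes c: "\<bar>c\<bar> < 1"
 shows "\<bar>green0' c\<bar> * sn c <= 5 * pole_weight c" (is ?g1) "\<bar>green1'' c\<bar> * (sn c * sn c) <= 5 * pole_weight c" (is ?g2)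
  "\<bar>green1' c\<bar> <= 4 * pole_weight c" (is ?g3)
proof -
 have "c^2 < 1" using c by (simp add: abs_square_less_1)
 then have s: "sn c > 0" "1 - c^2 = sn c * sn c" by (simp_all add: sn_def)
 have W: "X <= C * pole_weight c" if "X * (sn c * sn c) <= C" for X C
  using that s(1) by (simp add: pole_weight_def s(2) pos_le_divide_eq)
 show ?g1
  by (rule W) (use green0'_bound[OF c] in \<open>simp add: power3_eq_cube mult_ac\<close>)
 show ?g2
  by (rule W) (use power_bound_weaken[OF green1''_bound[OF c] _ c, of 4] in \<open>simp add: eval_nat_numeral mult_ac\<close>)
 show ?g3
  by (rule W) (use power_bound_weaken[of "\<bar>green1' c\<bar>" c 1 4 2] green1'_bound[OF c] c in \<open>simp add: power2_eq_square\<close>)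
qed

text \<open>\<open>green0'\<close> is of order \<open>sin^-3\<close> and meets one factor of order \<open>sin\<close>; \<open>green1''\<close> is of the same order and meets two.\<close>

lemma k_bounds:
 obtains C where "C \<ge> 0" "!!x y. x \<in> S3 ==> y \<in> S3 ==> \<bar>x \<bullet> y\<bar> < 1 ==> \<bar>k1 (x, y)\<bar> <= C * pole_weight (x \<bullet> y)"
  "!!x y. x \<in> S3 ==> y \<in> S3 ==> \<bar>x \<bullet> y\<bar> < 1 ==> \<bar>k2 (x, y)\<bar> <= C * pole_weight (x \<bullet> y)"
  "!!x y. x \<in> S3 ==> y \<in> S3 ==> \<bar>x \<bullet> y\<bar> < 1 ==> \<bar>k3 (x, y)\<bar> <= C * pole_weight (x \<bullet> y)"
proof -
 obtain K where K: "K > 0" "!!x. x \<in> S3 ==> norm (v x) <= K" using v_bound by blast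
 have n1: "norm z = 1" if "z \<in> S3" for z using that by (simp add: S3_def)
 have nL: "norm (qmult y (qmult (qconj x) (v x))) <= K" if "x \<in> S3" "y \<in> S3" for x y
  using K(2)[OF that(1)] by (simp add: norm_qmult n1 that)
 have tL: "qmult y (qmult (qconj x) (v x)) \<bullet> y = 0" if "x \<in> S3" for x y
  unfolding u_eq[OF that] by (rule inner_qmult_imaginary) simp
 have tv: "v y \<bullet> y = 0" if "y \<in> S3" for y using v_tangent[OF that] by (simp add: inner_commute)
 have f: "\<bar>frame_comp v p x\<bar> <= K" if "imag_unit p" "x \<in> S3" for p x
 proof -
  have "\<bar>v x \<bullet> qmult x p\<bar> <= norm (v x) * norm (qmult x p)" by (rule Cauchy_Schwarz_ineq2)
  then show ?thesis using K(2)[OF that(2)] n1[OF that(2)] n1[OF imag_unit_in_S3[OF that(1)]]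
   by (simp add: frame_comp_S3[OF that(2)] norm_qmult)
 qed
 show ?thesis
 \<comment> \<open>Six terms of size 5 in the first integrand; the others need less.\<close>
 proof (rule that[of "30 * (K * K)"])
  show "0 <= 30 * (K * K)" by simp
  fix x y assume x: "x \<in> S3" and y: "y \<in> S3" and c: "\<bar>x \<bullet> y\<bar> < 1"
  have s: "sn (x \<bullet> y) > 0" by (rule sn_pos(1)[OF c])
  have w1: "1 <= pole_weight (x \<bullet> y)"
   using c by (simp add: pole_weight_def abs_square_less_1)
  have w0: "0 <= K * K * pole_weight (x \<bullet> y)" using w1 by simp
  have t: "\<bar>frame_comp v q y * (green0' (x \<bullet> y) * (qmult x p \<bullet> y) * frame_comp v r x)\<bar> <= 5 * (K * K * pole_weight (x \<bullet> y))"
   if "imag_unit p" "imag_unit q" "imag_unit r" for p q r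
  proof -
   have "\<bar>frame_comp v q y * (green0' (x \<bullet> y) * (qmult x p \<bullet> y) * frame_comp v r x)\<bar>
    = (\<bar>frame_comp v q y\<bar> * \<bar>frame_comp v r x\<bar>) * (\<bar>green0' (x \<bullet> y)\<bar> * \<bar>qmult x p \<bullet> y\<bar>)" by (simp add: abs_mult)
   also have "\<dots> <= (K * K) * (\<bar>green0' (x \<bullet> y)\<bar> * sn (x \<bullet> y))"
    using K(1) s by (intro mult_mono f that x y order_refl tangential_bound) auto
   also have "\<dots> <= (K * K) * (5 * pole_weight (x \<bullet> y))" by (intro mult_left_mono sn_weight c) simp
   finally show ?thesis by simp
  qed
  show "\<bar>k1 (x, y)\<bar> <= 30 * (K * K) * pole_weight (x \<bullet> y)"
   unfolding k1_frame[OF x y] right_diff_distrib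
   using t[of qj qi qk] t[of qk qi qj] t[of qk qj qi] t[of qi qj qk] t[of qi qk qj] t[of qj qk qi] by simp
  have "\<bar>k2 (x, y)\<bar> <= norm (qmult y (qmult (qconj x) (v x))) * norm (v y)"
   unfolding k2_def case_prod_conv by (rule Cauchy_Schwarz_ineq2)
  also have "\<dots> <= K * K" using K(1) by (intro mult_mono nL K(2) x y) auto
  also have "\<dots> <= K * K * pole_weight (x \<bullet> y)" using w1 mult_left_mono[OF w1, of "K * K"] by simp
  finally show "\<bar>k2 (x, y)\<bar> <= 30 * (K * K) * pole_weight (x \<bullet> y)" using w0 by simp
  have c': "x \<bullet> y ~= - 1" using c by auto
  let ?A = "green1'' (x \<bullet> y) * (x \<bullet> v y) * (qmult y (qmult (qconj x) (v x)) \<bullet> x)"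
  let ?B = "green1' (x \<bullet> y) * (qmult (v y) (qmult (qconj x) (v x)) \<bullet> x)"
  have "\<bar>?A\<bar> = \<bar>green1'' (x \<bullet> y)\<bar> * (\<bar>v y \<bullet> x\<bar> * \<bar>qmult y (qmult (qconj x) (v x)) \<bullet> x\<bar>)"
   by (simp add: abs_mult inner_commute)
  also have "\<dots> <= \<bar>green1'' (x \<bullet> y)\<bar> * ((K * sn (x \<bullet> y)) * (K * sn (x \<bullet> y)))"
  proof (intro mult_left_mono mult_mono)
   show "\<bar>v y \<bullet> x\<bar> <= K * sn (x \<bullet> y)"
    by (rule order_trans[OF tangent_inner_bound[OF x y tv[OF y]]]) (use K(2)[OF y] s in simp)
   show "\<bar>qmult y (qmult (qconj x) (v x)) \<bullet> x\<bar> <= K * sn (x \<bullet> y)"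
    by (rule order_trans[OF tangent_inner_bound[OF x y tL[OF x]]]) (use nL[OF x y] s in simp)
  qed (use K s in auto)
  also have "\<dots> = (K * K) * (\<bar>green1'' (x \<bullet> y)\<bar> * (sn (x \<bullet> y) * sn (x \<bullet> y)))" by simp
  also have "\<dots> <= (K * K) * (5 * pole_weight (x \<bullet> y))" by (intro mult_left_mono sn_weight c) simp
  finally have A: "\<bar>?A\<bar> <= 5 * (K * K * pole_weight (x \<bullet> y))" by simp
  have "\<bar>qmult (v y) (qmult (qconj x) (v x)) \<bullet> x\<bar> <= norm (qmult (v y) (qmult (qconj x) (v x))) * norm x"
   by (rule Cauchy_Schwarz_ineq2)
  also have "\<dots> <= K * K" using K(1) by (simp add: norm_qmult n1 x) (intro mult_mono K(2) x y; simp)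
  finally have "\<bar>?B\<bar> <= (4 * pole_weight (x \<bullet> y)) * (K * K)"
   unfolding abs_mult using w1 by (intro mult_mono sn_weight c) auto
  then have "\<bar>?B\<bar> <= 4 * (K * K * pole_weight (x \<bullet> y))" by (simp add: mult_ac)
  then have "\<bar>?A + ?B\<bar> <= 9 * (K * K * pole_weight (x \<bullet> y))"
   using A abs_triangle_ineq[of ?A ?B] by linarith
  then show "\<bar>k3 (x, y)\<bar> <= 30 * (K * K) * pole_weight (x \<bullet> y)"
   unfolding k3_def case_prod_conv integrand_left_3_explicit_def if_not_P[OF c'] using w0 by simp
 qed
qed

lemma has_bochner_integral_eqI: "integrable M f ==> integral\<^sup>L M f = a ==> has_bochner_integral M f (a :: real)"
 by (simp add: has_bochner_integral_iff)

text \<open>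
 Integration in \<open>x\<close> first: in the frame the kernels are those of \<open>green0_by_parts\<close> and \<open>green1_by_parts\<close>, read from
 right to left.
\<close>

lemma k_integrals:
 shows "has_bochner_integral vol_S3_pair k1 (intS3 (%y. - (v1 y * G0 c1 y + v2 y * G0 c2 y + v3 y * G0 c3 y)))" (is ?g1)
  "has_bochner_integral vol_S3_pair k2 (intS3 (%y. v1 y * intS3 v1 + v2 y * intS3 v2 + v3 y * intS3 v3))" (is ?g2)
  "has_bochner_integral vol_S3_pair k3
   (intS3 (%y. v1 y * G1 (Lie qi dv) y + v2 y * G1 (Lie qj dv) y + v3 y * G1 (Lie qk dv) y))" (is ?g3)
proof -
 obtain C where C: "C \<ge> 0" "!!x y. x \<in> S3 ==> y \<in> S3 ==> \<bar>x \<bullet> y\<bar> < 1 ==> \<bar>k1 (x, y)\<bar> <= C * pole_weight (x \<bullet> y)"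
  "!!x y. x \<in> S3 ==> y \<in> S3 ==> \<bar>x \<bullet> y\<bar> < 1 ==> \<bar>k2 (x, y)\<bar> <= C * pole_weight (x \<bullet> y)"
  "!!x y. x \<in> S3 ==> y \<in> S3 ==> \<bar>x \<bullet> y\<bar> < 1 ==> \<bar>k3 (x, y)\<bar> <= C * pole_weight (x \<bullet> y)"
  by (rule k_bounds) (rule that; assumption)
 have e1: "has_bochner_integral vol_S3 (%x. green0' (x \<bullet> y) * (qmult x p \<bullet> y) * frame_comp v q x) (- G0 (Lie p (frame_comp v q)) y)"
  if p: "imag_unit p" and y: "y \<in> S3" for p q y
  by (rule has_bochner_integral_eqI[OF green0'_limit(1)[OF y p continuous_S3_smooth[OF v_comp]]])
    (use green0_by_parts[OF y p v_comp] in \<open>simp add: G_eq[OF y] cont_lie[OF v_comp]\<close>)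
 have cl: "continuous_on S3 (Lie p (frame_comp v q))" for p q by (rule cont_lie[OF v_comp])
 show ?g1
 proof (rule S3_kernel_integral[OF measurable_k(1) C(1,2) _ k1_frame])
  fix y assume y: "y \<in> S3"
  have g: "G0 c1 y = G0 (Lie qj v3) y - G0 (Lie qk v2) y" "G0 c2 y = G0 (Lie qk v1) y - G0 (Lie qi v3) y"
   "G0 c3 y = G0 (Lie qi v2) y - G0 (Lie qj v1) y"
   unfolding c1_def[abs_def] c2_def[abs_def] c3_def[abs_def] by (simp_all add: G_linear[OF y] cl)
  let ?e = "%p q. - G0 (Lie p (frame_comp v q)) y"
  have eq: "- (v1 y * G0 c1 y + v2 y * G0 c2 y + v3 y * G0 c3 y)
   = v1 y * (?e qj qk - ?e qk qj) + v2 y * (?e qk qi - ?e qi qk) + v3 y * (?e qi qj - ?e qj qi)"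
   unfolding g by (simp add: algebra_simps)
  show "has_bochner_integral vol_S3 (%x.
    v1 y * (green0' (x \<bullet> y) * (qmult x qj \<bullet> y) * v3 x - green0' (x \<bullet> y) * (qmult x qk \<bullet> y) * v2 x)
   + v2 y * (green0' (x \<bullet> y) * (qmult x qk \<bullet> y) * v1 x - green0' (x \<bullet> y) * (qmult x qi \<bullet> y) * v3 x)
   + v3 y * (green0' (x \<bullet> y) * (qmult x qi \<bullet> y) * v2 x - green0' (x \<bullet> y) * (qmult x qj \<bullet> y) * v1 x))
   (- (v1 y * G0 c1 y + v2 y * G0 c2 y + v3 y * G0 c3 y))"
   unfolding eq by (intro has_bochner_integral_add has_bochner_integral_diff has_bochner_integral_mult_right e1 y imag_unit_ijk)
 qed
 have e2: "has_bochner_integral vol_S3 (frame_comp v q) (intS3 (frame_comp v q))" for q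
  by (rule has_bochner_integral_eqI[OF integrable_S3_continuous[OF continuous_S3_smooth[OF v_comp]] refl])
 show ?g2
 proof (rule S3_kernel_integral[OF measurable_k(2) C(1,3) _ k2_frame])
  show "has_bochner_integral vol_S3 (%x. v1 y * v1 x + v2 y * v2 x + v3 y * v3 x)
   (v1 y * intS3 v1 + v2 y * intS3 v2 + v3 y * intS3 v3)" for y
   by (intro has_bochner_integral_add has_bochner_integral_mult_right e2)
 qed
 have e3: "has_bochner_integral vol_S3 (%x. e3 p q x y) (G1 (Lie p (Lie q (frame_comp v q))) y)"
  if p: "imag_unit p" and q: "imag_unit q" and y: "y \<in> S3" for p q y
 proof -
  have c: "continuous_on S3 (frame_comp v q)" by (rule continuous_S3_smooth[OF v_comp])
  have qp: "qmult q p \<in> S3" by (intro qmult_in_S3 imag_unit_in_S3 p q)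
  have "G1 (Lie p (Lie q (frame_comp v q))) y
   = intS3 (%x. green1 (x \<bullet> y) * Lie p (Lie q (frame_comp v q)) x)"
   by (rule G_eq(2)[OF y cont_lie[OF Cinf_on_Lie[OF v_comp]]])
  then show ?thesis
   unfolding e3_def green1_by_parts[OF y p q v_comp]
   by (simp only:) (intro has_bochner_integral_add has_bochner_integral_eqI refl green1''_limit(1)[OF y p q c] green1'_limit(1)[OF y qp c])
 qed
 show ?g3
 proof (rule S3_kernel_integral[OF measurable_k(3) C(1,4) _ k3_frame])
  fix y assume y: "y \<in> S3"
  have cl2: "continuous_on S3 (Lie p (Lie q (frame_comp v q)))" for p q
   by (rule cont_lie[OF Cinf_on_Lie[OF v_comp]])
  let ?e = "%p q. G1 (Lie p (Lie q (frame_comp v q))) y"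
  have g: "G1 (Lie p dv) y = ?e p qi + ?e p qj + ?e p qk" for p
  proof -
   have "G1 (Lie p dv) y = G1 (%x. Lie p (Lie qi v1) x + Lie p (Lie qj v2) x + Lie p (Lie qk v3) x) y"
    by (rule G_cong(2)[OF y cont_lie[OF Cinf_dc(1)] _ Lie_dc(1)]) (intro continuous_on_add cl2)
   then show ?thesis by (simp add: G_linear[OF y] cl2 continuous_on_add)
  qed
  show "has_bochner_integral vol_S3 (%x. v1 y * (e3 qi qi x y + e3 qi qj x y + e3 qi qk x y)
   + v2 y * (e3 qj qi x y + e3 qj qj x y + e3 qj qk x y) + v3 y * (e3 qk qi x y + e3 qk qj x y + e3 qk qk x y))
   (v1 y * G1 (Lie qi dv) y + v2 y * G1 (Lie qj dv) y + v3 y * G1 (Lie qk dv) y)"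
   unfolding g by (intro has_bochner_integral_add has_bochner_integral_mult_right e3 y imag_unit_ijk)
 qed
qed

lemma helicity_S3_eq:
 "helicity_S3 v = integral\<^sup>L vol_S3_pair k1 - 1 / (4 * pi^2) * integral\<^sup>L vol_S3_pair k2 + 2 * integral\<^sup>L vol_S3_pair k3"
proof -
 let ?a = "%y. - (v1 y * G0 c1 y + v2 y * G0 c2 y + v3 y * G0 c3 y)"
 let ?b = "%y. v1 y * intS3 v1 + v2 y * intS3 v2 + v3 y * intS3 v3"
 let ?c = "%y. v1 y * G1 (Lie qi dv) y + v2 y * G1 (Lie qj dv) y + v3 y * G1 (Lie qk dv) y"
 have cv: "continuous_on S3 (frame_comp v p)" for p by (rule continuous_S3_smooth[OF v_comp])
 have cG: "continuous_on S3 (G0 F)" "continuous_on S3 (G1 F)" if "smooth F" for F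
  using Cinf_on_G[OF that] by (auto intro: continuous_S3_smooth)
 have I: "integrable vol_S3 ?a" "integrable vol_S3 ?b" "integrable vol_S3 ?c"
  by (intro integrable_S3_continuous continuous_intros cv cG Cinf_dc Cinf_on_Lie)+
 have "helicity_S3 v = intS3 (%y. ?a y - 1 / (4 * pi^2) * ?b y + 2 * ?c y)"
  unfolding helicity_S3_def biot_savart_S3_eq
 proof (rule intS3_cong)
  fix y assume y: "y \<in> S3"
  have "W y \<bullet> v y = w1 y * v1 y + w2 y * v2 y + w3 y * v3 y"
   using y frame_comp_frame_field[OF y, of w1 w2 w3] v_expansion[OF y]
   by (simp add: W_def frame_field_def[of v1] inner_add_right mult.commute)
  then show "W y \<bullet> v y = ?a y - 1 / (4 * pi^2) * ?b y + 2 * ?c y"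
   by (simp add: w1_def w2_def w3_def algebra_simps add_divide_distrib)
 qed
 also have "\<dots> = intS3 ?a - 1 / (4 * pi^2) * intS3 ?b + 2 * intS3 ?c"
  by (simp only: Bochner_Integration.integral_add Bochner_Integration.integral_diff integral_mult_right_zero
    Bochner_Integration.integrable_diff integrable_mult_right I)
 finally show ?thesis using k_integrals by (simp add: has_bochner_integral_integral_eq)
qed

text \<open>
 Put \<open>r = y\<^sup>-\<^sup>1 x = c + \<rho>\<close> with \<open>c = x \<cdot> y\<close>, and let \<open>a, b\<close> be the fields at \<open>x, y\<close> translated to the unit
 element. Both sides are combinations of \<open>T = \<rho> \<cdot> (a \<times> b)\<close>, \<open>(a \<cdot> \<rho>) (b \<cdot> \<rho>)\<close> and \<open>a \<cdot> b\<close>: the determinant on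
 the left is \<open>c T + (a \<cdot> \<rho>) (b \<cdot> \<rho>) - \<bar>\<rho>\<bar>^2 (a \<cdot> b)\<close>. The coefficients agree by \<open>green_relations\<close>.
\<close>

lemma parallel_integrand_eq:
 assumes x: "x \<in> S3" and y: "y \<in> S3" and c: "\<bar>x \<bullet> y\<bar> < 1"
 shows "2 * green1'' (x \<bullet> y) * det4 y (v x) (v y) x
  = k1 (x, y) - 1 / (4 * pi^2) * k2 (x, y) + 2 * k3 (x, y)"
proof -
 obtain r where r: "x = qmult y r" "r \<bullet> r = 1" "x \<bullet> y = r$1" "qmult x qi \<bullet> y = - r$2" "qmult x qj \<bullet> y = - r$3" "qmult x qk \<bullet> y = - r$4"
  "!!a. qmult y a \<bullet> x = a \<bullet> r" using inner_coords_S3[OF x y] by metis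
 define a b where "a = u x" and "b = u y"
 have a1: "a$1 = 0" and b1: "b$1 = 0" by (simp_all add: a_def b_def)
 have i: "x \<bullet> v y = b \<bullet> r" by (simp add: inner_commute[of x] v_eq_u[OF y] r(7) b_def)
 have ii: "qmult (v y) a \<bullet> x = qmult b a \<bullet> r" by (simp add: v_eq_u[OF y] qmult_assoc r(7) b_def)
 have c': "x \<bullet> y ~= - 1" using c by auto
 define T where "T = r$2 * (a$3 * b$4 - a$4 * b$3) + r$3 * (a$4 * b$2 - a$2 * b$4) + r$4 * (a$2 * b$3 - a$3 * b$2)"
 have d1: "det4 y (qmult y a) (v y) x = T"
  using det_frame[OF y, of a b r] by (simp add: v_eq_u[OF y] r(1)[symmetric] b_def[symmetric] T_def algebra_simps)
 have vx: "v x = qmult y (qmult r a)" by (simp add: v_eq_u[OF x] a_def[symmetric] qmult_assoc[symmetric] r(1)[symmetric])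
 have "det4 y (v x) (v y) x = r$1 * T + (b \<bullet> r) * (a \<bullet> r) - (r \<bullet> r - (r$1)^2) * (a \<bullet> b)"
  using det_frame[OF y, of "qmult r a" b r] a1 b1
  by (simp add: vx v_eq_u[OF y] r(1)[symmetric] b_def[symmetric] T_def) (simp add: qmult_nth inner_R4 power2_eq_square algebra_simps)
 then have d2: "det4 y (v x) (v y) x = r$1 * T + (b \<bullet> r) * (a \<bullet> r) - (1 - (r$1)^2) * (a \<bullet> b)"
  unfolding r(2) .
 have q: "qmult b a \<bullet> r = - (r$1 * (a \<bullet> b)) - T"
  using a1 b1 by (simp add: T_def qmult_nth inner_R4 algebra_simps)
 have k2: "k2 (x, y) = a \<bullet> b" unfolding k2_frame[OF x y] by (simp add: a_def b_def inner_R4 mult.commute)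
 have k1: "k1 (x, y) = - green0' (r$1) * T"
  unfolding k1_def case_prod_conv u_eq[OF x] a_def[symmetric] d1 r(3) ..
 have k3: "k3 (x, y) = green1'' (r$1) * (b \<bullet> r) * (a \<bullet> r) + green1' (r$1) * (- (r$1 * (a \<bullet> b)) - T)"
  unfolding k3_def case_prod_conv integrand_left_3_explicit_def u_eq[OF x] a_def[symmetric] i ii q r(7) if_not_P[OF c'] unfolding r(3) ..
 note g = green_relations[OF c, unfolded r(3)]
 have "2 * green1'' (r$1) * (r$1 * T + (b \<bullet> r) * (a \<bullet> r) - (1 - (r$1)^2) * (a \<bullet> b))
   = (2 * r$1 * green1'' (r$1)) * T + 2 * (green1'' (r$1) * (b \<bullet> r) * (a \<bullet> r)) - (2 * (1 - (r$1)^2) * green1'' (r$1)) * (a \<bullet> b)"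
  by (simp add: algebra_simps)
 also have "\<dots> = (- green0' (r$1) - 2 * green1' (r$1)) * T + 2 * (green1'' (r$1) * (b \<bullet> r) * (a \<bullet> r)) - (1 / (4 * pi^2) + 2 * r$1 * green1' (r$1)) * (a \<bullet> b)"
  unfolding g(1)[symmetric] g(2)[symmetric] by (simp add: algebra_simps)
 finally show ?thesis unfolding d2 r(3) k1 k2 k3 by (simp add: algebra_simps)
qed

lemma S3_pair_integral_cong:
 assumes "has_bochner_integral vol_S3_pair F I" "!!x y. x \<in> S3 ==> y \<in> S3 ==> F' (x, y) = F (x, y)"
 shows "has_bochner_integral vol_S3_pair F' I"
 by (rule has_bochner_integral_cong[THEN iffD1, OF refl _ refl assms(1)])
   (auto simp: space_pair_measure S3.space_volume assms(2))

lemma helicity_S3_left: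
 "\<exists>I\<^sub>1 I\<^sub>2 I\<^sub>3.
   has_bochner_integral vol_S3_pair
    (%(x, y). cross_S3 y (left_transport y x (v x)) (v y)
          \<bullet> grad_S3 (%z. 1 / (4 * pi^2) * (pi - dist_S3 x z) * cot (dist_S3 x z)) y) I\<^sub>1 \<and>
   has_bochner_integral vol_S3_pair (%(x, y). left_transport y x (v x) \<bullet> v y) I\<^sub>2 \<and>
   has_bochner_integral vol_S3_pair
    (%(x, y). grad_S3 (%z. left_transport z x (v x)
            \<bullet> grad_S3 (%s. - (1 / (16 * pi^2)) * dist_S3 x s * (2 * pi - dist_S3 x s)) z) y \<bullet> v y) I\<^sub>3 \<and>
   helicity_S3 v = I\<^sub>1 - 1 / (4 * pi^2) * I\<^sub>2 + 2 * I\<^sub>3"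
proof -
 note K = k_integrals[unfolded k_integrals[THEN has_bochner_integral_integral_eq, symmetric]]
 show ?thesis
  by (intro exI conjI, rule S3_pair_integral_cong[OF K(1)], simp only: case_prod_conv k1_def integrand_left_1[where v = v] v_tangent,
    rule S3_pair_integral_cong[OF K(2)], simp only: case_prod_conv k2_def left_transport_eq,
    rule S3_pair_integral_cong[OF K(3)], simp only: case_prod_conv k3_def integrand_left_3[where v = v] v_tangent,
    rule helicity_S3_eq)
qed

lemma helicity_S3_parallel:
 "has_bochner_integral vol_S3_pair
   (%(x, y). cross_S3 y (transport_S3 y x (v x)) (v y)
         \<bullet> grad_S3 (%z. 1 / (4 * pi^2) * (pi - dist_S3 x z) * (1 / sin (dist_S3 x z))) y) (helicity_S3 v)"
proof (rule S3_pair_integral_cong)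
 let ?k = "%(x, y). 2 * green1'' (x \<bullet> y) * det4 y (v x) (v y) x"
 note K = k_integrals[THEN has_bochner_integral_integral_eq, symmetric]
 have s: "has_bochner_integral vol_S3_pair (%z. k1 z - 1 / (4 * pi^2) * k2 z + 2 * k3 z) (helicity_S3 v)"
  unfolding helicity_S3_eq
  by (intro has_bochner_integral_add has_bochner_integral_diff has_bochner_integral_mult_right k_integrals[unfolded K])
 show "has_bochner_integral vol_S3_pair ?k (helicity_S3 v)"
 proof (rule has_bochner_integral_cong_AE[THEN iffD1, OF _ _ _ s])
  show "(%z. k1 z - 1 / (4 * pi^2) * k2 z + 2 * k3 z) \<in> borel_measurable vol_S3_pair"
   using s by (rule borel_measurable_has_bochner_integral)
  show "?k \<in> borel_measurable vol_S3_pair" by (rule measurable_k(4))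
  show "AE z in vol_S3_pair. k1 z - 1 / (4 * pi^2) * k2 z + 2 * k3 z = ?k z"
   using AE_S3_pair_not_pole AE_space
  proof eventually_elim
   case (elim z)
   then show ?case
    using parallel_integrand_eq[of "fst z" "snd z"]
    by (simp add: space_pair_measure S3.space_volume case_prod_unfold mem_Times_iff)
  qed
 qed
 fix x y assume "x \<in> S3" "y \<in> S3"
 then show "(case (x, y) of (x, y) => cross_S3 y (transport_S3 y x (v x)) (v y)
         \<bullet> grad_S3 (%z. 1 / (4 * pi^2) * (pi - dist_S3 x z) * (1 / sin (dist_S3 x z))) y) = ?k (x, y)"
  by (simp only: case_prod_conv integrand_parallel[where v = v] v_tangent)
qed

end

section \<open>Helicity on hyperbolic space\<close>

text \<open>A crude form of Hadamard's inequality, from the Leibniz expansion.\<close>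

lemma abs_det_le:
 fixes A :: "real^'n^'n"
 shows "\<bar>det A\<bar> <= fact CARD('n) * (\<Prod>i\<in>UNIV. norm (A $ i))"
proof -
 have "\<bar>det A\<bar> <= (\<Sum>p | p permutes (UNIV :: 'n set). \<bar>of_int (sign p) * (\<Prod>i\<in>UNIV. A $ i $ p i)\<bar>)"
  unfolding det_def by (rule sum_abs)
 also have "\<dots> <= (\<Sum>p | p permutes (UNIV :: 'n set). \<Prod>i\<in>UNIV. norm (A $ i))"
 proof (rule sum_mono)
  fix p assume "p \<in> {p. p permutes (UNIV :: 'n set)}"
  have "\<bar>of_int (sign p) * (\<Prod>i\<in>UNIV. A $ i $ p i)\<bar> = (\<Prod>i\<in>UNIV. \<bar>A $ i $ p i\<bar>)"
   by (simp add: abs_mult abs_prod sign_def)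
  also have "\<dots> <= (\<Prod>i\<in>UNIV. norm (A $ i))"
   by (intro prod_mono) (simp add: component_le_norm_cart)
  finally show "\<bar>of_int (sign p) * (\<Prod>i\<in>UNIV. A $ i $ p i)\<bar> <= (\<Prod>i\<in>UNIV. norm (A $ i))" .
 qed
 also have "\<dots> = fact CARD('n) * (\<Prod>i\<in>UNIV. norm (A $ i))"
  by (simp add: card_permutations[OF refl])
 finally show ?thesis .
qed

lemma abs_det_4_le: "\<bar>det4 a b c d\<bar> <= 24 * (norm a * norm b * norm c * norm d)"
proof -
 have p: "(\<Prod>i\<in>UNIV. f i) = f 1 * f 2 * f 3 * f 4" for f :: "4 => real"
  unfolding UNIV_4 by (simp add: mult.assoc)
 have f: "fact CARD(4) = (24 :: real)" by (simp add: fact_numeral)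
 show ?thesis
  using abs_det_le[of "vector [a, b, c, d] :: real^4^4"] unfolding p f vector_4_nth .
qed

subsection \<open>The integrands\<close>

text \<open>The derivative of \<open>1 / (4 \<pi> sinh \<alpha>)\<close> with respect to \<open>b = - cosh \<alpha>\<close>; it is 0 at \<open>b = - 1\<close>.\<close>

definition csch_kernel :: "real => real" where
 "csch_kernel b = - b / (4 * pi * sqrt (b^2 - 1) ^ 3)"

lemma DERIV_csch:
 assumes b: "b < - 1"
 shows "((%b. k / (4 * pi) * (1 / sqrt (b^2 - 1))) has_real_derivative k * csch_kernel b) (at b)"
proof -
 have "1 < b^2" using one_less_power[of "- b" 2] b by simp
 then have s: "sqrt (b^2 - 1) > 0" by simp
 then have "((%b. k / (4 * pi) * (1 / sqrt (b^2 - 1))) has_real_derivative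
  k / (4 * pi) * (- (b / sqrt (b^2 - 1)) / (sqrt (b^2 - 1) * sqrt (b^2 - 1)))) (at b)"
  by (auto intro!: derivative_eq_intros simp: divide_simps)
 moreover have "k / (4 * pi) * (- (b / sqrt (b^2 - 1)) / (sqrt (b^2 - 1) * sqrt (b^2 - 1))) = k * csch_kernel b"
  using s by (simp add: csch_kernel_def power3_eq_cube)
 ultimately show ?thesis by simp
qed

lemma csch_dist_H3:
 "x \<in> H3 ==> z \<in> H3 ==> 1 / sinh (dist_H3 x z) = 1 / sqrt ((hdot x z)^2 - 1)"
 using H3_hdot_le[of x z] by (simp add: dist_H3_eq sinh_arcosh_real)

lemma grad_csch_H3:
 assumes x: "x \<in> H3" and y: "y \<in> H3" and ne: "x ~= y"
 shows "grad_H3 (%z. k / (4 * pi) * (1 / sinh (dist_H3 x z))) y = (k * csch_kernel (hdot x y)) *\<^sub>R (x + hdot x y *\<^sub>R y)"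
proof (rule H3.grad_eqI[OF y])
 have b: "hdot x y < - 1" using H3_hdot_le[OF x y] H3_hdot_eq[OF x y] ne by fastforce
 show "hdot y ((k * csch_kernel (hdot x y)) *\<^sub>R (x + hdot x y *\<^sub>R y)) = 0"
  using y by (simp add: H3_iff hdot_commute[of y x])
 have "((%z. hdot x z) has_derivative (%h. hdot x h)) (at y within H3)"
  by (rule bounded_linear_imp_has_derivative[OF hdot.bounded_linear_right])
 from has_derivative_compose[OF this DERIV_csch[OF b, unfolded has_field_derivative_def]]
 have "((%z. k / (4 * pi) * (1 / sqrt ((hdot x z)^2 - 1))) has_derivative (%h. k * csch_kernel (hdot x y) * hdot x h)) (at y within H3)" .
 then show "((%z. k / (4 * pi) * (1 / sinh (dist_H3 x z))) has_derivative (%h. k * csch_kernel (hdot x y) * hdot x h)) (at y within H3)"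
  by (rule has_derivative_transform[OF y, rotated]) (simp only: csch_dist_H3[OF x])
 show "hdot ((k * csch_kernel (hdot x y)) *\<^sub>R (x + hdot x y *\<^sub>R y)) h = k * csch_kernel (hdot x y) * hdot x h"
  if "hdot y h = 0" for h using that by simp
qed

text \<open>The function is unbounded near \<open>x\<close>, hence not continuous.\<close>

lemma grad_csch_H3_pole:
 assumes x: "x \<in> H3" and k: "k ~= 0"
 shows "grad_H3 (%z. k / (4 * pi) * (1 / sinh (dist_H3 x z))) x = 0"
proof (rule H3.grad_eq_0I)
 let ?F = "%z. k / (4 * pi) * (1 / sinh (dist_H3 x z))"
 define l where "l t = graph_chart 1 (spatial x + t *\<^sub>R axis 1 1)" for t :: real
 have l0: "l 0 = x" by (simp add: l_def graph_chart_H3_spatial x)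
 have lM: "l t \<in> H3" for t using graph_chart_H3 by (auto simp: parametrization_def l_def)
 have c: "continuous_on UNIV (graph_chart 1)"
  by (rule Cinf_on_continuous) (use graph_chart_H3 in \<open>simp add: parametrization_def\<close>)
 have "continuous_on UNIV l" unfolding l_def
  by (rule continuous_on_compose2[OF c]) (auto intro!: continuous_intros)
 then have "(l \<longlongrightarrow> l 0) (at 0)" by (simp add: continuous_on_def)
 then have lim: "(l \<longlongrightarrow> x) (at 0)" by (simp add: l0)
 show "\<not> continuous (at x within H3) ?F"
 proof (rule H3.not_continuous_withinI[OF lim _ lM, of 1])
  have "((%t. (hdot x (l t))^2 - 1) \<longlongrightarrow> (hdot x x)^2 - 1) (at 0)"
   by (intro tendsto_intros hdot.tendsto lim)
  then have "((%t. (hdot x (l t))^2 - 1) \<longlongrightarrow> 0) (at 0)" using x by (simp add: H3_iff)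
  then have "eventually (%t. (hdot x (l t))^2 - 1 < (\<bar>k\<bar> / (4 * pi))^2) (at 0)"
   by (rule order_tendstoD) (use k in simp)
  moreover have "eventually (%t. t ~= 0) (at (0::real))" by (simp add: eventually_at_filter)
  ultimately show "eventually (%t. 1 <= \<bar>?F (l t) - ?F x\<bar>) (at 0)"
  proof eventually_elim
   case (elim t)
   have "spatial (l t) ~= spatial x" using elim(2) by (simp add: l_def axis_eq_0_iff)
   then have "x ~= l t" by auto
   then have "hdot x (l t) < - 1" using H3_hdot_le[OF x lM[of t]] H3_hdot_eq[OF x lM[of t]] by fastforce
   then have "1 < (hdot x (l t))^2" using one_less_power[of "- hdot x (l t)" 2] by simp
   then have s: "sqrt ((hdot x (l t))^2 - 1) > 0" by simp
   have "sqrt ((hdot x (l t))^2 - 1) <= \<bar>k\<bar> / (4 * pi)"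
    using elim(1) by (intro real_le_lsqrt) auto
   then have "1 <= \<bar>k\<bar> / (4 * pi) * (1 / sqrt ((hdot x (l t))^2 - 1))" using s by (simp add: pos_le_divide_eq mult.commute)
   moreover have F: "?F (l t) = k / (4 * pi) * (1 / sqrt ((hdot x (l t))^2 - 1))" "?F x = 0"
    using x by (simp_all only: csch_dist_H3 lM) (simp add: H3_iff)
   moreover have "\<bar>?F (l t) - ?F x\<bar> = \<bar>k\<bar> / (4 * pi) * (1 / sqrt ((hdot x (l t))^2 - 1))"
    unfolding F using s by (simp add: abs_mult)
   ultimately show ?case by linarith
  qed
 qed auto
qed

text \<open>
 Adding combinations of other rows to a row: this removes transport and the projection of \<open>x\<close> from the
 integrands, and lets \<open>x - y\<close>, which is small near the diagonal, replace \<open>x\<close>.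
\<close>

lemma det_drop:
 "det4 y (u - s *\<^sub>R (x + y)) w (k *\<^sub>R (x + b *\<^sub>R y)) = k * det4 y u w x"
 "det4 y (u - s *\<^sub>R (x + y)) (k *\<^sub>R (x + b *\<^sub>R y)) w = k * det4 y u x w"
 "det4 y u (x - y) w = det4 y u x w"
 unfolding det_4 vector_4_nth by (simp_all add: algebra_simps)

lemma integrand_H3:
 assumes x: "x \<in> H3" and y: "y \<in> H3" and ux: "hdot x (v x) = 0"
 shows "hdot (cross_H3 y (transport_H3 y x (v x)) (v y)) (grad_H3 (%z. 1 / (4 * pi) * (1 / sinh (dist_H3 x z))) y)
  = - csch_kernel (hdot x y) * det4 y (v x) x (v y)"
proof (cases "x = y")
 case True
 then show ?thesis using grad_csch_H3_pole[OF y, of 1] x by (simp add: csch_kernel_def H3_iff)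
next
 case False
 have "det4 y (v x) (v y) x = - det4 y (v x) x (v y)"
  unfolding det_4 vector_4_nth by (simp add: algebra_simps)
 then show ?thesis
  unfolding cross_H3_hdot[OF y] grad_csch_H3[OF x y False, of 1] transport_H3_eq[OF x y ux False] det_drop by simp
qed

lemma biot_savart_kernel_H3:
 assumes x: "x \<in> H3" and y: "y \<in> H3" and ux: "hdot x (v x) = 0"
 shows "hdot (cross_H3 y (transport_H3 y x (v x)) (grad_H3 (%z. phi0_H3 (dist_H3 x z)) y)) w
  = - csch_kernel (hdot x y) * det4 y (v x) x w"
proof -
 have p: "phi0_H3 (dist_H3 x z) = - 1 / (4 * pi) * (1 / sinh (dist_H3 x z))" for z by (simp add: phi0_H3_def)
 show ?thesis
 proof (cases "x = y")
  case True
  then show ?thesis unfolding p using grad_csch_H3_pole[OF y, of "- 1"] x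
   by (simp add: csch_kernel_def H3_iff cross_H3_hdot[OF y] det_zero)
 next
  case False
  show ?thesis
   unfolding p cross_H3_hdot[OF y] grad_csch_H3[OF x y False, of "- 1"] transport_H3_eq[OF x y ux False] det_drop by simp
 qed
qed

subsection \<open>Integrability of the singularity\<close>

abbreviation inv_sq :: "R4 => R4 => real" where
 "inv_sq x y \<equiv> 1 / (norm (spatial x - spatial y))^2"

text \<open>
 On bounded sets, the distance \<open>\<delta>\<close> of the space coordinates bounds \<open>sinh \<alpha>\<close> from below. With \<open>\<tau>, T\<close> the difference and
 the sum of the time coordinates and \<open>m\<close> the length of the sum of the space coordinates,
 \<open>T \<tau> \<le> \<delta> m\<close>; and \<open>m^2 \<le> T^2 - 4\<close> because the sum of two points is time-like of square length at least 4.
\<close>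

lemma H3_separation:
 assumes x: "x \<in> H3" and y: "y \<in> H3" and R: "norm x <= R" "norm y <= R"
 defines "\<delta> \<equiv> norm (spatial x - spatial y)"
 shows "\<delta>^2 / R^2 <= (hdot x y)^2 - 1" (is ?g1) "norm (x - y) <= 2 * \<delta>" (is ?g2)
proof -
 define \<tau> where "\<tau> = x$1 - y$1"
 define T where "T = x$1 + y$1"
 define m where "m = norm (spatial x + spatial y)"
 have x0: "x$1 \<ge> 1" "y$1 \<ge> 1" using H3_ge_1 x y by auto
 have x1: "x$1 <= R" "y$1 <= R" using component_le_norm_cart[of x 1] component_le_norm_cart[of y 1] R by linarith+
 have h: "hdot x x = - 1" "hdot y y = - 1" using x y by (auto simp: H3_iff)
 have b: "hdot x y <= - 1" by (rule H3_hdot_le[OF x y])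
 have d2: "\<delta>^2 = hdot (x - y) (x - y) + \<tau>^2"
  unfolding \<delta>_def power2_norm_eq_inner by (simp add: \<tau>_def hdot_R4 inner_R3 spatial_def vector_3 power2_eq_square)
 have m2: "m^2 = T^2 + hdot (x + y) (x + y)"
  unfolding m_def power2_norm_eq_inner by (simp add: T_def hdot_R4 inner_R3 spatial_def vector_3 power2_eq_square)
 have hm: "hdot (x - y) (x - y) = - 2 - 2 * hdot x y" "hdot (x + y) (x + y) = 2 * hdot x y - 2"
  using h by (simp_all add: hdot_commute[of y x])
 have "T * \<tau> = (spatial x - spatial y) \<bullet> (spatial x + spatial y)"
  using h unfolding hdot_R4 inner_R3 by (simp add: T_def \<tau>_def spatial_def vector_3 algebra_simps)
 then have "\<bar>T * \<tau>\<bar> <= \<delta> * m" unfolding \<delta>_def m_def by (metis Cauchy_Schwarz_ineq2)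
 then have "(T * \<tau>)^2 <= (\<delta> * m)^2" by (simp add: abs_le_square_iff[symmetric] \<delta>_def m_def)
 then have *: "T^2 * \<tau>^2 <= \<delta>^2 * (T^2 + hdot (x + y) (x + y))" by (simp add: power_mult_distrib m2)
 have "\<delta>^2 * 4 <= \<delta>^2 * (- hdot (x + y) (x + y))" using hm(2) b by (intro mult_left_mono) auto
 with * have "\<delta>^2 * 4 <= T^2 * hdot (x - y) (x - y)" unfolding d2 by (simp add: algebra_simps)
 also have "\<dots> <= (2 * R)^2 * hdot (x - y) (x - y)"
  using hm(1) b x0 x1 by (intro mult_right_mono power_mono) (auto simp: T_def)
 finally have "\<delta>^2 / R^2 <= hdot (x - y) (x - y)"
  using x0 x1 by (simp add: power_mult_distrib pos_divide_le_eq mult.commute)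
 also have "\<dots> <= (hdot x y)^2 - 1"
 proof -
  have "0 <= (- hdot x y - 1) * (- hdot x y - 1)" by simp
  then show ?thesis unfolding hm(1) by (simp add: power2_eq_square algebra_simps)
 qed
 finally show ?g1 .
 have "(norm (x - y))^2 = \<delta>^2 + \<tau>^2"
  unfolding \<delta>_def power2_norm_eq_inner by (simp add: \<tau>_def inner_R3 inner_R4 spatial_def vector_3 power2_eq_square)
 also have "\<dots> <= (2 * \<delta>)^2"
 proof -
  have "0 <= hdot (x - y) (x - y)" unfolding hm(1) using b by simp
  moreover have "(2 * \<delta>)^2 = 4 * \<delta>^2" by (simp add: power_mult_distrib)
  moreover have "0 <= \<delta>^2" by simp
  ultimately show ?thesis using d2 by linarith
 qed
 finally show ?g2 by (rule power2_le_imp_le) (simp add: \<delta>_def)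
qed

text \<open>The kernel is of order \<open>\<delta>\<^sup>-\<^sup>3\<close>, and the determinant gains one factor \<open>\<delta>\<close> from \<open>x - y\<close>.\<close>

lemma csch_kernel_bound:
 assumes x: "x \<in> H3" and y: "y \<in> H3" and R: "norm x <= R" "norm y <= R"
 shows "\<bar>csch_kernel (hdot x y) * det4 y a x w\<bar>
  <= 48 * R^6 * norm a * norm w * inv_sq x y"
proof (cases "x = y")
 case True
 then show ?thesis using x by (simp add: csch_kernel_def H3_iff)
next
 case False
 define \<delta> where "\<delta> = norm (spatial x - spatial y)"
 note S = H3_separation[OF x y R, folded \<delta>_def]
 have "1 <= norm x" using H3_ge_1[OF x] component_le_norm_cart[of x 1] by linarith
 then have R1: "1 <= R" using R by linarith
 have "\<delta> ~= 0"
 proof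
  assume "\<delta> = 0"
  then have "spatial x = spatial y" by (simp add: \<delta>_def)
  then have "x = y" using graph_chart_H3_spatial x y by metis
  with False show False ..
 qed
 then have d: "\<delta> > 0" by (simp add: \<delta>_def)
 define s where "s = sqrt ((hdot x y)^2 - 1)"
 have "\<delta> / R <= s" unfolding s_def using S(1) by (intro real_le_rsqrt) (simp add: power_divide)
 then have s3: "(\<delta> / R)^3 <= s^3" using d R1 by (intro power_mono) auto
 have p: "0 < (\<delta> / R)^3" using d R1 by simp
 have "\<bar>hdot x y\<bar> <= R * R"
  using abs_hdot_le[of x y] mult_mono[OF R(1) R(2)] R1 by (simp add: order_trans[OF abs_hdot_le])
 then have "\<bar>csch_kernel (hdot x y)\<bar> <= (R * R) / (1 * (\<delta> / R)^3)"
  unfolding csch_kernel_def s_def[symmetric] abs_divide abs_mult using p s3 pi_gt3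
  by (intro frac_le mult_mono) auto
 also have "\<dots> = R^5 / \<delta>^3" using R1 by (simp add: power_divide eval_nat_numeral)
 finally have k: "\<bar>csch_kernel (hdot x y)\<bar> <= R^5 / \<delta>^3" .
 have "det4 y a x w = det4 y a (x - y) w" by (rule det_drop(3)[symmetric])
 then have "\<bar>det4 y a x w\<bar> <= 24 * (norm y * norm a * norm (x - y) * norm w)"
  using abs_det_4_le by simp
 also have "\<dots> <= 24 * (R * norm a * (2 * \<delta>) * norm w)"
  using S(2) R R1 d by (intro mult_left_mono mult_mono) auto
 finally have "\<bar>csch_kernel (hdot x y) * det4 y a x w\<bar>
  <= (R^5 / \<delta>^3) * (24 * (R * norm a * (2 * \<delta>) * norm w))"
  unfolding abs_mult using R1 d k by (intro mult_mono) auto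
 also have "\<dots> = 48 * R^6 * norm a * norm w * (1 / \<delta>^2)"
  using d by (simp add: eval_nat_numeral)
 finally show ?thesis by (simp add: \<delta>_def)
qed

text \<open>Summation over dyadic balls: the ball of radius \<open>\<rho> / 2\<^sup>n\<close> contributes at most a multiple of \<open>4\<^sup>n / 8\<^sup>n\<close>.\<close>

lemma inverse_square_nn_integral:
 assumes \<rho>: "\<rho> > 0"
 shows "\<exists>C. \<forall>a::real^3. (\<integral>\<^sup>+u. ennreal (1 / (norm (u - a))^2) * indicator (cball a \<rho>) u \<partial>lborel) <= ennreal C"
proof (intro exI allI)
 fix a :: "real^3"
 let ?V = "unit_ball_vol 3"
 define c where "c n = 4 ^ Suc n / \<rho>^2" for n :: nat
 have "(\<integral>\<^sup>+u. ennreal (1 / (norm (u - a))^2) * indicator (cball a \<rho>) u \<partial>lborel)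
  <= (\<integral>\<^sup>+u. (\<Sum>n. ennreal (c n) * indicator (cball a (\<rho> / 2 ^ n)) u) \<partial>lborel)"
 proof (rule nn_integral_mono)
  fix u :: "real^3"
  define r where "r = norm (u - a)"
  show "ennreal (1 / (norm (u - a))^2) * indicator (cball a \<rho>) u <= (\<Sum>n. ennreal (c n) * indicator (cball a (\<rho> / 2 ^ n)) u)"
  proof (cases "0 < r \<and> r <= \<rho>")
   case True
   \<comment> \<open>The least ball of the sequence that contains the point.\<close>
   obtain m where m: "(1/2) ^ m < r / \<rho>" using real_arch_pow_inv[of "r / \<rho>" "1/2"] True \<rho> by auto
   define k where "k = (LEAST m. (1/2) ^ m < r / \<rho>)"
   have k: "(1/2) ^ k < r / \<rho>" unfolding k_def by (rule LeastI[of _ m]) (rule m)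
   have "k ~= 0" using k True \<rho> by (auto intro: ccontr)
   then obtain n where n: "k = Suc n" using not0_implies_Suc by blast
   have "\<not> (1/2) ^ n < r / \<rho>" using not_less_Least[of n "%m. (1/2) ^ m < r / \<rho>"] n by (simp add: k_def)
   then have "r <= \<rho> / 2 ^ n" using \<rho> by (simp add: power_divide field_simps)
   then have mem: "u \<in> cball a (\<rho> / 2 ^ n)" by (simp add: r_def dist_norm norm_minus_commute)
   have "\<rho> / 2 ^ Suc n <= r" using k \<rho> unfolding n by (simp add: power_divide field_simps)
   then have "(\<rho> / 2 ^ Suc n)^2 <= r^2" using \<rho> by (intro power_mono) auto
   moreover have "(\<rho> / 2 ^ Suc n)^2 = 1 / c n"
    by (simp add: c_def power_divide power_mult[symmetric] power_even_eq power2_eq_square) (simp add: power_mult_distrib[symmetric])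
   ultimately have "1 / c n <= r^2" by simp
   moreover have "c n > 0" using \<rho> by (simp add: c_def)
   ultimately have le: "1 / r^2 <= c n" using True by (simp add: field_simps)
   have "ennreal (1 / (norm (u - a))^2) * indicator (cball a \<rho>) u <= ennreal (c n) * indicator (cball a (\<rho> / 2 ^ n)) u"
    using le mem by (auto simp: r_def indicator_def intro: ennreal_leI)
   also have "\<dots> = (\<Sum>i\<in>{n}. ennreal (c i) * indicator (cball a (\<rho> / 2 ^ i)) u)"
    by (simp only: sum.insert[OF finite.emptyI] sum.empty empty_iff not_False_eq_True add_0_right)
   also have "\<dots> <= (\<Sum>n. ennreal (c n) * indicator (cball a (\<rho> / 2 ^ n)) u)" by (rule sum_le_suminf) auto
   finally show ?thesis .
  next
   case False
   then have "r = 0 \<or> u \<notin> cball a \<rho>" by (auto simp: r_def dist_norm norm_minus_commute)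
   then show ?thesis by (auto simp: r_def)
  qed
 qed
 also have "\<dots> = (\<Sum>n. \<integral>\<^sup>+u. ennreal (c n) * indicator (cball a (\<rho> / 2 ^ n)) u \<partial>lborel)"
  by (intro nn_integral_suminf borel_measurable_times_ennreal borel_measurable_const borel_measurable_indicator) simp
 also have "\<dots> = (\<Sum>n. ennreal (4 * ?V * \<rho> * (1/2) ^ n))"
 proof (rule suminf_cong)
  fix n
  have "(\<integral>\<^sup>+u. ennreal (c n) * indicator (cball a (\<rho> / 2 ^ n)) u \<partial>lborel) = ennreal (c n) * emeasure lborel (cball a (\<rho> / 2 ^ n))"
   by (rule nn_integral_cmult_indicator) simp
  also have "\<dots> = ennreal (c n * (?V * (\<rho> / 2 ^ n) ^ 3))"
  proof -
   have "emeasure lborel (cball a (\<rho> / 2 ^ n)) = ennreal (?V * (\<rho> / 2 ^ n) ^ 3)"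
    using emeasure_cball[of "\<rho> / 2 ^ n" a] \<rho> by simp
   then show ?thesis using \<rho> by (simp only:) (rule ennreal_mult[symmetric]; simp add: c_def)
  qed
  also have "c n * (?V * (\<rho> / 2 ^ n) ^ 3) = 4 * ?V * \<rho> * (1/2) ^ n"
  proof -
   have "(8::real) ^ n = 4 ^ n * 2 ^ n" by (simp add: power_mult_distrib[symmetric])
   moreover have "(2 ^ n) ^ 3 = (8::real) ^ n" by (simp add: power_mult[symmetric] mult.commute[of n] power_mult)
   ultimately show ?thesis using \<rho> by (simp add: c_def power_divide power2_eq_square power3_eq_cube)
  qed
  finally show "(\<integral>\<^sup>+u. ennreal (c n) * indicator (cball a (\<rho> / 2 ^ n)) u \<partial>lborel) = ennreal (4 * ?V * \<rho> * (1/2) ^ n)" .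
 qed
 also have "\<dots> = ennreal (\<Sum>n. 4 * ?V * \<rho> * (1/2) ^ n)"
  using \<rho> by (intro suminf_ennreal2) (auto intro!: summable_mult)
 finally show "(\<integral>\<^sup>+u. ennreal (1 / (norm (u - a))^2) * indicator (cball a \<rho>) u \<partial>lborel) <= ennreal (\<Sum>n. 4 * ?V * \<rho> * (1/2) ^ n)" by simp
qed

lemma measurable_H3_ident [measurable]: "(%x. x) \<in> vol_H3 \<rightarrow>\<^sub>M borel"
 unfolding measurable_cong_sets[OF H3.sets_volume refl] by (rule measurable_restrict_space1) simp

lemma measurable_H3_continuous:
 fixes F :: "R4 => 'b::{second_countable_topology, topological_space}"
 shows "continuous_on H3 F ==> F \<in> borel_measurable vol_H3"
 unfolding measurable_cong_sets[OF H3.sets_volume refl] by (rule borel_measurable_continuous_on_restrict)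

text \<open>The density of the volume in the graph chart, \<open>1 / sqrt (1 + \<bar>u\<bar>^2)\<close>, is at most 1.\<close>

lemma nn_integral_vol_H3_le:
 assumes f: "f \<in> borel_measurable vol_H3"
 shows "(\<integral>\<^sup>+x. f x \<partial>vol_H3) <= (\<integral>\<^sup>+u. f (graph_chart 1 u) \<partial>lborel)"
proof -
 have c: "continuous_on UNIV (graph_chart 1)"
  by (rule Cinf_on_continuous) (use graph_chart_H3 in \<open>simp add: parametrization_def\<close>)
 have mg: "graph_chart 1 \<in> lborel \<rightarrow>\<^sub>M restrict_space borel H3"
  using graph_chart_H3 by (intro measurable_restrict_space2) (auto simp: parametrization_def borel_measurable_continuous_onI[OF c])
 have f': "f \<in> borel_measurable (restrict_space borel H3)" using f unfolding measurable_cong_sets[OF H3.sets_volume refl] .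
 have [measurable]: "(%u. f (graph_chart 1 u)) \<in> borel_measurable lborel" by (rule measurable_compose[OF mg f'])
 have [measurable]: "(%u::real^3. ennreal (1 / sqrt (1 + u \<bullet> u))) \<in> borel_measurable lborel" by measurable
 have "(\<integral>\<^sup>+x. f x \<partial>vol_H3) = (\<integral>\<^sup>+u. ennreal (1 / sqrt (1 + u \<bullet> u)) * f (graph_chart 1 u) \<partial>lborel)"
  unfolding vol_H3_eq using mg f'
  by (subst nn_integral_distr) (simp_all add: measurable_density_eq1 nn_integral_density)
 also have "\<dots> <= (\<integral>\<^sup>+u. f (graph_chart 1 u) \<partial>lborel)"
 proof (rule nn_integral_mono)
  fix u :: "real^3"
  have "1 <= sqrt (1 + u \<bullet> u)" by simp
  then have "1 / sqrt (1 + u \<bullet> u) <= 1" by (auto simp: divide_le_eq_1)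
  then have "ennreal (1 / sqrt (1 + u \<bullet> u)) <= 1" using ennreal_leI by fastforce
  from mult_right_mono[OF this] show "ennreal (1 / sqrt (1 + u \<bullet> u)) * f (graph_chart 1 u) <= f (graph_chart 1 u)" by simp
 qed
 finally show ?thesis .
qed

definition H3_ball :: "real => R4 set" where "H3_ball R = H3 \<inter> cball 0 R"

lemma norm_spatial_le: "norm (spatial x) <= norm x"
 by (simp add: norm_eq_sqrt_inner inner_R3 inner_R4 spatial_def vector_3)

lemma H3_ball_sets: "H3_ball R \<in> sets vol_H3"
 by (auto simp: H3.sets_volume H3_ball_def sets_restrict_space)

lemma emeasure_H3_ball: "emeasure vol_H3 (H3_ball R) < \<infinity>"
proof -
 have "emeasure vol_H3 (H3_ball R) = (\<integral>\<^sup>+x. indicator (H3_ball R) x \<partial>vol_H3)" by (simp add: H3_ball_sets)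
 also have "\<dots> <= (\<integral>\<^sup>+u. indicator (H3_ball R) (graph_chart 1 u) \<partial>lborel)"
  by (intro nn_integral_vol_H3_le borel_measurable_indicator H3_ball_sets)
 also have "\<dots> <= (\<integral>\<^sup>+u. indicator (cball 0 R) (u :: real^3) \<partial>lborel)"
 proof (rule nn_integral_mono)
  fix u :: "real^3"
  have "norm u <= R" if "norm (graph_chart 1 u) <= R"
   using norm_spatial_le[of "graph_chart 1 u"] that by simp
  then show "indicator (H3_ball R) (graph_chart 1 u) <= (indicator (cball 0 R) u :: ennreal)"
   by (auto simp: indicator_def H3_ball_def)
 qed
 also have "\<dots> < \<infinity>" using emeasure_lborel_cball_finite[of 0 R] by simp
 finally show ?thesis .
qed

interpretation vol_H3: sigma_finite_measure vol_H3
proof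
 show "\<exists>A. countable A \<and> A \<subseteq> sets vol_H3 \<and> \<Union>A = space vol_H3 \<and> (\<forall>a\<in>A. emeasure vol_H3 a ~= \<infinity>)"
 proof (intro exI[of _ "range (%n::nat. H3_ball (real n))"] conjI)
  show "\<Union>(range (%n::nat. H3_ball (real n))) = space vol_H3"
   using real_arch_simple by (auto simp: H3_ball_def H3.space_volume)
  show "\<forall>a\<in>range (%n::nat. H3_ball (real n)). emeasure vol_H3 a ~= \<infinity>"
   using emeasure_H3_ball by (metis imageE order.strict_implies_not_eq)
 qed (auto simp: H3_ball_sets)
qed

lemma measurable_inverse_square:
 "(%x. ennreal (inv_sq x y) * indicator (H3_ball R) x) \<in> borel_measurable vol_H3"
proof -
 have [measurable]: "spatial \<in> borel_measurable vol_H3"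
  by (intro measurable_H3_continuous linear_continuous_on bounded_linear_spatial)
 note [measurable] = H3_ball_sets
 show ?thesis by measurable
qed

lemma inverse_square_vol_H3:
 "\<exists>C. \<forall>y. norm y <= R -->
  (\<integral>\<^sup>+x. ennreal (inv_sq x y) * indicator (H3_ball R) x \<partial>vol_H3) <= ennreal C"
proof -
 define \<rho> where "\<rho> = max 1 (2 * R)"
 have "\<rho> > 0" by (simp add: \<rho>_def)
 from inverse_square_nn_integral[OF this] obtain C where
  C: "!!a::real^3. (\<integral>\<^sup>+u. ennreal (1 / (norm (u - a))^2) * indicator (cball a \<rho>) u \<partial>lborel) <= ennreal C" by blast
 show ?thesis
 proof (intro exI[of _ C] allI impI)
  fix y :: R4 assume y: "norm y <= R"
  have "(\<integral>\<^sup>+x. ennreal (inv_sq x y) * indicator (H3_ball R) x \<partial>vol_H3)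
   <= (\<integral>\<^sup>+u. ennreal (inv_sq (graph_chart 1 u) y) * indicator (H3_ball R) (graph_chart 1 u) \<partial>lborel)"
   by (rule nn_integral_vol_H3_le[OF measurable_inverse_square])
  also have "\<dots> <= (\<integral>\<^sup>+u. ennreal (1 / (norm (u - spatial y))^2) * indicator (cball (spatial y) \<rho>) u \<partial>lborel)"
  proof (rule nn_integral_mono)
   fix u :: "real^3"
   have "norm (u - spatial y) <= \<rho>" if "norm (graph_chart 1 u) <= R"
    using norm_spatial_le[of "graph_chart 1 u"] norm_spatial_le[of y] norm_triangle_ineq4[of u "spatial y"] that y
    by (simp add: \<rho>_def)
   then show "ennreal (inv_sq (graph_chart 1 u) y) * indicator (H3_ball R) (graph_chart 1 u)
    <= ennreal (1 / (norm (u - spatial y))^2) * indicator (cball (spatial y) \<rho>) u"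
    by (auto simp: indicator_def H3_ball_def dist_norm norm_minus_commute)
  qed
  also have "\<dots> <= ennreal C" by (rule C)
  finally show "(\<integral>\<^sup>+x. ennreal (inv_sq x y) * indicator (H3_ball R) x \<partial>vol_H3) <= ennreal C" .
 qed
qed

subsection \<open>The helicity formula\<close>

abbreviation "vol_H3_pair \<equiv> vol_H3 \<Otimes>\<^sub>M vol_H3"

locale H3_field =
 fixes v :: "R4 => R4"
 assumes v: "smooth_vector_field hdot H3 v" and compact_support: "compact (closure {x \<in> H3. v x ~= 0})"
begin

lemma v_tangent: "x \<in> H3 ==> hdot x (v x) = 0"
 using v by (simp add: smooth_vector_field_def tangent_def)

lemma v_continuous: "continuous_on H3 v"
 using v by (intro smooth_map_on_continuous) (simp add: smooth_vector_field_def)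

lemma v_support:
 obtains R K where "R > 0" "K > 0" "!!x. x \<in> H3 ==> norm x > R ==> v x = 0" "!!x. x \<in> H3 ==> norm (v x) <= K"
proof -
 have "bounded {x \<in> H3. v x ~= 0}" by (rule bounded_subset[OF compact_imp_bounded[OF compact_support] closure_subset])
 then obtain R where R: "R > 0" "\<forall>x\<in>{x \<in> H3. v x ~= 0}. norm x <= R" using bounded_pos by blast
 have "compact (H3 \<inter> cball 0 R)" using H3.closed_M by (rule closed_Int_compact) simp
 then have "bounded (v ` (H3 \<inter> cball 0 R))"
  by (intro compact_imp_bounded compact_continuous_image continuous_on_subset[OF v_continuous]) auto
 then obtain K where K: "K > 0" "\<forall>z\<in>v ` (H3 \<inter> cball 0 R). norm z <= K" using bounded_pos by blast
 show ?thesis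
 proof (rule that[OF R(1) K(1)])
  show 1: "v x = 0" if "x \<in> H3" "norm x > R" for x using R(2) that by force
  show "norm (v x) <= K" if "x \<in> H3" for x
   using K 1[OF that] that by (cases "norm x > R") auto
 qed
qed

text \<open>The integrand of the formula in explicit form.\<close>

definition k :: "R4 \<times> R4 => real" where
 "k = (%(x, y). - csch_kernel (hdot x y) * det4 y (v x) x (v y))"

lemma measurable_csch: "csch_kernel \<in> borel_measurable borel"
 unfolding csch_kernel_def[abs_def] by measurable

lemma measurable_k: "k \<in> borel_measurable vol_H3_pair"
proof -
 note [measurable] = measurable_compose[OF measurable_fst measurable_H3_ident] measurable_compose[OF measurable_snd measurable_H3_ident]
  measurable_compose[OF measurable_fst measurable_H3_continuous[OF v_continuous]]
  measurable_compose[OF measurable_snd measurable_H3_continuous[OF v_continuous]]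
 have m: "(%z. (fst z, snd z, v (fst z), v (snd z))) \<in> borel_measurable vol_H3_pair" by measurable
 have c: "continuous_on UNIV (%(x, y, u, w). hdot x y)" "continuous_on UNIV (%(x, y, u, w). det4 y u x w)"
  unfolding case_prod_unfold hdot_R4 det_4 vector_4_nth by (intro continuous_intros)+
 have "(%z. hdot (fst z) (snd z)) \<in> borel_measurable vol_H3_pair"
  using borel_measurable_continuous_on[OF c(1) m] by simp
 from measurable_compose[OF this measurable_csch]
 have [measurable]: "(%z. csch_kernel (hdot (fst z) (snd z))) \<in> borel_measurable vol_H3_pair" .
 have [measurable]: "(%z. det4 (snd z) (v (fst z)) (fst z) (v (snd z))) \<in> borel_measurable vol_H3_pair"
  using borel_measurable_continuous_on[OF c(2) m] by simp
 show ?thesis unfolding k_def case_prod_unfold by measurable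
qed

definition kernel :: "R4 => R4 => R4" where
 "kernel y x = cross_H3 y (transport_H3 y x (v x)) (grad_H3 (%z. phi0_H3 (dist_H3 x z)) y)"

lemma kernel_inner:
 assumes "x \<in> H3" "y \<in> H3"
 shows "kernel y x \<bullet> w = - csch_kernel (hdot x y) * det4 y (v x) x (time_flip w)"
 using biot_savart_kernel_H3[where v = v, OF assms v_tangent[OF assms(1)], of "time_flip w"]
 by (simp add: kernel_def hdot_commute[of _ "time_flip w"] hdot_time_flip inner_commute)

text \<open>Integrability as a vector-valued function is what permits the product with \<open>v y\<close> to be taken under the integral.\<close>

lemma kernel_integrable:
 assumes y: "y \<in> H3"
 shows "integrable vol_H3 (kernel y)"
proof (rule integrableI_bounded)
 have [measurable]: "(%x. csch_kernel (hdot x y)) \<in> borel_measurable vol_H3"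
  by (rule measurable_compose[OF _ measurable_csch])
    (intro measurable_H3_continuous bounded_linear.continuous_on[OF hdot.bounded_linear_left] continuous_on_id)
 have c: "continuous_on UNIV (%(x, u). det4 y u x w)" for w
  unfolding case_prod_unfold det_4 vector_4_nth by (intro continuous_intros)
 have [measurable]: "(%x. det4 y (v x) x w) \<in> borel_measurable vol_H3" for w
  using borel_measurable_continuous_on[OF c, of "%x. (x, v x)" vol_H3 w] measurable_H3_continuous[OF v_continuous] by simp
 have "(%x. kernel y x \<bullet> w) \<in> borel_measurable vol_H3" for w
 proof (rule measurable_cong[THEN iffD1, rotated])
  show "(%x. - csch_kernel (hdot x y) * det4 y (v x) x (time_flip w)) \<in> borel_measurable vol_H3" by measurable
 qed (simp add: H3.space_volume kernel_inner[OF _ y])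
 then show "kernel y \<in> borel_measurable vol_H3" by (subst borel_measurable_euclidean_space) (rule ballI)
 obtain R K where R: "R > 0" "K > 0" "!!x. x \<in> H3 ==> norm x > R ==> v x = 0" "!!x. x \<in> H3 ==> norm (v x) <= K"
  using v_support by blast
 define R' where "R' = max R (norm y)"
 obtain C where C: "(\<integral>\<^sup>+x. ennreal (inv_sq x y) * indicator (H3_ball R') x \<partial>vol_H3) <= ennreal C"
  using inverse_square_vol_H3[of R'] max.cobounded2[of "norm y" R] unfolding R'_def by blast
 define D where "D = 4 * (48 * R'^6 * K * 1)"
 have R': "0 <= R'" using R(1) by (simp add: R'_def)
 have D: "D \<ge> 0" using R R' by (simp add: D_def)
 have "(\<integral>\<^sup>+x. norm (kernel y x) \<partial>vol_H3)
  <= (\<integral>\<^sup>+x. ennreal D * (ennreal (inv_sq x y) * indicator (H3_ball R') x) \<partial>vol_H3)"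
 proof (rule nn_integral_mono)
  fix x assume "x \<in> space vol_H3"
  then have x: "x \<in> H3" by (simp add: H3.space_volume)
  show "ennreal (norm (kernel y x)) <= ennreal D * (ennreal (inv_sq x y) * indicator (H3_ball R') x)"
  proof (cases "norm x <= R'")
   case True
   have b: "\<bar>kernel y x \<bullet> i\<bar> <= 48 * R'^6 * K * 1 * inv_sq x y" if i: "i \<in> Basis" for i
   proof -
    have n: "norm (time_flip i) = 1" using norm_Basis[OF i] by (simp add: norm_eq_sqrt_inner inner_R4 time_flip_def)
    have "\<bar>kernel y x \<bullet> i\<bar> <= 48 * R'^6 * norm (v x) * norm (time_flip i) * inv_sq x y"
     unfolding kernel_inner[OF x y] mult_minus_left abs_minus_cancel
     by (rule csch_kernel_bound[OF x y True]) (simp add: R'_def)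
    also have "\<dots> <= 48 * R'^6 * K * 1 * inv_sq x y"
     unfolding n using R(4)[OF x] R' by (intro mult_right_mono mult_left_mono) auto
    finally show ?thesis .
   qed
   have "norm (kernel y x) <= (\<Sum>i\<in>Basis. \<bar>kernel y x \<bullet> i\<bar>)" by (rule norm_le_l1)
   also have "\<dots> <= (\<Sum>i\<in>(Basis :: R4 set). 48 * R'^6 * K * 1 * inv_sq x y)"
    by (rule sum_mono) (rule b)
   also have "\<dots> = D * inv_sq x y" by (simp add: D_def)
   finally have "ennreal (norm (kernel y x)) <= ennreal D * ennreal (inv_sq x y)"
    using D by (simp add: ennreal_mult'[symmetric] ennreal_leI)
   then show ?thesis using True x by (simp add: H3_ball_def)
  next
   case False
   then have "v x = 0" using R(3)[OF x] by (simp add: R'_def)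
   then have "kernel y x \<bullet> w = 0" for w unfolding kernel_inner[OF x y] by (simp add: det_zero)
   then have "kernel y x = 0" by (metis inner_eq_zero_iff)
   then show ?thesis by simp
  qed
 qed
 also have "\<dots> = ennreal D * (\<integral>\<^sup>+x. ennreal (inv_sq x y) * indicator (H3_ball R') x \<partial>vol_H3)"
  by (rule nn_integral_cmult[OF measurable_inverse_square])
 also have "\<dots> <= ennreal D * ennreal C" by (intro mult_left_mono C) simp
 also have "\<dots> < \<infinity>" by (simp add: ennreal_mult_less_top)
 finally show "(\<integral>\<^sup>+x. norm (kernel y x) \<partial>vol_H3) < \<infinity>" .
qed

lemma k_integrable: "integrable vol_H3_pair k"
proof (rule integrableI_bounded[OF measurable_k])
 interpret P: pair_sigma_finite vol_H3 vol_H3 ..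
 obtain R K where R: "R > 0" "K > 0" "!!x. x \<in> H3 ==> norm x > R ==> v x = 0" "!!x. x \<in> H3 ==> norm (v x) <= K"
  using v_support by blast
 obtain C where C: "!!y. norm y <= R ==>
  (\<integral>\<^sup>+x. ennreal (inv_sq x y) * indicator (H3_ball R) x \<partial>vol_H3) <= ennreal C"
  using inverse_square_vol_H3[of R] by blast
 define D where "D = 48 * R^6 * K * K"
 have D: "D \<ge> 0" using R by (simp add: D_def)
 have "(\<integral>\<^sup>+z. norm (k z) \<partial>vol_H3_pair) = (\<integral>\<^sup>+y. \<integral>\<^sup>+x. norm (k (x, y)) \<partial>vol_H3 \<partial>vol_H3)"
  using measurable_k by (intro P.nn_integral_snd[symmetric]) measurable
 also have "\<dots> <= (\<integral>\<^sup>+y. (ennreal D * ennreal C) * indicator (H3_ball R) y \<partial>vol_H3)"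
 proof (rule nn_integral_mono)
  fix y assume "y \<in> space vol_H3"
  then have y: "y \<in> H3" by (simp add: H3.space_volume)
  show "(\<integral>\<^sup>+x. norm (k (x, y)) \<partial>vol_H3) <= ennreal D * ennreal C * indicator (H3_ball R) y"
  proof (cases "norm y <= R")
   case True
   have "(\<integral>\<^sup>+x. norm (k (x, y)) \<partial>vol_H3)
    <= (\<integral>\<^sup>+x. ennreal D * (ennreal (inv_sq x y) * indicator (H3_ball R) x) \<partial>vol_H3)"
   proof (rule nn_integral_mono)
    fix x assume "x \<in> space vol_H3"
    then have x: "x \<in> H3" by (simp add: H3.space_volume)
    show "ennreal (norm (k (x, y))) <= ennreal D * (ennreal (inv_sq x y) * indicator (H3_ball R) x)"
    proof (cases "norm x <= R")
     case xR: True
     have "norm (k (x, y)) <= 48 * R^6 * norm (v x) * norm (v y) * inv_sq x y"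
      using csch_kernel_bound[OF x y xR True] by (simp add: k_def)
     also have "\<dots> <= D * inv_sq x y"
      unfolding D_def using R(1,2) R(4)[OF x] R(4)[OF y] by (intro mult_right_mono mult_mono) auto
     finally have "ennreal (norm (k (x, y))) <= ennreal D * ennreal (inv_sq x y)"
      using D by (simp add: ennreal_mult'[symmetric] ennreal_leI)
     then show ?thesis using xR x by (simp add: H3_ball_def)
    next
     case False
     then have "v x = 0" using R(3)[OF x] by simp
     then show ?thesis by (simp add: k_def det_zero)
    qed
   qed
   also have "\<dots> = ennreal D * (\<integral>\<^sup>+x. ennreal (inv_sq x y) * indicator (H3_ball R) x \<partial>vol_H3)"
    by (rule nn_integral_cmult[OF measurable_inverse_square])
   also have "\<dots> <= ennreal D * ennreal C" by (intro mult_left_mono C True) simp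
   finally show ?thesis using True y by (simp add: H3_ball_def)
  next
   case False
   then have "v y = 0" using R(3)[OF y] by simp
   then show ?thesis by (simp add: k_def det_zero)
  qed
 qed
 also have "\<dots> = (ennreal D * ennreal C) * emeasure vol_H3 (H3_ball R)"
  by (rule nn_integral_cmult_indicator[OF H3_ball_sets])
 also have "\<dots> < \<infinity>"
  using emeasure_H3_ball[of R] by (simp add: ennreal_mult_less_top)
 finally show "(\<integral>\<^sup>+z. norm (k z) \<partial>vol_H3_pair) < \<infinity>" .
qed

lemma helicity_H3_parallel:
 "has_bochner_integral vol_H3_pair
   (%(x, y). hdot (cross_H3 y (transport_H3 y x (v x)) (v y)) (grad_H3 (%z. 1 / (4 * pi) * (1 / sinh (dist_H3 x z))) y))
   (helicity_H3 v)"
proof -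
 interpret P: pair_sigma_finite vol_H3 vol_H3 ..
 have "integral\<^sup>L vol_H3_pair k = (\<integral>y. (\<integral>x. k (x, y) \<partial>vol_H3) \<partial>vol_H3)"
  using P.integral_snd[of "%x y. k (x, y)"] k_integrable by simp
 also have "\<dots> = helicity_H3 v"
  unfolding helicity_H3_def
 proof (rule Bochner_Integration.integral_cong[OF refl])
  fix y assume "y \<in> space vol_H3"
  then have y: "y \<in> H3" by (simp add: H3.space_volume)
  have "hdot (biot_savart_H3 v y) (v y) = (\<integral>x. hdot (kernel y x) (v y) \<partial>vol_H3)"
   unfolding biot_savart_H3_def kernel_def[symmetric]
   by (rule integral_bounded_linear[OF hdot.bounded_linear_left kernel_integrable[OF y], symmetric])
  also have "\<dots> = (\<integral>x. k (x, y) \<partial>vol_H3)"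
   by (rule Bochner_Integration.integral_cong[OF refl])
     (simp only: H3.space_volume kernel_def biot_savart_kernel_H3[where v = v] v_tangent y k_def case_prod_conv)
  finally show "(\<integral>x. k (x, y) \<partial>vol_H3) = hdot (biot_savart_H3 v y) (v y)" ..
 qed
 finally have "has_bochner_integral vol_H3_pair k (helicity_H3 v)" using k_integrable by (simp add: has_bochner_integral_iff)
 then show ?thesis
 proof (rule has_bochner_integral_cong[THEN iffD1, OF refl _ refl, rotated])
  fix z assume "z \<in> space vol_H3_pair"
  then obtain x y where z: "z = (x, y)" "x \<in> H3" "y \<in> H3" by (auto simp: space_pair_measure H3.space_volume)
  show "k z = (case z of (x, y) =>
    hdot (cross_H3 y (transport_H3 y x (v x)) (v y)) (grad_H3 (%z. 1 / (4 * pi) * (1 / sinh (dist_H3 x z))) y))"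
   by (simp only: z case_prod_conv k_def integrand_H3[where v = v] v_tangent)
 qed
qed

end

section \<open>The helicity formulas\<close>

theorem theorem8p3:
  shows
    "(\<forall>v. smooth_vector_field (\<bullet>) S3 v \<longrightarrow>
        (let \<phi> = (\<lambda>\<alpha>::real. 1 / (4 * pi\<^sup>2) * (pi - \<alpha>) * cot \<alpha>);
             \<phi>\<^sub>1 = (\<lambda>\<alpha>::real. - (1 / (16 * pi\<^sup>2)) * \<alpha> * (2 * pi - \<alpha>))
         in \<exists>I\<^sub>1 I\<^sub>2 I\<^sub>3.
           has_bochner_integral (vol_S3 \<Otimes>\<^sub>M vol_S3)
             (\<lambda>(x, y). cross_S3 y (left_transport y x (v x)) (v y)
                         \<bullet> grad_S3 (\<lambda>z. \<phi> (dist_S3 x z)) y) I\<^sub>1 \<and>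
           has_bochner_integral (vol_S3 \<Otimes>\<^sub>M vol_S3)
             (\<lambda>(x, y). left_transport y x (v x) \<bullet> v y) I\<^sub>2 \<and>
           has_bochner_integral (vol_S3 \<Otimes>\<^sub>M vol_S3)
             (\<lambda>(x, y). grad_S3 (\<lambda>z. left_transport z x (v x)
                                        \<bullet> grad_S3 (\<lambda>s. \<phi>\<^sub>1 (dist_S3 x s)) z) y
                         \<bullet> v y) I\<^sub>3 \<and>
           helicity_S3 v = I\<^sub>1 - 1 / (4 * pi\<^sup>2) * I\<^sub>2 + 2 * I\<^sub>3))
     \<and>
     (\<forall>v. smooth_vector_field (\<bullet>) S3 v \<longrightarrow>
        (let \<phi> = (\<lambda>\<alpha>::real. 1 / (4 * pi\<^sup>2) * (pi - \<alpha>) * (1 / sin \<alpha>))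
         in has_bochner_integral (vol_S3 \<Otimes>\<^sub>M vol_S3)
              (\<lambda>(x, y). cross_S3 y (transport_S3 y x (v x)) (v y)
                          \<bullet> grad_S3 (\<lambda>z. \<phi> (dist_S3 x z)) y)
              (helicity_S3 v)))
     \<and>
     (\<forall>v. smooth_vector_field hdot H3 v \<and> compact (closure {x \<in> H3. v x \<noteq> 0}) \<longrightarrow>
        (let \<phi> = (\<lambda>\<alpha>::real. 1 / (4 * pi) * (1 / sinh \<alpha>))
         in has_bochner_integral (vol_H3 \<Otimes>\<^sub>M vol_H3)
              (\<lambda>(x, y). hdot (cross_H3 y (transport_H3 y x (v x)) (v y))
                              (grad_H3 (\<lambda>z. \<phi> (dist_H3 x z)) y))
              (helicity_H3 v)))"
  unfolding Let_def
  by (intro conjI allI impI S3_field.helicity_S3_left S3_field.helicity_S3_parallel H3_field.helicity_H3_parallel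
      S3_field.intro H3_field.intro; blast)

end
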